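(* Let $N,e,s$ be integers with $1\le e\le N$ and $e\le s$. Then: (a) $\rho(S_N(N,s))=N(s-N+1)/s$ (here $s\ge N$); and (b) $e(s-e+1)/s\le\rho(S_N(e,s))$. (c) More generally, given $\mathbf{d}=(d_1,\dots,d_s)$ with positive integers $d_1\le\cdots\le d_s$, we have $$\frac{e(d_1+\cdots+d_{s-e+1})}{d_1+\cdots+d_s}\le\rho(S_N(e,s,\mathbf{d})).$$
   Context: $k$ is an arbitrary algebraically closed field and $k[\mathbf{P}^N]=k[x_0,\dots,x_N]$ is the polynomial ring with its standard grading. $S_N(e,s,\mathbf{d})\subset\mathbf{P}^N$, for $\mathbf{d}=(d_1,\dots,d_s)$, denotes the reduced scheme that is the union of all $e$-wise intersections $H_{i_1}\cap\cdots\cap H_{i_e}$ ($i_1<\cdots<i_e$) of $s$ general hypersurfaces $H_1,\dots,H_s$ in $\mathbf{P}^N$ of respective degrees $d_1,\dots,d_s$. If all $d_i=1$ (general hyperplanes) it is denoted $S_N(e,s)$. "General" means for all tuples $(H_1,\dots,H_s)$ in a suitable nonempty Zariski-open subset of the parameter space of such tuples. Symbolic powers: for a homogeneous ideal $0\ne I\subsetneq R=k[\mathbf{P}^N]$ and $m\ge 1$, $I^{(m)}$ is the contraction to $R$ of $I^mR_A$, where $R_A$ is the localization of $R$ at the multiplicative system $A$ equal to the complement of the union of the associated primes of $I$. Resurgence: $\rho(I)=\sup\{m/r : m,r\ge 1 \text{ integers},\ I^{(m)}\not\subseteq I^r\}$, and for a subscheme $Z\subset\mathbf{P}^N$ with saturated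 homogeneous ideal $I(Z)$, $\rho(Z)=\rho(I(Z))$. *)

theory Defs
  imports
    "HOL-Library.Poly_Mapping"
    "HOL-Library.FuncSet"
    "HOL-Library.Extended_Real"
    "HOL-Computational_Algebra.Polynomial"
    "HOL-Computational_Algebra.Fraction_Field"
    "HOL-Algebra.Ideal_Product"
    "HOL-Algebra.Algebraic_Closure_Type"
begin

section \<open>Polynomial rings\<close>

text \<open>A multivariate polynomial is a finitely supported map from exponent vectors to coefficients;
  sums and products are those of \<^theory>\<open>HOL-Library.Poly_Mapping\<close>.\<close>

type_synonym ('v, 'k) mpoly = "('v \<Rightarrow>\<^sub>0 nat) \<Rightarrow>\<^sub>0 'k"

definition mpoly_eval :: "('v \<Rightarrow> 'k) \<Rightarrow> ('v, 'k::comm_ring_1) mpoly \<Rightarrow> 'k" where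
  "mpoly_eval x p =
     (\<Sum>\<mu>\<in>Poly_Mapping.keys p. Poly_Mapping.lookup p \<mu> *
        (\<Prod>v\<in>Poly_Mapping.keys \<mu>. x v ^ Poly_Mapping.lookup \<mu> v))"

definition mpoly_homogeneous :: "nat \<Rightarrow> ('v, 'k::comm_ring_1) mpoly \<Rightarrow> bool" where
  "mpoly_homogeneous n p \<longleftrightarrow>
     (\<forall>\<mu>\<in>Poly_Mapping.keys p. (\<Sum>v\<in>Poly_Mapping.keys \<mu>. Poly_Mapping.lookup \<mu> v) = n)"

text \<open>The ring $k[\mathbf{P}^N] = k[x_0,\dots,x_N]$, inside the ring of polynomials in countably
  many variables.\<close>

definition poly_ring :: "nat \<Rightarrow> (nat, 'k::field) mpoly ring" where
  "poly_ring N = ring_of_type_algebra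
     \<lparr>carrier := {p. \<forall>\<mu>\<in>Poly_Mapping.keys p. Poly_Mapping.keys \<mu> \<subseteq> {0..N}}\<rparr>"

text \<open>The homogeneous polynomials of degree \<open>n\<close>, including \<open>0\<close>.\<close>

definition forms :: "nat \<Rightarrow> nat \<Rightarrow> (nat, 'k::field) mpoly set" where
  "forms N n = {p \<in> carrier (poly_ring N). mpoly_homogeneous n p}"


section \<open>Symbolic powers and resurgence\<close>

text \<open>From here on \<open>R\<close> is meant to be a subring of an integral domain that is given as a type. Its
  localizations at multiplicative sets \<open>A\<close> with \<open>0 \<notin> A\<close> are then subrings of the field of fractions
  of that type. Powers of ideals are powers in the monoid \<^const>\<open>ideals_set\<close>.\<close>

definition localization :: "'a::idom ring \<Rightarrow> 'a set \<Rightarrow> 'a fract ring" where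
  "localization R A = ring_of_type_algebra
     \<lparr>carrier := {Fract f a | f a. f \<in> carrier R \<and> a \<in> A}\<rparr>"

definition associated_primes :: "'a ring \<Rightarrow> 'a set \<Rightarrow> 'a set set" where
  "associated_primes R I =
     {P. primeideal P R \<and> (\<exists>f\<in>carrier R. P = {g \<in> carrier R. g \<otimes>\<^bsub>R\<^esub> f \<in> I})}"

definition symbolic_power :: "'a::idom ring \<Rightarrow> 'a set \<Rightarrow> nat \<Rightarrow> 'a set" where
  "symbolic_power R I m =
     (let R\<^sub>A = localization R (carrier R - \<Union> (associated_primes R I))
      in {f \<in> carrier R.
            Fract f 1 \<in> genideal R\<^sub>A ((\<lambda>g. Fract g 1) ` (I [^]\<^bsub>ideals_set R\<^esub> m))})"

text \<open>The supremum is taken in the extended reals, so that an equation with a real number includes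
  the claim that the set is bounded.\<close>

definition resurgence :: "'a::idom ring \<Rightarrow> 'a set \<Rightarrow> ereal" where
  "resurgence R I =
     Sup {ereal (real m / real r) | m r.
            1 \<le> m \<and> 1 \<le> r \<and> \<not> symbolic_power R I m \<subseteq> I [^]\<^bsub>ideals_set R\<^esub> r}"


section \<open>Reduced subschemes of projective space\<close>

text \<open>Since $k$ is algebraically closed, a reduced closed subscheme of $\mathbf{P}^N$ is given by
  its set of $k$-points. A set of points is represented by the set of all homogeneous coordinate
  vectors of its points, extended by zero beyond index \<open>N\<close>.\<close>

definition proj_space :: "nat \<Rightarrow> (nat \<Rightarrow> 'k::field) set" where
  "proj_space N = {x. (\<forall>i>N. x i = 0) \<and> (\<exists>i\<le>N. x i \<noteq> 0)}"

definition hypersurface :: "nat \<Rightarrow> (nat, 'k::field) mpoly \<Rightarrow> (nat \<Rightarrow> 'k) set" where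
  "hypersurface N F = {x \<in> proj_space N. mpoly_eval x F = 0}"

text \<open>The saturated homogeneous ideal of \<open>Z\<close> with its reduced structure.\<close>

definition vanishing_ideal :: "nat \<Rightarrow> (nat \<Rightarrow> 'k::field) set \<Rightarrow> (nat, 'k) mpoly set" where
  "vanishing_ideal N Z =
     genideal (poly_ring N) {f. (\<exists>n. f \<in> forms N n) \<and> (\<forall>x\<in>Z. mpoly_eval x f = 0)}"

definition proj_resurgence :: "nat \<Rightarrow> (nat \<Rightarrow> 'k::field) set \<Rightarrow> ereal" where
  "proj_resurgence N Z = resurgence (poly_ring N) (vanishing_ideal N Z)"

text \<open>$S_N(e,s,\mathbf{d})$ for the hypersurfaces with equations $F_1,\dots,F_s$.\<close>

definition star_config ::
  "nat \<Rightarrow> nat \<Rightarrow> nat \<Rightarrow> (nat \<Rightarrow> (nat, 'k::field) mpoly) \<Rightarrow> (nat \<Rightarrow> 'k) set" where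
  "star_config N e s F =
     (\<Union>T\<in>{T. T \<subseteq> {1..s} \<and> card T = e}. \<Inter>i\<in>T. hypersurface N (F i))"


section \<open>General hypersurfaces\<close>

text \<open>Tuples of hypersurfaces of degrees $d_1,\dots,d_s$ are represented by tuples of equations, that
  is, of nonzero forms.\<close>

definition hypersurface_tuples ::
  "nat \<Rightarrow> nat \<Rightarrow> (nat \<Rightarrow> nat) \<Rightarrow> (nat \<Rightarrow> (nat, 'k::field) mpoly) set" where
  "hypersurface_tuples N s d = (\<Pi>\<^sub>E i\<in>{1..s}. forms N (d i) - {0})"

text \<open>The Zariski topology on these tuples, with the coefficients as coordinates: the variable
  \<open>(i, \<mu>)\<close> stands for the coefficient of the monomial \<open>\<mu>\<close> in the \<open>i\<close>-th form. Variables that do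
  not correspond to a coordinate are constant functions of the tuple, so they are harmless.\<close>

definition zariski_open ::
  "nat \<Rightarrow> nat \<Rightarrow> (nat \<Rightarrow> nat) \<Rightarrow> (nat \<Rightarrow> (nat, 'k::field) mpoly) set \<Rightarrow> bool" where
  "zariski_open N s d U \<longleftrightarrow>
     (\<exists>P :: (nat \<times> (nat \<Rightarrow>\<^sub>0 nat), 'k) mpoly set.
        U = {F \<in> hypersurface_tuples N s d.
               \<exists>p\<in>P. mpoly_eval (\<lambda>(i, \<mu>). Poly_Mapping.lookup (F i) \<mu>) p \<noteq> 0})"

text \<open>A property of tuples of hypersurfaces does not change when the equations are rescaled. For
  such properties, holding on a nonempty open set of tuples of equations is the same as holding on
  a nonempty open set of the product of the projective spaces of forms of degree $d_i$, because
  the union of all rescalings of an open set is open.\<close>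

definition for_general ::
  "nat \<Rightarrow> nat \<Rightarrow> (nat \<Rightarrow> nat) \<Rightarrow> ((nat \<Rightarrow> (nat, 'k::field) mpoly) \<Rightarrow> bool) \<Rightarrow> bool" where
  "for_general N s d Q \<longleftrightarrow> (\<exists>U. zariski_open N s d U \<and> U \<noteq> {} \<and> (\<forall>F\<in>U. Q F))"

end

(*
  Lower bounds.  Let I be the ideal of the star configuration of F_1, ..., F_s.  A form of I lies in
  (F_i, i in T) for all T with card T = e; since F_j is a nonzerodivisor modulo (F_i, i in T) for
  card T < e and j not in T, such a form of degree less than d_1 + ... + d_{s-e+1} lies in all the
  ideals (F_i, i in T) with card T = e - 1, then card T = e - 2, and so on, hence is 0.  On the other
  hand (F_1 ... F_s)^t lies in the symbolic power I^(te), and comparing degrees it is in I^r only if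
  r (d_1 + ... + d_{s-e+1}) <= t (d_1 + ... + d_s).

  The only property of general F used here is that the points of V(F_i, i in T) off the other
  hypersurfaces detect membership in (F_i, i in T).  It is deduced from a multiplicity-free instance
  of Bezout's theorem: adding N + 1 - card T coordinates gives N + 1 forms G_0, ..., G_N, and over the
  local ring at a grid of products of linear forms the quotient by the G_i - c_i is free on the
  reduced monomials and the characteristic polynomial of a separating linear form has simple roots.

  Upper bound for points.  The components of an element of I^(m) vanish to order m at each point of
  the configuration, and two facts are proved by induction on the dimension, by restriction to one
  of the hyperplanes: a nonzero form of degree k of order m at the points satisfies m s <= N k, and
  a form of degree k >= r (s - N + 1) of order r at the points is in I^r.
*)

theory Submission
  imports Defs "Jordan_Normal_Form.Determinant"
begin

section \<open>Polynomials, the grading, and polynomial functions over an infinite field\<close>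

section \<open>Polynomials and their evaluation\<close>

text \<open>Points detect membership in (F_i, i in T) only if a general complete intersection is
  radical, in every characteristic. Instead of differentials, the proof uses the affine slices x_0 =
  y_0, x_i = y_i (i > card T) of V(F_i, i in T). At the grid a slice is visibly reduced, with one
  point for each reduced monomial. Invertibility of a matrix persists near the grid, and so do the
  dimension of the coordinate ring and the simplicity of the spectrum, the latter because \<chi>'(u)
  stays a unit. A polynomial vanishing at the points of a slice therefore has zero coefficients at
  all reduced monomials there. Letting y vary over an open set gives the vanishing of the polynomial
  itself.

  The two facts about points combine as follows. Let a component of degree k of an element of I^(m)
  lie outside I^r, with m \<ge> r. Then k < r (s - N + 1) by the second fact and m s \<le> N k by
  the first, so m / r < N (s - N + 1) / s. For m < r the bound follows from s \<le> N (s - N + 1).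
  The product of all hyperplanes, of degree s and order N, is the equality case of the first
  fact.\<close>

abbreviation lookup where "lookup \<equiv> Poly_Mapping.lookup"
abbreviation keys where "keys \<equiv> Poly_Mapping.keys"
abbreviation single where "single \<equiv> Poly_Mapping.single"

definition const :: "'k::comm_ring_1 \<Rightarrow> ('v, 'k) mpoly" where
  "const c = single 0 c"

definition var :: "'v \<Rightarrow> ('v, 'k::comm_ring_1) mpoly" where
  "var v = single (single v 1) 1"

definition mono_eval :: "('v \<Rightarrow> 'k::comm_ring_1) \<Rightarrow> ('v \<Rightarrow>\<^sub>0 nat) \<Rightarrow> 'k" where
  "mono_eval x \<mu> = (\<Prod>v\<in>keys \<mu>. x v ^ lookup \<mu> v)"

definition tdeg :: "('v \<Rightarrow>\<^sub>0 nat) \<Rightarrow> nat" where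
  "tdeg \<mu> = (\<Sum>v\<in>keys \<mu>. lookup \<mu> v)"

lemma mono_eval_superset:
  "finite K \<Longrightarrow> keys \<mu> \<subseteq> K \<Longrightarrow> mono_eval x \<mu> = (\<Prod>v\<in>K. x v ^ lookup \<mu> v)"
  unfolding mono_eval_def by (rule prod.mono_neutral_left) (auto simp: in_keys_iff)

lemma tdeg_superset: "finite K \<Longrightarrow> keys \<mu> \<subseteq> K \<Longrightarrow> tdeg \<mu> = (\<Sum>v\<in>K. lookup \<mu> v)"
  unfolding tdeg_def by (rule sum.mono_neutral_left) (auto simp: in_keys_iff)

lemma keys_add_nat: "keys (\<mu> + \<nu> :: 'v \<Rightarrow>\<^sub>0 nat) = keys \<mu> \<union> keys \<nu>"
  by (auto simp: in_keys_iff lookup_add)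

lemma mono_eval_0 [simp]: "mono_eval x 0 = 1"
  by (simp add: mono_eval_def)

lemma mono_eval_add: "mono_eval x (\<mu> + \<nu>) = mono_eval x \<mu> * mono_eval x \<nu>"
proof -
  let ?K = "keys \<mu> \<union> keys \<nu>"
  have "mono_eval x (\<mu> + \<nu>) = (\<Prod>v\<in>?K. x v ^ lookup (\<mu> + \<nu>) v)"
    by (rule mono_eval_superset) (auto simp: keys_add_nat)
  also have "\<dots> = (\<Prod>v\<in>?K. x v ^ lookup \<mu> v) * (\<Prod>v\<in>?K. x v ^ lookup \<nu> v)"
    by (simp add: lookup_add power_add prod.distrib)
  finally show ?thesis
    by (subst (1 2) mono_eval_superset[of ?K]) auto
qed

lemma mono_eval_single [simp]: "mono_eval x (single v n) = x v ^ n"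
  by (cases "n = 0") (auto simp: mono_eval_def)

lemma tdeg_0 [simp]: "tdeg 0 = 0"
  by (simp add: tdeg_def)

lemma tdeg_add: "tdeg (\<mu> + \<nu>) = tdeg \<mu> + tdeg \<nu>"
proof -
  let ?K = "keys \<mu> \<union> keys \<nu>"
  have "tdeg (\<mu> + \<nu>) = (\<Sum>v\<in>?K. lookup (\<mu> + \<nu>) v)"
    by (rule tdeg_superset) (auto simp: keys_add_nat)
  also have "\<dots> = (\<Sum>v\<in>?K. lookup \<mu> v) + (\<Sum>v\<in>?K. lookup \<nu> v)"
    by (simp add: lookup_add sum.distrib)
  finally show ?thesis
    by (subst (1 2) tdeg_superset[of ?K]) auto
qed

lemma tdeg_single [simp]: "tdeg (single v n) = n"
  by (cases "n = 0") (auto simp: tdeg_def)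

lemma tdeg_eq_0_iff [simp]: "tdeg \<mu> = 0 \<longleftrightarrow> \<mu> = 0"
  by (metis Poly_Mapping.keys_eq_empty finite_keys lookup_eq_zero_in_keys_contradict
      subsetI subset_empty sum_eq_0_iff tdeg_0 tdeg_def)

lemma mono_induct [case_names zero add]:
  fixes \<mu> :: "'v \<Rightarrow>\<^sub>0 nat"
  assumes "P 0" and "\<And>\<mu> v. P \<mu> \<Longrightarrow> P (single v 1 + \<mu>)"
  shows "P \<mu>"
proof (induction "tdeg \<mu>" arbitrary: \<mu>)
  case 0
  then show ?case using assms(1) by simp
next
  case (Suc n)
  then have "\<mu> \<noteq> 0" by auto
  then obtain v where v: "v \<in> keys \<mu>" by (metis keys_eq_empty equals0I)
  define \<nu> where "\<nu> = \<mu> - single v 1"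
  have "\<mu> = single v 1 + \<nu>"
    using v by (intro poly_mapping_eqI)
      (auto simp: \<nu>_def lookup_add lookup_minus lookup_single when_def in_keys_iff)
  moreover from this have "tdeg \<nu> = n" using Suc(2) by (simp add: tdeg_add)
  ultimately show ?case using Suc(1)[of \<nu>] assms(2) by simp
qed

lemma mpoly_eval_superset:
  assumes "finite K" "keys p \<subseteq> K"
  shows "mpoly_eval x p = (\<Sum>\<mu>\<in>K. lookup p \<mu> * mono_eval x \<mu>)"
  unfolding mpoly_eval_def mono_eval_def[symmetric]
  using assms by (intro sum.mono_neutral_left) (auto simp: in_keys_iff)

lemma eval_0 [simp]: "mpoly_eval x 0 = 0"
  by (simp add: mpoly_eval_def)

lemma eval_single: "mpoly_eval x (single \<mu> c) = c * mono_eval x \<mu>"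
  by (subst mpoly_eval_superset[of "{\<mu>}"]) auto

lemma eval_add [simp]: "mpoly_eval x (p + q) = mpoly_eval x p + mpoly_eval x q"
proof -
  let ?K = "keys p \<union> keys q"
  have "keys (p + q) \<subseteq> ?K" by (rule Poly_Mapping.keys_add)
  then show ?thesis
    by (subst (1 2 3) mpoly_eval_superset[of ?K])
      (auto simp: lookup_add algebra_simps sum.distrib)
qed

lemma mpoly_sum_single: "(p :: ('v, 'k::comm_ring_1) mpoly) = (\<Sum>\<mu>\<in>keys p. single \<mu> (lookup p \<mu>))"
  by (rule poly_mapping_eqI) (auto simp: lookup_sum lookup_single when_def sum.delta' in_keys_iff)

lemma mpoly_induct [case_names zero single add]:
  fixes p :: "('v, 'k::comm_ring_1) mpoly"
  assumes "P 0" "\<And>\<mu> c. \<mu> \<in> keys p \<Longrightarrow> P (single \<mu> c)" "\<And>p q. P p \<Longrightarrow> P q \<Longrightarrow> P (p + q)"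
  shows "P p"
proof -
  have "P (\<Sum>\<mu>\<in>K. single \<mu> (lookup p \<mu>))" if "finite K" "K \<subseteq> keys p" for K
    using that by (induction K rule: finite_induct) (use assms in auto)
  from this[of "keys p"] show ?thesis by (subst mpoly_sum_single) auto
qed

lemma eval_sum [simp]: "mpoly_eval x (\<Sum>i\<in>A. f i) = (\<Sum>i\<in>A. mpoly_eval x (f i))"
  by (induction A rule: infinite_finite_induct) auto

lemma eval_mult [simp]: "mpoly_eval x (p * q) = mpoly_eval x p * mpoly_eval x q"
proof (induction p rule: mpoly_induct)
  case (single \<mu> c)
  show ?case
    by (induction q rule: mpoly_induct)
      (auto simp: mult_single eval_single mono_eval_add algebra_simps)
qed (auto simp: algebra_simps)

lemma eval_const [simp]: "mpoly_eval x (const c) = c"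
  by (simp add: const_def eval_single)

lemma eval_var [simp]: "mpoly_eval x (var v) = x v"
  by (simp add: var_def eval_single)

lemma const_0 [simp]: "const 0 = 0" by (simp add: const_def)
lemma const_1 [simp]: "const 1 = 1" by (simp add: const_def)
lemma const_add: "const (a + b) = const a + const b" by (simp add: const_def single_add)
lemma const_mult: "const (a * b) = const a * const b" by (simp add: const_def mult_single)
lemma const_uminus: "const (- a) = - const a" by (simp add: const_def single_uminus)
lemma const_sum: "const (\<Sum>i\<in>A. f i) = (\<Sum>i\<in>A. const (f i))"
  by (induction A rule: infinite_finite_induct) (auto simp: const_add)

lemma eval_1 [simp]: "mpoly_eval x 1 = 1"
  using eval_const[of x 1] by simp

lemma eval_uminus [simp]: "mpoly_eval x (- p) = - mpoly_eval x p"
proof -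
  have "mpoly_eval x (const (-1) * p) = - mpoly_eval x p" by (simp only: eval_mult eval_const) simp
  then show ?thesis by (simp add: const_uminus)
qed

lemma eval_diff [simp]: "mpoly_eval x (p - q) = mpoly_eval x p - mpoly_eval x q"
  using eval_add[of x p "- q"] by simp

lemma eval_power [simp]: "mpoly_eval x (p ^ n) = mpoly_eval x p ^ n"
  by (induction n) auto

lemma eval_prod [simp]: "mpoly_eval x (\<Prod>i\<in>A. f i) = (\<Prod>i\<in>A. mpoly_eval x (f i))"
  by (induction A rule: infinite_finite_induct) auto

lemma single_conv: "single \<mu> c = const c * single \<mu> 1"
  by (simp add: const_def mult_single)

lemma lookup_const_mult [simp]: "lookup (const c * p) \<mu> = c * lookup p \<mu>"
proof (induction p rule: mpoly_induct)
  case (single \<nu> d)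
  then show ?case by (simp add: const_def mult_single lookup_single when_def)
qed (auto simp: algebra_simps lookup_add)

lemma single_var_mult: "single (single v (Suc 0) + \<mu>) 1 = var v * single \<mu> 1"
  by (simp add: var_def mult_single)

lemma single_eq_prod_var:
  assumes "finite K" "keys \<mu> \<subseteq> K"
  shows "single \<mu> 1 = (\<Prod>v\<in>K. var v ^ lookup \<mu> v :: ('v, 'k::comm_ring_1) mpoly)"
proof -
  have "keys \<mu> \<subseteq> K \<Longrightarrow> single \<mu> 1 = (\<Prod>v\<in>K. var v ^ lookup \<mu> v :: ('v, 'k) mpoly)"
  proof (induction \<mu> rule: mono_induct)
    case zero
    then show ?case by simp
  next
    case (add \<mu> v)
    then have v: "v \<in> K" and "keys \<mu> \<subseteq> K" by (auto simp: keys_add_nat)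
    have "(\<Prod>w\<in>K. var w ^ lookup (single v 1 + \<mu>) w :: ('v, 'k) mpoly)
        = (\<Prod>w\<in>K. var w ^ lookup (single v 1) w) * (\<Prod>w\<in>K. var w ^ lookup \<mu> w)"
      by (simp add: lookup_add power_add prod.distrib)
    also have "(\<Prod>w\<in>K. var w ^ lookup (single v 1) w :: ('v, 'k) mpoly) = var v"
    proof -
      have "(\<Prod>w\<in>K - {v}. var w ^ lookup (single v 1) w :: ('v, 'k) mpoly) = 1"
        by (rule prod.neutral) (auto simp: lookup_single when_def)
      then show ?thesis using v assms(1) by (subst prod.remove[of K v]) auto
    qed
    finally show ?case using add \<open>keys \<mu> \<subseteq> K\<close> by (simp add: single_var_mult)
  qed
  then show ?thesis using assms(2) by simp
qed


section \<open>The ring of polynomials in the variables up to N\<close>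

lemma carrier_poly_ring: "carrier (poly_ring N) = {p. \<forall>\<mu>\<in>keys p. keys \<mu> \<subseteq> {0..N}}"
  by (simp add: poly_ring_def)

lemma poly_ring_ops [simp]:
  "x \<otimes>\<^bsub>poly_ring N\<^esub> y = x * y" "x \<oplus>\<^bsub>poly_ring N\<^esub> y = x + y"
  "\<one>\<^bsub>poly_ring N\<^esub> = 1" "\<zero>\<^bsub>poly_ring N\<^esub> = 0"
  by (simp_all add: poly_ring_def ring_of_type_algebra_def)

abbreviation polys :: "nat \<Rightarrow> (nat, 'k::field) mpoly set" where
  "polys N \<equiv> carrier (poly_ring N)"

lemma polys_0 [simp]: "0 \<in> polys N" by (simp add: carrier_poly_ring)
lemma polys_const [simp]: "const c \<in> polys N" by (simp add: carrier_poly_ring const_def)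
lemma polys_1 [simp]: "1 \<in> polys N" using polys_const[of 1] by simp
lemma polys_var [simp]: "var i \<in> polys N \<longleftrightarrow> i \<le> N" by (simp add: carrier_poly_ring var_def)
lemma polys_single [simp]: "single \<mu> c \<in> polys N \<longleftrightarrow> c = 0 \<or> keys \<mu> \<subseteq> {0..N}"
  by (auto simp: carrier_poly_ring)

lemma polys_add [simp]: "p \<in> polys N \<Longrightarrow> q \<in> polys N \<Longrightarrow> p + q \<in> polys N"
  using Poly_Mapping.keys_add[of p q] by (auto simp: carrier_poly_ring)

lemma polys_uminus [simp]: "p \<in> polys N \<Longrightarrow> - p \<in> polys N"
  by (auto simp: carrier_poly_ring in_keys_iff)

lemma polys_diff [simp]: "p \<in> polys N \<Longrightarrow> q \<in> polys N \<Longrightarrow> p - q \<in> polys N"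
  using polys_add[of p N "- q"] by simp

lemma polys_mult [simp]:
  assumes "p \<in> polys N" "q \<in> polys N"
  shows "p * q \<in> polys N"
proof -
  have "keys \<mu> \<subseteq> {0..N}" if mu: "\<mu> \<in> keys (p * q)" for \<mu>
  proof -
    obtain a b where "\<mu> = a + b" "a \<in> keys p" "b \<in> keys q"
      using mu Poly_Mapping.keys_mult[of p q] by blast
    then show ?thesis using assms by (auto simp: carrier_poly_ring keys_add_nat)
  qed
  then show ?thesis by (auto simp: carrier_poly_ring)
qed

lemma polys_sum [simp]: "(\<And>i. i \<in> A \<Longrightarrow> f i \<in> polys N) \<Longrightarrow> (\<Sum>i\<in>A. f i) \<in> polys N"
  by (induction A rule: infinite_finite_induct) auto

lemma polys_prod [simp]: "(\<And>i. i \<in> A \<Longrightarrow> f i \<in> polys N) \<Longrightarrow> (\<Prod>i\<in>A. f i) \<in> polys N"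
  by (induction A rule: infinite_finite_induct) auto

lemma polys_power [simp]: "p \<in> polys N \<Longrightarrow> p ^ n \<in> polys N"
  by (induction n) auto

lemma cring_poly_ring: "cring (poly_ring N :: (nat, 'k::field) mpoly ring)"
proof (rule cringI)
  show "abelian_group (poly_ring N :: (nat, 'k) mpoly ring)"
  proof (rule abelian_groupI)
    fix x :: "(nat, 'k) mpoly" assume "x \<in> polys N"
    then show "\<exists>y\<in>polys N. y \<oplus>\<^bsub>poly_ring N\<^esub> x = \<zero>\<^bsub>poly_ring N\<^esub>"
      by (intro bexI[of _ "- x"]) auto
  qed (auto simp: algebra_simps)
  show "comm_monoid (poly_ring N :: (nat, 'k) mpoly ring)"
    by (rule comm_monoidI) (auto simp: algebra_simps)
qed (auto simp: algebra_simps)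

lemma ring_poly_ring: "ring (poly_ring N)"
  using cring_poly_ring by (rule cring.axioms)

lemma minus_poly_ring [simp]: "x \<in> polys N \<Longrightarrow> \<ominus>\<^bsub>poly_ring N\<^esub> x = - x"
  by (rule abelian_group.minus_equality[OF ring.is_abelian_group[OF ring_poly_ring]]) auto

lemma polys_induct [consumes 1, case_names const add var]:
  assumes "p \<in> polys N"
    and "\<And>c. P (const c)"
    and "\<And>p q. p \<in> polys N \<Longrightarrow> q \<in> polys N \<Longrightarrow> P p \<Longrightarrow> P q \<Longrightarrow> P (p + q)"
    and "\<And>i p. i \<le> N \<Longrightarrow> p \<in> polys N \<Longrightarrow> P p \<Longrightarrow> P (var i * p)"
  shows "P p"
proof -
  have mon: "P (single \<mu> c)" if "keys \<mu> \<subseteq> {0..N}" for \<mu> c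
    using that
  proof (induction \<mu> rule: mono_induct)
    case zero
    then show ?case using assms(2)[of c] by (simp add: const_def)
  next
    case (add \<mu> v)
    then have "P (var v * single \<mu> c)"
      by (intro assms(4)) (auto simp: keys_add_nat)
    then show ?case by (simp add: var_def mult_single)
  qed
  have "(\<Sum>\<mu>\<in>K. single \<mu> (lookup p \<mu>)) \<in> polys N \<and> P (\<Sum>\<mu>\<in>K. single \<mu> (lookup p \<mu>))"
    if "finite K" "K \<subseteq> keys p" for K
    using that
  proof (induction K rule: finite_induct)
    case empty
    then show ?case using assms(2)[of 0] by simp
  next
    case (insert \<mu> K)
    then have "keys \<mu> \<subseteq> {0..N}" using assms(1) by (auto simp: carrier_poly_ring)
    then show ?case using insert by (auto intro!: assms(3) mon)
  qed
  from this[of "keys p"] show ?thesis by (subst mpoly_sum_single) auto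
qed

lemma eval_cong: "p \<in> polys N \<Longrightarrow> (\<And>i. i \<le> N \<Longrightarrow> x i = y i) \<Longrightarrow> mpoly_eval x p = mpoly_eval y p"
  by (induction p rule: polys_induct) auto


section \<open>Forms\<close>

lemma forms_iff: "p \<in> forms N n \<longleftrightarrow> p \<in> polys N \<and> (\<forall>\<mu>\<in>keys p. tdeg \<mu> = n)"
  by (simp add: forms_def mpoly_homogeneous_def tdeg_def)

lemma forms_polys: "p \<in> forms N n \<Longrightarrow> p \<in> polys N" by (simp add: forms_iff)

lemma forms_0 [simp]: "0 \<in> forms N n" by (simp add: forms_iff)

lemma forms_const [simp]: "const c \<in> forms N 0"
  by (auto simp: forms_iff const_def split: if_splits)

lemma forms_1 [simp]: "1 \<in> forms N 0"
  using forms_const[of 1] by simp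

lemma forms_var: "i \<le> N \<Longrightarrow> var i \<in> forms N 1"
  by (auto simp: forms_iff var_def)

lemma forms_single: "keys \<mu> \<subseteq> {0..N} \<Longrightarrow> single \<mu> c \<in> forms N (tdeg \<mu>)"
  by (auto simp: forms_iff)

lemma forms_add [simp]: "p \<in> forms N n \<Longrightarrow> q \<in> forms N n \<Longrightarrow> p + q \<in> forms N n"
  using Poly_Mapping.keys_add[of p q] by (auto simp: forms_iff)

lemma forms_mult:
  assumes "p \<in> forms N m" "q \<in> forms N n"
  shows "p * q \<in> forms N (m + n)"
proof -
  have "tdeg \<mu> = m + n" if mu: "\<mu> \<in> keys (p * q)" for \<mu>
  proof -
    obtain a b where "\<mu> = a + b" "a \<in> keys p" "b \<in> keys q"
      using mu Poly_Mapping.keys_mult[of p q] by blast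
    then show ?thesis using assms by (auto simp: forms_iff tdeg_add)
  qed
  then show ?thesis using assms by (auto simp: forms_iff)
qed

lemma forms_uminus [simp]: "p \<in> forms N n \<Longrightarrow> - p \<in> forms N n"
  using forms_mult[OF forms_const[of "-1"]] by (fastforce simp: const_uminus)

lemma forms_diff [simp]: "p \<in> forms N n \<Longrightarrow> q \<in> forms N n \<Longrightarrow> p - q \<in> forms N n"
  using forms_add[of p N n "- q"] by simp

lemma forms_const_mult [simp]: "p \<in> forms N n \<Longrightarrow> const c * p \<in> forms N n"
  using forms_mult[OF forms_const] by fastforce

lemma forms_sum [simp]: "(\<And>i. i \<in> A \<Longrightarrow> f i \<in> forms N n) \<Longrightarrow> (\<Sum>i\<in>A. f i) \<in> forms N n"
  by (induction A rule: infinite_finite_induct) auto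

lemma forms_prod: "(\<And>i. i \<in> A \<Longrightarrow> f i \<in> forms N (d i)) \<Longrightarrow> (\<Prod>i\<in>A. f i) \<in> forms N (\<Sum>i\<in>A. d i)"
  by (induction A rule: infinite_finite_induct) (auto intro: forms_mult)

lemma forms_power: "p \<in> forms N d \<Longrightarrow> p ^ n \<in> forms N (n * d)"
  by (induction n) (auto intro: forms_mult)

text \<open>The degree is carried along because multiplication by a variable raises it. Zero has a
  case of its own: it is a form of every degree, whereas a constant is one of degree 0.\<close>

lemma forms_induct [consumes 1, case_names zero const add var]:
  assumes "p \<in> forms N n"
    and zero: "\<And>n. P n 0"
    and const: "\<And>c. P 0 (const c)"
    and add: "\<And>n p q. p \<in> forms N n \<Longrightarrow> q \<in> forms N n \<Longrightarrow> P n p \<Longrightarrow> P n q \<Longrightarrow> P n (p + q)"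
    and var: "\<And>n i p. i \<le> N \<Longrightarrow> p \<in> forms N n \<Longrightarrow> P n p \<Longrightarrow> P (Suc n) (var i * p)"
  shows "P n p"
proof -
  have mon: "P (tdeg \<mu>) (single \<mu> c)" if "keys \<mu> \<subseteq> {0..N}" for \<mu> c
    using that
  proof (induction \<mu> rule: mono_induct)
    case zero
    then show ?case using const[of c] by (simp add: const_def)
  next
    case (add \<mu> v)
    then have "P (Suc (tdeg \<mu>)) (var v * single \<mu> c)"
      by (intro var) (auto simp: keys_add_nat intro: forms_single)
    then show ?case by (simp add: var_def mult_single tdeg_add)
  qed
  have "(\<Sum>\<mu>\<in>K. single \<mu> (lookup p \<mu>)) \<in> forms N n \<and> P n (\<Sum>\<mu>\<in>K. single \<mu> (lookup p \<mu>))"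
    if "finite K" "K \<subseteq> keys p" for K
    using that
  proof (induction K rule: finite_induct)
    case empty
    then show ?case using zero by simp
  next
    case (insert \<mu> K)
    then have "keys \<mu> \<subseteq> {0..N}" "tdeg \<mu> = n" using assms(1) by (auto simp: forms_iff carrier_poly_ring)
    then show ?case using insert mon[of \<mu>] forms_single[of \<mu>] by (auto intro!: add)
  qed
  from this[of "keys p"] show ?thesis by (subst mpoly_sum_single) auto
qed

lemma eval_forms_scale:
  "p \<in> forms N n \<Longrightarrow> mpoly_eval (\<lambda>i. t * x i) p = t ^ n * mpoly_eval x p"
  by (induction rule: forms_induct) (auto simp: algebra_simps)

definition hcomp :: "nat \<Rightarrow> ('v, 'k::comm_ring_1) mpoly \<Rightarrow> ('v, 'k) mpoly" where
  "hcomp n p = (\<Sum>\<mu>\<in>{\<mu>\<in>keys p. tdeg \<mu> = n}. single \<mu> (lookup p \<mu>))"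

lemma lookup_hcomp: "lookup (hcomp n p) \<mu> = (if tdeg \<mu> = n then lookup p \<mu> else 0)"
  by (auto simp: hcomp_def lookup_sum lookup_single when_def sum.delta' in_keys_iff)

lemma hcomp_forms [simp]: "p \<in> polys N \<Longrightarrow> hcomp n p \<in> forms N n"
  unfolding forms_iff carrier_poly_ring by (auto simp: in_keys_iff lookup_hcomp split: if_splits)

lemma hcomp_add: "hcomp n (p + q) = hcomp n p + hcomp n q"
  by (rule poly_mapping_eqI) (auto simp: lookup_hcomp lookup_add)

lemma hcomp_form: "p \<in> forms N m \<Longrightarrow> hcomp n p = (if n = m then p else 0)"
  by (rule poly_mapping_eqI) (auto simp: lookup_hcomp forms_iff in_keys_iff)

lemma hcomp_sum: "hcomp n (\<Sum>i\<in>A. f i) = (\<Sum>i\<in>A. hcomp n (f i))"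
  by (rule poly_mapping_eqI) (auto simp: lookup_hcomp lookup_sum)

definition maxdeg :: "('v, 'k::comm_ring_1) mpoly \<Rightarrow> nat" where
  "maxdeg p = Max (insert 0 (tdeg ` keys p))"

lemma tdeg_le_maxdeg: "\<mu> \<in> keys p \<Longrightarrow> tdeg \<mu> \<le> maxdeg p"
  unfolding maxdeg_def by (rule Max_ge) auto

lemma sum_hcomp: "p = (\<Sum>n\<le>maxdeg p. hcomp n p)"
proof (rule poly_mapping_eqI)
  fix \<mu>
  show "lookup p \<mu> = lookup (\<Sum>n\<le>maxdeg p. hcomp n p) \<mu>"
    using tdeg_le_maxdeg[of \<mu> p] by (auto simp: lookup_sum lookup_hcomp sum.delta in_keys_iff)
qed

text \<open>Multiplication by a form shifts the grading by its degree. The condition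
  \<open>m \<le> n\<close> guards the truncated subtraction: below degree m the product has no
  component.\<close>

lemma hcomp_mult_form:
  assumes p: "p \<in> forms N m" and q: "q \<in> polys N"
  shows "hcomp n (p * q) = (if m \<le> n then p * hcomp (n - m) q else 0)"
proof -
  have "hcomp n (p * q) = hcomp n (\<Sum>i\<le>maxdeg q. p * hcomp i q)"
    by (metis sum_distrib_left sum_hcomp)
  also have "\<dots> = (\<Sum>i\<le>maxdeg q. if n = m + i then p * hcomp i q else 0)"
    unfolding hcomp_sum using p q
    by (intro sum.cong refl, subst hcomp_form[where m = "m + _"]) (auto intro: forms_mult)
  also have "\<dots> = (if m \<le> n then p * hcomp (n - m) q else 0)"
  proof (cases "m \<le> n \<and> n - m \<le> maxdeg q")
    case True
    then have "(\<Sum>i\<le>maxdeg q. if n = m + i then p * hcomp i q else 0)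
        = (\<Sum>i\<le>maxdeg q. if i = n - m then p * hcomp i q else 0)"
      by (intro sum.cong) auto
    then show ?thesis using True by (simp add: sum.delta)
  next
    case False
    moreover have "hcomp (n - m) q = 0" if "n - m > maxdeg q"
      using that tdeg_le_maxdeg[of _ q]
      by (intro poly_mapping_eqI) (fastforce simp: lookup_hcomp in_keys_iff)
    ultimately show ?thesis by (auto intro!: sum.neutral)
  qed
  finally show ?thesis .
qed


section \<open>Polynomial functions over an infinite field\<close>

text \<open>Over a finite field the product of all T - a, plus 1, has positive degree but takes only
  the value 1.\<close>

lemma infinite_UNIV_alg_closed: "infinite (UNIV :: 'k::alg_closed_field set)"
proof
  assume fin: "finite (UNIV :: 'k set)"
  define p where "p = (\<Prod>a\<in>(UNIV :: 'k set). [:- a, 1:])"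
  have deg: "degree p = card (UNIV :: 'k set)"
    unfolding p_def by (subst degree_prod_eq_sum_degree) (auto simp: fin)
  have pos: "card (UNIV :: 'k set) > 0" using fin by (simp add: card_gt_0_iff)
  then have "degree (p + 1) = degree p" using deg by (intro degree_add_eq_left) simp
  then obtain x where "poly (p + 1) x = 0"
    using alg_closed_imp_poly_has_root[of "p + 1"] deg pos by auto
  moreover have "poly p x = 0"
    unfolding p_def poly_prod using fin by (auto intro!: prod_zero)
  ultimately show False by simp
qed

lemma poly_eq_0_if_zeros:
  fixes p :: "'k::idom poly"
  assumes "infinite {t. poly p t = 0}"
  shows "p = 0"
  using poly_roots_finite[of p] assms by auto

lemma digits_bound:
  assumes "\<And>i. i < n \<Longrightarrow> a i < (B::nat)"
  shows "(\<Sum>i<n. a i * B ^ i) < B ^ n"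
  using assms
proof (induction n)
  case (Suc n)
  then have "(\<Sum>i<n. a i * B ^ i) < B ^ n" by simp
  moreover have "a n * B ^ n + B ^ n \<le> B * B ^ n"
    using Suc.prems[of n] mult_le_mono1[of "Suc (a n)" B "B ^ n"] by simp
  ultimately show ?case by simp
qed simp

text \<open>By \<open>digits_bound\<close> the lower digits add up to less than
  \<open>B ^ n\<close>, so division by \<open>B ^ n\<close> isolates the top digit.\<close>

lemma digits_inj:
  assumes "\<And>i. i < n \<Longrightarrow> a i < (B::nat)" "\<And>i. i < n \<Longrightarrow> b i < B"
    and "(\<Sum>i<n. a i * B ^ i) = (\<Sum>i<n. b i * B ^ i)" "i < n"
  shows "a i = b i"
  using assms
proof (induction n)
  case (Suc n)
  let ?a = "\<Sum>i<n. a i * B ^ i" and ?b = "\<Sum>i<n. b i * B ^ i"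
  have l: "?a < B ^ n" "?b < B ^ n" using Suc.prems by (auto intro!: digits_bound)
  have eq: "?a + a n * B ^ n = ?b + b n * B ^ n" using Suc.prems(3) by simp
  have "B ^ n \<noteq> 0" using l(1) by linarith
  then have "(?a + a n * B ^ n) div B ^ n = a n" "(?b + b n * B ^ n) div B ^ n = b n"
    using l by simp_all
  then have n: "a n = b n" using eq by metis
  then have "?a = ?b" using eq by simp
  then have "a i = b i" if "i < n"
    by (intro Suc.IH) (use Suc.prems that in auto)
  then show ?case using n Suc.prems(4) by (cases "i = n") auto
qed simp

text \<open>Kronecker's substitution \<open>x\<^sub>i = t ^ (B ^ i)\<close> sends distinct monomials to distinct powers of \<open>t\<close>.\<close>

lemma eval_eq_0_imp_eq_0:
  fixes p :: "(nat, 'k::field) mpoly"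
  assumes inf: "infinite (UNIV :: 'k set)" and p: "p \<in> polys N" and zero: "\<And>x. mpoly_eval x p = 0"
  shows "p = 0"
proof -
  \<comment> \<open>B exceeds every exponent occurring in p, so \<open>w \<mu>\<close> has the
    exponents of \<mu> as its base B digits and determines \<mu>.\<close>
  define B where "B = Suc (Max (insert 0 ((\<lambda>(\<mu>, i). lookup \<mu> i) ` (keys p \<times> {..N}))))"
  define w where "w \<mu> = (\<Sum>i<Suc N. lookup \<mu> i * B ^ i)" for \<mu>
  have B: "lookup \<mu> i < B" if "\<mu> \<in> keys p" "i < Suc N" for \<mu> i
  proof -
    have "lookup \<mu> i \<in> (\<lambda>(\<mu>, i). lookup \<mu> i) ` (keys p \<times> {..N})" using that by force
    then show ?thesis unfolding B_def by (intro le_imp_less_Suc Max_ge) auto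
  qed
  have keys: "keys \<mu> \<subseteq> {..<Suc N}" if "\<mu> \<in> keys p" for \<mu>
    using p that by (fastforce simp: carrier_poly_ring)
  have inj: "inj_on w (keys p)"
  proof (rule inj_onI, rule poly_mapping_eqI)
    fix \<mu> \<nu> i assume mu: "\<mu> \<in> keys p" "\<nu> \<in> keys p" "w \<mu> = w \<nu>"
    show "lookup \<mu> i = lookup \<nu> i"
    proof (cases "i < Suc N")
      case True
      then show ?thesis using B mu digits_inj[of "Suc N" "lookup \<mu>" B "lookup \<nu>" i] by (simp add: w_def)
    next
      case False
      then have "i \<notin> keys \<mu>" "i \<notin> keys \<nu>" using keys[OF mu(1)] keys[OF mu(2)] by blast+
      then show ?thesis by (simp add: in_keys_iff)
    qed
  qed
  define P where "P = (\<Sum>\<mu>\<in>keys p. monom (lookup p \<mu>) (w \<mu>))"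
  have "poly P t = mpoly_eval (\<lambda>i. t ^ (B ^ i)) p" for t
  proof -
    have "mono_eval (\<lambda>i. t ^ (B ^ i)) \<mu> = t ^ w \<mu>" if "\<mu> \<in> keys p" for \<mu>
      by (subst mono_eval_superset[OF _ keys[OF that]])
        (auto simp: w_def power_sum power_mult[symmetric] mult.commute simp del: sum.lessThan_Suc prod.lessThan_Suc)
    then show ?thesis
      by (subst mpoly_eval_superset[of "keys p"]) (auto simp: P_def poly_sum poly_monom)
  qed
  then have "P = 0" using zero inf by (intro poly_eq_0_if_zeros) auto
  have "lookup p \<mu> = 0" if "\<mu> \<in> keys p" for \<mu>
  proof -
    have "coeff P (w \<mu>) = (\<Sum>\<nu>\<in>keys p. if \<nu> = \<mu> then lookup p \<nu> else 0)"
      unfolding P_def coeff_sum coeff_monom using inj that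
      by (intro sum.cong) (auto dest: inj_onD)
    then show ?thesis using \<open>P = 0\<close> that by (simp add: sum.delta)
  qed
  then show ?thesis by (metis in_keys_iff keys_eq_empty equals0I)
qed

lemma eval_eqI:
  fixes p :: "(nat, 'k::field) mpoly"
  assumes "infinite (UNIV :: 'k set)" "p \<in> polys N" "q \<in> polys N" "\<And>x. mpoly_eval x p = mpoly_eval x q"
  shows "p = q"
  using eval_eq_0_imp_eq_0[of "p - q" N] assms by simp

text \<open>Turns questions about polynomial functions into root counting: along a polynomial curve
  they become univariate, so over an infinite field nonvanishing at one parameter gives nonvanishing
  at all but finitely many.\<close>

lemma eval_poly_subst: "\<exists>P. \<forall>t. mpoly_eval (\<lambda>i. poly (q i) t) p = poly P t"
proof (induction p rule: mpoly_induct)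
  case zero
  show ?case by (intro exI[of _ 0]) simp
next
  case (single \<mu> c)
  have "\<exists>P. \<forall>t. mono_eval (\<lambda>i. poly (q i) t) \<mu> = poly P t"
    by (intro exI[of _ "\<Prod>v\<in>keys \<mu>. q v ^ lookup \<mu> v"]) (simp add: mono_eval_def poly_prod)
  then obtain P where "\<And>t. mono_eval (\<lambda>i. poly (q i) t) \<mu> = poly P t" by blast
  then show ?case by (intro exI[of _ "smult c P"]) (simp add: eval_single)
next
  case (add p1 p2)
  then obtain P1 P2 where "\<forall>t. mpoly_eval (\<lambda>i. poly (q i) t) p1 = poly P1 t"
    "\<forall>t. mpoly_eval (\<lambda>i. poly (q i) t) p2 = poly P2 t" by blast
  then show ?case by (intro exI[of _ "P1 + P2"]) simp
qed

lemma eval_line: "\<exists>P. \<forall>t. mpoly_eval (\<lambda>i. x i + t * y i) p = poly P t"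
  using eval_poly_subst[of "\<lambda>i. [:x i, y i:]" p] by (simp add: mult.commute)


section \<open>Bezout's theorem without multiplicities, for systems near a known one\<close>

section \<open>Rational functions regular at a point\<close>

text \<open>\<open>PF\<close> is a ring of functions on a parameter space; \<open>near\<close> and \<open>regular\<close> are the neighbourhood
  filter and the local ring of the point \<open>w\<close> in the Zariski topology.\<close>

locale function_ring =
  fixes PF :: "('p \<Rightarrow> 'k::field) set" and D :: "'p set" and w :: 'p
  assumes base_point: "w \<in> D"
    and PF_const: "(\<lambda>_. c) \<in> PF"
    and PF_add: "f \<in> PF \<Longrightarrow> g \<in> PF \<Longrightarrow> (\<lambda>p. f p + g p) \<in> PF"
    and PF_mult: "f \<in> PF \<Longrightarrow> g \<in> PF \<Longrightarrow> (\<lambda>p. f p * g p) \<in> PF"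
begin

definition near :: "('p \<Rightarrow> bool) \<Rightarrow> bool" where
  "near P \<longleftrightarrow> (\<exists>q\<in>PF. q w \<noteq> 0 \<and> (\<forall>p\<in>D. q p \<noteq> 0 \<longrightarrow> P p))"

definition regular :: "('p \<Rightarrow> 'k) set" where
  "regular = {f. \<exists>a\<in>PF. \<exists>q\<in>PF. q w \<noteq> 0 \<and> (\<forall>p\<in>D. q p \<noteq> 0 \<longrightarrow> f p = a p / q p)}"

lemma near_at: "near P \<Longrightarrow> P w" using base_point by (auto simp: near_def)

lemma near_mono: "near P \<Longrightarrow> (\<And>p. p \<in> D \<Longrightarrow> P p \<Longrightarrow> Q p) \<Longrightarrow> near Q"
  unfolding near_def by blast

lemma near_always: "(\<And>p. p \<in> D \<Longrightarrow> P p) \<Longrightarrow> near P"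
  unfolding near_def using PF_const[of 1] by (intro bexI[of _ "\<lambda>_. 1"]) auto

lemma near_conj:
  assumes "near P" "near Q"
  shows "near (\<lambda>p. P p \<and> Q p)"
proof -
  obtain q r where "q \<in> PF" "q w \<noteq> 0" "\<And>p. p \<in> D \<Longrightarrow> q p \<noteq> 0 \<Longrightarrow> P p" "r \<in> PF" "r w \<noteq> 0" "\<And>p. p \<in> D \<Longrightarrow> r p \<noteq> 0 \<Longrightarrow> Q p"
    using assms unfolding near_def by blast
  then show ?thesis unfolding near_def by (intro bexI[of _ "\<lambda>p. q p * r p"]) (auto intro: PF_mult)
qed

lemma near_ball: "finite A \<Longrightarrow> (\<And>a. a \<in> A \<Longrightarrow> near (P a)) \<Longrightarrow> near (\<lambda>p. \<forall>a\<in>A. P a p)"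
  by (induction A rule: finite_induct) (auto intro: near_conj near_always)

lemma regularI: "a \<in> PF \<Longrightarrow> q \<in> PF \<Longrightarrow> q w \<noteq> 0 \<Longrightarrow> (\<And>p. p \<in> D \<Longrightarrow> q p \<noteq> 0 \<Longrightarrow> f p = a p / q p) \<Longrightarrow> f \<in> regular"
  unfolding regular_def by blast

lemma PF_regular: "f \<in> PF \<Longrightarrow> f \<in> regular"
  by (rule regularI[of f "\<lambda>_. 1"]) (auto intro: PF_const)

lemma regular_const [intro]: "(\<lambda>_. c) \<in> regular"
  by (intro PF_regular PF_const)

lemma regular_add [intro]:
  assumes "f \<in> regular" "g \<in> regular"
  shows "(\<lambda>p. f p + g p) \<in> regular"
proof -
  obtain a q where f: "a \<in> PF" "q \<in> PF" "q w \<noteq> 0" "\<And>p. p \<in> D \<Longrightarrow> q p \<noteq> 0 \<Longrightarrow> f p = a p / q p"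
    using assms(1) unfolding regular_def by blast
  obtain b r where g: "b \<in> PF" "r \<in> PF" "r w \<noteq> 0" "\<And>p. p \<in> D \<Longrightarrow> r p \<noteq> 0 \<Longrightarrow> g p = b p / r p"
    using assms(2) unfolding regular_def by blast
  show ?thesis
    by (rule regularI[of "\<lambda>p. a p * r p + b p * q p" "\<lambda>p. q p * r p"])
      (use f g in \<open>auto intro!: PF_add PF_mult simp: field_simps\<close>)
qed

lemma regular_mult [intro]:
  assumes "f \<in> regular" "g \<in> regular"
  shows "(\<lambda>p. f p * g p) \<in> regular"
proof -
  obtain a q where f: "a \<in> PF" "q \<in> PF" "q w \<noteq> 0" "\<And>p. p \<in> D \<Longrightarrow> q p \<noteq> 0 \<Longrightarrow> f p = a p / q p"
    using assms(1) unfolding regular_def by blast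
  obtain b r where g: "b \<in> PF" "r \<in> PF" "r w \<noteq> 0" "\<And>p. p \<in> D \<Longrightarrow> r p \<noteq> 0 \<Longrightarrow> g p = b p / r p"
    using assms(2) unfolding regular_def by blast
  show ?thesis
    by (rule regularI[of "\<lambda>p. a p * b p" "\<lambda>p. q p * r p"])
      (use f g in \<open>auto intro!: PF_mult simp: field_simps\<close>)
qed

lemma regular_cong:
  assumes "f \<in> regular" "near (\<lambda>p. f p = g p)"
  shows "g \<in> regular"
proof -
  obtain a q where f: "a \<in> PF" "q \<in> PF" "q w \<noteq> 0" "\<And>p. p \<in> D \<Longrightarrow> q p \<noteq> 0 \<Longrightarrow> f p = a p / q p"
    using assms(1) unfolding regular_def by blast
  obtain r where g: "r \<in> PF" "r w \<noteq> 0" "\<And>p. p \<in> D \<Longrightarrow> r p \<noteq> 0 \<Longrightarrow> f p = g p"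
    using assms(2) unfolding near_def by blast
  have "g p = a p * r p / (q p * r p)" if "p \<in> D" "q p * r p \<noteq> 0" for p
    using f(4)[of p] g(3)[of p] that by auto
  then show ?thesis
    by (intro regularI[of "\<lambda>p. a p * r p" "\<lambda>p. q p * r p"]) (use f g in \<open>auto intro!: PF_mult\<close>)
qed

lemma regular_uminus [intro]: "f \<in> regular \<Longrightarrow> (\<lambda>p. - f p) \<in> regular"
  using regular_mult[OF regular_const[of "-1"]] by fastforce

lemma regular_sum [intro]: "(\<And>i. i \<in> A \<Longrightarrow> f i \<in> regular) \<Longrightarrow> (\<lambda>p. \<Sum>i\<in>A. f i p) \<in> regular"
  by (induction A rule: infinite_finite_induct) auto

lemma regular_prod [intro]: "(\<And>i. i \<in> A \<Longrightarrow> f i \<in> regular) \<Longrightarrow> (\<lambda>p. \<Prod>i\<in>A. f i p) \<in> regular"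
  by (induction A rule: infinite_finite_induct) auto

lemma near_nonzero:
  assumes "f \<in> regular" "f w \<noteq> 0"
  shows "near (\<lambda>p. f p \<noteq> 0)"
proof -
  obtain a q where f: "a \<in> PF" "q \<in> PF" "q w \<noteq> 0" "\<And>p. p \<in> D \<Longrightarrow> q p \<noteq> 0 \<Longrightarrow> f p = a p / q p"
    using assms(1) unfolding regular_def by blast
  then show ?thesis using assms(2) f(4)[OF base_point] unfolding near_def
    by (intro bexI[of _ "\<lambda>p. a p * q p"]) (auto intro: PF_mult)
qed

lemma regular_inverse:
  assumes "f \<in> regular" "f w \<noteq> 0"
  shows "(\<lambda>p. inverse (f p)) \<in> regular"
proof -
  obtain a q where f: "a \<in> PF" "q \<in> PF" "q w \<noteq> 0" "\<And>p. p \<in> D \<Longrightarrow> q p \<noteq> 0 \<Longrightarrow> f p = a p / q p"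
    using assms(1) unfolding regular_def by blast
  \<comment> \<open>The fraction q / a is expanded by q because f agrees with a / q only where q
    does not vanish.\<close>
  have "inverse (f p) = q p * q p / (a p * q p)" if "p \<in> D" "a p * q p \<noteq> 0" for p
    using f(4)[of p] that by simp
  then show ?thesis
    by (intro regularI[of "\<lambda>p. q p * q p" "\<lambda>p. a p * q p"])
      (use f assms(2) f(4)[OF base_point] in \<open>auto intro: PF_mult\<close>)
qed

lemma regular_det:
  assumes "\<And>i j. i < n \<Longrightarrow> j < n \<Longrightarrow> (\<lambda>p. M p i j) \<in> regular"
  shows "(\<lambda>p. det (mat n n (\<lambda>(i, j). M p i j))) \<in> regular"
proof -
  have "det (mat n n (\<lambda>(i, j). M p i j))
      = (\<Sum>\<sigma>\<in>{\<sigma>. \<sigma> permutes {0..<n}}. signof \<sigma> * (\<Prod>i = 0..<n. M p i (\<sigma> i)))" for p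
    by (subst det_def'[of _ n])
      (auto intro!: sum.cong prod.cong arg_cong2[where f = "(*)"] simp: permutes_in_image)
  moreover have "(\<lambda>p. M p i (\<sigma> i)) \<in> regular" if "\<sigma> permutes {0..<n}" "i \<in> {0..<n}" for \<sigma> i
    using that permutes_in_image[OF that(1), of i] by (intro assms) auto
  ultimately show ?thesis
    by (simp only:) (intro regular_sum regular_mult regular_const regular_prod, auto)
qed

text \<open>Cramer's rule over the local ring: a matrix that is invertible at \<open>w\<close> has a regular inverse
  near \<open>w\<close>.\<close>

lemma regular_inverse_matrix:
  fixes A :: "'i \<Rightarrow> 'i \<Rightarrow> 'p \<Rightarrow> 'k"
  assumes fin: "finite I"
    and reg: "\<And>i j. i \<in> I \<Longrightarrow> j \<in> I \<Longrightarrow> A i j \<in> regular"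
    and indep: "\<And>c. (\<And>j. j \<in> I \<Longrightarrow> (\<Sum>i\<in>I. c i * A i j w) = 0) \<Longrightarrow> \<forall>i\<in>I. c i = 0"
  obtains C where "\<And>i j. i \<in> I \<Longrightarrow> j \<in> I \<Longrightarrow> C i j \<in> regular"
    and "near (\<lambda>p. \<forall>i\<in>I. \<forall>l\<in>I. (\<Sum>j\<in>I. C i j p * A j l p) = (if i = l then 1 else 0))"
    and "near (\<lambda>p. \<forall>i\<in>I. \<forall>l\<in>I. (\<Sum>j\<in>I. A i j p * C j l p) = (if i = l then 1 else 0))"
proof -
  obtain h where h: "bij_betw h {0..<card I} I"
    using ex_bij_betw_nat_finite[OF fin] by blast
  define n where "n = card I"
  define g where "g = inv_into {0..<n} h"
  have hI: "h i \<in> I" if "i < n" for i using h that by (auto simp: bij_betw_def n_def)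
  have h_img: "h ` {0..<n} = I" using h by (simp add: bij_betw_def n_def)
  have gn: "g i < n" "h (g i) = i" if "i \<in> I" for i
    using that inv_into_into[of i h "{0..<n}"] f_inv_into_f[of i h "{0..<n}"]
    by (auto simp: g_def h_img)
  have gh: "g (h i) = i" if "i < n" for i
    using h that unfolding g_def n_def bij_betw_def by (simp add: inv_into_f_f)
  have sum_h: "(\<Sum>i\<in>I. f i) = (\<Sum>i = 0..<n. f (h i))" for f :: "'i \<Rightarrow> 'k"
    using sum.reindex_bij_betw[OF h, of f] by (simp add: n_def)
  define M where "M p = mat n n (\<lambda>(i, j). A (h i) (h j) p)" for p
  have M: "M p \<in> carrier_mat n n" for p by (simp add: M_def)
  have det0: "det (M w) \<noteq> 0"
  proof
    assume "det (M w) = 0"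
    \<comment> \<open>\<open>indep\<close> speaks of relations among the rows, so a kernel vector of
      the transpose is wanted.\<close>
    then have "det (transpose_mat (M w)) = 0" using det_transpose[OF M] by simp
    then obtain v where v: "v \<in> carrier_vec n" "v \<noteq> 0\<^sub>v n" "transpose_mat (M w) *\<^sub>v v = 0\<^sub>v n"
      using det_0_iff_vec_prod_zero_field[of "transpose_mat (M w)" n] M by auto
    have "(\<Sum>i\<in>I. v $ g i * A i j w) = 0" if "j \<in> I" for j
    proof -
      have "(\<Sum>i\<in>I. v $ g i * A i j w) = (\<Sum>i = 0..<n. v $ i * A (h i) j w)"
        by (subst sum_h) (auto intro!: sum.cong simp: gh)
      also have "\<dots> = (transpose_mat (M w) *\<^sub>v v) $ g j"
        using gn[OF that] v(1) by (auto simp: M_def scalar_prod_def intro!: sum.cong)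
      finally show ?thesis using v(3) gn[OF that] by simp
    qed
    then have "\<forall>i\<in>I. v $ g i = 0" by (rule indep)
    then have "v $ i = 0" if "i < n" for i using hI[OF that] gh[OF that] by force
    then have "v = 0\<^sub>v n" using v(1) by (intro eq_vecI) auto
    then show False using v by simp
  qed
  have detreg: "(\<lambda>p. det (M p)) \<in> regular"
    unfolding M_def by (rule regular_det) (auto intro: reg hI)
  \<comment> \<open>The entries of the adjugate are signed minors, hence regular; the determinant is
    the only thing that has to be inverted.\<close>
  have adj: "(\<lambda>p. adj_mat (M p) $$ (i, j)) \<in> regular" if ij: "i < n" "j < n" for i j
  proof -
    have "adj_mat (M p) $$ (i, j) = (- 1) ^ (j + i) *
        det (mat (n - 1) (n - 1) (\<lambda>(a, b). A (h (insert_index j a)) (h (insert_index i b)) p))" for p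
    proof -
      have "mat_delete (M p) j i
          = mat (n - 1) (n - 1) (\<lambda>(a, b). A (h (insert_index j a)) (h (insert_index i b)) p)"
        by (rule eq_matI)
          (use ij in \<open>auto simp: mat_delete_def M_def insert_index_def\<close>)
      then show ?thesis using ij M[of p] by (auto simp: adj_mat_def cofactor_def)
    qed
    moreover have "insert_index j a < n" if "a < n - 1" for a j
      using that by (auto simp: insert_index_def)
    ultimately show ?thesis
      by (auto intro!: regular_mult regular_det reg hI)
  qed
  define C where "C i j p = adj_mat (M p) $$ (g i, g j) * inverse (det (M p))" for i j p
  have nz: "near (\<lambda>p. det (M p) \<noteq> 0)" by (rule near_nonzero[OF detreg det0])
  show thesis
  proof (rule that[of C])
    show "C i j \<in> regular" if "i \<in> I" "j \<in> I" for i j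
      unfolding C_def using gn that by (intro regular_mult regular_inverse adj detreg det0)
    have CA: "(\<Sum>j\<in>I. C i j p * A j l p) = (if i = l then 1 else 0)"
      if "det (M p) \<noteq> 0" "i \<in> I" "l \<in> I" for i l p
    proof -
      have "(\<Sum>j\<in>I. C i j p * A j l p)
          = inverse (det (M p)) * (\<Sum>j = 0..<n. adj_mat (M p) $$ (g i, j) * A (h j) l p)"
        by (subst sum_h) (auto intro!: sum.cong simp: gh C_def sum_distrib_left)
      also have "(\<Sum>j = 0..<n. adj_mat (M p) $$ (g i, j) * A (h j) l p) = (adj_mat (M p) * M p) $$ (g i, g l)"
        using gn that M[of p] adj_mat(1)[OF M, of p]
        by (auto simp: scalar_prod_def M_def intro!: sum.cong)
      also have "\<dots> = (if i = l then det (M p) else 0)"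
        using gn that adj_mat(3)[OF M, of p] by (auto, metis)
      finally show ?thesis using that by auto
    qed
    show "near (\<lambda>p. \<forall>i\<in>I. \<forall>l\<in>I. (\<Sum>j\<in>I. C i j p * A j l p) = (if i = l then 1 else 0))"
      using nz by (rule near_mono) (use CA in auto)
    have AC: "(\<Sum>j\<in>I. A i j p * C j l p) = (if i = l then 1 else 0)"
      if "det (M p) \<noteq> 0" "i \<in> I" "l \<in> I" for i l p
    proof -
      have "(\<Sum>j\<in>I. A i j p * C j l p)
          = inverse (det (M p)) * (\<Sum>j = 0..<n. A i (h j) p * adj_mat (M p) $$ (j, g l))"
        by (subst sum_h) (auto intro!: sum.cong simp: gh C_def sum_distrib_left)
      also have "(\<Sum>j = 0..<n. A i (h j) p * adj_mat (M p) $$ (j, g l)) = (M p * adj_mat (M p)) $$ (g i, g l)"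
        using gn that M[of p] adj_mat(1)[OF M, of p]
        by (auto simp: scalar_prod_def M_def intro!: sum.cong)
      also have "\<dots> = (if i = l then det (M p) else 0)"
        using gn that adj_mat(2)[OF M, of p] by (auto, metis)
      finally show ?thesis using that by auto
    qed
    show "near (\<lambda>p. \<forall>i\<in>I. \<forall>l\<in>I. (\<Sum>j\<in>I. A i j p * C j l p) = (if i = l then 1 else 0))"
      using nz by (rule near_mono) (use AC in auto)
  qed
qed

end


section \<open>Bases adapted to a system of forms\<close>

definition all_mons :: "nat \<Rightarrow> (nat \<Rightarrow>\<^sub>0 nat) set" where
  "all_mons N = {\<mu>. keys \<mu> \<subseteq> {0..N}}"

definition mons :: "nat \<Rightarrow> nat \<Rightarrow> (nat \<Rightarrow>\<^sub>0 nat) set" where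
  "mons N n = {\<mu>. keys \<mu> \<subseteq> {0..N} \<and> tdeg \<mu> = n}"

lemma mons_all_mons: "\<mu> \<in> mons N n \<Longrightarrow> \<mu> \<in> all_mons N" by (simp add: mons_def all_mons_def)

lemma tdeg_all_mons: "\<mu> \<in> all_mons N \<Longrightarrow> tdeg \<mu> = (\<Sum>i\<le>N. lookup \<mu> i)"
  unfolding all_mons_def by (subst tdeg_superset[of "{0..N}"]) (auto simp: atLeast0AtMost)

lemma lookup_le_tdeg: "lookup \<mu> i \<le> tdeg \<mu>"
  by (cases "i \<in> keys \<mu>") (auto simp: tdeg_def in_keys_iff intro: member_le_sum)

lemma bounded_mons_finite: "finite {\<mu>. keys \<mu> \<subseteq> {0..N::nat} \<and> (\<forall>i\<le>N. lookup \<mu> i \<le> (b :: nat))}"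
    (is "finite ?A")
proof (rule finite_imageD)
  show "finite ((\<lambda>\<mu>. restrict (lookup \<mu>) {0..N}) ` ?A)"
  proof (rule finite_subset)
    show "finite (\<Pi>\<^sub>E i\<in>{0..N}. {0..b})" by (rule finite_PiE) simp_all
  qed auto
  show "inj_on (\<lambda>\<mu>. restrict (lookup \<mu>) {0..N}) ?A"
  proof (rule inj_onI, rule poly_mapping_eqI)
    fix \<mu> \<nu> i
    assume a: "\<mu> \<in> ?A" "\<nu> \<in> ?A" "restrict (lookup \<mu>) {0..N} = restrict (lookup \<nu>) {0..N}"
    show "lookup \<mu> i = lookup \<nu> i"
    proof (cases "i \<le> N")
      case True
      then show ?thesis using fun_cong[OF a(3), of i] by simp
    next
      case False
      then have "i \<notin> keys \<mu>" "i \<notin> keys \<nu>" using a by auto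
      then show ?thesis by (simp add: in_keys_iff)
    qed
  qed
qed

lemma finite_mons [simp]: "finite (mons N n)"
  by (rule finite_subset[OF _ bounded_mons_finite[of N n]]) (auto simp: mons_def lookup_le_tdeg)

lemma single_form: "\<mu> \<in> mons N n \<Longrightarrow> single \<mu> c \<in> forms N n"
  using forms_single[of \<mu> N c] by (auto simp: mons_def)

lemma single_polys: "\<mu> \<in> all_mons N \<Longrightarrow> single \<mu> c \<in> polys N"
  by (simp add: all_mons_def)

lemma form_sum_mons:
  assumes "p \<in> forms N n"
  shows "p = (\<Sum>\<mu>\<in>mons N n. const (lookup p \<mu>) * single \<mu> 1)"
proof -
  have "keys p \<subseteq> mons N n" using assms by (auto simp: forms_iff carrier_poly_ring mons_def)
  then have "(\<Sum>\<mu>\<in>keys p. single \<mu> (lookup p \<mu>)) = (\<Sum>\<mu>\<in>mons N n. single \<mu> (lookup p \<mu>))"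
    by (intro sum.mono_neutral_left) (auto simp: in_keys_iff)
  then show ?thesis using mpoly_sum_single[of p] by (simp add: single_conv[of _ "lookup p _"])
qed

lemma mono_split:
  assumes "n \<le> tdeg (\<mu> :: 'v \<Rightarrow>\<^sub>0 nat)"
  obtains \<mu>1 \<mu>2 where "\<mu> = \<mu>1 + \<mu>2" "tdeg \<mu>1 = n"
proof -
  have "\<exists>\<mu>1 \<mu>2. \<mu> = \<mu>1 + \<mu>2 \<and> tdeg \<mu>1 = n"
    using assms
  proof (induction \<mu> arbitrary: n rule: mono_induct)
    case zero
    then show ?case by (intro exI[of _ 0]) simp
  next
    case (add \<mu> v)
    show ?case
    proof (cases n)
      case 0
      then show ?thesis by (intro exI[of _ 0] exI[of _ "single v 1 + \<mu>"]) simp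
    next
      case (Suc m)
      then obtain \<mu>1 \<mu>2 where "\<mu> = \<mu>1 + \<mu>2" "tdeg \<mu>1 = m"
        using add.IH[of m] add.prems by (auto simp: tdeg_add)
      then show ?thesis using Suc
        by (intro exI[of _ "single v 1 + \<mu>1"] exI[of _ \<mu>2]) (simp add: tdeg_add add.assoc)
    qed
  qed
  then show thesis using that by blast
qed

text \<open>Transfers the fact about square matrices to an arbitrary finite index set. It turns a
  spanning family with as many members as there are monomials into an independent one.\<close>

lemma finite_left_inverse_right_inverse:
  fixes A C :: "'i \<Rightarrow> 'i \<Rightarrow> 'k::field"
  assumes fin: "finite I"
    and CA: "\<And>i l. i \<in> I \<Longrightarrow> l \<in> I \<Longrightarrow> (\<Sum>j\<in>I. C i j * A j l) = (if i = l then 1 else 0)"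
    and il: "i \<in> I" "l \<in> I"
  shows "(\<Sum>j\<in>I. A i j * C j l) = (if i = l then 1 else 0)"
proof -
  obtain h where h: "bij_betw h {0..<card I} I"
    using ex_bij_betw_nat_finite[OF fin] by blast
  define n where "n = card I"
  have hI: "h i \<in> I" if "i < n" for i using h that by (auto simp: bij_betw_def n_def)
  have hinj: "h i = h j \<longleftrightarrow> i = j" if "i < n" "j < n" for i j
    using h that by (auto simp: bij_betw_def n_def inj_on_def)
  have sum_h: "(\<Sum>i\<in>I. f i) = (\<Sum>i = 0..<n. f (h i))" for f :: "'i \<Rightarrow> 'k"
    using sum.reindex_bij_betw[OF h, of f] by (simp add: n_def)
  let ?A = "mat n n (\<lambda>(i, j). A (h i) (h j))" and ?C = "mat n n (\<lambda>(i, j). C (h i) (h j))"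
  have "?C * ?A = 1\<^sub>m n"
    using CA[OF hI hI] hinj by (intro eq_matI) (auto simp: scalar_prod_def sum_h)
  then have AC: "?A * ?C = 1\<^sub>m n"
    by (rule mat_mult_left_right_inverse[rotated 2]) auto
  obtain i' l' where i': "i = h i'" "i' < n" "l = h l'" "l' < n"
    using h il unfolding bij_betw_def n_def by (metis atLeastLessThan_iff imageE)
  have "(?A * ?C) $$ (i', l') = (\<Sum>j = 0..<n. A i (h j) * C (h j) l)"
    using i' by (auto simp: scalar_prod_def)
  then show ?thesis using AC i' hinj[of i' l'] by (auto simp: sum_h)
qed

text \<open>As many forms as variables. Nondegeneracy is added only by \<open>spanning\<close>, so
  that the definitions make sense at every parameter of a family.\<close>

locale form_system =
  fixes N :: nat and d :: "nat \<Rightarrow> nat" and G :: "nat \<Rightarrow> (nat, 'k::alg_closed_field) mpoly"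
  assumes d_pos: "i \<le> N \<Longrightarrow> 0 < d i"
    and G_form: "i \<le> N \<Longrightarrow> G i \<in> forms N (d i)"
begin

text \<open>The monomial \<mu> with each block x_i^(d_i) replaced by G_i: exponents are split into
  quotient and remainder modulo d_i. For G_i = x_i^(d_i) it is \<mu> itself.\<close>

definition Phi :: "(nat \<Rightarrow>\<^sub>0 nat) \<Rightarrow> (nat, 'k) mpoly" where
  "Phi \<mu> = (\<Prod>i\<le>N. var i ^ (lookup \<mu> i mod d i) * G i ^ (lookup \<mu> i div d i))"

definition span_Phi :: "nat \<Rightarrow> (nat, 'k) mpoly set" where
  "span_Phi n = {(\<Sum>\<mu>\<in>mons N n. const (c \<mu>) * Phi \<mu>) | c. True}"

text \<open>There are d_0 ... d_N of these, the Bezout number of the system.\<close>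

definition reduced :: "(nat \<Rightarrow>\<^sub>0 nat) set" where
  "reduced = {\<mu> \<in> all_mons N. \<forall>i\<le>N. lookup \<mu> i < d i}"

text \<open>One more than the largest degree of a reduced monomial.\<close>

definition crit :: nat where "crit = (\<Sum>i\<le>N. d i - 1) + 1"

lemma Phi_form: "\<mu> \<in> mons N n \<Longrightarrow> Phi \<mu> \<in> forms N n"
proof -
  assume mu: "\<mu> \<in> mons N n"
  have "Phi \<mu> \<in> forms N (\<Sum>i\<le>N. (lookup \<mu> i mod d i) * 1 + (lookup \<mu> i div d i) * d i)"
    unfolding Phi_def by (intro forms_prod forms_mult forms_power G_form forms_var) auto
  also have "(\<Sum>i\<le>N. (lookup \<mu> i mod d i) * 1 + (lookup \<mu> i div d i) * d i) = n"
    using mu tdeg_all_mons[OF mons_all_mons[OF mu]] by (simp add: mons_def)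
  finally show ?thesis .
qed

lemma Phi_polys: "\<mu> \<in> all_mons N \<Longrightarrow> Phi \<mu> \<in> polys N"
  using Phi_form[of \<mu> "tdeg \<mu>"] by (auto simp: mons_def all_mons_def intro: forms_polys)

lemma Phi_reduced: "\<mu> \<in> reduced \<Longrightarrow> Phi \<mu> = single \<mu> 1"
  unfolding Phi_def reduced_def all_mons_def
  by (subst single_eq_prod_var[of "{0..N}"]) (auto simp: atLeast0AtMost)

lemma finite_reduced [simp]: "finite reduced"
proof (rule finite_subset)
  show "reduced \<subseteq> {\<mu>. keys \<mu> \<subseteq> {0..N} \<and> (\<forall>i\<le>N. lookup \<mu> i \<le> (\<Sum>i\<le>N. d i))}"
    unfolding reduced_def all_mons_def
    by (auto intro!: order_trans[OF less_imp_le member_le_sum])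
qed (rule bounded_mons_finite)

lemma tdeg_reduced: "\<mu> \<in> reduced \<Longrightarrow> tdeg \<mu> < crit"
proof -
  assume mu: "\<mu> \<in> reduced"
  then have "tdeg \<mu> = (\<Sum>i\<le>N. lookup \<mu> i)" by (intro tdeg_all_mons) (simp add: reduced_def)
  also have "\<dots> \<le> (\<Sum>i\<le>N. d i - 1)" using mu by (intro sum_mono) (fastforce simp: reduced_def)
  finally show ?thesis by (simp add: crit_def)
qed

text \<open>The quotient at i grows by one and all remainders stay. Thus multiplication by G_i maps
  the family into itself, which makes the polynomial ring free over the ring generated by the G_i
  once the family is a basis.\<close>

lemma Phi_shift:
  assumes "i \<le> N"
  shows "Phi (single i (d i) + \<mu>) = G i * Phi \<mu>"
proof -
  let ?f = "\<lambda>\<mu> j. var j ^ (lookup \<mu> j mod d j) * G j ^ (lookup \<mu> j div d j)"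
  have "Phi (single i (d i) + \<mu>) = ?f (single i (d i) + \<mu>) i * (\<Prod>j\<in>{..N} - {i}. ?f (single i (d i) + \<mu>) j)"
    unfolding Phi_def using assms by (subst prod.remove[of _ i]) auto
  also have "?f (single i (d i) + \<mu>) i = G i * ?f \<mu> i"
    using d_pos[OF assms] by (simp add: lookup_add)
  also have "(\<Prod>j\<in>{..N} - {i}. ?f (single i (d i) + \<mu>) j) = (\<Prod>j\<in>{..N} - {i}. ?f \<mu> j)"
    by (intro prod.cong) (auto simp: lookup_add lookup_single when_def)
  also have "G i * ?f \<mu> i * (\<Prod>j\<in>{..N} - {i}. ?f \<mu> j) = G i * Phi \<mu>"
    unfolding Phi_def using assms by (subst (2) prod.remove[of _ i]) (auto simp: mult.assoc)
  finally show ?thesis .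
qed

lemma not_reducedE:
  assumes "\<mu> \<in> all_mons N" "\<mu> \<notin> reduced"
  obtains i \<nu> where "i \<le> N" "\<mu> = single i (d i) + \<nu>" "\<nu> \<in> all_mons N" "tdeg \<mu> = d i + tdeg \<nu>"
proof -
  obtain i where i: "i \<le> N" "d i \<le> lookup \<mu> i" using assms by (auto simp: reduced_def not_less)
  define \<nu> where "\<nu> = \<mu> - single i (d i)"
  have "\<mu> = single i (d i) + \<nu>"
    using i by (intro poly_mapping_eqI) (auto simp: \<nu>_def lookup_add lookup_minus lookup_single when_def)
  moreover from this have "\<nu> \<in> all_mons N" using assms(1) by (auto simp: all_mons_def keys_add_nat)
  ultimately show thesis using that[of i \<nu>] i by (auto simp: tdeg_add)
qed

lemma span_Phi_add: "f \<in> span_Phi n \<Longrightarrow> g \<in> span_Phi n \<Longrightarrow> f + g \<in> span_Phi n"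
proof -
  assume "f \<in> span_Phi n" "g \<in> span_Phi n"
  then obtain a b where "f = (\<Sum>\<mu>\<in>mons N n. const (a \<mu>) * Phi \<mu>)" "g = (\<Sum>\<mu>\<in>mons N n. const (b \<mu>) * Phi \<mu>)"
    unfolding span_Phi_def by blast
  then show ?thesis unfolding span_Phi_def
    by (auto intro!: exI[of _ "\<lambda>\<mu>. a \<mu> + b \<mu>"] simp: const_add algebra_simps sum.distrib)
qed

lemma span_Phi_scale: "f \<in> span_Phi n \<Longrightarrow> const c * f \<in> span_Phi n"
proof -
  assume "f \<in> span_Phi n"
  then obtain a where "f = (\<Sum>\<mu>\<in>mons N n. const (a \<mu>) * Phi \<mu>)"
    unfolding span_Phi_def by blast
  then show ?thesis unfolding span_Phi_def
    by (auto intro!: exI[of _ "\<lambda>\<mu>. c * a \<mu>"] simp: const_mult algebra_simps sum_distrib_left)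
qed

lemma span_Phi_0: "0 \<in> span_Phi n"
  unfolding span_Phi_def by (auto intro!: exI[of _ "\<lambda>\<mu>. 0"])

lemma span_Phi_sum: "(\<And>i. i \<in> A \<Longrightarrow> f i \<in> span_Phi n) \<Longrightarrow> (\<Sum>i\<in>A. f i) \<in> span_Phi n"
  by (induction A rule: infinite_finite_induct) (auto intro: span_Phi_add span_Phi_0)

lemma Phi_span: "\<mu> \<in> mons N n \<Longrightarrow> Phi \<mu> \<in> span_Phi n"
  unfolding span_Phi_def
  by (auto intro!: exI[of _ "\<lambda>\<nu>. if \<nu> = \<mu> then 1 else 0"] simp: if_distrib[of const] if_distrib[of "\<lambda>x. x * _"] sum.delta cong: if_cong)

lemma span_Phi_G: "i \<le> N \<Longrightarrow> f \<in> span_Phi n \<Longrightarrow> G i * f \<in> span_Phi (d i + n)"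
proof -
  assume i: "i \<le> N" and "f \<in> span_Phi n"
  then obtain a where "f = (\<Sum>\<mu>\<in>mons N n. const (a \<mu>) * Phi \<mu>)"
    unfolding span_Phi_def by blast
  then have "G i * f = (\<Sum>\<mu>\<in>mons N n. const (a \<mu>) * Phi (single i (d i) + \<mu>))"
    using i by (simp add: Phi_shift sum_distrib_left mult.left_commute)
  also have "\<dots> \<in> span_Phi (d i + n)"
    using i by (intro span_Phi_sum span_Phi_scale Phi_span) (auto simp: mons_def keys_add_nat tdeg_add)
  finally show ?thesis .
qed

text \<open>Degrees up to \<open>crit\<close> suffice by \<open>forms_span_Phi\<close>. The bound
  leaves finitely many conditions, which can be met together on one neighbourhood of a
  parameter.\<close>

definition spanning :: bool where
  "spanning \<longleftrightarrow> (\<forall>n\<le>crit. \<forall>\<mu>\<in>mons N n. single \<mu> 1 \<in> span_Phi n)"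

lemma forms_spanI:
  assumes "f \<in> forms N n" "\<And>\<mu>. \<mu> \<in> mons N n \<Longrightarrow> single \<mu> 1 \<in> span_Phi n"
  shows "f \<in> span_Phi n"
  by (subst form_sum_mons[OF assms(1)]) (intro span_Phi_sum span_Phi_scale assms(2))

text \<open>Above the critical degree every monomial is a combination of multiples of the \<open>G i\<close>, because
  no reduced monomial has critical degree.\<close>

lemma forms_span_Phi:
  assumes spanning "f \<in> forms N n"
  shows "f \<in> span_Phi n"
  using assms(2)
proof (induction n arbitrary: f rule: less_induct)
  case (less n)
  show ?case
  proof (rule forms_spanI[OF less.prems])
    fix \<mu> assume mu: "\<mu> \<in> mons N n"
    show "single \<mu> 1 \<in> span_Phi n"
    proof (cases "n \<le> crit")
      case True
      then show ?thesis using assms(1) mu unfolding spanning_def by blast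
    next
      case False
      then obtain \<mu>1 \<mu>2 where m: "\<mu> = \<mu>1 + \<mu>2" "tdeg \<mu>1 = crit"
        using mu mono_split[of crit \<mu>] by (auto simp: mons_def)
      then have mm: "\<mu>1 \<in> mons N crit" "\<mu>2 \<in> mons N (n - crit)"
        using mu by (auto simp: mons_def keys_add_nat tdeg_add)
      then have "single \<mu>1 1 \<in> span_Phi crit" using assms(1) unfolding spanning_def by blast
      then obtain a where "single \<mu>1 1 = (\<Sum>\<nu>\<in>mons N crit. const (a \<nu>) * Phi \<nu>)"
        unfolding span_Phi_def by blast
      then have eq: "single \<mu> 1 = (\<Sum>\<nu>\<in>mons N crit. const (a \<nu>) * (Phi \<nu> * single \<mu>2 1))"
        using m mult_single[of \<mu>1 "1::'k" \<mu>2 1] by (simp add: sum_distrib_right mult.assoc)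
      have "Phi \<nu> * single \<mu>2 1 \<in> span_Phi n" if nu: "\<nu> \<in> mons N crit" for \<nu>
      proof -
        have "\<nu> \<notin> reduced" using tdeg_reduced[of \<nu>] nu by (auto simp: mons_def)
        then obtain i \<nu>' where i: "i \<le> N" "\<nu> = single i (d i) + \<nu>'" "\<nu>' \<in> all_mons N" "tdeg \<nu> = d i + tdeg \<nu>'"
          using not_reducedE[OF mons_all_mons[OF nu]] by metis
        have t: "crit = d i + tdeg \<nu>'" using nu i by (simp add: mons_def)
        have "Phi \<nu>' * single \<mu>2 1 \<in> forms N (tdeg \<nu>' + (n - crit))"
          using i mm by (intro forms_mult Phi_form single_form) (auto simp: all_mons_def mons_def)
        then have "Phi \<nu>' * single \<mu>2 1 \<in> forms N (n - d i)"
          using t False by simp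
        moreover have "n - d i < n" using d_pos[OF i(1)] False by simp
        ultimately have "Phi \<nu>' * single \<mu>2 1 \<in> span_Phi (n - d i)" by (rule less.IH[rotated])
        then have "G i * (Phi \<nu>' * single \<mu>2 1) \<in> span_Phi (d i + (n - d i))"
          by (rule span_Phi_G[OF i(1)])
        moreover have "d i + (n - d i) = n" using t False by simp
        ultimately show ?thesis using i by (simp add: Phi_shift mult.assoc)
      qed
      then show ?thesis unfolding eq by (intro span_Phi_sum span_Phi_scale)
    qed
  qed
qed

text \<open>The family \<open>Phi\<close> has as many members of degree \<open>n\<close> as there are monomials, so it is a basis.\<close>

lemma Phi_independent:
  assumes span: "\<And>\<mu>. \<mu> \<in> mons N n \<Longrightarrow> single \<mu> 1 \<in> span_Phi n"
    and zero: "(\<Sum>\<nu>\<in>mons N n. const (c \<nu>) * Phi \<nu>) = 0" and nu: "\<nu> \<in> mons N n"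
  shows "c \<nu> = 0"
proof -
  have "\<forall>\<mu>\<in>mons N n. \<exists>C. single \<mu> 1 = (\<Sum>\<nu>\<in>mons N n. const (C \<nu>) * Phi \<nu>)"
    using span unfolding span_Phi_def by blast
  then obtain C where C: "\<And>\<mu>. \<mu> \<in> mons N n \<Longrightarrow> single \<mu> 1 = (\<Sum>\<nu>\<in>mons N n. const (C \<mu> \<nu>) * Phi \<nu>)"
    by metis
  let ?A = "\<lambda>\<nu> \<mu>. lookup (Phi \<nu>) \<mu>"
  have CA: "(\<Sum>j\<in>mons N n. C i j * ?A j l) = (if i = l then 1 else 0)" if "i \<in> mons N n" "l \<in> mons N n" for i l
  proof -
    have "(\<Sum>j\<in>mons N n. C i j * ?A j l) = lookup (single i 1) l"
      using C[OF that(1)] by (simp add: lookup_sum)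
    then show ?thesis by (simp add: lookup_single when_def)
  qed
  have AC: "(\<Sum>j\<in>mons N n. ?A i j * C j l) = (if i = l then 1 else 0)" if "i \<in> mons N n" "l \<in> mons N n" for i l
    by (rule finite_left_inverse_right_inverse[of "mons N n" C ?A, OF finite_mons CA that])
  have "c \<nu> = (\<Sum>i\<in>mons N n. c i * (if i = \<nu> then 1 else 0))"
    using nu by (simp add: if_distrib sum.delta cong: if_cong)
  also have "\<dots> = (\<Sum>i\<in>mons N n. \<Sum>j\<in>mons N n. c i * (?A i j * C j \<nu>))"
    using AC nu by (intro sum.cong) (auto simp: sum_distrib_left[symmetric])
  also have "\<dots> = (\<Sum>j\<in>mons N n. (\<Sum>i\<in>mons N n. c i * ?A i j) * C j \<nu>)"
    by (subst sum.swap) (simp add: sum_distrib_right mult.assoc)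
  also have "\<dots> = 0"
  proof (intro sum.neutral ballI)
    fix j
    have "(\<Sum>i\<in>mons N n. c i * ?A i j) = 0"
    using arg_cong[OF zero, of "\<lambda>f. lookup f j"] by (simp add: lookup_sum)
    then show "(\<Sum>i\<in>mons N n. c i * ?A i j) * C j \<nu> = 0" by simp
  qed
  finally show ?thesis .
qed

text \<open>The members of the family are homogeneous, so a relation splits into relations of fixed
  degree, to which \<open>Phi_independent\<close> applies.\<close>

lemma Phi_independent_all:
  assumes spanning and S: "finite S" "S \<subseteq> all_mons N"
    and zero: "(\<Sum>\<nu>\<in>S. const (c \<nu>) * Phi \<nu>) = 0" and nu: "\<nu> \<in> S"
  shows "c \<nu> = 0"
proof -
  define n where "n = tdeg \<nu>"
  define c' where "c' \<mu> = (if \<mu> \<in> S then c \<mu> else 0)" for \<mu>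
  have "0 = hcomp n (\<Sum>\<nu>\<in>S. const (c \<nu>) * Phi \<nu>)"
    using zero by (auto simp: hcomp_def)
  also have "\<dots> = (\<Sum>\<nu>\<in>S. if tdeg \<nu> = n then const (c \<nu>) * Phi \<nu> else 0)"
    unfolding hcomp_sum
  proof (intro sum.cong refl)
    fix \<mu> assume "\<mu> \<in> S"
    then have "const (c \<mu>) * Phi \<mu> \<in> forms N (tdeg \<mu>)"
      using S Phi_form[of \<mu> "tdeg \<mu>"] by (auto simp: all_mons_def mons_def)
    then show "hcomp n (const (c \<mu>) * Phi \<mu>) = (if tdeg \<mu> = n then const (c \<mu>) * Phi \<mu> else 0)"
      by (subst hcomp_form) auto
  qed
  also have "\<dots> = (\<Sum>\<nu>\<in>{\<nu>\<in>S. tdeg \<nu> = n}. const (c' \<nu>) * Phi \<nu>)"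
    using S by (subst sum.inter_filter[symmetric]) (auto simp: c'_def intro!: sum.cong)
  also have "\<dots> = (\<Sum>\<nu>\<in>mons N n. const (c' \<nu>) * Phi \<nu>)"
    using S by (intro sum.mono_neutral_left finite_mons) (auto simp: c'_def mons_def all_mons_def)
  finally have "c' \<nu> = 0"
  proof (intro Phi_independent[of n c' \<nu>])
    show "\<nu> \<in> mons N n" using nu S by (auto simp: mons_def all_mons_def n_def)
    show "single \<mu> 1 \<in> span_Phi n" if "\<mu> \<in> mons N n" for \<mu>
      using that by (intro forms_span_Phi \<open>spanning\<close> single_form)
  qed auto
  then show ?thesis using nu by (simp add: c'_def)
qed

end


section \<open>Zeros of a system with a simple spectrum\<close>

text \<open>The value at q of the algebra homomorphism from k[T] to the polynomial ring that sends T
  to u.\<close>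

definition pcompose_mpoly :: "'k::field poly \<Rightarrow> ('v, 'k) mpoly \<Rightarrow> ('v, 'k) mpoly" where
  "pcompose_mpoly q u = poly (map_poly const q) u"

lemma pcompose_mpoly_0 [simp]: "pcompose_mpoly 0 u = 0"
  by (simp add: pcompose_mpoly_def)

lemma pcompose_mpoly_pCons [simp]: "pcompose_mpoly (pCons a q) u = const a + u * pcompose_mpoly q u"
  by (cases "a = 0 \<and> q = 0") (auto simp: pcompose_mpoly_def map_poly_pCons)

lemma pcompose_mpoly_add: "pcompose_mpoly (p + q) u = pcompose_mpoly p u + pcompose_mpoly q u"
  by (induction p q rule: poly_induct2) (auto simp: const_add algebra_simps)

lemma pcompose_mpoly_smult: "pcompose_mpoly (smult a p) u = const a * pcompose_mpoly p u"
  by (induction p) (auto simp: const_mult algebra_simps)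

lemma pcompose_mpoly_mult: "pcompose_mpoly (p * q) u = pcompose_mpoly p u * pcompose_mpoly q u"
  by (induction p) (auto simp: pcompose_mpoly_add pcompose_mpoly_smult algebra_simps)

lemma pcompose_mpoly_diff: "pcompose_mpoly (p - q) u = pcompose_mpoly p u - pcompose_mpoly q u"
  using pcompose_mpoly_add[of "p - q" q u] by simp

lemma pcompose_mpoly_sum: "pcompose_mpoly (\<Sum>i\<in>A. f i) u = (\<Sum>i\<in>A. pcompose_mpoly (f i) u)"
  by (induction A rule: infinite_finite_induct) (auto simp: pcompose_mpoly_add)

lemma pcompose_mpoly_monom: "pcompose_mpoly (monom a n) u = const a * u ^ n"
  by (induction n) (auto simp: monom_0 monom_Suc algebra_simps)

lemma eval_pcompose_mpoly [simp]: "mpoly_eval x (pcompose_mpoly q u) = poly q (mpoly_eval x u)"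
  by (induction q) auto

lemma pcompose_mpoly_polys [simp]: "u \<in> polys N \<Longrightarrow> pcompose_mpoly q u \<in> polys N"
  by (induction q) auto

text \<open>At a root r of p both polynomials lose the factor T - r. Simplicity keeps r from being a
  root of the cofactor of p, so at the roots of that cofactor the zeros of q come from the cofactor
  of q.\<close>

lemma dvd_if_simple_roots:
  fixes p q :: "'k::alg_closed_field poly"
  assumes "p \<noteq> 0" and simple: "\<And>r. poly p r = 0 \<Longrightarrow> poly (pderiv p) r \<noteq> 0"
    and zeros: "\<And>r. poly p r = 0 \<Longrightarrow> poly q r = 0"
  shows "p dvd q"
  using assms
proof (induction "degree p" arbitrary: p q)
  case 0
  then show ?case using is_unit_iff_degree by (metis dvd_trans one_dvd)
next
  case (Suc n)
  then obtain r where r: "poly p r = 0" using alg_closed_imp_poly_has_root[of p] by auto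
  then obtain p1 where p1: "p = [:- r, 1:] * p1" by (metis dvdE poly_eq_0_iff_dvd)
  obtain q1 where q1: "q = [:- r, 1:] * q1" using Suc.prems(3)[OF r] by (metis dvdE poly_eq_0_iff_dvd)
  have p1nz: "p1 \<noteq> 0" using Suc.prems(1) p1 by auto
  have d: "pderiv p = p1 + [:- r, 1:] * pderiv p1"
    unfolding p1 by (simp only: pderiv_mult) (simp add: pderiv_pCons algebra_simps)
  have r1: "poly p1 r \<noteq> 0" using Suc.prems(2)[OF r] d by simp
  have "p1 dvd q1"
  proof (rule Suc.hyps(1))
    show "n = degree p1" using Suc.hyps(2) p1nz unfolding p1 by (subst (asm) degree_mult_eq) auto
    show "p1 \<noteq> 0" by fact
    fix s assume s: "poly p1 s = 0"
    then have "s \<noteq> r" using r1 by auto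
    have ps: "poly p s = 0" using s p1 by simp
    show "poly (pderiv p1) s \<noteq> 0" using Suc.prems(2)[OF ps] d s by auto
    show "poly q1 s = 0" using Suc.prems(3)[OF ps] q1 \<open>s \<noteq> r\<close> by auto
  qed
  then show ?case unfolding p1 q1 by (rule mult_dvd_mono[OF dvd_refl])
qed

context form_system
begin

text \<open>Levels make the system affine: under \<open>spanning\<close> the forms G_i have only the
  origin as a common zero, with full multiplicity, while the equations G_i = c_i can define distinct
  points.\<close>

definition level_ideal :: "(nat \<Rightarrow> 'k) \<Rightarrow> (nat, 'k) mpoly set" where
  "level_ideal c = {(\<Sum>i\<le>N. (G i - const (c i)) * h i) | h. \<forall>i\<le>N. h i \<in> polys N}"

lemma level_ideal_0: "0 \<in> level_ideal c"
  unfolding level_ideal_def by (auto intro!: exI[of _ "\<lambda>_. 0"])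

lemma level_ideal_add:
  assumes "f \<in> level_ideal c" "g \<in> level_ideal c"
  shows "f + g \<in> level_ideal c"
proof -
  obtain h k where "\<forall>i\<le>N. h i \<in> polys N" "f = (\<Sum>i\<le>N. (G i - const (c i)) * h i)"
    "\<forall>i\<le>N. k i \<in> polys N" "g = (\<Sum>i\<le>N. (G i - const (c i)) * k i)"
    using assms unfolding level_ideal_def by blast
  then show ?thesis unfolding level_ideal_def
    by (auto intro!: exI[of _ "\<lambda>i. h i + k i"] simp: distrib_left sum.distrib)
qed

lemma level_ideal_mult:
  assumes "f \<in> level_ideal c" "g \<in> polys N"
  shows "f * g \<in> level_ideal c"
proof -
  obtain h where "\<forall>i\<le>N. h i \<in> polys N" "f = (\<Sum>i\<le>N. (G i - const (c i)) * h i)"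
    using assms unfolding level_ideal_def by blast
  then show ?thesis using assms(2) unfolding level_ideal_def
    by (auto intro!: exI[of _ "\<lambda>i. h i * g"] simp: mult.assoc sum_distrib_right)
qed

lemma level_ideal_mult': "f \<in> level_ideal c \<Longrightarrow> g \<in> polys N \<Longrightarrow> g * f \<in> level_ideal c"
  using level_ideal_mult[of f c g] by (simp add: mult.commute)

lemma level_ideal_uminus: "f \<in> level_ideal c \<Longrightarrow> - f \<in> level_ideal c"
  using level_ideal_mult'[of f c "- 1"] by simp

lemma level_ideal_diff: "f \<in> level_ideal c \<Longrightarrow> g \<in> level_ideal c \<Longrightarrow> f - g \<in> level_ideal c"
  using level_ideal_add[of f c "- g"] level_ideal_uminus by simp

lemma level_ideal_sum: "(\<And>i. i \<in> A \<Longrightarrow> f i \<in> level_ideal c) \<Longrightarrow> (\<Sum>i\<in>A. f i) \<in> level_ideal c"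
  by (induction A rule: infinite_finite_induct) (auto intro: level_ideal_add level_ideal_0)

lemma level_ideal_generator: "i \<le> N \<Longrightarrow> G i - const (c i) \<in> level_ideal c"
  unfolding level_ideal_def
  by (auto intro!: exI[of _ "\<lambda>j. if j = i then 1 else 0"] simp: if_distrib[of "\<lambda>x. _ * x"] sum.delta cong: if_cong)

lemma level_ideal_polys: "f \<in> level_ideal c \<Longrightarrow> f \<in> polys N"
  unfolding level_ideal_def by (auto intro!: polys_sum polys_mult polys_diff forms_polys[OF G_form])

lemma level_ideal_trans: "f - g \<in> level_ideal c \<Longrightarrow> g - h \<in> level_ideal c \<Longrightarrow> f - h \<in> level_ideal c"
  using level_ideal_add[of "f - g" c "g - h"] by simp

lemma level_ideal_sym: "f - g \<in> level_ideal c \<Longrightarrow> g - f \<in> level_ideal c"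
  using level_ideal_uminus[of "f - g" c] by simp

text \<open>The polynomial ring is free over the ring generated by the \<open>G i\<close>, with the reduced monomials
  as a basis; specializing \<open>G i\<close> to \<open>c i\<close> gives the coordinate functionals of the quotient.\<close>

lemma reduced_independent:
  assumes spanning and J: "(\<Sum>\<mu>\<in>reduced. const (a \<mu>) * single \<mu> 1) \<in> level_ideal c" and b: "b \<in> reduced"
  shows "a b = 0"
proof -
  interpret vs: vector_space_pair "\<lambda>(c::'k) (p::(nat, 'k) mpoly). const c * p" "\<lambda>(c::'k) (x::'k). c * x"
    by unfold_locales (auto simp: const_add const_mult algebra_simps)
  have inj: "inj_on Phi (all_mons N)"
  proof (rule inj_onI, rule ccontr)
    fix \<mu> \<nu> assume m: "\<mu> \<in> all_mons N" "\<nu> \<in> all_mons N" "Phi \<mu> = Phi \<nu>" "\<mu> \<noteq> \<nu>"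
    have "(if \<mu> = \<mu> then 1 else -1) = (0::'k)"
      by (rule Phi_independent_all[OF \<open>spanning\<close>, of "{\<mu>, \<nu>}" "\<lambda>x. if x = \<mu> then 1 else -1"])
        (use m in \<open>auto simp: const_uminus\<close>)
    then show False by simp
  qed
  have indep: "vs.vs1.independent (Phi ` all_mons N)"
    unfolding vs.vs1.independent_explicit_finite_subsets
  proof (intro allI impI ballI)
    fix S u v
    assume S: "S \<subseteq> Phi ` all_mons N" "finite S" and z: "(\<Sum>v\<in>S. const (u v) * v) = 0" and v: "v \<in> S"
    obtain T where T: "T \<subseteq> all_mons N" "S = Phi ` T" "finite T"
      using S by (meson finite_subset_image)
    obtain t where t: "t \<in> T" "v = Phi t" using T v by auto
    have "(\<Sum>v\<in>S. const (u v) * v) = (\<Sum>\<nu>\<in>T. const (u (Phi \<nu>)) * Phi \<nu>)"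
      unfolding T(2) by (subst sum.reindex) (use inj T inj_on_subset in auto)
    then show "u v = 0" using Phi_independent_all[OF \<open>spanning\<close> T(3,1), of "\<lambda>\<nu>. u (Phi \<nu>)" t] z t by simp
  qed
  \<comment> \<open>\<open>val\<close> reads off the coefficient of b after each G_i has been
    replaced by c_i: \<open>Phi \<nu>\<close> is the reduced monomial of the remainders times powers
    of the G_i, and only the remainder b counts. Its linear extension l kills
    \<open>(G i - const (c i)) * Phi \<mu>\<close> by \<open>val_shift\<close>.\<close>
  define val where "val \<nu> = (if \<forall>i\<le>N. lookup \<nu> i mod d i = lookup b i then \<Prod>i\<le>N. c i ^ (lookup \<nu> i div d i) else 0)" for \<nu>
  obtain l where lin: "Vector_Spaces.linear (\<lambda>c p. const c * p) (*) l"
    and l: "\<And>x. x \<in> Phi ` all_mons N \<Longrightarrow> l x = val (inv_into (all_mons N) Phi x)"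
    using vs.linear_independent_extend[OF indep, of "\<lambda>x. val (inv_into (all_mons N) Phi x)"] by blast
  interpret l: Vector_Spaces.linear "\<lambda>c p. const c * p" "(*)" l by (rule lin)
  have lPhi: "l (Phi \<nu>) = val \<nu>" if "\<nu> \<in> all_mons N" for \<nu>
    using that l inj by (simp add: inv_into_f_f)
  have val_shift: "val (single i (d i) + \<nu>) = c i * val \<nu>" if i: "i \<le> N" for i \<nu>
  proof -
    have "(\<Prod>j\<le>N. c j ^ (lookup (single i (d i) + \<nu>) j div d j)) = c i * (\<Prod>j\<le>N. c j ^ (lookup \<nu> j div d j))"
      using i d_pos[OF i]
      by (subst (1 2) prod.remove[of _ i]) (auto simp: lookup_add lookup_single when_def intro!: prod.cong)
    moreover have "lookup (single i (d i) + \<nu>) j mod d j = lookup \<nu> j mod d j" for j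
      by (auto simp: lookup_add lookup_single when_def)
    ultimately show ?thesis by (auto simp: val_def)
  qed
  have l_form: "l ((G i - const (c i)) * h) = 0" if i: "i \<le> N" and h: "h \<in> forms N n" for i h n
  proof -
    obtain e where e: "h = (\<Sum>\<mu>\<in>mons N n. const (e \<mu>) * Phi \<mu>)"
      using forms_span_Phi[OF \<open>spanning\<close> h] unfolding span_Phi_def by blast
    have "(G i - const (c i)) * h
        = (\<Sum>\<mu>\<in>mons N n. const (e \<mu>) * Phi (single i (d i) + \<mu>) - const (c i) * (const (e \<mu>) * Phi \<mu>))"
      unfolding e sum_distrib_left Phi_shift[OF i] by (intro sum.cong refl) (simp add: algebra_simps)
    also have "l \<dots> = (\<Sum>\<mu>\<in>mons N n. e \<mu> * val (single i (d i) + \<mu>) - c i * (e \<mu> * val \<mu>))"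
      unfolding l.sum
    proof (intro sum.cong refl)
      fix \<mu> assume "\<mu> \<in> mons N n"
      then have "\<mu> \<in> all_mons N" "single i (d i) + \<mu> \<in> all_mons N"
        using i by (auto simp: mons_def all_mons_def keys_add_nat)
      then show "l (const (e \<mu>) * Phi (single i (d i) + \<mu>) - const (c i) * (const (e \<mu>) * Phi \<mu>))
          = e \<mu> * val (single i (d i) + \<mu>) - c i * (e \<mu> * val \<mu>)"
        by (simp only: l.diff l.scale lPhi)
    qed
    also have "\<dots> = 0" using i by (simp add: val_shift)
    finally show ?thesis .
  qed
  have l_poly: "l ((G i - const (c i)) * h) = 0" if i: "i \<le> N" and h: "h \<in> polys N" for i h
  proof -
    have "l ((G i - const (c i)) * h) = (\<Sum>n\<le>maxdeg h. l ((G i - const (c i)) * hcomp n h))"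
      by (subst sum_hcomp[of h]) (simp add: sum_distrib_left l.sum)
    then show ?thesis using l_form[OF i hcomp_forms[OF h]] by simp
  qed
  obtain h where h: "\<forall>i\<le>N. h i \<in> polys N"
    "(\<Sum>\<mu>\<in>reduced. const (a \<mu>) * single \<mu> 1) = (\<Sum>i\<le>N. (G i - const (c i)) * h i)"
    using J unfolding level_ideal_def by blast
  have "l (\<Sum>\<mu>\<in>reduced. const (a \<mu>) * single \<mu> 1) = 0"
    unfolding h(2) l.sum using h(1) by (simp add: l_poly)
  also have "l (\<Sum>\<mu>\<in>reduced. const (a \<mu>) * single \<mu> 1) = (\<Sum>\<mu>\<in>reduced. if \<mu> = b then a \<mu> else 0)"
    unfolding l.sum
  proof (intro sum.cong refl)
    fix \<mu> assume mu: "\<mu> \<in> reduced"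
    have "val \<mu> = (if \<mu> = b then 1 else 0)"
    proof -
      have eq: "(\<forall>i\<le>N. lookup \<mu> i mod d i = lookup b i) \<longleftrightarrow> \<mu> = b"
      proof
        assume h: "\<forall>i\<le>N. lookup \<mu> i mod d i = lookup b i"
        show "\<mu> = b"
        proof (rule poly_mapping_eqI)
          fix i
          show "lookup \<mu> i = lookup b i"
          proof (cases "i \<le> N")
            case True
            then show ?thesis using h mu by (auto simp: reduced_def)
          next
            case False
            then have "i \<notin> keys \<mu>" "i \<notin> keys b" using mu b by (auto simp: reduced_def all_mons_def)
            then show ?thesis by (simp add: in_keys_iff)
          qed
        qed
      next
        assume "\<mu> = b"
        then show "\<forall>i\<le>N. lookup \<mu> i mod d i = lookup b i" using b by (auto simp: reduced_def)
      qed
      have one: "(\<Prod>i\<le>N. c i ^ (lookup \<mu> i div d i)) = 1"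
        using mu by (intro prod.neutral) (auto simp: reduced_def)
      show ?thesis unfolding val_def eq one ..
    qed
    moreover have "l (single \<mu> 1) = val \<mu>"
      using mu by (subst Phi_reduced[symmetric]) (auto intro: lPhi simp: reduced_def)
    ultimately show "l (const (a \<mu>) * single \<mu> 1) = (if \<mu> = b then a \<mu> else 0)"
      by (simp add: l.scale)
  qed
  finally show ?thesis using b by (simp add: sum.delta)
qed

text \<open>The quotient by the level ideal is \<open>k[T]/(\<chi>)\<close>, the class of \<open>T\<close> being that of \<open>u\<close>; the
  roots of \<open>\<chi>\<close>, all simple, are the points of the level set.\<close>

lemma simple_level_set:
  assumes spanning and u: "u \<in> polys N"
    and gen: "\<And>f. f \<in> polys N \<Longrightarrow> \<exists>q. f - pcompose_mpoly q u \<in> level_ideal c"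
    and chi: "\<chi> \<noteq> 0" "pcompose_mpoly \<chi> u \<in> level_ideal c"
    and ker: "\<And>q. pcompose_mpoly q u \<in> level_ideal c \<Longrightarrow> \<chi> dvd q"
    and unit: "1 - pcompose_mpoly (pderiv \<chi>) u * K * y \<in> level_ideal c" "K \<in> polys N" "y \<in> polys N"
  shows "\<exists>Z. (\<forall>x\<in>Z. (\<forall>i\<le>N. mpoly_eval x (G i) = c i) \<and> mpoly_eval x K \<noteq> 0) \<and>
    (\<forall>a. (\<forall>x\<in>Z. (\<Sum>b\<in>reduced. a b * mono_eval x b) = 0) \<longrightarrow> (\<forall>b\<in>reduced. a b = 0))"
proof -
  have "\<forall>i\<in>{..N}. \<exists>q. var i - pcompose_mpoly q u \<in> level_ideal c"
    using gen by simp
  then obtain q where q: "\<And>i. i \<le> N \<Longrightarrow> var i - pcompose_mpoly (q i) u \<in> level_ideal c"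
    by (metis atMost_iff)
  \<comment> \<open>P is f with the q i substituted for the variables, so its value at t is that of
    f at the point of the curve (q_0(t), ..., q_N(t)).\<close>
  have lift: "\<exists>P. f - pcompose_mpoly P u \<in> level_ideal c \<and> (\<forall>t. poly P t = mpoly_eval (\<lambda>i. poly (q i) t) f)"
    if "f \<in> polys N" for f
    using that
  proof (induction f rule: polys_induct)
    case (const a)
    show ?case by (intro exI[of _ "[:a:]"]) (simp add: level_ideal_0)
  next
    case (add f g)
    then obtain P Q where "f - pcompose_mpoly P u \<in> level_ideal c" "\<forall>t. poly P t = mpoly_eval (\<lambda>i. poly (q i) t) f"
      "g - pcompose_mpoly Q u \<in> level_ideal c" "\<forall>t. poly Q t = mpoly_eval (\<lambda>i. poly (q i) t) g" by blast
    then show ?case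
      using level_ideal_add[of "f - pcompose_mpoly P u" c "g - pcompose_mpoly Q u"]
      by (intro exI[of _ "P + Q"]) (simp add: pcompose_mpoly_add algebra_simps)
  next
    case (var i f)
    then obtain P where P: "f - pcompose_mpoly P u \<in> level_ideal c" "\<forall>t. poly P t = mpoly_eval (\<lambda>i. poly (q i) t) f"
      by blast
    have "var i * (f - pcompose_mpoly P u) + (var i - pcompose_mpoly (q i) u) * pcompose_mpoly P u \<in> level_ideal c"
      using P q[of i] var u by (intro level_ideal_add level_ideal_mult level_ideal_mult') auto
    then show ?case using P
      by (intro exI[of _ "q i * P"]) (simp add: pcompose_mpoly_mult algebra_simps)
  qed
  \<comment> \<open>Every coordinate is a polynomial in u modulo the ideal, so a value r of u
    determines a point; the ideal vanishes there if r is a root of \<chi>.\<close>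
  define pt where "pt r = (\<lambda>i. poly (q i) r)" for r
  have vanish: "mpoly_eval (pt r) f = 0" if f: "f \<in> level_ideal c" and r: "poly \<chi> r = 0" for f r
  proof -
    obtain P where P: "f - pcompose_mpoly P u \<in> level_ideal c" "\<forall>t. poly P t = mpoly_eval (\<lambda>i. poly (q i) t) f"
      using lift[OF level_ideal_polys[OF f]] by blast
    have "pcompose_mpoly P u \<in> level_ideal c" using level_ideal_diff[OF f P(1)] by simp
    then have "poly P r = 0" using ker r by (metis dvd_trans poly_eq_0_iff_dvd)
    then show ?thesis using P(2) by (simp add: pt_def)
  qed
  have u_pt: "mpoly_eval (pt r) u = r" if r: "poly \<chi> r = 0" for r
  proof -
    obtain P where P: "u - pcompose_mpoly P u \<in> level_ideal c" "\<forall>t. poly P t = mpoly_eval (\<lambda>i. poly (q i) t) u"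
      using lift[OF u] by blast
    then have "pcompose_mpoly ([:0, 1:] - P) u \<in> level_ideal c" by (simp add: pcompose_mpoly_diff)
    then have "poly ([:0, 1:] - P) r = 0" using ker r by (metis dvd_trans poly_eq_0_iff_dvd)
    then show ?thesis using P(2) by (simp add: pt_def)
  qed
  define Z where "Z = pt ` {r. poly \<chi> r = 0}"
  \<comment> \<open>At \<open>pt r\<close> the relation in \<open>unit\<close> becomes 1 =
    \<chi>'(r) K(pt r) y(pt r), so no factor vanishes.\<close>
  have nonzero: "poly (pderiv \<chi>) r \<noteq> 0 \<and> mpoly_eval (pt r) K \<noteq> 0" if r: "poly \<chi> r = 0" for r
    using vanish[OF unit(1) r] u_pt[OF r] by auto
  show ?thesis
  proof (intro exI[of _ Z] conjI ballI allI impI)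
    fix x i assume "x \<in> Z" and i: "i \<le> N"
    then obtain r where r: "x = pt r" "poly \<chi> r = 0" by (auto simp: Z_def)
    then show "mpoly_eval x (G i) = c i" using vanish[OF level_ideal_generator[OF i] r(2)] by simp
  next
    fix x assume "x \<in> Z"
    then show "mpoly_eval x K \<noteq> 0" using nonzero by (auto simp: Z_def)
  next
    fix a b assume z: "\<forall>x\<in>Z. (\<Sum>b\<in>reduced. a b * mono_eval x b) = 0" and b: "b \<in> reduced"
    let ?f = "\<Sum>\<mu>\<in>reduced. const (a \<mu>) * single \<mu> 1"
    have "?f \<in> polys N"
      by (intro polys_sum polys_mult polys_const single_polys) (auto simp: reduced_def)
    then obtain Q where Q: "?f - pcompose_mpoly Q u \<in> level_ideal c" using gen by blast
    have "poly Q r = 0" if r: "poly \<chi> r = 0" for r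
    proof -
      have "mpoly_eval (pt r) ?f = 0"
        using z r by (auto simp: Z_def eval_single)
      then show ?thesis using vanish[OF Q r] u_pt[OF r] by simp
    qed
    then have "\<chi> dvd Q" using chi(1) nonzero by (intro dvd_if_simple_roots) auto
    then obtain Q' where "Q = \<chi> * Q'" by (rule dvdE)
    then have "pcompose_mpoly Q u \<in> level_ideal c"
      using level_ideal_mult[OF chi(2), of "pcompose_mpoly Q' u"] u by (simp add: pcompose_mpoly_mult)
    then have "?f \<in> level_ideal c" using level_ideal_add[OF Q, of "pcompose_mpoly Q u"] by simp
    then show "a b = 0" using reduced_independent[OF \<open>spanning\<close>] b by blast
  qed
qed

end


section \<open>Families of polynomials with regular coefficients\<close>

context function_ring
begin

text \<open>The set M of monomials is the same for all parameters, which keeps the number of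
  coefficient functions finite.\<close>

definition family :: "nat \<Rightarrow> ('p \<Rightarrow> (nat, 'k) mpoly) set" where
  "family N = {f. \<exists>M a. finite M \<and> M \<subseteq> all_mons N \<and> (\<forall>\<mu>\<in>M. a \<mu> \<in> regular) \<and>
     (\<forall>p\<in>D. f p = (\<Sum>\<mu>\<in>M. const (a \<mu> p) * single \<mu> 1))}"

lemma family_cong: "f \<in> family N \<Longrightarrow> (\<And>p. p \<in> D \<Longrightarrow> g p = f p) \<Longrightarrow> g \<in> family N"
  unfolding family_def by fastforce

lemma family_term:
  assumes "\<phi> \<in> regular" "\<mu> \<in> all_mons N"
  shows "(\<lambda>p. const (\<phi> p) * single \<mu> 1) \<in> family N"
  unfolding family_def
  by (intro CollectI exI[of _ "{\<mu>}"] exI[of _ "\<lambda>_. \<phi>"]) (use assms in auto)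

lemma family_add:
  assumes "f \<in> family N" "g \<in> family N"
  shows "(\<lambda>p. f p + g p) \<in> family N"
proof -
  obtain M a where f: "finite M" "M \<subseteq> all_mons N" "\<And>\<mu>. \<mu> \<in> M \<Longrightarrow> a \<mu> \<in> regular"
    "\<And>p. p \<in> D \<Longrightarrow> f p = (\<Sum>\<mu>\<in>M. const (a \<mu> p) * single \<mu> 1)"
    using assms(1) unfolding family_def by blast
  obtain L b where g: "finite L" "L \<subseteq> all_mons N" "\<And>\<mu>. \<mu> \<in> L \<Longrightarrow> b \<mu> \<in> regular"
    "\<And>p. p \<in> D \<Longrightarrow> g p = (\<Sum>\<mu>\<in>L. const (b \<mu> p) * single \<mu> 1)"
    using assms(2) unfolding family_def by blast
  define a' where "a' \<mu> p = (if \<mu> \<in> M then a \<mu> p else 0)" for \<mu> p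
  define b' where "b' \<mu> p = (if \<mu> \<in> L then b \<mu> p else 0)" for \<mu> p
  have reg: "a' \<mu> \<in> regular" "b' \<mu> \<in> regular" for \<mu>
  proof -
    have "a' \<mu> = (if \<mu> \<in> M then a \<mu> else (\<lambda>_. 0))" "b' \<mu> = (if \<mu> \<in> L then b \<mu> else (\<lambda>_. 0))"
      by (auto simp: a'_def b'_def)
    then show "a' \<mu> \<in> regular" "b' \<mu> \<in> regular"
      using f(3)[of \<mu>] g(3)[of \<mu>] regular_const[of 0] by simp_all
  qed
  have "f p = (\<Sum>\<mu>\<in>M \<union> L. const (a' \<mu> p) * single \<mu> 1)" if "p \<in> D" for p
    unfolding f(4)[OF that] using f(1) g(1) by (intro sum.mono_neutral_cong_left) (auto simp: a'_def)
  moreover have "g p = (\<Sum>\<mu>\<in>M \<union> L. const (b' \<mu> p) * single \<mu> 1)" if "p \<in> D" for p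
    unfolding g(4)[OF that] using f(1) g(1) by (intro sum.mono_neutral_cong_left) (auto simp: b'_def)
  ultimately show ?thesis
    unfolding family_def using f(1,2) g(1,2) reg
    by (intro CollectI exI[of _ "M \<union> L"] exI[of _ "\<lambda>\<mu> p. a' \<mu> p + b' \<mu> p"])
      (auto simp: const_add algebra_simps sum.distrib)
qed

lemma family_0: "(\<lambda>_. 0) \<in> family N"
  unfolding family_def by (intro CollectI exI[of _ "{}"]) auto

lemma family_sum: "(\<And>i. i \<in> A \<Longrightarrow> f i \<in> family N) \<Longrightarrow> (\<lambda>p. \<Sum>i\<in>A. f i p) \<in> family N"
  by (induction A rule: infinite_finite_induct) (auto intro: family_add family_0)

lemma family_mult:
  assumes "f \<in> family N" "g \<in> family N"
  shows "(\<lambda>p. f p * g p) \<in> family N"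
proof -
  obtain M a where f: "finite M" "M \<subseteq> all_mons N" "\<And>\<mu>. \<mu> \<in> M \<Longrightarrow> a \<mu> \<in> regular"
    "\<And>p. p \<in> D \<Longrightarrow> f p = (\<Sum>\<mu>\<in>M. const (a \<mu> p) * single \<mu> 1)"
    using assms(1) unfolding family_def by blast
  obtain L b where g: "finite L" "L \<subseteq> all_mons N" "\<And>\<mu>. \<mu> \<in> L \<Longrightarrow> b \<mu> \<in> regular"
    "\<And>p. p \<in> D \<Longrightarrow> g p = (\<Sum>\<mu>\<in>L. const (b \<mu> p) * single \<mu> 1)"
    using assms(2) unfolding family_def by blast
  have "(\<lambda>p. \<Sum>\<mu>\<in>M. \<Sum>\<nu>\<in>L. const (a \<mu> p * b \<nu> p) * single (\<mu> + \<nu>) 1) \<in> family N"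
    using f(2,3) g(2,3)
    by (intro family_sum family_term) (auto simp: all_mons_def keys_add_nat)
  then show ?thesis
  proof (rule family_cong)
    fix p assume p: "p \<in> D"
    have "const (a \<mu> p * b \<nu> p) * single (\<mu> + \<nu>) 1
        = (const (a \<mu> p) * single \<mu> 1) * (const (b \<nu> p) * single \<nu> 1)" for \<mu> \<nu>
      by (simp add: const_def mult_single)
    then show "f p * g p = (\<Sum>\<mu>\<in>M. \<Sum>\<nu>\<in>L. const (a \<mu> p * b \<nu> p) * single (\<mu> + \<nu>) 1)"
      unfolding f(4)[OF p] g(4)[OF p] by (simp add: sum_product)
  qed
qed

lemma family_regular: "\<phi> \<in> regular \<Longrightarrow> (\<lambda>p. const (\<phi> p)) \<in> family N"
  using family_term[of \<phi> 0 N] by (simp add: all_mons_def)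

lemma family_prod: "(\<And>i. i \<in> A \<Longrightarrow> f i \<in> family N) \<Longrightarrow> (\<lambda>p. \<Prod>i\<in>A. f i p) \<in> family N"
  by (induction A rule: infinite_finite_induct)
    (auto intro: family_mult family_regular[OF regular_const[of 1], simplified])

lemma family_power: "f \<in> family N \<Longrightarrow> (\<lambda>p. f p ^ n) \<in> family N"
  using family_prod[of "{..<n}" "\<lambda>_. f"] by simp

lemma family_polys: "q \<in> polys N \<Longrightarrow> (\<lambda>_. q) \<in> family N"
  unfolding family_def
  by (intro CollectI exI[of _ "keys q"] exI[of _ "\<lambda>\<mu> _. lookup q \<mu>"])
    (auto simp: carrier_poly_ring all_mons_def single_conv[symmetric] mpoly_sum_single[symmetric])

lemma family_in_polys:
  assumes "f \<in> family N" "p \<in> D"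
  shows "f p \<in> polys N"
proof -
  obtain M a where f: "M \<subseteq> all_mons N" "\<And>p. p \<in> D \<Longrightarrow> f p = (\<Sum>\<mu>\<in>M. const (a \<mu> p) * single \<mu> 1)"
    using assms(1) unfolding family_def by blast
  then show ?thesis using assms(2)
    by (auto intro!: polys_sum polys_mult single_polys)
qed

lemma family_lookup:
  assumes "f \<in> family N"
  shows "(\<lambda>p. lookup (f p) \<mu>) \<in> regular"
proof -
  obtain M a where f: "finite M" "\<And>\<mu>. \<mu> \<in> M \<Longrightarrow> a \<mu> \<in> regular"
    "\<And>p. p \<in> D \<Longrightarrow> f p = (\<Sum>\<mu>\<in>M. const (a \<mu> p) * single \<mu> 1)"
    using assms(1) unfolding family_def by blast
  have "(\<lambda>p. \<Sum>\<nu>\<in>M. a \<nu> p * lookup (single \<nu> 1) \<mu>) \<in> regular"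
    using f(2) by (intro regular_sum regular_mult regular_const)
  then show ?thesis
    by (rule regular_cong) (auto intro!: near_always simp: f(3) lookup_sum)
qed

lemma family_form:
  assumes "\<And>p. p \<in> D \<Longrightarrow> f p \<in> forms N n" "\<And>\<mu>. \<mu> \<in> mons N n \<Longrightarrow> (\<lambda>p. lookup (f p) \<mu>) \<in> regular"
  shows "f \<in> family N"
  unfolding family_def
  by (intro CollectI exI[of _ "mons N n"] exI[of _ "\<lambda>\<mu> p. lookup (f p) \<mu>"])
    (use assms in \<open>auto intro: form_sum_mons mons_all_mons\<close>)

end


section \<open>Deformation of a reduced level set\<close>

text \<open>The base point w carries a fully known level set: points \<open>z b\<close>, one for
  each reduced monomial b, separated by u and lying off K = 0. This picture is to be deformed to
  nearby parameters. The forms, the levels and K vary with the parameter; u is fixed.\<close>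

locale level_family = function_ring PF D w
  for PF :: "('p \<Rightarrow> 'k::alg_closed_field) set" and D w +
  fixes N :: nat and d :: "nat \<Rightarrow> nat" and G :: "nat \<Rightarrow> 'p \<Rightarrow> (nat, 'k) mpoly"
    and c :: "nat \<Rightarrow> 'p \<Rightarrow> 'k" and K :: "'p \<Rightarrow> (nat, 'k) mpoly"
    and u :: "(nat, 'k) mpoly" and z :: "(nat \<Rightarrow>\<^sub>0 nat) \<Rightarrow> nat \<Rightarrow> 'k"
  assumes d_pos: "i \<le> N \<Longrightarrow> 0 < d i"
    and G_form: "i \<le> N \<Longrightarrow> p \<in> D \<Longrightarrow> G i p \<in> forms N (d i)"
    and G_coeff: "i \<le> N \<Longrightarrow> (\<lambda>p. lookup (G i p) \<mu>) \<in> PF"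
    and c_PF: "i \<le> N \<Longrightarrow> c i \<in> PF"
    and K_family: "K \<in> family N"
    and u_polys: "u \<in> polys N"
    and spanning_w: "form_system.spanning N d (\<lambda>i. G i w)"
    and z_level: "b \<in> form_system.reduced N d \<Longrightarrow> i \<le> N \<Longrightarrow> mpoly_eval (z b) (G i w) = c i w"
    and z_inj: "inj_on (\<lambda>b. mpoly_eval (z b) u) (form_system.reduced N d)"
    and z_K: "b \<in> form_system.reduced N d \<Longrightarrow> mpoly_eval (z b) (K w) \<noteq> 0"
begin

abbreviation "Phi_at p \<equiv> form_system.Phi N d (\<lambda>i. G i p)"
abbreviation "red \<equiv> form_system.reduced N d"
abbreviation "ideal_at p \<equiv> form_system.level_ideal N (\<lambda>i. G i p) (\<lambda>i. c i p)"
abbreviation "spanning_at p \<equiv> form_system.spanning N d (\<lambda>i. G i p)"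
abbreviation "span_at p \<equiv> form_system.span_Phi N d (\<lambda>i. G i p)"
abbreviation "crit_deg \<equiv> form_system.crit N d"

lemma fs: "p \<in> D \<Longrightarrow> form_system N d (\<lambda>i. G i p)"
  using d_pos G_form by unfold_locales

lemma finite_red: "finite red"
  using form_system.finite_reduced[OF fs[OF base_point]] .

lemma red_all_mons: "b \<in> red \<Longrightarrow> b \<in> all_mons N"
  by (simp add: form_system.reduced_def[OF fs[OF base_point]])

lemma Phi_family: "\<mu> \<in> all_mons N \<Longrightarrow> (\<lambda>p. Phi_at p \<mu>) \<in> family N"
proof -
  assume mu: "\<mu> \<in> all_mons N"
  have "(\<lambda>p. \<Prod>i\<le>N. var i ^ (lookup \<mu> i mod d i) * G i p ^ (lookup \<mu> i div d i)) \<in> family N"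
    by (intro family_prod family_mult family_power family_polys family_form)
      (auto intro: G_form PF_regular G_coeff)
  then show ?thesis
    by (rule family_cong) (simp add: form_system.Phi_def[OF fs])
qed

text \<open>At w the \<open>Phi\<close> of degree n are a basis, so the matrix of their coefficients
  is invertible there. Its inverse C has regular entries and expresses the monomials near w.\<close>

lemma monomial_expansion:
  obtains C where "\<And>\<mu> \<nu>. \<mu> \<in> mons N n \<Longrightarrow> \<nu> \<in> mons N n \<Longrightarrow> C \<mu> \<nu> \<in> regular"
    and "near (\<lambda>p. \<forall>\<mu>\<in>mons N n. single \<mu> 1 = (\<Sum>\<nu>\<in>mons N n. const (C \<mu> \<nu> p) * Phi_at p \<nu>))"
proof -
  let ?A = "\<lambda>\<nu> \<mu> p. lookup (Phi_at p \<nu>) \<mu>"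
  interpret W: form_system N d "\<lambda>i. G i w" by (rule fs[OF base_point])
  have indep: "\<forall>\<nu>\<in>mons N n. x \<nu> = 0"
    if x: "\<And>\<mu>. \<mu> \<in> mons N n \<Longrightarrow> (\<Sum>\<nu>\<in>mons N n. x \<nu> * ?A \<nu> \<mu> w) = 0" for x
  proof -
    have "(\<Sum>\<nu>\<in>mons N n. const (x \<nu>) * Phi_at w \<nu>) \<in> forms N n"
      by (intro forms_sum forms_const_mult W.Phi_form)
    then have "(\<Sum>\<nu>\<in>mons N n. const (x \<nu>) * Phi_at w \<nu>) = 0"
      using x by (subst form_sum_mons) (auto simp: lookup_sum)
    then show ?thesis
      using W.Phi_independent[of n x] W.forms_span_Phi[OF spanning_w single_form] by blast
  qed
  have reg: "?A i j \<in> regular" if "i \<in> mons N n" "j \<in> mons N n" for i j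
    using that by (intro family_lookup[OF Phi_family] mons_all_mons)
  obtain C where C: "\<forall>i\<in>mons N n. \<forall>j\<in>mons N n. C i j \<in> regular"
    "near (\<lambda>p. \<forall>i\<in>mons N n. \<forall>l\<in>mons N n. (\<Sum>j\<in>mons N n. C i j p * ?A j l p) = (if i = l then 1 else 0))"
  proof (rule regular_inverse_matrix[OF finite_mons reg indep])
    fix C
    assume C: "\<And>i j. i \<in> mons N n \<Longrightarrow> j \<in> mons N n \<Longrightarrow> C i j \<in> regular"
      "near (\<lambda>p. \<forall>i\<in>mons N n. \<forall>l\<in>mons N n. (\<Sum>j\<in>mons N n. C i j p * ?A j l p) = (if i = l then 1 else 0))"
    show thesis by (rule that[of C]) (use C in simp_all)
  qed
  have "near (\<lambda>p. \<forall>\<mu>\<in>mons N n. single \<mu> 1 = (\<Sum>\<nu>\<in>mons N n. const (C \<mu> \<nu> p) * Phi_at p \<nu>))"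
    using C(2)
  proof (rule near_mono, intro ballI)
    fix p \<mu>
    assume p: "p \<in> D" and mu: "\<mu> \<in> mons N n"
      and CA: "\<forall>i\<in>mons N n. \<forall>l\<in>mons N n. (\<Sum>j\<in>mons N n. C i j p * ?A j l p) = (if i = l then 1 else 0)"
    let ?f = "\<Sum>\<nu>\<in>mons N n. const (C \<mu> \<nu> p) * Phi_at p \<nu>"
    have "?f \<in> forms N n"
      using form_system.Phi_form[OF fs[OF p]] by (intro forms_sum forms_const_mult)
    then have "?f = (\<Sum>l\<in>mons N n. const (lookup ?f l) * single l 1)" by (rule form_sum_mons)
    also have "\<dots> = (\<Sum>l\<in>mons N n. if l = \<mu> then single l 1 else 0)"
      using CA mu by (intro sum.cong refl) (auto simp: lookup_sum)
    also have "\<dots> = single \<mu> 1" using mu by (simp add: sum.delta)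
    finally show "single \<mu> 1 = ?f" by simp
  qed
  with C(1) show thesis by (intro that[of C]) auto
qed

lemma near_spanning: "near spanning_at"
proof -
  have "near (\<lambda>p. \<forall>n\<in>{..crit_deg}. \<forall>\<mu>\<in>mons N n. single \<mu> 1 \<in> span_at p n)"
  proof (rule near_ball)
    fix n
    obtain C where "near (\<lambda>p. \<forall>\<mu>\<in>mons N n. single \<mu> 1 = (\<Sum>\<nu>\<in>mons N n. const (C \<mu> \<nu> p) * Phi_at p \<nu>))"
      using monomial_expansion[of n] by blast
    then show "near (\<lambda>p. \<forall>\<mu>\<in>mons N n. single \<mu> 1 \<in> span_at p n)"
      by (rule near_mono) (auto simp: form_system.span_Phi_def[OF fs])
  qed auto
  then show ?thesis
    by (rule near_mono) (simp add: form_system.spanning_def[OF fs])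
qed

definition normal_form :: "((nat \<Rightarrow>\<^sub>0 nat) \<Rightarrow> 'p \<Rightarrow> 'k) \<Rightarrow> 'p \<Rightarrow> (nat, 'k) mpoly" where
  "normal_form \<rho> p = (\<Sum>b\<in>red. const (\<rho> b p) * single b 1)"

text \<open>The neighbourhood depends on f. Only finitely many families may be reduced at a time,
  and statements about all polynomials must be derived from those.\<close>

definition reducible :: "('p \<Rightarrow> (nat, 'k) mpoly) set" where
  "reducible = {f. \<exists>\<rho>. (\<forall>b\<in>red. \<rho> b \<in> regular) \<and> near (\<lambda>p. f p - normal_form \<rho> p \<in> ideal_at p)}"

lemma reducible_cong:
  assumes "g \<in> reducible" "near (\<lambda>p. f p - g p \<in> ideal_at p)"
  shows "f \<in> reducible"
proof -
  obtain \<rho> where r: "\<forall>b\<in>red. \<rho> b \<in> regular" "near (\<lambda>p. g p - normal_form \<rho> p \<in> ideal_at p)"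
    using assms(1) unfolding reducible_def by blast
  have "near (\<lambda>p. f p - normal_form \<rho> p \<in> ideal_at p)"
    using near_conj[OF assms(2) r(2)]
    by (rule near_mono) (use form_system.level_ideal_trans[OF fs] in blast)
  then show ?thesis unfolding reducible_def using r(1) by blast
qed

lemma reducible_add:
  assumes "f \<in> reducible" "g \<in> reducible"
  shows "(\<lambda>p. f p + g p) \<in> reducible"
proof -
  obtain \<rho> where r: "\<forall>b\<in>red. \<rho> b \<in> regular" "near (\<lambda>p. f p - normal_form \<rho> p \<in> ideal_at p)"
    using assms(1) unfolding reducible_def by blast
  obtain \<sigma> where s: "\<forall>b\<in>red. \<sigma> b \<in> regular" "near (\<lambda>p. g p - normal_form \<sigma> p \<in> ideal_at p)"
    using assms(2) unfolding reducible_def by blast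
  have "near (\<lambda>p. f p + g p - normal_form (\<lambda>b p. \<rho> b p + \<sigma> b p) p \<in> ideal_at p)"
    using near_conj[OF r(2) s(2)]
  proof (rule near_mono)
    fix p assume p: "p \<in> D"
      and h: "f p - normal_form \<rho> p \<in> ideal_at p \<and> g p - normal_form \<sigma> p \<in> ideal_at p"
    have "normal_form (\<lambda>b p. \<rho> b p + \<sigma> b p) p = normal_form \<rho> p + normal_form \<sigma> p"
      by (simp add: normal_form_def const_add algebra_simps sum.distrib)
    then show "f p + g p - normal_form (\<lambda>b p. \<rho> b p + \<sigma> b p) p \<in> ideal_at p"
      using form_system.level_ideal_add[OF fs[OF p] conjunct1[OF h] conjunct2[OF h]]
      by (simp add: algebra_simps)
  qed
  then show ?thesis unfolding reducible_def using r(1) s(1)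
    by (intro CollectI exI[of _ "\<lambda>b p. \<rho> b p + \<sigma> b p"] conjI ballI regular_add) blast+
qed

lemma reducible_scale:
  assumes "f \<in> reducible" "\<phi> \<in> regular"
  shows "(\<lambda>p. const (\<phi> p) * f p) \<in> reducible"
proof -
  obtain \<rho> where r: "\<forall>b\<in>red. \<rho> b \<in> regular" "near (\<lambda>p. f p - normal_form \<rho> p \<in> ideal_at p)"
    using assms(1) unfolding reducible_def by blast
  have "near (\<lambda>p. const (\<phi> p) * f p - normal_form (\<lambda>b p. \<phi> p * \<rho> b p) p \<in> ideal_at p)"
    using r(2)
  proof (rule near_mono)
    fix p assume p: "p \<in> D" and h: "f p - normal_form \<rho> p \<in> ideal_at p"
    have "normal_form (\<lambda>b p. \<phi> p * \<rho> b p) p = const (\<phi> p) * normal_form \<rho> p"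
      by (simp add: normal_form_def const_mult mult.assoc sum_distrib_left)
    then show "const (\<phi> p) * f p - normal_form (\<lambda>b p. \<phi> p * \<rho> b p) p \<in> ideal_at p"
      using form_system.level_ideal_mult'[OF fs[OF p] h, of "const (\<phi> p)"]
      by (simp add: right_diff_distrib)
  qed
  then show ?thesis unfolding reducible_def using r(1) assms(2)
    by (intro CollectI exI[of _ "\<lambda>b p. \<phi> p * \<rho> b p"] conjI ballI regular_mult) blast+
qed

lemma reducible_0: "(\<lambda>_. 0) \<in> reducible"
  unfolding reducible_def
  by (intro CollectI exI[of _ "\<lambda>_ _. 0"])
    (auto simp: normal_form_def intro: near_always form_system.level_ideal_0[OF fs])

lemma reducible_sum: "(\<And>i. i \<in> A \<Longrightarrow> f i \<in> reducible) \<Longrightarrow> (\<lambda>p. \<Sum>i\<in>A. f i p) \<in> reducible"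
  by (induction A rule: infinite_finite_induct) (auto intro: reducible_add reducible_0)

lemma reducible_eq: "g \<in> reducible \<Longrightarrow> near (\<lambda>p. f p = g p) \<Longrightarrow> f \<in> reducible"
  by (rule reducible_cong, assumption, erule near_mono) (simp add: form_system.level_ideal_0[OF fs])

lemma reducible_red:
  assumes "b \<in> red"
  shows "(\<lambda>_. single b 1) \<in> reducible"
  unfolding reducible_def
proof (intro CollectI exI[of _ "\<lambda>a _. if a = b then 1 else 0"] conjI ballI near_always)
  fix p assume p: "p \<in> D"
  have "normal_form (\<lambda>a _. if a = b then 1 else 0) p = (\<Sum>a\<in>red. if a = b then single a 1 else 0)"
    unfolding normal_form_def by (intro sum.cong) auto
  also have "\<dots> = single b 1" using assms finite_red by (simp add: sum.delta)
  finally show "single b 1 - normal_form (\<lambda>a _. if a = b then 1 else 0) p \<in> ideal_at p"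
    using form_system.level_ideal_0[OF fs[OF p]] by simp
qed auto

text \<open>Induction on the degree, by expansion in the \<open>Phi \<nu>\<close>. For reduced \<nu>
  this is a reduced monomial; otherwise it is G_i times some \<open>Phi \<nu>'\<close>, hence c_i
  times it modulo the ideal, and the degree has dropped by d_i > 0.\<close>

lemma reducible_low_monomial:
  assumes "\<mu> \<in> all_mons N"
  shows "(\<lambda>_. single \<mu> 1) \<in> reducible"
  using assms
proof (induction "tdeg \<mu>" arbitrary: \<mu> rule: less_induct)
  case less
  define n where "n = tdeg \<mu>"
  have mu: "\<mu> \<in> mons N n" using less.prems by (simp add: n_def mons_def all_mons_def)
  obtain C where C: "\<And>\<mu> \<nu>. \<mu> \<in> mons N n \<Longrightarrow> \<nu> \<in> mons N n \<Longrightarrow> C \<mu> \<nu> \<in> regular"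
    "near (\<lambda>p. \<forall>\<mu>\<in>mons N n. single \<mu> 1 = (\<Sum>\<nu>\<in>mons N n. const (C \<mu> \<nu> p) * Phi_at p \<nu>))"
    using monomial_expansion[of n] by blast
  have Phi: "(\<lambda>p. Phi_at p \<nu>) \<in> reducible" if nu: "\<nu> \<in> mons N n" for \<nu>
  proof (cases "\<nu> \<in> red")
    case True
    show ?thesis
      by (rule reducible_eq[OF reducible_red[OF True]])
        (intro near_always, simp add: form_system.Phi_reduced[OF fs True])
  next
    case False
    obtain i \<nu>' where i: "i \<le> N" "\<nu> = single i (d i) + \<nu>'" "\<nu>' \<in> all_mons N" "tdeg \<nu> = d i + tdeg \<nu>'"
      using form_system.not_reducedE[OF fs[OF base_point] mons_all_mons[OF nu] False] by metis
    have lt: "tdeg \<nu>' < tdeg \<mu>" using i(4) d_pos[OF i(1)] nu mu by (simp add: mons_def)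
    define m where "m = tdeg \<nu>'"
    have nu': "\<nu>' \<in> mons N m" using i(3) by (simp add: m_def mons_def all_mons_def)
    have "(\<lambda>p. \<Sum>\<kappa>\<in>mons N m. const (lookup (Phi_at p \<nu>') \<kappa>) * single \<kappa> 1) \<in> reducible"
      using less.hyps lt
      by (intro reducible_sum reducible_scale family_lookup[OF Phi_family[OF i(3)]]) (auto simp: mons_def all_mons_def m_def)
    then have "(\<lambda>p. Phi_at p \<nu>') \<in> reducible"
      by (rule reducible_eq) (intro near_always form_sum_mons form_system.Phi_form[OF fs nu'])
    then have "(\<lambda>p. const (c i p) * Phi_at p \<nu>') \<in> reducible"
      by (rule reducible_scale) (intro PF_regular c_PF i)
    then show ?thesis
    proof (rule reducible_cong, intro near_always)
      fix p assume p: "p \<in> D"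
      interpret P: form_system N d "\<lambda>i. G i p" by (rule fs[OF p])
      have "(G i p - const (c i p)) * Phi_at p \<nu>' \<in> ideal_at p"
        using P.level_ideal_generator[OF i(1)] P.Phi_polys[OF i(3)] by (rule P.level_ideal_mult)
      then show "Phi_at p \<nu> - const (c i p) * Phi_at p \<nu>' \<in> ideal_at p"
        using i(1,2) P.Phi_shift by (simp add: left_diff_distrib)
    qed
  qed
  have "(\<lambda>p. \<Sum>\<nu>\<in>mons N n. const (C \<mu> \<nu> p) * Phi_at p \<nu>) \<in> reducible"
    using Phi C(1) mu by (intro reducible_sum reducible_scale) auto
  then show ?case
    by (rule reducible_eq) (use C(2) mu in \<open>auto elim!: near_mono\<close>)
qed

lemma reducible_family:
  assumes "f \<in> family N"
  shows "f \<in> reducible"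
proof -
  obtain M a where f: "finite M" "M \<subseteq> all_mons N" "\<And>\<mu>. \<mu> \<in> M \<Longrightarrow> a \<mu> \<in> regular"
    "\<And>p. p \<in> D \<Longrightarrow> f p = (\<Sum>\<mu>\<in>M. const (a \<mu> p) * single \<mu> 1)"
    using assms(1) unfolding family_def by blast
  have "(\<lambda>p. \<Sum>\<mu>\<in>M. const (a \<mu> p) * single \<mu> 1) \<in> reducible"
    using f(2,3) by (intro reducible_sum reducible_scale reducible_low_monomial) auto
  then show ?thesis by (rule reducible_eq) (intro near_always f(4))
qed

lemma ideal_at_eval: "f \<in> ideal_at w \<Longrightarrow> b \<in> red \<Longrightarrow> mpoly_eval (z b) f = 0"
  by (auto simp: form_system.level_ideal_def[OF fs[OF base_point]] z_level)

text \<open>A family of as many elements as there are reduced monomials, whose values at the points \<open>z b\<close>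
  form an invertible matrix, is a basis of the quotient near \<open>w\<close>.\<close>

lemma change_basis:
  assumes fam: "\<And>a. a \<in> red \<Longrightarrow> g a \<in> family N"
    and indep: "\<And>x. (\<And>b. b \<in> red \<Longrightarrow> (\<Sum>a\<in>red. x a * mpoly_eval (z b) (g a w)) = 0) \<Longrightarrow> \<forall>a\<in>red. x a = 0"
  obtains C where "\<And>a b. a \<in> red \<Longrightarrow> b \<in> red \<Longrightarrow> C a b \<in> regular"
    and "near (\<lambda>p. \<forall>b\<in>red. single b 1 - (\<Sum>a\<in>red. const (C b a p) * g a p) \<in> ideal_at p)"
    and "near (\<lambda>p. \<forall>x. (\<Sum>a\<in>red. const (x a) * g a p) \<in> ideal_at p \<longrightarrow> (\<forall>a\<in>red. x a = 0))"
proof -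
  have "\<forall>a\<in>red. \<exists>\<rho>. (\<forall>b\<in>red. \<rho> b \<in> regular) \<and> near (\<lambda>p. g a p - normal_form \<rho> p \<in> ideal_at p)"
    using reducible_family[OF fam] unfolding reducible_def by blast
  from bchoice[OF this] obtain \<rho> where r: "\<forall>a\<in>red. (\<forall>b\<in>red. \<rho> a b \<in> regular) \<and>
      near (\<lambda>p. g a p - normal_form (\<rho> a) p \<in> ideal_at p)" ..
  have rho: "\<And>a b. a \<in> red \<Longrightarrow> b \<in> red \<Longrightarrow> \<rho> a b \<in> regular"
    "\<And>a. a \<in> red \<Longrightarrow> near (\<lambda>p. g a p - normal_form (\<rho> a) p \<in> ideal_at p)"
    using r by simp_all
  have near_rho: "near (\<lambda>p. \<forall>a\<in>red. g a p - normal_form (\<rho> a) p \<in> ideal_at p)"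
    by (rule near_ball[OF finite_red rho(2)])
  have swap: "(\<Sum>a\<in>red. const (x a) * normal_form (\<rho> a) p)
      = (\<Sum>b\<in>red. const (\<Sum>a\<in>red. x a * \<rho> a b p) * single b 1)" for x p
    unfolding normal_form_def const_sum sum_distrib_left sum_distrib_right
    by (subst sum.swap) (simp add: const_mult mult.assoc)
  have comb: "(\<Sum>a\<in>red. const (x a) * g a p) - (\<Sum>b\<in>red. const (\<Sum>a\<in>red. x a * \<rho> a b p) * single b 1) \<in> ideal_at p"
    if "p \<in> D" "\<forall>a\<in>red. g a p - normal_form (\<rho> a) p \<in> ideal_at p" for x p
  proof -
    interpret P: form_system N d "\<lambda>i. G i p" by (rule fs[OF that(1)])
    have "(\<Sum>a\<in>red. const (x a) * (g a p - normal_form (\<rho> a) p)) \<in> ideal_at p"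
      using that(2) by (intro P.level_ideal_sum P.level_ideal_mult') auto
    then show ?thesis by (simp add: right_diff_distrib sum_subtractf swap)
  qed
  \<comment> \<open>A relation among the rows of \<rho> at w puts a combination of the g into the
    ideal at w; it vanishes at all \<open>z b\<close>, so \<open>indep\<close> makes it
    trivial.\<close>
  have indep': "\<forall>a\<in>red. x a = 0" if x: "\<And>b. b \<in> red \<Longrightarrow> (\<Sum>a\<in>red. x a * \<rho> a b w) = 0" for x
  proof (rule indep)
    fix b assume b: "b \<in> red"
    have "(\<Sum>a\<in>red. const (x a) * g a w) \<in> ideal_at w"
      using comb[OF base_point near_at[OF near_rho], of x] x by simp
    from ideal_at_eval[OF this b] show "(\<Sum>a\<in>red. x a * mpoly_eval (z b) (g a w)) = 0" by simp
  qed
  show thesis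
  proof (rule regular_inverse_matrix[OF finite_red rho(1) indep'])
    fix C
    assume C: "\<And>i j. i \<in> red \<Longrightarrow> j \<in> red \<Longrightarrow> C i j \<in> regular"
      "near (\<lambda>p. \<forall>i\<in>red. \<forall>l\<in>red. (\<Sum>j\<in>red. C i j p * \<rho> j l p) = (if i = l then 1 else 0))"
      "near (\<lambda>p. \<forall>i\<in>red. \<forall>l\<in>red. (\<Sum>j\<in>red. \<rho> i j p * C j l p) = (if i = l then 1 else 0))"
    show thesis
  proof (rule that[of C])
    show "C a b \<in> regular" if "a \<in> red" "b \<in> red" for a b by (rule C(1)[OF that])
    show "near (\<lambda>p. \<forall>b\<in>red. single b 1 - (\<Sum>a\<in>red. const (C b a p) * g a p) \<in> ideal_at p)"
      using near_conj[OF near_rho C(2)]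
    proof (rule near_mono, intro ballI)
      fix p b assume p: "p \<in> D" and b: "b \<in> red"
        and h: "(\<forall>a\<in>red. g a p - normal_form (\<rho> a) p \<in> ideal_at p) \<and>
          (\<forall>i\<in>red. \<forall>l\<in>red. (\<Sum>j\<in>red. C i j p * \<rho> j l p) = (if i = l then 1 else 0))"
      have "(\<Sum>l\<in>red. const (\<Sum>a\<in>red. C b a p * \<rho> a l p) * single l 1)
          = (\<Sum>l\<in>red. if l = b then single l 1 else 0)"
        using h b by (intro sum.cong) auto
      also have "\<dots> = single b 1" using b finite_red by (simp add: sum.delta)
      finally have "(\<Sum>a\<in>red. const (C b a p) * g a p) - single b 1 \<in> ideal_at p"
        using comb[OF p, of "\<lambda>a. C b a p"] h by simp
      then show "single b 1 - (\<Sum>a\<in>red. const (C b a p) * g a p) \<in> ideal_at p"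
        by (rule form_system.level_ideal_sym[OF fs[OF p]])
    qed
    \<comment> \<open>Here normal forms have to be unique, which holds where the system is
      spanning.\<close>
    show "near (\<lambda>p. \<forall>x. (\<Sum>a\<in>red. const (x a) * g a p) \<in> ideal_at p \<longrightarrow> (\<forall>a\<in>red. x a = 0))"
      using near_conj[OF near_spanning near_conj[OF near_rho C(3)]]
    proof (rule near_mono, intro allI impI ballI)
      fix p x a assume p: "p \<in> D" and a: "a \<in> red"
        and zero: "(\<Sum>a\<in>red. const (x a) * g a p) \<in> ideal_at p"
        and h: "spanning_at p \<and> (\<forall>a\<in>red. g a p - normal_form (\<rho> a) p \<in> ideal_at p) \<and>
          (\<forall>i\<in>red. \<forall>l\<in>red. (\<Sum>j\<in>red. \<rho> i j p * C j l p) = (if i = l then 1 else 0))"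
      interpret P: form_system N d "\<lambda>i. G i p" by (rule fs[OF p])
      have "(\<Sum>b\<in>red. const (\<Sum>a\<in>red. x a * \<rho> a b p) * single b 1) \<in> ideal_at p"
        using P.level_ideal_diff[OF zero comb[OF p, of x]] h by simp
      then have xr: "(\<Sum>a\<in>red. x a * \<rho> a b p) = 0" if "b \<in> red" for b
        using P.reduced_independent[of "\<lambda>b. \<Sum>a\<in>red. x a * \<rho> a b p"] h that by blast
      have "x a = (\<Sum>i\<in>red. x i * (if i = a then 1 else 0))"
        using a finite_red by (simp add: if_distrib sum.delta cong: if_cong)
      also have "\<dots> = (\<Sum>i\<in>red. \<Sum>j\<in>red. x i * (\<rho> i j p * C j a p))"
        using h a by (intro sum.cong) (auto simp: sum_distrib_left[symmetric])
      also have "\<dots> = (\<Sum>j\<in>red. (\<Sum>i\<in>red. x i * \<rho> i j p) * C j a p)"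
        by (subst sum.swap) (simp add: sum_distrib_right mult.assoc)
      also have "\<dots> = 0" using xr by simp
      finally show "x a = 0" .
    qed
  qed
  qed
qed

end


lemma poly_eq_0_if_many_zeros:
  fixes q :: "'k::idom poly"
  assumes "finite S" "\<And>x. x \<in> S \<Longrightarrow> poly q x = 0" "q = 0 \<or> degree q < card S"
  shows "q = 0"
proof (rule ccontr)
  assume "q \<noteq> 0"
  then have "card S \<le> card {x. poly q x = 0}"
    using assms(2) by (intro card_mono poly_roots_finite) auto
  then show False using card_poly_roots_bound[OF \<open>q \<noteq> 0\<close>] assms(3) \<open>q \<noteq> 0\<close> by auto
qed

text \<open>If the derivative vanished at r, the cofactor of T - r in q would vanish on all of S, r
  included, with degree only card S - 1.\<close>

lemma pderiv_nonzero_if_all_roots: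
  fixes q :: "'k::field poly"
  assumes q: "q \<noteq> 0" "degree q = card S" and S: "finite S" "\<And>x. x \<in> S \<Longrightarrow> poly q x = 0" and r: "r \<in> S"
  shows "poly (pderiv q) r \<noteq> 0"
proof
  assume z: "poly (pderiv q) r = 0"
  obtain p where p: "q = [:- r, 1:] * p" using S(2)[OF r] by (metis dvdE poly_eq_0_iff_dvd)
  have pd: "pderiv q = p + [:- r, 1:] * pderiv p"
    unfolding p by (simp only: pderiv_mult) (simp add: pderiv_pCons algebra_simps)
  have pnz: "p \<noteq> 0" using p q by auto
  have "degree q = Suc (degree p)" unfolding p using pnz by (subst degree_mult_eq) auto
  moreover have "poly p x = 0" if "x \<in> S" for x
    using S(2)[OF that] z pd p by (cases "x = r") auto
  ultimately have "p = 0" using q(2) S by (intro poly_eq_0_if_many_zeros[of S]) auto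
  then show False using pnz by simp
qed

lemma pderiv_of_sum: "pderiv (\<Sum>i\<in>A. f i) = (\<Sum>i\<in>A. pderiv (f i))"
  by (induction A rule: infinite_finite_induct) (auto simp: pderiv_add)

text \<open>For \<open>h a < n\<close> this is a monic polynomial given by its lower coefficients.
  The numbering h is there because the powers of u will be indexed by the reduced monomials.\<close>

definition tau_poly :: "nat \<Rightarrow> 'b set \<Rightarrow> ('b \<Rightarrow> nat) \<Rightarrow> ('b \<Rightarrow> 'k::field) \<Rightarrow> 'k poly" where
  "tau_poly n I h t = monom 1 n - (\<Sum>a\<in>I. monom (t a) (h a))"

lemma degree_sum_monom:
  assumes "\<And>a. a \<in> I \<Longrightarrow> h a < n" "0 < n"
  shows "degree (\<Sum>a\<in>I. monom (t a) (h a)) < n"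
  using assms by (intro degree_sum_less) (auto intro: le_less_trans[OF degree_monom_le])

lemma coeff_sum_monom:
  assumes "finite I" "inj_on h I" "a \<in> I"
  shows "coeff (\<Sum>a\<in>I. monom (t a) (h a)) (h a) = t a"
proof -
  have "coeff (\<Sum>a\<in>I. monom (t a) (h a)) (h a) = (\<Sum>b\<in>I. if b = a then t b else 0)"
    unfolding coeff_sum coeff_monom using assms by (intro sum.cong) (auto dest: inj_onD)
  then show ?thesis using assms by (simp add: sum.delta)
qed

lemma poly_sum_monom_bij:
  assumes "bij_betw h I {0..<n}" "degree q < n"
  shows "q = (\<Sum>a\<in>I. monom (coeff q (h a)) (h a))"
proof -
  obtain m where m: "n = Suc m" using assms(2) by (cases n) auto
  have "(\<Sum>a\<in>I. monom (coeff q (h a)) (h a)) = (\<Sum>i\<in>{0..<n}. monom (coeff q i) i)"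
    by (rule sum.reindex_bij_betw[OF assms(1)])
  also have "{0..<n} = {..m}" using m by auto
  finally show ?thesis using poly_as_sum_of_monoms'[of q m] assms(2) m by simp
qed

lemma tau_poly_degree:
  assumes "\<And>a. a \<in> I \<Longrightarrow> h a < n" "0 < n"
  shows "degree (tau_poly n I h t) = n" "lead_coeff (tau_poly n I h t) = 1" "tau_poly n I h t \<noteq> 0"
proof -
  have d: "degree (\<Sum>a\<in>I. monom (t a) (h a)) < n" using assms by (rule degree_sum_monom)
  then have c: "coeff (tau_poly n I h t) n = 1" by (simp add: tau_poly_def coeff_eq_0)
  have "degree (tau_poly n I h t) \<le> n"
    unfolding tau_poly_def using d by (intro degree_diff_le degree_monom_le) auto
  moreover have "n \<le> degree (tau_poly n I h t)" using c by (intro le_degree) simp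
  ultimately show deg: "degree (tau_poly n I h t) = n" by simp
  then show "lead_coeff (tau_poly n I h t) = 1" using c by simp
  then show "tau_poly n I h t \<noteq> 0" by auto
qed

context level_family
begin

text \<open>Modulo the ideal the span of the reduced monomials contains 1 and, by
  \<open>step\<close>, is stable under the variables, so it is everything. \<open>step\<close>
  concerns finitely many products, so one neighbourhood serves all f at once.\<close>

lemma ideal_polys_induct:
  assumes p: "p \<in> D" and f: "f \<in> polys N" and zero: "0 \<in> red"
    and step: "\<forall>b\<in>red. \<forall>i\<in>{..N}. \<exists>a. var i * single b 1 - (\<Sum>b\<in>red. const (a b) * single b 1) \<in> ideal_at p"
  shows "\<exists>a. f - (\<Sum>b\<in>red. const (a b) * single b 1) \<in> ideal_at p"
proof -
  interpret P: form_system N d "\<lambda>i. G i p" by (rule fs[OF p])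
  let ?n = "\<lambda>a. \<Sum>b\<in>red. const (a b) * single b 1"
  have sum_rule: "\<exists>a. f + g - ?n a \<in> ideal_at p" if "f - ?n a \<in> ideal_at p" "g - ?n b \<in> ideal_at p" for f g a b
  proof -
    have "?n (\<lambda>x. a x + b x) = ?n a + ?n b" by (simp add: const_add algebra_simps sum.distrib)
    then have "f + g - ?n (\<lambda>x. a x + b x) \<in> ideal_at p"
      using P.level_ideal_add[OF that] by (simp add: algebra_simps)
    then show ?thesis by (rule exI[of _ "\<lambda>x. a x + b x"])
  qed
  have scale: "\<exists>a. const x * f - ?n a \<in> ideal_at p" if "f - ?n a \<in> ideal_at p" for f a x
  proof -
    have "?n (\<lambda>b. x * a b) = const x * ?n a" by (simp add: const_mult mult.assoc sum_distrib_left)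
    then have "const x * f - ?n (\<lambda>b. x * a b) \<in> ideal_at p"
      using P.level_ideal_mult'[OF that, of "const x"] by (simp add: right_diff_distrib)
    then show ?thesis by (rule exI[of _ "\<lambda>b. x * a b"])
  qed
  have sum: "\<exists>a. (\<Sum>x\<in>A. f x) - ?n a \<in> ideal_at p"
    if "\<And>x. x \<in> A \<Longrightarrow> \<exists>a. f x - ?n a \<in> ideal_at p" for A and f :: "_ \<Rightarrow> (nat, 'k) mpoly"
    using that
  proof (induction A rule: infinite_finite_induct)
    case (insert x A)
    then obtain a b where "f x - ?n a \<in> ideal_at p" "(\<Sum>x\<in>A. f x) - ?n b \<in> ideal_at p" by blast
    from sum_rule[OF this] show ?case using insert by simp
  qed (auto intro!: exI[of _ "\<lambda>_. 0"] P.level_ideal_0)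
  show ?thesis
    using f
  proof (induction f rule: polys_induct)
    case (const x)
    have "?n (\<lambda>b. if b = 0 then x else 0) = (\<Sum>b\<in>red. if b = 0 then const x else 0)"
      by (intro sum.cong) auto
    also have "\<dots> = const x" using zero finite_red by (simp add: sum.delta)
    finally have "const x - ?n (\<lambda>b. if b = 0 then x else 0) \<in> ideal_at p"
      using P.level_ideal_0 by simp
    then show ?case by (rule exI[of _ "\<lambda>b. if b = 0 then x else 0"])
  next
    case (add f g)
    then obtain a b where "f - ?n a \<in> ideal_at p" "g - ?n b \<in> ideal_at p" by blast
    then show ?case by (rule sum_rule)
  next
    case (var i f)
    then obtain a where a: "f - ?n a \<in> ideal_at p" by blast
    have "\<exists>c. (\<Sum>b\<in>red. const (a b) * (var i * single b 1)) - ?n c \<in> ideal_at p"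
    proof (rule sum)
      fix b assume "b \<in> red"
      then obtain c where "var i * single b 1 - ?n c \<in> ideal_at p" using step var(1) by auto
      then show "\<exists>c. const (a b) * (var i * single b 1) - ?n c \<in> ideal_at p" by (rule scale)
    qed
    then obtain c where c: "(\<Sum>b\<in>red. const (a b) * (var i * single b 1)) - ?n c \<in> ideal_at p" by blast
    have eq: "(\<Sum>b\<in>red. const (a b) * (var i * single b 1)) = var i * ?n a"
      by (simp add: sum_distrib_left mult.left_commute)
    have "var i * f - var i * ?n a \<in> ideal_at p"
      using P.level_ideal_mult'[OF a, of "var i"] var(1) by (simp add: right_diff_distrib)
    from P.level_ideal_trans[OF this c[unfolded eq]] show ?case by (rule exI[of _ c])
  qed
qed

text \<open>Let n be the number of reduced monomials. The powers of u below n are a basis of the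
  quotient near w, since their values at the \<open>z b\<close> form a Vandermonde matrix.
  Expressing u^n in this basis gives the monic \<chi>, whose roots at w are the n distinct values of
  u. So \<chi>'(u) K vanishes at no \<open>z b\<close>, its products with those powers are again a
  basis, and writing 1 in the new basis shows that \<chi>'(u) K is a unit near w. These are the
  hypotheses of \<open>simple_level_set\<close>.\<close>

theorem near_simple_level_set:
  "near (\<lambda>p. spanning_at p \<and> (\<exists>Z. (\<forall>x\<in>Z. (\<forall>i\<le>N. mpoly_eval x (G i p) = c i p) \<and> mpoly_eval x (K p) \<noteq> 0) \<and>
    (\<forall>a. (\<forall>x\<in>Z. (\<Sum>b\<in>red. a b * mono_eval x b) = 0) \<longrightarrow> (\<forall>b\<in>red. a b = 0))))"
proof -
  define n where "n = card red"
  obtain h where h: "bij_betw h red {0..<n}"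
    using ex_bij_betw_finite_nat[OF finite_red] by (auto simp: n_def)
  have hn: "h a < n" if "a \<in> red" for a using h that by (auto simp: bij_betw_def)
  have hinj: "inj_on h red" using h by (simp add: bij_betw_def)
  have zero: "0 \<in> red" using d_pos by (simp add: form_system.reduced_def[OF fs[OF base_point]] all_mons_def)
  then have n0: "0 < n" using finite_red by (auto simp: n_def card_gt_0_iff)
  define U where "U = (\<lambda>b. mpoly_eval (z b) u) ` red"
  have U: "finite U" "card U = n" using finite_red z_inj by (auto simp: U_def n_def card_image)
  have vander: "\<forall>a\<in>red. x a = 0"
    if x: "\<And>b. b \<in> red \<Longrightarrow> (\<Sum>a\<in>red. x a * mpoly_eval (z b) u ^ h a) = 0" for x
  proof -
    let ?q = "\<Sum>a\<in>red. monom (x a) (h a)"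
    have "degree ?q < card U" unfolding U(2) by (intro degree_sum_monom hn n0)
    moreover have "poly ?q y = 0" if "y \<in> U" for y
      using x that by (auto simp: U_def poly_sum poly_monom)
    ultimately have "?q = 0" using poly_eq_0_if_many_zeros[OF U(1)] by blast
    then show ?thesis using coeff_sum_monom[OF finite_red hinj, of _ x] by simp
  qed
  have pow_family: "(\<lambda>_. u ^ m) \<in> family N" for m
    by (intro family_polys polys_power u_polys)
  obtain C where C: "\<And>a b. a \<in> red \<Longrightarrow> b \<in> red \<Longrightarrow> C a b \<in> regular"
    and C_basis: "near (\<lambda>p. \<forall>b\<in>red. single b 1 - (\<Sum>a\<in>red. const (C b a p) * u ^ h a) \<in> ideal_at p)"
    and C_indep: "near (\<lambda>p. \<forall>x. (\<Sum>a\<in>red. const (x a) * u ^ h a) \<in> ideal_at p \<longrightarrow> (\<forall>a\<in>red. x a = 0))"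
  proof (rule change_basis[of "\<lambda>a _. u ^ h a"])
    show "\<forall>a\<in>red. x a = 0" if "\<And>b. b \<in> red \<Longrightarrow> (\<Sum>a\<in>red. x a * mpoly_eval (z b) (u ^ h a)) = 0" for x
      using that by (intro vander) simp
  qed (use pow_family that in auto)
  obtain \<rho> where rho: "\<forall>b\<in>red. \<rho> b \<in> regular" "near (\<lambda>p. u ^ n - normal_form \<rho> p \<in> ideal_at p)"
    using reducible_family[OF pow_family[of n]] unfolding reducible_def by blast
  \<comment> \<open>The coordinates of u^n in the lower powers: its normal form, followed by the
    change of basis C.\<close>
  define \<tau> where "\<tau> a p = (\<Sum>b\<in>red. \<rho> b p * C b a p)" for a p
  have tau_reg: "\<tau> a \<in> regular" if "a \<in> red" for a
    unfolding \<tau>_def using rho(1) C that by (intro regular_sum regular_mult) auto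
  define \<chi> where "\<chi> p = tau_poly n red h (\<lambda>a. \<tau> a p)" for p
  have chi: "degree (\<chi> p) = n" "\<chi> p \<noteq> 0" for p
    unfolding \<chi>_def using tau_poly_degree[of red h n, OF hn n0] by auto
  have chi_u: "pcompose_mpoly (\<chi> p) u = u ^ n - (\<Sum>a\<in>red. const (\<tau> a p) * u ^ h a)" for p
    by (simp add: \<chi>_def tau_poly_def pcompose_mpoly_diff pcompose_mpoly_sum pcompose_mpoly_monom)
  have chi_zero: "near (\<lambda>p. pcompose_mpoly (\<chi> p) u \<in> ideal_at p)"
    using near_conj[OF rho(2) C_basis]
  proof (rule near_mono)
    fix p assume p: "p \<in> D"
      and H: "u ^ n - normal_form \<rho> p \<in> ideal_at p \<and>
        (\<forall>b\<in>red. single b 1 - (\<Sum>a\<in>red. const (C b a p) * u ^ h a) \<in> ideal_at p)"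
    interpret P: form_system N d "\<lambda>i. G i p" by (rule fs[OF p])
    have "(\<Sum>b\<in>red. const (\<rho> b p) * (single b 1 - (\<Sum>a\<in>red. const (C b a p) * u ^ h a))) \<in> ideal_at p"
      using H by (intro P.level_ideal_sum P.level_ideal_mult') auto
    also have "(\<Sum>b\<in>red. const (\<rho> b p) * (single b 1 - (\<Sum>a\<in>red. const (C b a p) * u ^ h a)))
        = normal_form \<rho> p - (\<Sum>b\<in>red. \<Sum>a\<in>red. const (\<rho> b p) * (const (C b a p) * u ^ h a))"
      by (simp add: normal_form_def right_diff_distrib sum_subtractf sum_distrib_left)
    also have "(\<Sum>b\<in>red. \<Sum>a\<in>red. const (\<rho> b p) * (const (C b a p) * u ^ h a)) = (\<Sum>a\<in>red. const (\<tau> a p) * u ^ h a)"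
      by (subst sum.swap) (simp add: \<tau>_def const_sum const_mult sum_distrib_right mult.assoc)
    finally show "pcompose_mpoly (\<chi> p) u \<in> ideal_at p"
      unfolding chi_u using H P.level_ideal_trans by blast
  qed
  define v where "v p = pcompose_mpoly (pderiv (\<chi> p)) u * K p" for p
  have "(\<lambda>p. const (of_nat n) * u ^ (n - 1) + (\<Sum>a\<in>red. const (- (of_nat (h a) * \<tau> a p)) * u ^ (h a - 1))) \<in> family N"
    using tau_reg
    by (intro family_add family_sum family_mult[OF family_regular] pow_family
        family_polys[of "const (of_nat n) * u ^ (n - 1)"] regular_uminus regular_mult regular_const)
      (auto simp: u_polys)
  then have "(\<lambda>p. pcompose_mpoly (pderiv (\<chi> p)) u) \<in> family N"
  proof (rule family_cong)
    fix p
    have "pderiv (\<chi> p) = monom (of_nat n) (n - 1) - (\<Sum>a\<in>red. monom (of_nat (h a) * \<tau> a p) (h a - 1))"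
      by (simp add: \<chi>_def tau_poly_def pderiv_diff pderiv_of_sum pderiv_monom)
    then show "pcompose_mpoly (pderiv (\<chi> p)) u
        = const (of_nat n) * u ^ (n - 1) + (\<Sum>a\<in>red. const (- (of_nat (h a) * \<tau> a p)) * u ^ (h a - 1))"
      by (simp add: pcompose_mpoly_diff pcompose_mpoly_sum pcompose_mpoly_monom const_uminus sum_negf)
  qed
  then have v_family: "v \<in> family N" unfolding v_def by (intro family_mult K_family)
  have v_nz: "mpoly_eval (z b) (v w) \<noteq> 0" if b: "b \<in> red" for b
  proof -
    have root: "poly (\<chi> w) x = 0" if x: "x \<in> U" for x
    proof -
      obtain b where b: "b \<in> red" "x = mpoly_eval (z b) u" using x by (auto simp: U_def)
      show ?thesis using ideal_at_eval[OF near_at[OF chi_zero] b(1)] b(2) by simp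
    qed
    have "poly (pderiv (\<chi> w)) (mpoly_eval (z b) u) \<noteq> 0"
      using chi[of w] U root b by (intro pderiv_nonzero_if_all_roots[of _ U]) (auto simp: U_def)
    then show ?thesis using z_K[OF b] by (simp add: v_def)
  qed
  obtain E where E_basis: "near (\<lambda>p. \<forall>b\<in>red. single b 1 - (\<Sum>a\<in>red. const (E b a p) * (v p * u ^ h a)) \<in> ideal_at p)"
  proof (rule change_basis[of "\<lambda>a p. v p * u ^ h a"])
    show "(\<lambda>p. v p * u ^ h a) \<in> family N" for a by (intro family_mult v_family pow_family)
    show "\<forall>a\<in>red. x a = 0" if x: "\<And>b. b \<in> red \<Longrightarrow> (\<Sum>a\<in>red. x a * mpoly_eval (z b) (v w * u ^ h a)) = 0" for x
    proof (rule vander)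
      fix b assume b: "b \<in> red"
      have "mpoly_eval (z b) (v w) * (\<Sum>a\<in>red. x a * mpoly_eval (z b) u ^ h a) = 0"
        using x[OF b] by (simp add: sum_distrib_left mult.left_commute mult.assoc)
      then show "(\<Sum>a\<in>red. x a * mpoly_eval (z b) u ^ h a) = 0" using v_nz[OF b] by simp
    qed
  qed (use that in auto)
  have border: "near (\<lambda>p. \<forall>b\<in>red. \<forall>i\<in>{..N}. \<exists>a. var i * single b 1 - (\<Sum>b\<in>red. const (a b) * single b 1) \<in> ideal_at p)"
  proof (intro near_ball finite_red)
    fix b i assume b: "b \<in> red" and i: "i \<in> {..N}"
    have "(\<lambda>_. var i * single b 1) \<in> family N"
      using i red_all_mons[OF b] by (intro family_polys polys_mult single_polys) auto
    then obtain \<sigma> where "near (\<lambda>p. var i * single b 1 - normal_form \<sigma> p \<in> ideal_at p)"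
      using reducible_family unfolding reducible_def by blast
    then show "near (\<lambda>p. \<exists>a. var i * single b 1 - (\<Sum>b\<in>red. const (a b) * single b 1) \<in> ideal_at p)"
      by (rule near_mono) (auto simp: normal_form_def)
  qed auto
  show ?thesis
    using near_conj[OF near_spanning near_conj[OF border near_conj[OF C_basis near_conj[OF C_indep
      near_conj[OF chi_zero E_basis]]]]]
  proof (rule near_mono)
    fix p assume p: "p \<in> D"
      and H: "spanning_at p \<and>
        (\<forall>b\<in>red. \<forall>i\<in>{..N}. \<exists>a. var i * single b 1 - (\<Sum>b\<in>red. const (a b) * single b 1) \<in> ideal_at p) \<and>
        (\<forall>b\<in>red. single b 1 - (\<Sum>a\<in>red. const (C b a p) * u ^ h a) \<in> ideal_at p) \<and>
        (\<forall>x. (\<Sum>a\<in>red. const (x a) * u ^ h a) \<in> ideal_at p \<longrightarrow> (\<forall>a\<in>red. x a = 0)) \<and>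
        pcompose_mpoly (\<chi> p) u \<in> ideal_at p \<and>
        (\<forall>b\<in>red. single b 1 - (\<Sum>a\<in>red. const (E b a p) * (v p * u ^ h a)) \<in> ideal_at p)"
    interpret P: form_system N d "\<lambda>i. G i p" by (rule fs[OF p])
    have gen: "\<exists>q. f - pcompose_mpoly q u \<in> ideal_at p" if f: "f \<in> polys N" for f
    proof -
      obtain a where a: "f - (\<Sum>b\<in>red. const (a b) * single b 1) \<in> ideal_at p"
        using ideal_polys_induct[OF p f zero] H by blast
      have "(\<Sum>b\<in>red. const (a b) * (single b 1 - (\<Sum>a\<in>red. const (C b a p) * u ^ h a))) \<in> ideal_at p"
        using H by (intro P.level_ideal_sum P.level_ideal_mult') auto
      also have "(\<Sum>b\<in>red. const (a b) * (single b 1 - (\<Sum>a\<in>red. const (C b a p) * u ^ h a)))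
          = (\<Sum>b\<in>red. const (a b) * single b 1)
            - pcompose_mpoly (\<Sum>b\<in>red. smult (a b) (\<Sum>a\<in>red. monom (C b a p) (h a))) u"
        by (simp add: right_diff_distrib sum_subtractf pcompose_mpoly_sum pcompose_mpoly_smult pcompose_mpoly_monom)
      finally show ?thesis using P.level_ideal_trans[OF a] by blast
    qed
    \<comment> \<open>Modulo the ideal q agrees with its remainder modulo \<chi>, of degree below n,
      and independence of the lower powers makes that remainder 0.\<close>
    have ker: "\<chi> p dvd q" if q: "pcompose_mpoly q u \<in> ideal_at p" for q
    proof -
      define r where "r = q mod \<chi> p"
      have rdeg: "degree r < n"
        using degree_mod_less'[of "\<chi> p" q] chi n0 by (cases "r = 0") (auto simp: r_def)
      have "q = \<chi> p * (q div \<chi> p) + r" by (simp add: r_def)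
      then have "pcompose_mpoly r u = pcompose_mpoly q u - pcompose_mpoly (\<chi> p) u * pcompose_mpoly (q div \<chi> p) u"
        by (metis add_diff_cancel_left' pcompose_mpoly_add pcompose_mpoly_mult)
      then have "pcompose_mpoly r u \<in> ideal_at p"
        using H q u_polys by (auto intro!: P.level_ideal_diff P.level_ideal_mult)
      also have "pcompose_mpoly r u = (\<Sum>a\<in>red. const (coeff r (h a)) * u ^ h a)"
        by (subst poly_sum_monom_bij[OF h rdeg]) (simp add: pcompose_mpoly_sum pcompose_mpoly_monom)
      finally have "\<forall>a\<in>red. coeff r (h a) = 0"
        by (rule H[THEN conjunct2, THEN conjunct2, THEN conjunct2, THEN conjunct1, rule_format,
              of "\<lambda>a. coeff r (h a)", THEN ballI[where A = red and P = "\<lambda>a. coeff r (h a) = 0"]])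
      then have "r = 0" by (subst poly_sum_monom_bij[OF h rdeg]) simp
      then show ?thesis by (auto simp: r_def dvd_eq_mod_eq_0)
    qed
    \<comment> \<open>The exponent 0 belongs to the monomial 1, so \<open>E 0\<close> holds the
      coordinates of 1 in the basis v u^a.\<close>
    define y where "y = (\<Sum>a\<in>red. const (E 0 a p) * u ^ h a)"
    have "single 0 1 - (\<Sum>a\<in>red. const (E 0 a p) * (v p * u ^ h a)) \<in> ideal_at p"
      using H zero by blast
    also have "single 0 1 - (\<Sum>a\<in>red. const (E 0 a p) * (v p * u ^ h a))
        = 1 - pcompose_mpoly (pderiv (\<chi> p)) u * K p * y"
      by (simp add: y_def v_def sum_distrib_left mult.left_commute)
    finally have unit: "1 - pcompose_mpoly (pderiv (\<chi> p)) u * K p * y \<in> ideal_at p" .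
    have "y \<in> polys N" unfolding y_def by (intro polys_sum polys_mult polys_power u_polys polys_const)
    then show "spanning_at p \<and> (\<exists>Z. (\<forall>x\<in>Z. (\<forall>i\<le>N. mpoly_eval x (G i p) = c i p) \<and> mpoly_eval x (K p) \<noteq> 0) \<and>
        (\<forall>a. (\<forall>x\<in>Z. (\<Sum>b\<in>red. a b * mono_eval x b) = 0) \<longrightarrow> (\<forall>b\<in>red. a b = 0)))"
      using P.simple_level_set[OF _ u_polys gen _ _ ker unit family_in_polys[OF K_family p]] H chi
      by blast
  qed
qed

end


section \<open>General tuples, and radicality of general complete intersections\<close>

section \<open>General tuples of forms\<close>

abbreviation coords :: "(nat \<Rightarrow> (nat, 'k::field) mpoly) \<Rightarrow> nat \<times> (nat \<Rightarrow>\<^sub>0 nat) \<Rightarrow> 'k" where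
  "coords F \<equiv> (\<lambda>(i, \<mu>). lookup (F i) \<mu>)"

lemma for_generalI:
  assumes "w \<in> hypersurface_tuples N s d" "mpoly_eval (coords w) q \<noteq> 0"
    and "\<And>F. F \<in> hypersurface_tuples N s d \<Longrightarrow> mpoly_eval (coords F) q \<noteq> 0 \<Longrightarrow> Q F"
  shows "for_general N s d Q"
  unfolding for_general_def zariski_open_def
  by (intro exI[of _ "{F \<in> hypersurface_tuples N s d. \<exists>p\<in>{q}. mpoly_eval (coords F) p \<noteq> 0}"] conjI exI[of _ "{q}"])
    (use assms in auto)

text \<open>A point of an open set has a principal open neighbourhood, so a single polynomial q
  suffices.\<close>

lemma for_generalE:
  assumes "for_general N s d Q"
  obtains w q where "w \<in> hypersurface_tuples N s d" "mpoly_eval (coords w) q \<noteq> 0"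
    and "\<And>F. F \<in> hypersurface_tuples N s d \<Longrightarrow> mpoly_eval (coords F) q \<noteq> 0 \<Longrightarrow> Q F"
proof -
  obtain U where U: "zariski_open N s d U" "U \<noteq> {}" "\<forall>F\<in>U. Q F"
    using assms unfolding for_general_def by blast
  obtain P where P: "U = {F \<in> hypersurface_tuples N s d. \<exists>p\<in>P. mpoly_eval (coords F) p \<noteq> 0}"
    using U(1) unfolding zariski_open_def ..
  obtain w where "w \<in> U" using U(2) by blast
  then obtain q where w: "w \<in> hypersurface_tuples N s d" "q \<in> P" "mpoly_eval (coords w) q \<noteq> 0"
    unfolding P by blast
  show thesis
  proof (rule that[OF w(1,3)])
    fix F assume "F \<in> hypersurface_tuples N s d" "mpoly_eval (coords F) q \<noteq> 0"
    then have "F \<in> U" unfolding P using w(2) by blast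
    then show "Q F" using U(3) by blast
  qed
qed

lemma for_general_mono:
  assumes "for_general N s d Q" "\<And>F. F \<in> hypersurface_tuples N s d \<Longrightarrow> Q F \<Longrightarrow> Q' F"
  shows "for_general N s d Q'"
  using assms(1)
proof (rule for_generalE)
  fix w q
  assume "w \<in> hypersurface_tuples N s d" "mpoly_eval (coords w) q \<noteq> 0"
    and "\<And>F. F \<in> hypersurface_tuples N s d \<Longrightarrow> mpoly_eval (coords F) q \<noteq> 0 \<Longrightarrow> Q F"
  then show ?thesis using assms(2) by (intro for_generalI[of w]) auto
qed

lemma hypersurface_tuples_form:
  "F \<in> hypersurface_tuples N s d \<Longrightarrow> i \<in> {1..s} \<Longrightarrow> F i \<in> forms N (d i)"
  "F \<in> hypersurface_tuples N s d \<Longrightarrow> i \<in> {1..s} \<Longrightarrow> F i \<noteq> 0"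
  by (auto simp: hypersurface_tuples_def PiE_iff)

text \<open>Two nonempty open sets of tuples meet on the line through a point of each.\<close>

lemma for_general_conj:
  fixes Q :: "(nat \<Rightarrow> (nat, 'k::field) mpoly) \<Rightarrow> bool"
  assumes inf: "infinite (UNIV :: 'k set)" and "for_general N s d Q" "for_general N s d Q'"
  shows "for_general N s d (\<lambda>F. Q F \<and> Q' F)"
proof -
  obtain w q where q: "w \<in> hypersurface_tuples N s d" "mpoly_eval (coords w) q \<noteq> 0"
    "\<And>F. F \<in> hypersurface_tuples N s d \<Longrightarrow> mpoly_eval (coords F) q \<noteq> 0 \<Longrightarrow> Q F"
    using assms(2) by (rule for_generalE) blast
  obtain w' q' where q': "w' \<in> hypersurface_tuples N s d" "mpoly_eval (coords w') q' \<noteq> 0"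
    "\<And>F. F \<in> hypersurface_tuples N s d \<Longrightarrow> mpoly_eval (coords F) q' \<noteq> 0 \<Longrightarrow> Q' F"
    using assms(3) by (rule for_generalE) blast
  define L where "L t = (\<lambda>i\<in>{1..s}. w i + const t * (w' i - w i))" for t
  have undef: "w i = undefined" "w' i = undefined" if "i \<notin> {1..s}" for i
    using q(1) q'(1) that by (auto simp: hypersurface_tuples_def PiE_def extensional_def)
  have L: "coords (L t) = (\<lambda>v. coords w v + t * (coords w' v - coords w v))" for t
  proof
    fix v :: "nat \<times> (nat \<Rightarrow>\<^sub>0 nat)"
    obtain i \<mu> where v: "v = (i, \<mu>)" by (cases v)
    show "coords (L t) v = coords w v + t * (coords w' v - coords w v)"
      using undef[of i] by (cases "i \<in> {1..s}") (auto simp: v L_def lookup_add lookup_minus)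
  qed
  \<comment> \<open>One nonzero coefficient of each \<open>w i\<close> is tracked along the line,
    because tuples consist of nonzero forms; the product of these coefficients is the polynomial
    M.\<close>
  have "\<forall>i\<in>{1..s}. \<exists>\<mu>. lookup (w i) \<mu> \<noteq> 0"
    using hypersurface_tuples_form(2)[OF q(1)] by (metis in_keys_iff keys_eq_empty ex_in_conv)
  then obtain m where m: "\<And>i. i \<in> {1..s} \<Longrightarrow> lookup (w i) (m i) \<noteq> 0" by metis
  obtain P where P: "\<And>t. mpoly_eval (coords (L t)) q = poly P t"
    unfolding L using eval_line[of "coords w" "\<lambda>v. coords w' v - coords w v" q] by blast
  obtain P' where P': "\<And>t. mpoly_eval (coords (L t)) q' = poly P' t"
    unfolding L using eval_line[of "coords w" "\<lambda>v. coords w' v - coords w v" q'] by blast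
  define M where "M = (\<Prod>i\<in>{1..s}. [:lookup (w i) (m i), lookup (w' i) (m i) - lookup (w i) (m i):])"
  have L0: "coords (L 0) = coords w" and L1: "coords (L 1) = coords w'" unfolding L by auto
  have "P * P' * M \<noteq> 0"
  proof -
    have "P \<noteq> 0" using q(2) P[of 0] L0 by auto
    moreover have "P' \<noteq> 0" using q'(2) P'[of 1] L1 by auto
    moreover have "M \<noteq> 0" using m by (auto simp: M_def prod_zero_iff)
    ultimately show ?thesis by simp
  qed
  then have "{t. poly (P * P' * M) t = 0} \<noteq> UNIV"
    using inf poly_eq_0_if_zeros[of "P * P' * M"] by metis
  then obtain t where t: "poly P t \<noteq> 0" "poly P' t \<noteq> 0" "poly M t \<noteq> 0" by auto
  have Lt: "L t \<in> hypersurface_tuples N s d"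
    unfolding hypersurface_tuples_def
  proof (rule PiE_I)
    fix i assume i: "i \<in> {1..s}"
    have "lookup (L t i) (m i) \<noteq> 0"
      using t(3) i by (auto simp: M_def L_def poly_prod lookup_add lookup_minus prod_zero_iff)
    then have "L t i \<noteq> 0" by auto
    moreover have "L t i \<in> forms N (d i)"
      using i q(1) q'(1) by (auto simp: L_def hypersurface_tuples_form)
    ultimately show "L t i \<in> forms N (d i) - {0}" by simp
  qed (auto simp: L_def)
  show ?thesis
    by (rule for_generalI[of "L t" N s d "q * q'"]) (use Lt t P P' q(3) q'(3) in auto)
qed

lemma for_general_ball:
  fixes Q :: "'i \<Rightarrow> (nat \<Rightarrow> (nat, 'k::field) mpoly) \<Rightarrow> bool"
  assumes inf: "infinite (UNIV :: 'k set)" and "finite A" "A \<noteq> {}" "\<And>a. a \<in> A \<Longrightarrow> for_general N s d (Q a)"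
  shows "for_general N s d (\<lambda>F. \<forall>a\<in>A. Q a F)"
  using assms(2,3,4)
  by (induction A rule: finite_ne_induct) (auto intro: for_general_conj[OF inf])

text \<open>A parameter is a tuple together with a vector y of levels. Freezing y leaves a
  polynomial condition on the tuple, which gives openness; freezing the tuple and moving y along a
  line gives density of the good levels.\<close>

inductive_set pair_functions :: "((nat \<Rightarrow> (nat, 'k::field) mpoly) \<times> (nat \<Rightarrow> 'k) \<Rightarrow> 'k) set" where
  const: "(\<lambda>_. c) \<in> pair_functions"
| coeff: "(\<lambda>p. lookup (fst p i) \<mu>) \<in> pair_functions"
| coord: "(\<lambda>p. snd p i) \<in> pair_functions"
| add: "f \<in> pair_functions \<Longrightarrow> g \<in> pair_functions \<Longrightarrow> (\<lambda>p. f p + g p) \<in> pair_functions"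
| mult: "f \<in> pair_functions \<Longrightarrow> g \<in> pair_functions \<Longrightarrow> (\<lambda>p. f p * g p) \<in> pair_functions"

lemma pair_functions_mpoly:
  "f \<in> pair_functions \<Longrightarrow> \<exists>q. \<forall>F. f (F, y) = mpoly_eval (coords F) q"
proof (induction rule: pair_functions.induct)
  case (const c)
  show ?case by (rule exI[of _ "const c"]) simp
next
  case (coeff i \<mu>)
  show ?case by (rule exI[of _ "var (i, \<mu>)"]) simp
next
  case (coord i)
  show ?case by (rule exI[of _ "const (y i)"]) simp
next
  case (add f g)
  then obtain q r where "\<forall>F. f (F, y) = mpoly_eval (coords F) q" "\<forall>F. g (F, y) = mpoly_eval (coords F) r" by blast
  then show ?case by (intro exI[of _ "q + r"]) simp
next
  case (mult f g)
  then obtain q r where "\<forall>F. f (F, y) = mpoly_eval (coords F) q" "\<forall>F. g (F, y) = mpoly_eval (coords F) r" by blast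
  then show ?case by (intro exI[of _ "q * r"]) simp
qed

lemma pair_functions_line:
  "f \<in> pair_functions \<Longrightarrow> \<exists>P. \<forall>t. f (F, \<lambda>i. x i + t * y i) = poly P t"
proof (induction rule: pair_functions.induct)
  case (const c)
  show ?case by (rule exI[of _ "[:c:]"]) simp
next
  case (coeff i \<mu>)
  show ?case by (rule exI[of _ "[:lookup (F i) \<mu>:]"]) simp
next
  case (coord i)
  show ?case by (rule exI[of _ "[:x i, y i:]"]) simp
next
  case (add f g)
  then obtain q r where "\<forall>t. f (F, \<lambda>i. x i + t * y i) = poly q t" "\<forall>t. g (F, \<lambda>i. x i + t * y i) = poly r t" by blast
  then show ?case by (intro exI[of _ "q + r"]) simp
next
  case (mult f g)
  then obtain q r where "\<forall>t. f (F, \<lambda>i. x i + t * y i) = poly q t" "\<forall>t. g (F, \<lambda>i. x i + t * y i) = poly r t" by blast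
  then show ?case by (intro exI[of _ "q * r"]) simp
qed

text \<open>On the line from y to x the product of q and f vanishes identically, but q is nonzero at
  y; so f vanishes on the line and hence at x.\<close>

lemma eval_eq_0_if_zero_on_open:
  fixes f :: "(nat, 'k::field) mpoly"
  assumes inf: "infinite (UNIV :: 'k set)" and q: "q \<in> pair_functions" "q (F, y) \<noteq> 0"
    and zero: "\<And>x. q (F, x) \<noteq> 0 \<Longrightarrow> mpoly_eval x f = 0"
  shows "mpoly_eval x f = 0"
proof -
  obtain P where P: "\<And>t. q (F, \<lambda>i. y i + t * (x i - y i)) = poly P t"
    using pair_functions_line[OF q(1), of F y "\<lambda>i. x i - y i"] by blast
  obtain P' where P': "\<And>t. mpoly_eval (\<lambda>i. y i + t * (x i - y i)) f = poly P' t"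
    using eval_line[of y "\<lambda>i. x i - y i" f] by blast
  have "poly (P * P') t = 0" for t using zero[of "\<lambda>i. y i + t * (x i - y i)"] P P' by auto
  then have "P * P' = 0" using inf by (intro poly_eq_0_if_zeros) auto
  moreover have "P \<noteq> 0" using q(2) P[of 0] by auto
  ultimately have "P' = 0" by simp
  then show ?thesis using P'[of 1] by simp
qed

text \<open>The coefficients 1, t, ..., t^N run along the moment curve. Points x and y fail to be
  separated only if t is a root of the nonzero polynomial with coefficients x_i - y_i, so finitely
  many pairs exclude finitely many t.\<close>

lemma separating_form:
  fixes S :: "(nat \<Rightarrow> 'k::field) set"
  assumes inf: "infinite (UNIV :: 'k set)" and S: "finite S"
    and diff: "\<And>x y. x \<in> S \<Longrightarrow> y \<in> S \<Longrightarrow> x \<noteq> y \<Longrightarrow> \<exists>i\<le>N. x i \<noteq> y i"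
  obtains u where "u \<in> polys N" "inj_on (\<lambda>x. mpoly_eval x u) S"
proof -
  let ?p = "\<lambda>x y. \<Sum>i\<le>N. monom (x i - y i :: 'k) i"
  let ?R = "\<Union>(x, y)\<in>{(x, y). x \<in> S \<and> y \<in> S \<and> x \<noteq> y}. {t. poly (?p x y) t = 0}"
  have "finite ?R"
  proof (intro finite_UN_I)
    show "finite {(x, y). x \<in> S \<and> y \<in> S \<and> x \<noteq> y}"
      by (rule finite_subset[of _ "S \<times> S"]) (use S in auto)
    fix xy assume "xy \<in> {(x, y). x \<in> S \<and> y \<in> S \<and> x \<noteq> y}"
    then obtain x y where xy: "xy = (x, y)" "x \<in> S" "y \<in> S" "x \<noteq> y" by auto
    obtain i where i: "i \<le> N" "x i \<noteq> y i" using diff[OF xy(2-4)] by blast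
    have "coeff (?p x y) i = x i - y i"
      using i by (simp add: coeff_sum sum.delta)
    then have "?p x y \<noteq> 0" using i by (metis coeff_0 right_minus_eq)
    then show "finite (case xy of (x, y) \<Rightarrow> {t. poly (?p x y) t = 0})"
      unfolding xy(1) prod.case by (rule poly_roots_finite)
  qed
  then obtain t where t: "t \<notin> ?R" using inf ex_new_if_finite by blast
  define u :: "(nat, 'k) mpoly" where "u = (\<Sum>i\<le>N. const (t ^ i) * var i)"
  show thesis
  proof (rule that[of u])
    show "u \<in> polys N" by (auto simp: u_def intro!: polys_sum polys_mult)
    show "inj_on (\<lambda>x. mpoly_eval x u) S"
    proof (rule inj_onI, rule ccontr)
      fix x y assume xy: "x \<in> S" "y \<in> S" "mpoly_eval x u = mpoly_eval y u" "x \<noteq> y"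
      have "poly (?p x y) t = mpoly_eval x u - mpoly_eval y u"
        by (simp add: u_def poly_sum poly_monom sum_subtractf[symmetric] algebra_simps)
      then show False using t xy by auto
    qed
  qed
qed


section \<open>Intersections of general hypersurfaces\<close>

definition form_ideal :: "nat \<Rightarrow> (nat \<Rightarrow> (nat, 'k::field) mpoly) \<Rightarrow> nat set \<Rightarrow> (nat, 'k) mpoly set" where
  "form_ideal N F T = {(\<Sum>i\<in>T. F i * h i) | h. \<forall>i\<in>T. h i \<in> polys N}"

lemma form_idealI: "(\<And>i. i \<in> T \<Longrightarrow> h i \<in> polys N) \<Longrightarrow> (\<Sum>i\<in>T. F i * h i) \<in> form_ideal N F T"
  unfolding form_ideal_def by blast

lemma form_ideal_0: "0 \<in> form_ideal N F T"
  using form_idealI[of T "\<lambda>_. 0" N F] by simp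

lemma form_ideal_add: "f \<in> form_ideal N F T \<Longrightarrow> g \<in> form_ideal N F T \<Longrightarrow> f + g \<in> form_ideal N F T"
proof -
  assume "f \<in> form_ideal N F T" "g \<in> form_ideal N F T"
  then obtain h k where "f = (\<Sum>i\<in>T. F i * h i)" "\<forall>i\<in>T. h i \<in> polys N"
    "g = (\<Sum>i\<in>T. F i * k i)" "\<forall>i\<in>T. k i \<in> polys N" unfolding form_ideal_def by blast
  then show ?thesis using form_idealI[of T "\<lambda>i. h i + k i" N F] by (simp add: distrib_left sum.distrib)
qed

lemma form_ideal_mult: "f \<in> form_ideal N F T \<Longrightarrow> g \<in> polys N \<Longrightarrow> f * g \<in> form_ideal N F T"
proof -
  assume "f \<in> form_ideal N F T" and g: "g \<in> polys N"
  then obtain h where "f = (\<Sum>i\<in>T. F i * h i)" "\<forall>i\<in>T. h i \<in> polys N" unfolding form_ideal_def by blast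
  then show ?thesis using g form_idealI[of T "\<lambda>i. h i * g" N F] by (simp add: sum_distrib_right mult.assoc)
qed

lemma form_ideal_sum: "(\<And>i. i \<in> A \<Longrightarrow> f i \<in> form_ideal N F T) \<Longrightarrow> (\<Sum>i\<in>A. f i) \<in> form_ideal N F T"
  by (induction A rule: infinite_finite_induct) (auto intro: form_ideal_add form_ideal_0)

lemma form_ideal_generator:
  assumes "finite T" "i \<in> T" "g \<in> polys N"
  shows "F i * g \<in> form_ideal N F T"
proof -
  have "(\<Sum>j\<in>T. F j * (if j = i then g else 0)) = (\<Sum>j\<in>T. if j = i then F j * g else 0)"
    by (intro sum.cong) auto
  then have "(\<Sum>j\<in>T. F j * (if j = i then g else 0)) = F i * g"
    using assms by (simp add: sum.delta)
  then show ?thesis using form_idealI[of T "\<lambda>j. if j = i then g else 0" N F] assms by simp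
qed

lemma form_ideal_eval: "f \<in> form_ideal N F T \<Longrightarrow> (\<And>i. i \<in> T \<Longrightarrow> mpoly_eval x (F i) = 0) \<Longrightarrow> mpoly_eval x f = 0"
  by (auto simp: form_ideal_def)

text \<open>The grid form is congruent to x_i^D modulo x_0, which drives the rewriting in
  \<open>grid_spanning\<close>. The clause for \<open>D = 0\<close> compensates for
  \<open>D - 1 = 0\<close>.\<close>

lemma grid_product:
  assumes "i \<le> N"
  shows "\<exists>H\<in>forms N (D - 1). (D = 0 \<longrightarrow> H = 0) \<and>
    (\<Prod>k<D. var i - const (\<alpha> k) * var 0) = var i ^ D + var 0 * (H :: (nat, 'k::field) mpoly)"
proof (induction D)
  case 0
  show ?case by (intro bexI[of _ 0]) auto
next
  case (Suc D)
  then obtain H where H: "H \<in> forms N (D - 1)" "D = 0 \<longrightarrow> H = 0"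
    "(\<Prod>k<D. var i - const (\<alpha> k) * var 0) = var i ^ D + var 0 * (H :: (nat, 'k) mpoly)" by blast
  have Hf: "H * var j \<in> forms N D" if "j \<le> N" for j
    using forms_mult[OF H(1) forms_var[OF that]] H(2) by (cases D) auto
  have "(var i :: (nat, 'k) mpoly) ^ D \<in> forms N D"
    using forms_power[OF forms_var[OF assms], of D] by simp
  then have "H * var i - const (\<alpha> D) * var i ^ D - const (\<alpha> D) * (H * var 0) \<in> forms N D"
    using Hf assms by (intro forms_diff forms_const_mult) auto
  moreover have "(\<Prod>k<Suc D. var i - const (\<alpha> k) * var 0)
      = var i ^ Suc D + var 0 * (H * var i - const (\<alpha> D) * var i ^ D - const (\<alpha> D) * (H * var 0))"
    unfolding prod.lessThan_Suc H(3) by (simp add: algebra_simps)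
  ultimately show ?case by (intro bexI) auto
qed

text \<open>For i in E the block x_i^(d_i) is G_i - x_0 H, and x_0 is G_0; so a monomial containing
  the block becomes a combination of members of the system times forms of smaller degree. Outside E
  the degrees are 1 and G_i is x_i, so those exponents call for no rewriting.\<close>

lemma grid_spanning:
  fixes \<alpha> :: "nat \<Rightarrow> 'k::alg_closed_field"
  assumes d: "\<And>i. i \<le> N \<Longrightarrow> 0 < d i" and E: "0 \<notin> E" "\<And>i. i \<notin> E \<Longrightarrow> d i = 1"
    and G: "\<And>i. G i = (if i \<in> E then \<Prod>k<d i. var i - const (\<alpha> k) * var 0 else var i)"
  shows "form_system N d G" "form_system.spanning N d G"
proof -
  have grid: "\<exists>H\<in>forms N (d i - 1). G i = var i ^ d i + var 0 * H" if i: "i \<le> N" for i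
  proof (cases "i \<in> E")
    case True
    then show ?thesis using grid_product[OF i, of "d i" \<alpha>] G[of i] by auto
  next
    case False
    then show ?thesis using E(2)[OF False] G[of i] by (intro bexI[of _ 0]) auto
  qed
  have form: "G i \<in> forms N (d i)" if i: "i \<le> N" for i
  proof -
    obtain H where H: "H \<in> forms N (d i - 1)" "G i = var i ^ d i + var 0 * H" using grid[OF i] by blast
    have "var 0 * H \<in> forms N (1 + (d i - 1))" by (intro forms_mult H forms_var) simp
    then show ?thesis using forms_power[OF forms_var[OF i], of "d i"] d[OF i] H(2) by (auto intro!: forms_add)
  qed
  show fs: "form_system N d G" using d form by unfold_locales
  interpret form_system N d G by (rule fs)
  have d0: "d 0 = 1" and G0: "G 0 = var 0" using E G by auto
  have span: "f \<in> span_Phi n" if "f \<in> forms N n" for f n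
    using that
  proof (induction n arbitrary: f rule: less_induct)
    case (less n)
    show ?case
    proof (rule forms_spanI[OF less.prems])
      fix \<mu> assume mu: "\<mu> \<in> mons N n"
      show "single \<mu> 1 \<in> span_Phi n"
      proof (cases "\<forall>i\<in>E. i \<le> N \<longrightarrow> lookup \<mu> i < d i")
        case True
        have "Phi \<mu> = (\<Prod>i\<in>{0..N}. var i ^ lookup \<mu> i)"
          unfolding Phi_def atLeast0AtMost
        proof (intro prod.cong refl)
          fix i assume i: "i \<in> {..N}"
          show "var i ^ (lookup \<mu> i mod d i) * G i ^ (lookup \<mu> i div d i) = var i ^ lookup \<mu> i"
            using True E(2)[of i] G[of i] i by (cases "i \<in> E") auto
        qed
        also have "\<dots> = single \<mu> 1"
          using mu by (intro single_eq_prod_var[symmetric]) (auto simp: mons_def)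
        finally show ?thesis using Phi_span[OF mu] by simp
      next
        case False
        then obtain i where i: "i \<in> E" "i \<le> N" "d i \<le> lookup \<mu> i" by (auto simp: not_less)
        define \<nu> where "\<nu> = \<mu> - single i (d i)"
        have mu_eq: "\<mu> = single i (d i) + \<nu>"
          using i by (intro poly_mapping_eqI) (auto simp: \<nu>_def lookup_add lookup_minus lookup_single when_def)
        have nu: "\<nu> \<in> mons N (n - d i)" "d i \<le> n"
          using mu mu_eq by (auto simp: mons_def keys_add_nat tdeg_add)
        obtain H where H: "H \<in> forms N (d i - 1)" "G i = var i ^ d i + var 0 * H" using grid[OF i(2)] by blast
        have "single (single i (d i)) 1 = (var i :: (nat, 'k) mpoly) ^ d i"
          by (subst single_eq_prod_var[of "{i}"]) auto
        then have "single \<mu> 1 = var i ^ d i * (single \<nu> 1 :: (nat, 'k) mpoly)"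
          using mult_single[of "single i (d i)" "1::'k" \<nu> 1] by (simp add: mu_eq)
        also have "\<dots> = G i * single \<nu> 1 + const (-1) * (G 0 * (H * single \<nu> 1))"
          by (simp add: H(2) G0 const_uminus algebra_simps)
        also have "\<dots> \<in> span_Phi n"
        proof (intro span_Phi_add span_Phi_scale)
          have lt: "n - d i < n" "n - 1 < n" using d[OF i(2)] nu(2) by auto
          have "single \<nu> 1 \<in> span_Phi (n - d i)"
            by (rule less.IH[OF lt(1) single_form[OF nu(1)]])
          from span_Phi_G[OF i(2) this] show "G i * single \<nu> 1 \<in> span_Phi n" using nu(2) by simp
          have "H * single \<nu> 1 \<in> forms N (d i - 1 + (n - d i))"
            by (intro forms_mult H single_form nu)
          then have "H * single \<nu> 1 \<in> forms N (n - 1)" using nu(2) d[OF i(2)] by simp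
          then have "H * single \<nu> 1 \<in> span_Phi (n - 1)" by (rule less.IH[OF lt(2)])
          from span_Phi_G[OF le0 this] show "G 0 * (H * single \<nu> 1) \<in> span_Phi n"
            using d0 lt by simp
        qed
        finally show ?thesis .
      qed
    qed
  qed
  then show spanning unfolding spanning_def by (blast intro: single_form)
qed

lemma distinct_scalars:
  assumes "infinite (UNIV :: 'k set)"
  obtains \<alpha> :: "nat \<Rightarrow> 'k" where "inj \<alpha>"
  using assms infinite_countable_subset by blast

text \<open>For general \<open>F\<close>, the points of the intersection over \<open>T\<close> lying on no other hypersurface of
  the tuple are dense enough to detect membership in the ideal generated by the \<open>F i\<close>, \<open>i \<in> T\<close>.
  The equations are completed by the coordinates \<open>x\<^sub>0\<close> and \<open>x\<^sub>i\<close>, \<open>i > card T\<close>, to a system of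
  \<open>N + 1\<close> forms, and the base point is the grid \<open>F\<^sub>i = \<Prod>\<^sub>k (x\<^sub>i - \<alpha>\<^sub>k x\<^sub>0)\<close>.\<close>

definition detects_ideal :: "nat \<Rightarrow> nat \<Rightarrow> (nat \<Rightarrow> (nat, 'k::field) mpoly) \<Rightarrow> nat set \<Rightarrow> bool" where
  "detects_ideal N s F T \<longleftrightarrow> (\<forall>f\<in>polys N.
    (\<forall>x. x 0 \<noteq> 0 \<longrightarrow> (\<forall>i\<in>T. mpoly_eval x (F i) = 0) \<longrightarrow> (\<forall>j\<in>{1..s} - T. mpoly_eval x (F j) \<noteq> 0) \<longrightarrow> mpoly_eval x f = 0)
    \<longrightarrow> f \<in> form_ideal N F T)"

theorem general_detects_ideal:
  fixes d :: "nat \<Rightarrow> nat"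
  assumes T: "T \<subseteq> {1..s}" "card T \<le> N" and d: "\<And>i. i \<in> {1..s} \<Longrightarrow> 0 < d i"
  shows "for_general N s d (\<lambda>F :: nat \<Rightarrow> (nat, 'k::alg_closed_field) mpoly. detects_ideal N s F T)"
proof -
  have inf: "infinite (UNIV :: 'k set)" by (rule infinite_UNIV_alg_closed)
  obtain \<alpha> :: "nat \<Rightarrow> 'k" where alpha: "inj \<alpha>" using distinct_scalars[OF inf] .
  have finT: "finite T" using T(1) finite_subset by blast
  define e where "e = card T"
  \<comment> \<open>T is moved to the indices 1, ..., e, so that \<open>F (\<tau> i)\<close> takes
    the place of the coordinate x_i in the system.\<close>
  obtain \<tau> where tau: "bij_betw \<tau> {1..e} T"
    using finite_same_card_bij[of "{1..e}" T] finT by (auto simp: e_def)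
  define \<tau>' where "\<tau>' = inv_into {1..e} \<tau>"
  have tauT: "\<tau> i \<in> T" if "i \<in> {1..e}" for i using tau that by (auto simp: bij_betw_def)
  have tau': "\<tau>' (\<tau> i) = i" if "i \<in> {1..e}" for i
    using tau that by (simp add: \<tau>'_def bij_betw_def inv_into_f_f)
  have tau'T: "\<tau>' j \<in> {1..e}" "\<tau> (\<tau>' j) = j" if "j \<in> T" for j
    using tau that inv_into_into[of j \<tau> "{1..e}"] f_inv_into_f[of j \<tau> "{1..e}"]
    by (auto simp: \<tau>'_def bij_betw_def)
  have eN: "e \<le> N" using T by (simp add: e_def)
  define dd where "dd i = (if i \<in> {1..e} then d (\<tau> i) else 1)" for i
  have dd: "0 < dd i" for i
  proof (cases "i \<in> {1..e}")
    case True
    then have "\<tau> i \<in> {1..s}" using tauT T(1) by blast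
    then show ?thesis using d True by (simp add: dd_def)
  qed (auto simp: dd_def)
  define G :: "nat \<Rightarrow> (nat \<Rightarrow> (nat, 'k) mpoly) \<times> (nat \<Rightarrow> 'k) \<Rightarrow> (nat, 'k) mpoly" where
    "G i p = (if i \<in> {1..e} then fst p (\<tau> i) else var i)" for i p
  \<comment> \<open>Level 0 at the hypersurfaces and y_i at the coordinates: the system cuts V(F_i,
    i in T) with the slice x_i = y_i for i = 0 and i > e.\<close>
  define c :: "nat \<Rightarrow> (nat \<Rightarrow> (nat, 'k) mpoly) \<times> (nat \<Rightarrow> 'k) \<Rightarrow> 'k" where
    "c i p = (if i \<in> {1..e} then 0 else snd p i)" for i p
  \<comment> \<open>Detection uses points with x_0 nonzero, hence the first factor; the others keep
    the points off the remaining hypersurfaces.\<close>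
  define K :: "(nat \<Rightarrow> (nat, 'k) mpoly) \<times> (nat \<Rightarrow> 'k) \<Rightarrow> (nat, 'k) mpoly" where
    "K p = var 0 * (\<Prod>j\<in>{1..s} - T. fst p j)" for p
  define D :: "((nat \<Rightarrow> (nat, 'k) mpoly) \<times> (nat \<Rightarrow> 'k)) set" where
    "D = hypersurface_tuples N s d \<times> UNIV"
  \<comment> \<open>Off T the base tuple consists of powers of x_0. These are 1 at all grid points,
    so K is nonzero there.\<close>
  define F0 :: "nat \<Rightarrow> (nat, 'k) mpoly" where
    "F0 = (\<lambda>j\<in>{1..s}. if j \<in> T then \<Prod>k<d j. var (\<tau>' j) - const (\<alpha> k) * var 0 else var 0 ^ d j)"
  define y0 :: "nat \<Rightarrow> 'k" where "y0 i = (if i = 0 then 1 else 0)" for i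
  define w where "w = (F0, y0)"
  \<comment> \<open>The grid point of b has x_0 = 1 and x_i = \<alpha>_k, where k is the exponent of
    x_i in b.\<close>
  define z :: "(nat \<Rightarrow>\<^sub>0 nat) \<Rightarrow> nat \<Rightarrow> 'k" where
    "z b i = (if i = 0 then 1 else if i \<in> {1..e} then \<alpha> (lookup b i) else 0)" for b i
  have F0_T: "F0 (\<tau> i) = (\<Prod>k<dd i. var i - const (\<alpha> k) * var 0)" if "i \<in> {1..e}" for i
    using that tauT[OF that] T(1) tau'[OF that] by (auto simp: F0_def dd_def)
  have Gw: "G i w = (if i \<in> {1..e} then \<Prod>k<dd i. var i - const (\<alpha> k) * var 0 else var i)" for i
    using F0_T by (simp add: G_def w_def)
  have grid: "form_system N dd (\<lambda>i. G i w)" "form_system.spanning N dd (\<lambda>i. G i w)"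
    by (rule grid_spanning[of N dd "{1..e}" _ \<alpha>]; use dd Gw in \<open>auto simp: dd_def\<close>)+
  define red where "red = form_system.reduced N dd"
  have red_iff: "b \<in> red \<longleftrightarrow> b \<in> all_mons N \<and> (\<forall>i\<le>N. lookup b i < dd i)" for b
    unfolding red_def by (simp add: form_system.reduced_def[OF grid(1)])
  have fin_red: "finite red" unfolding red_def by (rule form_system.finite_reduced[OF grid(1)])
  have F0_tuple: "F0 \<in> hypersurface_tuples N s d"
    unfolding hypersurface_tuples_def
  proof (rule PiE_I)
    fix j assume j: "j \<in> {1..s}"
    show "F0 j \<in> forms N (d j) - {0}"
    proof (cases "j \<in> T")
      case True
      have i: "\<tau>' j \<in> {1..e}" "F0 j = G (\<tau>' j) w"
        using tau'T[OF True] by (simp_all add: G_def w_def)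
      have "F0 j \<in> forms N (dd (\<tau>' j))"
        unfolding i(2) using i(1) eN by (intro form_system.G_form[OF grid(1)]) auto
      moreover have "dd (\<tau>' j) = d j" using i(1) tau'T[OF True] by (simp add: dd_def)
      moreover have "mpoly_eval (\<lambda>i. if i = 0 then 0 else 1) (F0 j) = 1"
        using i(1) by (simp add: i(2) Gw)
      ultimately show ?thesis by auto
    next
      case False
      have "(var 0 :: (nat, 'k) mpoly) ^ d j \<in> forms N (d j)"
        using forms_power[OF forms_var[of 0 N], of "d j"] by simp
      moreover have "(var 0 :: (nat, 'k) mpoly) ^ d j \<noteq> 0"
      proof
        assume "(var 0 :: (nat, 'k) mpoly) ^ d j = 0"
        then have "mpoly_eval (\<lambda>i. 1) ((var 0 :: (nat, 'k) mpoly) ^ d j) = 0" by (simp only: eval_0)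
        then show False by simp
      qed
      ultimately show ?thesis using False j by (auto simp: F0_def)
    qed
  qed (auto simp: F0_def)
  obtain u where u: "u \<in> polys N" "inj_on (\<lambda>x. mpoly_eval x u) (z ` red)"
  proof (rule separating_form[OF inf, of "z ` red" N])
    fix x y assume xy: "x \<in> z ` red" "y \<in> z ` red" and "x \<noteq> y"
    then obtain i where i: "x i \<noteq> y i" by (meson ext)
    with xy have "i \<in> {1..e}" by (auto simp: z_def split: if_splits)
    then show "\<exists>i\<le>N. x i \<noteq> y i" using i eN by (intro exI[of _ i]) auto
  qed (use fin_red that in auto)
  have z_inj: "inj_on z red"
  proof (rule inj_onI, rule poly_mapping_eqI)
    fix a b i assume ab: "a \<in> red" "b \<in> red" "z a = z b"
    show "lookup a i = lookup b i"
    proof (cases "i \<in> {1..e}")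
      case True
      then show ?thesis using fun_cong[OF ab(3), of i] alpha by (auto simp: z_def inj_eq)
    next
      case False
      show ?thesis
      proof (cases "i \<le> N")
        case True
        then show ?thesis using ab(1,2) False by (auto simp: red_iff dd_def dest!: spec[of _ i])
      next
        case False
        then have "i \<notin> keys a" "i \<notin> keys b" using ab by (auto simp: red_iff all_mons_def)
        then show ?thesis by (simp add: in_keys_iff)
      qed
    qed
  qed
  interpret fr: function_ring pair_functions D w
    by unfold_locales (auto simp: D_def w_def F0_tuple intro: pair_functions.intros)
  have dT: "d (\<tau> i) = dd i" if "i \<in> {1..e}" for i using that by (simp add: dd_def)
  interpret level_family pair_functions D w N dd G c K u z
  proof unfold_locales
    show "0 < dd i" for i by (rule dd)
    show "G i p \<in> forms N (dd i)" if "i \<le> N" "p \<in> D" for i p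
    proof (cases "i \<in> {1..e}")
      case True
      then show ?thesis
        using hypersurface_tuples_form(1)[of "fst p" N s d "\<tau> i"] that tauT[OF True] T(1)
        by (auto simp: G_def D_def dT)
    next
      case False
      then show ?thesis using that forms_var[of i N] by (auto simp: G_def dd_def)
    qed
    show "(\<lambda>p. lookup (G i p) \<mu>) \<in> pair_functions" for i \<mu>
      by (cases "i \<in> {1..e}") (auto simp: G_def intro: pair_functions.intros)
    show "c i \<in> pair_functions" for i
      unfolding c_def by (cases "i \<in> {1..e}") (auto intro: pair_functions.intros)
    show "K \<in> fr.family N"
      unfolding K_def
    proof (rule fr.family_mult[OF fr.family_polys fr.family_prod[OF fr.family_form]])
      show "var 0 \<in> polys N" by simp
    next
      fix j p assume "j \<in> {1..s} - T" "p \<in> D"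
      then show "fst p j \<in> forms N (d j)" by (auto simp: D_def hypersurface_tuples_form)
    qed (intro fr.PF_regular pair_functions.coeff)
    show "u \<in> polys N" by (rule u(1))
    show "form_system.spanning N dd (\<lambda>i. G i w)" by (rule grid(2))
    show "mpoly_eval (z b) (G i w) = c i w" if b: "b \<in> form_system.reduced N dd" and i: "i \<le> N" for b i
    proof (cases "i \<in> {1..e}")
      case True
      have "lookup b i < dd i" using b i by (simp add: red_iff[unfolded red_def])
      then have "(\<Prod>k<dd i. \<alpha> (lookup b i) - \<alpha> k) = 0" by (intro prod_zero) auto
      then show ?thesis using True unfolding Gw by (simp add: c_def z_def)
    next
      case False
      then show ?thesis unfolding Gw by (auto simp: c_def z_def w_def y0_def)
    qed
    show "inj_on (\<lambda>b. mpoly_eval (z b) u) (form_system.reduced N dd)"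
      using comp_inj_on[OF z_inj u(2)] by (simp add: o_def red_def)
    show "mpoly_eval (z b) (K w) \<noteq> 0" for b
    proof -
      have "mpoly_eval (z b) (F0 j) = 1" if "j \<in> {1..s} - T" for j
        using that by (simp add: F0_def z_def)
      then show ?thesis by (simp add: K_def w_def prod_zero_iff z_def)
    qed
  qed
  define Z_prop where "Z_prop F y Z \<longleftrightarrow> (\<forall>x\<in>Z. (\<forall>i\<le>N. mpoly_eval x (G i (F, y)) = c i (F, y)) \<and> mpoly_eval x (K (F, y)) \<noteq> 0) \<and>
    (\<forall>a. (\<forall>x\<in>Z. (\<Sum>b\<in>red. a b * mono_eval x b) = 0) \<longrightarrow> (\<forall>b\<in>red. a b = 0))" for F y Z
  obtain q where q12: "q \<in> pair_functions" "q w \<noteq> 0"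
    and q_all: "\<forall>p\<in>D. q p \<noteq> 0 \<longrightarrow> spanning_at p \<and> (\<exists>Z. (\<forall>x\<in>Z. (\<forall>i\<le>N. mpoly_eval x (G i p) = c i p) \<and> mpoly_eval x (K p) \<noteq> 0) \<and>
      (\<forall>a. (\<forall>x\<in>Z. (\<Sum>b\<in>form_system.reduced N dd. a b * mono_eval x b) = 0) \<longrightarrow> (\<forall>b\<in>form_system.reduced N dd. a b = 0)))"
    using near_simple_level_set unfolding fr.near_def by blast
  have q3: "spanning_at (F, y) \<and> (\<exists>Z. Z_prop F y Z)" if "F \<in> hypersurface_tuples N s d" "q (F, y) \<noteq> 0" for F y
    using bspec[OF q_all, of "(F, y)"] that unfolding Z_prop_def red_def by (simp add: D_def)
  note q = q12 q3
  \<comment> \<open>Freezing the levels at \<open>y0\<close> gives the open condition on F. For such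
    F the function q (F, _) is not identically zero, so the good slices are dense.\<close>
  obtain q0 where q0: "\<And>F. q (F, y0) = mpoly_eval (coords F) q0"
    using pair_functions_mpoly[OF q(1)] by blast
  show ?thesis
  proof (rule for_generalI[OF F0_tuple, of q0], goal_cases)
    case 1
    then show ?case using q(2) q0 by (simp add: w_def)
  next
    case (2 F)
    show ?case
      unfolding detects_ideal_def
    proof (intro ballI impI)
      fix f assume f: "f \<in> polys N"
        and van: "\<forall>x. x 0 \<noteq> 0 \<longrightarrow> (\<forall>i\<in>T. mpoly_eval x (F i) = 0) \<longrightarrow> (\<forall>j\<in>{1..s} - T. mpoly_eval x (F j) \<noteq> 0) \<longrightarrow> mpoly_eval x f = 0"
      have qF: "q (F, y0) \<noteq> 0" using 2 q0 by simp
      interpret P: form_system N dd "\<lambda>i. G i (F, y0)"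
        by (rule fs) (use 2 in \<open>simp add: D_def\<close>)
      have spanF: P.spanning using q(3)[OF 2(1) qF] by simp
      have reds: "P.reduced = red" by (simp add: red_def)
      have span1: "\<exists>M a. finite M \<and> M \<subseteq> all_mons N \<and> g = (\<Sum>\<mu>\<in>M. const (a \<mu>) * P.Phi \<mu>)" if g: "g \<in> forms N n" for g n
      proof -
        obtain a where "g = (\<Sum>\<mu>\<in>mons N n. const (a \<mu>) * P.Phi \<mu>)"
          using P.forms_span_Phi[OF spanF g] unfolding P.span_Phi_def by blast
        then show ?thesis by (intro exI[of _ "mons N n"] exI[of _ a]) (auto dest: mons_all_mons)
      qed
      \<comment> \<open>Exponents are separated: \<open>bp\<close> is the part in the variables 1,
        ..., e; \<open>yp\<close> is the factor in the other variables, constant on a slice;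
        \<open>low\<close> collects the monomials whose \<open>bp\<close> is reduced.\<close>
      define bp where "bp \<mu> = (\<Sum>i\<in>{1..e}. single i (lookup \<mu> i))" for \<mu> :: "nat \<Rightarrow>\<^sub>0 nat"
      have lookup_bp: "lookup (bp \<mu>) i = (if i \<in> {1..e} then lookup \<mu> i else 0)" for \<mu> i
        by (simp add: bp_def lookup_sum lookup_single when_def sum.delta)
      define low where "low = {\<mu> \<in> all_mons N. \<forall>i\<in>{1..e}. lookup \<mu> i < dd i}"
      define yp :: "(nat \<Rightarrow>\<^sub>0 nat) \<Rightarrow> (nat, 'k) mpoly" where
        "yp \<mu> = (\<Prod>i\<in>{..N} - {1..e}. var i ^ lookup \<mu> i)" for \<mu>
      have Phi_low: "P.Phi \<mu> = yp \<mu> * single (bp \<mu>) 1" if mu: "\<mu> \<in> low" for \<mu>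
      proof -
        have "P.Phi \<mu> = (\<Prod>i\<in>{..N}. var i ^ lookup \<mu> i)"
          unfolding P.Phi_def
        proof (intro prod.cong refl)
          fix i
          show "var i ^ (lookup \<mu> i mod dd i) * G i (F, y0) ^ (lookup \<mu> i div dd i) = var i ^ lookup \<mu> i"
          proof (cases "i \<in> {1..e}")
            case True
            then have "lookup \<mu> i < dd i" using mu by (simp add: low_def)
            then show ?thesis by simp
          next
            case False
            then show ?thesis by (auto simp: dd_def G_def)
          qed
        qed
        also have "\<dots> = yp \<mu> * (\<Prod>i\<in>{1..e}. var i ^ lookup \<mu> i)"
          unfolding yp_def using eN by (subst prod.subset_diff[of "{1..e}"]) auto
        also have "(\<Prod>i\<in>{1..e}. var i ^ lookup \<mu> i :: (nat, 'k) mpoly) = (\<Prod>i\<in>{1..e}. var i ^ lookup (bp \<mu>) i)"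
          by (intro prod.cong) (auto simp: lookup_bp)
        also have "\<dots> = single (bp \<mu>) 1"
          by (intro single_eq_prod_var[symmetric]) (auto simp: in_keys_iff lookup_bp split: if_splits)
        finally show ?thesis .
      qed
      have bp_red: "bp \<mu> \<in> red" if "\<mu> \<in> low" for \<mu>
      proof -
        have "keys (bp \<mu>) \<subseteq> {0..N}" using eN by (auto simp: in_keys_iff lookup_bp split: if_splits)
        then show ?thesis using that dd by (auto simp: red_iff all_mons_def lookup_bp low_def)
      qed
      have Phi_high: "P.Phi \<mu> \<in> form_ideal N F T" if mu: "\<mu> \<in> all_mons N" "\<mu> \<notin> low" for \<mu>
      proof -
        obtain i where i: "i \<in> {1..e}" "dd i \<le> lookup \<mu> i" using mu by (auto simp: low_def not_less)
        define \<nu> where "\<nu> = \<mu> - single i (dd i)"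
        have mu_eq: "\<mu> = single i (dd i) + \<nu>"
          using i by (intro poly_mapping_eqI) (auto simp: \<nu>_def lookup_add lookup_minus lookup_single when_def)
        then have "\<nu> \<in> all_mons N" using mu by (auto simp: all_mons_def keys_add_nat)
        then have "F (\<tau> i) * P.Phi \<nu> \<in> form_ideal N F T"
          by (intro form_ideal_generator finT tauT i P.Phi_polys)
        moreover have "P.Phi \<mu> = F (\<tau> i) * P.Phi \<nu>"
          using P.Phi_shift[of i \<nu>] i eN mu_eq by (simp add: G_def)
        ultimately show ?thesis by simp
      qed
      have split: "\<exists>M a. finite M \<and> M \<subseteq> low \<and> g - (\<Sum>\<mu>\<in>M. const (a \<mu>) * P.Phi \<mu>) \<in> form_ideal N F T"
        if g: "g \<in> forms N n" for g n
      proof -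
        obtain M a where M: "finite M" "M \<subseteq> all_mons N" "g = (\<Sum>\<mu>\<in>M. const (a \<mu>) * P.Phi \<mu>)"
          using span1[OF g] by blast
        have "g = (\<Sum>\<mu>\<in>M - low. const (a \<mu>) * P.Phi \<mu>) + (\<Sum>\<mu>\<in>M \<inter> low. const (a \<mu>) * P.Phi \<mu>)"
          unfolding M(3) using M(1) by (subst sum.Int_Diff[of M _ low]) auto
        moreover have "(\<Sum>\<mu>\<in>M - low. const (a \<mu>) * P.Phi \<mu>) \<in> form_ideal N F T"
          using M(2) form_ideal_mult[OF Phi_high polys_const]
          by (intro form_ideal_sum) (auto simp: mult.commute)
        ultimately show ?thesis using M(1)
          by (intro exI[of _ "M \<inter> low"] exI[of _ a]) auto
      qed
      have "\<forall>n. \<exists>M a. finite M \<and> M \<subseteq> low \<and> hcomp n f - (\<Sum>\<mu>\<in>M. const (a \<mu>) * P.Phi \<mu>) \<in> form_ideal N F T"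
        using split[OF hcomp_forms[OF f]] by blast
      from choice[OF this] obtain M where "\<forall>n. \<exists>a. finite (M n) \<and> M n \<subseteq> low \<and>
          hcomp n f - (\<Sum>\<mu>\<in>M n. const (a \<mu>) * P.Phi \<mu>) \<in> form_ideal N F T" ..
      from choice[OF this] obtain a where Ma: "\<forall>n. finite (M n) \<and> M n \<subseteq> low \<and>
          hcomp n f - (\<Sum>\<mu>\<in>M n. const (a n \<mu>) * P.Phi \<mu>) \<in> form_ideal N F T" ..
      then have M: "\<And>n. finite (M n)" "\<And>n. M n \<subseteq> low"
        "\<And>n. hcomp n f - (\<Sum>\<mu>\<in>M n. const (a n \<mu>) * P.Phi \<mu>) \<in> form_ideal N F T"
        by blast+
      \<comment> \<open>g agrees with f modulo the ideal, hence on V(F_i, i in T), but involves only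
        members of \<open>low\<close>.\<close>
      define g where "g = (\<Sum>n\<le>maxdeg f. \<Sum>\<mu>\<in>M n. const (a n \<mu>) * P.Phi \<mu>)"
      have fg: "f - g \<in> form_ideal N F T"
      proof -
        have "f - g = (\<Sum>n\<le>maxdeg f. hcomp n f - (\<Sum>\<mu>\<in>M n. const (a n \<mu>) * P.Phi \<mu>))"
          unfolding g_def sum_subtractf using sum_hcomp[of f] by simp
        then show ?thesis using M(3) by (auto intro: form_ideal_sum)
      qed
      have g_polys: "g \<in> polys N"
        unfolding g_def using M(2) by (intro polys_sum polys_mult polys_const P.Phi_polys) (auto simp: low_def)
      \<comment> \<open>The coefficient of the reduced monomial b in the restriction of g to the
        slice through y.\<close>
      define A where "A y b = (\<Sum>n\<le>maxdeg f. \<Sum>\<mu>\<in>M n. if bp \<mu> = b then a n \<mu> * mpoly_eval y (yp \<mu>) else 0)" for y b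
      have g_eval: "mpoly_eval x g = (\<Sum>b\<in>red. A y b * mono_eval x b)"
        if xy: "\<And>i. i \<le> N \<Longrightarrow> i \<notin> {1..e} \<Longrightarrow> x i = y i" for x y
      proof -
        have yp: "mpoly_eval x (yp \<mu>) = mpoly_eval y (yp \<mu>)" for \<mu>
          unfolding yp_def using xy by (auto intro!: prod.cong)
        have "(\<Sum>b\<in>red. A y b * mono_eval x b)
            = (\<Sum>n\<le>maxdeg f. \<Sum>\<mu>\<in>M n. \<Sum>b\<in>red. (if bp \<mu> = b then a n \<mu> * mpoly_eval y (yp \<mu>) else 0) * mono_eval x b)"
          unfolding A_def sum_distrib_right
          by (rule trans[OF sum.swap], rule sum.cong[OF refl], rule sum.swap)
        also have "\<dots> = (\<Sum>n\<le>maxdeg f. \<Sum>\<mu>\<in>M n. a n \<mu> * mpoly_eval y (yp \<mu>) * mono_eval x (bp \<mu>))"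
        proof (intro sum.cong refl)
          fix n \<mu> assume "\<mu> \<in> M n"
          then have "bp \<mu> \<in> red" using M(2) bp_red by blast
          then show "(\<Sum>b\<in>red. (if bp \<mu> = b then a n \<mu> * mpoly_eval y (yp \<mu>) else 0) * mono_eval x b)
              = a n \<mu> * mpoly_eval y (yp \<mu>) * mono_eval x (bp \<mu>)"
            using fin_red by (simp add: if_distrib[of "\<lambda>t. t * _"] sum.delta cong: if_cong)
        qed
        also have "\<dots> = mpoly_eval x g"
          unfolding g_def eval_sum
        proof (intro sum.cong refl)
          fix n \<mu> assume "\<mu> \<in> M n"
          then have "\<mu> \<in> low" using M(2) by blast
          then show "a n \<mu> * mpoly_eval y (yp \<mu>) * mono_eval x (bp \<mu>) = mpoly_eval x (const (a n \<mu>) * P.Phi \<mu>)"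
            by (simp add: Phi_low yp eval_single)
        qed
        finally show ?thesis by simp
      qed
      \<comment> \<open>The points of Z lie on the slice through y and on V(F_i, i in T) off the
        rest, so f and g vanish there. Z determines the coefficients, so g vanishes on the whole
        slice, in particular at y.\<close>
      have "mpoly_eval y g = 0" if qy: "q (F, y) \<noteq> 0" for y
      proof -
        obtain Z where Z: "Z_prop F y Z" using q(3)[OF 2(1) qy] by blast
        have "(\<Sum>b\<in>red. A y b * mono_eval x b) = 0" if x: "x \<in> Z" for x
        proof -
          have Gx: "mpoly_eval x (G i (F, y)) = c i (F, y)" if "i \<le> N" for i
            using Z x that unfolding Z_prop_def by blast
          have FT: "mpoly_eval x (F j) = 0" if j: "j \<in> T" for j
            using Gx[of "\<tau>' j"] tau'T[OF j] eN by (auto simp: G_def c_def)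
          have Kx: "mpoly_eval x (K (F, y)) \<noteq> 0" using Z x unfolding Z_prop_def by blast
          then have x0: "x 0 \<noteq> 0" by (simp add: K_def)
          from Kx have "mpoly_eval x (F j) \<noteq> 0" if "j \<in> {1..s} - T" for j
            using that by (auto simp: K_def prod_zero_iff)
          then have "mpoly_eval x f = 0" using van FT x0 by blast
          moreover have "mpoly_eval x (f - g) = 0" by (rule form_ideal_eval[OF fg FT])
          ultimately have "mpoly_eval x g = 0" by simp
          moreover have "x i = y i" if "i \<le> N" "i \<notin> {1..e}" for i
            using Gx[OF that(1)] that(2) by (auto simp: G_def c_def split: if_splits)
          ultimately show ?thesis using g_eval[of x y] by simp
        qed
        then have "\<forall>b\<in>red. A y b = 0" using Z unfolding Z_prop_def by blast
        then show ?thesis using g_eval[of y y] by simp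
      qed
      then have "mpoly_eval x g = 0" for x
        by (rule eval_eq_0_if_zero_on_open[OF inf q(1) qF])
      then have "g = 0" by (rule eval_eq_0_imp_eq_0[OF inf g_polys])
      then show "f \<in> form_ideal N F T" using fg by simp
    qed
  qed
qed


section \<open>Powers, initial degrees, and the lower bound for the resurgence\<close>

section \<open>Powers of ideals\<close>

abbreviation ideal_power :: "nat \<Rightarrow> (nat, 'k::field) mpoly set \<Rightarrow> nat \<Rightarrow> (nat, 'k) mpoly set" where
  "ideal_power N I n \<equiv> I [^]\<^bsub>ideals_set (poly_ring N)\<^esub> n"

lemma one_ideals_set [simp]: "\<one>\<^bsub>ideals_set R\<^esub> = carrier R"
  by (simp add: ideals_set_def)

lemma hcomp_polys: "p \<in> polys N \<Longrightarrow> hcomp n p \<in> polys N"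
  by (rule forms_polys[OF hcomp_forms])

lemma ideal_power_0: "ideal_power N I 0 = polys N"
  by (simp add: nat_pow_def ideals_set_def)

lemma ideal_power_Suc: "ideal_power N I (Suc n) = ideal_prod (poly_ring N) (ideal_power N I n) I"
  by (simp add: nat_pow_def ideals_set_def)

lemma ideal_power_ideal:
  assumes "ideal I (poly_ring N)"
  shows "ideal (ideal_power N I n) (poly_ring N)"
proof (induction n)
  case 0
  show ?case unfolding ideal_power_0 by (rule ring.oneideal[OF ring_poly_ring])
next
  case (Suc n)
  show ?case unfolding ideal_power_Suc by (rule ring.ideal_prod_is_ideal[OF ring_poly_ring Suc assms])
qed

lemma ideal_poly_ringI:
  assumes "I \<subseteq> polys N" "0 \<in> I" "\<And>f g. f \<in> I \<Longrightarrow> g \<in> I \<Longrightarrow> f + g \<in> I"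
    "\<And>f g. f \<in> I \<Longrightarrow> g \<in> polys N \<Longrightarrow> g * f \<in> I"
  shows "ideal I (poly_ring N)"
proof (rule idealI)
  show "subgroup I (add_monoid (poly_ring N))"
  proof (unfold_locales, goal_cases)
    case (4 x)
    then have "- x = -1 * x" "x \<in> polys N" using assms(1) by auto
    then have "- x \<in> I" using assms(4)[of x "-1"] 4 by simp
    then show ?case using \<open>x \<in> polys N\<close> minus_poly_ring[of x N] by (simp add: a_inv_def)
  qed (use assms in auto)
qed (use assms in \<open>auto intro: ring_poly_ring simp: mult.commute\<close>)

lemma ideal_closed:
  assumes "ideal I (poly_ring N)"
  shows "f \<in> I \<Longrightarrow> f \<in> polys N" "0 \<in> I" "f \<in> I \<Longrightarrow> g \<in> I \<Longrightarrow> f + g \<in> I"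
    "f \<in> I \<Longrightarrow> g \<in> polys N \<Longrightarrow> g * f \<in> I" "f \<in> I \<Longrightarrow> g \<in> polys N \<Longrightarrow> f * g \<in> I"
  using ideal.Icarr[OF assms] additive_subgroup.zero_closed[OF ideal.axioms(1)[OF assms]]
    additive_subgroup.a_closed[OF ideal.axioms(1)[OF assms], of f g]
    ideal.I_l_closed[OF assms, of f g] ideal.I_r_closed[OF assms, of f g]
  by simp_all

lemma ideal_sum_closed:
  "ideal I (poly_ring N) \<Longrightarrow> (\<And>i. i \<in> A \<Longrightarrow> f i \<in> I) \<Longrightarrow> (\<Sum>i\<in>A. f i) \<in> I"
  by (induction A rule: infinite_finite_induct) (auto intro: ideal_closed)

lemma ideal_power_mult1: "f \<in> ideal_power N I n \<Longrightarrow> g \<in> I \<Longrightarrow> f * g \<in> ideal_power N I (Suc n)"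
  unfolding ideal_power_Suc using ideal_prod.prod[of f _ g I "poly_ring N"] by simp

lemma ideal_power_mult:
  assumes I: "ideal I (poly_ring N)" and f: "f \<in> ideal_power N I m"
  shows "g \<in> ideal_power N I n \<Longrightarrow> f * g \<in> ideal_power N I (m + n)"
proof (induction n arbitrary: g)
  case 0
  then show ?case using f ideal_closed(5)[OF ideal_power_ideal[OF I]] by (simp add: ideal_power_0)
next
  case (Suc n)
  have "f * g \<in> ideal_power N I (Suc (m + n))"
    using Suc.prems unfolding ideal_power_Suc[of N I n]
  proof (induction g rule: ideal_prod.induct)
    case (prod i j)
    then show ?case using ideal_power_mult1[OF Suc.IH[of i] prod(2)] by (simp add: mult.assoc)
  next
    case (sum s1 s2)
    from ideal_closed(3)[OF ideal_power_ideal[OF I] sum.IH] show ?case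
      by (simp only: poly_ring_ops distrib_left)
  qed
  then show ?case by simp
qed

lemma ideal_power_power:
  assumes I: "ideal I (poly_ring N)" and f: "f \<in> ideal_power N I m"
  shows "f ^ t \<in> ideal_power N I (t * m)"
  by (induction t) (auto simp: ideal_power_0 intro: ideal_power_mult[OF I f])

lemma ideal_power_prod:
  assumes I: "ideal I (poly_ring N)" and A: "finite A" "\<And>i. i \<in> A \<Longrightarrow> f i \<in> I"
  shows "(\<Prod>i\<in>A. f i) \<in> ideal_power N I (card A)"
  using A
proof (induction A rule: finite_induct)
  case empty
  then show ?case by (simp add: ideal_power_0)
next
  case (insert i A)
  then have "(\<Prod>i\<in>A. f i) * f i \<in> ideal_power N I (Suc (card A))"
    by (intro ideal_power_mult1) auto
  then show ?case using insert by (simp add: mult.commute)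
qed

text \<open>Order at least a at the origin. For a homogeneous ideal this expresses the initial
  degree, but it applies to arbitrary elements and not only to forms.\<close>

definition low_order :: "nat \<Rightarrow> nat \<Rightarrow> (nat, 'k::field) mpoly set" where
  "low_order N a = {f \<in> polys N. \<forall>\<mu>\<in>keys f. a \<le> tdeg \<mu>}"

lemma low_order_mult: "f \<in> low_order N a \<Longrightarrow> g \<in> low_order N b \<Longrightarrow> f * g \<in> low_order N (a + b)"
proof -
  assume f: "f \<in> low_order N a" and g: "g \<in> low_order N b"
  have "a + b \<le> tdeg \<mu>" if mu: "\<mu> \<in> keys (f * g)" for \<mu>
  proof -
    obtain x y where "\<mu> = x + y" "x \<in> keys f" "y \<in> keys g"
      using mu Poly_Mapping.keys_mult[of f g] by blast
    then show ?thesis using f g by (auto simp: low_order_def tdeg_add add_mono)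
  qed
  then show ?thesis using f g by (auto simp: low_order_def)
qed

lemma low_order_add: "f \<in> low_order N a \<Longrightarrow> g \<in> low_order N a \<Longrightarrow> f + g \<in> low_order N a"
  using Poly_Mapping.keys_add[of f g] by (auto simp: low_order_def)

lemma ideal_power_low_order:
  assumes "I \<subseteq> low_order N a"
  shows "f \<in> ideal_power N I n \<Longrightarrow> f \<in> low_order N (n * a)"
proof (induction n arbitrary: f)
  case 0
  then show ?case by (simp add: ideal_power_0 low_order_def)
next
  case (Suc n)
  from Suc.prems show ?case
    unfolding ideal_power_Suc
  proof (induction f rule: ideal_prod.induct)
    case (prod i j)
    then have "i * j \<in> low_order N (n * a + a)" using Suc.IH assms by (intro low_order_mult) auto
    then show ?case by (simp add: add.commute)
  next
    case (sum s1 s2)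
    then show ?case by (simp add: low_order_add)
  qed
qed


section \<open>The vanishing ideal of a star configuration\<close>

text \<open>For \<open>e = 0\<close> the intersection over the empty T would be the set of all
  functions instead of projective space.\<close>

lemma star_config_iff:
  assumes "0 < e"
  shows "x \<in> star_config N e s F \<longleftrightarrow>
    x \<in> proj_space N \<and> (\<exists>T\<subseteq>{1..s}. card T = e \<and> (\<forall>i\<in>T. mpoly_eval x (F i) = 0))"
proof
  assume "x \<in> star_config N e s F"
  then obtain T where T: "T \<subseteq> {1..s}" "card T = e" "\<forall>i\<in>T. x \<in> hypersurface N (F i)"
    unfolding star_config_def by blast
  then obtain i where "i \<in> T" using assms by fastforce
  then show "x \<in> proj_space N \<and> (\<exists>T\<subseteq>{1..s}. card T = e \<and> (\<forall>i\<in>T. mpoly_eval x (F i) = 0))"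
    using T unfolding hypersurface_def by blast
next
  assume "x \<in> proj_space N \<and> (\<exists>T\<subseteq>{1..s}. card T = e \<and> (\<forall>i\<in>T. mpoly_eval x (F i) = 0))"
  then show "x \<in> star_config N e s F" unfolding star_config_def hypersurface_def by blast
qed

lemma star_config_scale:
  assumes "0 < e" and F: "\<And>i. i \<in> {1..s} \<Longrightarrow> F i \<in> forms N (d i)" and t: "t \<noteq> 0"
    and x: "x \<in> star_config N e s F"
  shows "(\<lambda>i. t * x i) \<in> star_config N e s F"
proof -
  obtain T where T: "T \<subseteq> {1..s}" "card T = e" "\<forall>i\<in>T. mpoly_eval x (F i) = 0" and px: "x \<in> proj_space N"
    using x by (auto simp: star_config_iff[OF assms(1)])
  have "mpoly_eval (\<lambda>i. t * x i) (F i) = 0" if "i \<in> T" for i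
    using T that eval_forms_scale[OF F[of i], of t x] by auto
  moreover have "(\<lambda>i. t * x i) \<in> proj_space N" using px t by (auto simp: proj_space_def)
  ultimately show ?thesis using T by (auto simp: star_config_iff[OF assms(1)])
qed

text \<open>On the line through x the value of f is a polynomial in t with the values of the
  components as coefficients, and it has infinitely many zeros.\<close>

lemma hcomp_zeros:
  fixes f :: "(nat, 'k::field) mpoly"
  assumes inf: "infinite (UNIV :: 'k set)" and f: "f \<in> polys N"
    and zero: "\<And>t. t \<noteq> 0 \<Longrightarrow> mpoly_eval (\<lambda>i. t * x i) f = 0"
  shows "mpoly_eval x (hcomp n f) = 0"
proof -
  define P where "P = (\<Sum>n\<le>maxdeg f. monom (mpoly_eval x (hcomp n f)) n)"
  have "poly P t = mpoly_eval (\<lambda>i. t * x i) f" for t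
  proof -
    have "mpoly_eval (\<lambda>i. t * x i) f = (\<Sum>n\<le>maxdeg f. mpoly_eval (\<lambda>i. t * x i) (hcomp n f))"
      by (subst sum_hcomp[of f]) simp
    also have "\<dots> = poly P t"
      using f by (simp add: P_def poly_sum poly_monom eval_forms_scale[OF hcomp_forms] mult.commute)
    finally show ?thesis by simp
  qed
  then have "UNIV - {0} \<subseteq> {t. poly P t = 0}" using zero by auto
  then have "infinite {t. poly P t = 0}" using inf by (meson finite.emptyI finite_Diff2 finite_insert finite_subset)
  then have "P = 0" by (rule poly_eq_0_if_zeros)
  then have "coeff P n = 0" by simp
  then show ?thesis
  proof (cases "n \<le> maxdeg f")
    case True
    then show ?thesis using \<open>coeff P n = 0\<close> by (simp add: P_def coeff_sum sum.delta)
  next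
    case False
    then have "hcomp n f = 0"
      using tdeg_le_maxdeg[of _ f] by (intro poly_mapping_eqI) (fastforce simp: lookup_hcomp in_keys_iff)
    then show ?thesis by simp
  qed
qed

text \<open>The configuration is closed under scaling, so the components of a polynomial vanishing
  on it vanish on it too; hence the forms generate all of these polynomials.\<close>

lemma vanishing_ideal_iff:
  fixes F :: "nat \<Rightarrow> (nat, 'k::field) mpoly"
  assumes inf: "infinite (UNIV :: 'k set)" and e: "0 < e"
    and F: "\<And>i. i \<in> {1..s} \<Longrightarrow> F i \<in> forms N (d i)"
  shows "vanishing_ideal N (star_config N e s F) = {f \<in> polys N. \<forall>x\<in>star_config N e s F. mpoly_eval x f = 0}"
    (is "?V = ?W")
    and "ideal (vanishing_ideal N (star_config N e s F)) (poly_ring N)"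
proof -
  let ?S = "{f. (\<exists>n. f \<in> forms N n) \<and> (\<forall>x\<in>star_config N e s F. mpoly_eval x f = 0)}"
  have S: "?S \<subseteq> polys N" by (auto intro: forms_polys)
  have W: "ideal ?W (poly_ring N)" by (rule ideal_poly_ringI) auto
  show V: "ideal ?V (poly_ring N)"
    unfolding vanishing_ideal_def by (rule ring.genideal_ideal[OF ring_poly_ring S])
  have "?V \<subseteq> ?W"
    unfolding vanishing_ideal_def
    by (rule ring.genideal_minimal[OF ring_poly_ring W]) (auto intro: forms_polys)
  moreover have "?W \<subseteq> ?V"
  proof
    fix f assume f: "f \<in> ?W"
    have "hcomp n f \<in> ?V" for n
    proof -
      have "mpoly_eval x (hcomp n f) = 0" if x: "x \<in> star_config N e s F" for x
      proof (rule hcomp_zeros[OF inf, of f N])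
        fix t :: 'k assume "t \<noteq> 0"
        then have "(\<lambda>i. t * x i) \<in> star_config N e s F" using star_config_scale[OF e F _ x] by blast
        then show "mpoly_eval (\<lambda>i. t * x i) f = 0" using f by blast
      qed (use f in auto)
      moreover have "hcomp n f \<in> forms N n" using f by simp
      ultimately have "hcomp n f \<in> ?S" by blast
      then show ?thesis unfolding vanishing_ideal_def using ring.genideal_self[OF ring_poly_ring S] by blast
    qed
    then show "f \<in> ?V" by (subst sum_hcomp[of f]) (rule ideal_sum_closed[OF V])
  qed
  ultimately show "?V = ?W" by blast
qed

lemma star_ideal_in_form_ideal:
  assumes inf: "infinite (UNIV :: 'k::field set)" and e: "0 < e"
    and T: "T \<subseteq> {1..s}" "card T = e" and det: "detects_ideal N s F T"
    and F: "\<And>i. i \<in> {1..s} \<Longrightarrow> F i \<in> forms N (d i)"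
    and f: "f \<in> polys N" "\<And>x. x \<in> star_config N e s F \<Longrightarrow> mpoly_eval x f = 0"
  shows "(f :: (nat, 'k) mpoly) \<in> form_ideal N F T"
proof -
  have "mpoly_eval x f = 0" if x: "x 0 \<noteq> 0" "\<forall>i\<in>T. mpoly_eval x (F i) = 0" for x
  proof -
    \<comment> \<open>Coordinates beyond N are cut off because \<open>proj_space\<close> prescribes
      0 there; elements of \<open>polys N\<close> do not see the difference.\<close>
    define x' where "x' i = (if i \<le> N then x i else 0)" for i
    have ev: "mpoly_eval x' g = mpoly_eval x g" if "g \<in> polys N" for g :: "(nat, 'k) mpoly"
      using that by (rule eval_cong) (simp add: x'_def)
    have "x' \<in> proj_space N" using x(1) by (auto simp: proj_space_def x'_def)
    moreover have "mpoly_eval x' (F i) = 0" if "i \<in> T" for i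
      using x(2) that ev[OF forms_polys[OF F]] T(1) by auto
    ultimately have "x' \<in> star_config N e s F" using T by (auto simp: star_config_iff[OF e])
    then show ?thesis using f(2) ev[OF f(1)] by simp
  qed
  then show ?thesis using det f(1) unfolding detects_ideal_def by blast
qed

lemma form_ideal_hcomp:
  assumes "\<And>i. i \<in> T \<Longrightarrow> F i \<in> forms N (d i)" "f \<in> form_ideal N F T"
  shows "hcomp n f \<in> form_ideal N F T"
proof -
  obtain h where h: "f = (\<Sum>i\<in>T. F i * h i)" "\<forall>i\<in>T. h i \<in> polys N"
    using assms(2) unfolding form_ideal_def by blast
  have "hcomp n f = (\<Sum>i\<in>T. F i * (if d i \<le> n then hcomp (n - d i) (h i) else 0))"
    unfolding h(1) hcomp_sum
    by (intro sum.cong refl, subst hcomp_mult_form[OF assms(1)]) (use h(2) in auto)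
  then show ?thesis using h(2) by (auto intro!: form_idealI hcomp_polys)
qed

text \<open>The F_i with i outside T are nonzero at all detecting points, so their product is a
  nonzerodivisor modulo the ideal.\<close>

lemma detects_ideal_cancel:
  assumes det: "detects_ideal N s F T" and A: "finite A" "A \<subseteq> {1..s} - T"
    and g: "g \<in> polys N" "(\<Prod>i\<in>A. F i) * g \<in> form_ideal N F T"
  shows "g \<in> form_ideal N F T"
proof -
  have "mpoly_eval x g = 0"
    if x: "\<forall>i\<in>T. mpoly_eval x (F i) = 0" "\<forall>j\<in>{1..s} - T. mpoly_eval x (F j) \<noteq> 0" for x
  proof -
    have "mpoly_eval x ((\<Prod>i\<in>A. F i) * g) = 0" using form_ideal_eval[OF g(2)] x(1) by blast
    moreover have "(\<Prod>i\<in>A. mpoly_eval x (F i)) \<noteq> 0" using A x(2) by (auto simp: prod_zero_iff)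
    ultimately show ?thesis by simp
  qed
  then show ?thesis using det g(1) unfolding detects_ideal_def by blast
qed

text \<open>A form in the ideals of all \<open>F\<^sub>i, i \<in> T \<union> {j}\<close>, is a multiple of the product of the
  \<open>F\<^sub>j\<close> modulo the ideal of \<open>F\<^sub>i, i \<in> T\<close>, hence lies in the latter for degree reasons.\<close>

lemma low_degree_form_in_smaller_ideal:
  fixes F :: "nat \<Rightarrow> (nat, 'k::field) mpoly"
  assumes F: "\<And>i. i \<in> {1..s} \<Longrightarrow> F i \<in> forms N (d i)"
    and T: "T \<subseteq> {1..s}" and det: "\<And>j. j \<in> {1..s} - T \<Longrightarrow> detects_ideal N s F (insert j T)"
    and f: "f \<in> forms N n" "\<And>j. j \<in> {1..s} - T \<Longrightarrow> f \<in> form_ideal N F (insert j T)"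
    and n: "n < (\<Sum>j\<in>{1..s} - T. d j)"
  shows "f \<in> form_ideal N F T"
proof -
  have finT: "finite T" using T finite_subset by blast
  have FT: "F i \<in> polys N" if "i \<in> {1..s}" for i using F[OF that] by (rule forms_polys)
  have "\<exists>g\<in>polys N. f - (\<Prod>i\<in>A. F i) * g \<in> form_ideal N F T" if "finite A" "A \<subseteq> {1..s} - T" for A
    using that
  proof (induction A rule: finite_induct)
    case empty
    show ?case by (intro bexI[of _ f]) (use f forms_polys in \<open>auto simp: form_ideal_0\<close>)
  next
    case (insert j A)
    then obtain g where g: "g \<in> polys N" "f - (\<Prod>i\<in>A. F i) * g \<in> form_ideal N F T" by auto
    have j: "j \<in> {1..s} - T" and jT: "j \<notin> T" using insert.prems by auto
    have mono: "h \<in> form_ideal N F (insert j T)" if h: "h \<in> form_ideal N F T" for h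
    proof -
      obtain k where k: "h = (\<Sum>i\<in>T. F i * k i)" "\<forall>i\<in>T. k i \<in> polys N"
        using h unfolding form_ideal_def by blast
      have "(\<Sum>i\<in>insert j T. F i * (if i = j then 0 else k i)) = h"
        using finT jT unfolding k(1) by (subst sum.insert) (auto intro!: sum.cong)
      moreover have "(\<Sum>i\<in>insert j T. F i * (if i = j then 0 else k i)) \<in> form_ideal N F (insert j T)"
        by (rule form_idealI) (use k(2) in auto)
      ultimately show ?thesis by simp
    qed
    \<comment> \<open>f lies in the ideal of \<open>insert j T\<close>, hence so does the product
      times g. Cancelling the product leaves g = F_j k_j modulo (F_i, i in T), which adds the factor
      F_j.\<close>
    have "f + (- 1) * (f - (\<Prod>i\<in>A. F i) * g) \<in> form_ideal N F (insert j T)"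
      using form_ideal_mult[OF mono[OF g(2)], of "-1"] by (intro form_ideal_add f(2) j) (simp add: algebra_simps)
    then have "(\<Prod>i\<in>A. F i) * g \<in> form_ideal N F (insert j T)" by simp
    then have "g \<in> form_ideal N F (insert j T)"
      using insert by (intro detects_ideal_cancel[OF det[OF j] _ _ g(1)]) auto
    then obtain k where k: "g = (\<Sum>i\<in>insert j T. F i * k i)" "\<forall>i\<in>insert j T. k i \<in> polys N"
      unfolding form_ideal_def by blast
    then have g_eq: "g = F j * k j + (\<Sum>i\<in>T. F i * k i)" using finT jT by simp
    have "(\<Sum>i\<in>T. F i * k i) * (\<Prod>i\<in>A. F i) \<in> form_ideal N F T"
      using k(2) insert.prems by (intro form_ideal_mult form_idealI polys_prod FT) auto
    then have "(f - (\<Prod>i\<in>A. F i) * g) + (\<Sum>i\<in>T. F i * k i) * (\<Prod>i\<in>A. F i) \<in> form_ideal N F T"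
      by (intro form_ideal_add g(2))
    also have "(f - (\<Prod>i\<in>A. F i) * g) + (\<Sum>i\<in>T. F i * k i) * (\<Prod>i\<in>A. F i)
        = f - (\<Prod>i\<in>insert j A. F i) * k j"
      using insert.hyps by (simp add: g_eq algebra_simps)
    finally show ?case using k(2) by (intro bexI[of _ "k j"]) auto
  qed
  from this[of "{1..s} - T"] obtain g where g: "g \<in> polys N"
    "f - (\<Prod>i\<in>{1..s} - T. F i) * g \<in> form_ideal N F T" by auto
  \<comment> \<open>The full product has degree above n, so its multiple disappears in the component
    of degree n.\<close>
  have "(\<Prod>i\<in>{1..s} - T. F i) \<in> forms N (\<Sum>j\<in>{1..s} - T. d j)" using F by (intro forms_prod) auto
  then have "hcomp n ((\<Prod>i\<in>{1..s} - T. F i) * g) = 0"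
    using n by (subst hcomp_mult_form[OF _ g(1)]) auto
  moreover have "hcomp n (f - (\<Prod>i\<in>{1..s} - T. F i) * g) = hcomp n f - hcomp n ((\<Prod>i\<in>{1..s} - T. F i) * g)"
    using hcomp_add[of n "f - (\<Prod>i\<in>{1..s} - T. F i) * g" "(\<Prod>i\<in>{1..s} - T. F i) * g"] by simp
  ultimately have "hcomp n (f - (\<Prod>i\<in>{1..s} - T. F i) * g) = f"
    using hcomp_form[OF f(1), of n] by simp
  moreover have "F i \<in> forms N (d i)" if "i \<in> T" for i using that T by (intro F) blast
  ultimately show ?thesis using form_ideal_hcomp[OF _ g(2), of d n] by simp
qed

text \<open>A set of at least m + 1 positive indices has a maximum of at least m + 1, so
  monotonicity pairs it with d (m + 1); the rest is induction.\<close>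

lemma sum_smallest_le:
  fixes d :: "nat \<Rightarrow> nat"
  assumes d: "mono_on {1..s} d" and C: "C \<subseteq> {1..s}" "m \<le> card C"
  shows "(\<Sum>i = 1..m. d i) \<le> (\<Sum>j\<in>C. d j)"
  using C
proof (induction m arbitrary: C)
  case (Suc m)
  have fin: "finite C" using Suc.prems(1) finite_subset by blast
  have ne: "C \<noteq> {}" using Suc.prems by auto
  define c where "c = Max C"
  have c: "c \<in> C" using fin ne by (simp add: c_def)
  have "C \<subseteq> {1..c}" using Suc.prems(1) fin by (auto simp: c_def)
  then have "card C \<le> card {1..c}" by (intro card_mono) auto
  then have "Suc m \<le> c" using Suc.prems(2) by simp
  then have "d (Suc m) \<le> d c"
    using c Suc.prems(1) by (intro mono_onD[OF d]) auto
  moreover have "(\<Sum>i = 1..m. d i) \<le> (\<Sum>j\<in>C - {c}. d j)"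
    using Suc.prems fin c by (intro Suc.IH) auto
  ultimately show ?case using fin c by (simp add: sum.remove[of C c])
qed simp

text \<open>Descending induction on the size of T, from e to 0: the complement of a set of fewer
  than e indices has at least s - e + 1 elements, so the degree hypothesis of
  \<open>low_degree_form_in_smaller_ideal\<close> holds each time. For empty T the ideal is
  0.\<close>

lemma low_degree_star_form_zero:
  fixes F :: "nat \<Rightarrow> (nat, 'k::field) mpoly"
  assumes F: "\<And>i. i \<in> {1..s} \<Longrightarrow> F i \<in> forms N (d i)" and d: "mono_on {1..s} d" and e: "e \<le> s"
    and det: "\<And>T. T \<subseteq> {1..s} \<Longrightarrow> card T \<le> e \<Longrightarrow> detects_ideal N s F T"
    and f: "f \<in> forms N n" "\<And>T. T \<subseteq> {1..s} \<Longrightarrow> card T = e \<Longrightarrow> f \<in> form_ideal N F T"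
    and n: "n < (\<Sum>i = 1..s - e + 1. d i)"
  shows "f = 0"
proof -
  have "f \<in> form_ideal N F T" if "T \<subseteq> {1..s}" "card T = e - k" "k \<le> e" for k T
    using that
  proof (induction k arbitrary: T)
    case 0
    then show ?case using f by simp
  next
    case (Suc k)
    have finT: "finite T" using Suc.prems finite_subset by blast
    have ins: "insert j T \<subseteq> {1..s}" "card (insert j T) = e - k" if "j \<in> {1..s} - T" for j
      using that Suc.prems finT by auto
    show ?case
    proof (rule low_degree_form_in_smaller_ideal[OF F Suc.prems(1) _ f(1)])
      show "detects_ideal N s F (insert j T)" if "j \<in> {1..s} - T" for j
        using ins[OF that] by (intro det) auto
      show "f \<in> form_ideal N F (insert j T)" if "j \<in> {1..s} - T" for j
        using ins[OF that] Suc.prems by (intro Suc.IH) auto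
      have "card ({1..s} - T) = s - card T" using Suc.prems(1) finT by (simp add: card_Diff_subset)
      then have "(\<Sum>i = 1..s - e + 1. d i) \<le> (\<Sum>j\<in>{1..s} - T. d j)"
        using Suc.prems e by (intro sum_smallest_le[OF d]) auto
      then show "n < (\<Sum>j\<in>{1..s} - T. d j)" using n by simp
    qed
  qed
  from this[of "{}" e] show ?thesis by (simp add: form_ideal_def)
qed


section \<open>The lower bound for the resurgence\<close>

text \<open>A nonzerodivisor a lies in no associated prime: if a annihilated the class of g, then g
  would be in I and the prime would be the whole ring. So a becomes a unit in the localization, and
  f = (1/a) (a f).\<close>

lemma symbolic_powerI:
  assumes I: "ideal I (poly_ring N)" and f: "f \<in> polys N" and a: "a \<in> polys N" "a \<noteq> 0"
    and nzd: "\<And>g. g \<in> polys N \<Longrightarrow> a * g \<in> I \<Longrightarrow> g \<in> I"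
    and af: "a * f \<in> ideal_power N I m"
  shows "f \<in> symbolic_power (poly_ring N) I m"
proof -
  define A where "A = carrier (poly_ring N) - \<Union> (associated_primes (poly_ring N) I)"
  define RA where "RA = localization (poly_ring N) A"
  have "a \<in> A"
  proof -
    have False if P: "primeideal P (poly_ring N)" and g: "g \<in> polys N"
      "P = {h \<in> polys N. h \<otimes>\<^bsub>poly_ring N\<^esub> g \<in> I}" "a \<in> P" for P g
    proof -
      have "a * g \<in> I" using g by simp
      then have "g \<in> I" using nzd g(1) by blast
      then have "P = polys N" using g(2) ideal_closed(4)[OF I] by auto
      then show False using primeideal.I_notcarr[OF P] by simp
    qed
    then show ?thesis using a(1) unfolding A_def associated_primes_def by blast
  qed
  have ops: "x \<otimes>\<^bsub>RA\<^esub> y = x * y" for x y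
    by (simp add: RA_def localization_def ring_of_type_algebra_def)
  have carrier: "carrier RA = {Fract f a | f a. f \<in> polys N \<and> a \<in> A}"
    by (simp add: RA_def localization_def)
  have "Fract f 1 \<in> genideal RA ((\<lambda>g. Fract g 1) ` ideal_power N I m)"
    unfolding genideal_def
  proof (intro InterI)
    fix J assume "J \<in> {J. ideal J RA \<and> (\<lambda>g. Fract g 1) ` ideal_power N I m \<subseteq> J}"
    then have J: "ideal J RA" "(\<lambda>g. Fract g 1) ` ideal_power N I m \<subseteq> J" by auto
    have "Fract (a * f) 1 \<in> J" using J(2) af by auto
    moreover have "Fract 1 a \<in> carrier RA" using \<open>a \<in> A\<close> unfolding carrier
      by (intro CollectI exI[of _ 1] exI[of _ a]) simp
    ultimately have "Fract 1 a * Fract (a * f) 1 \<in> J"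
      using ideal.I_l_closed[OF J(1)] by (fastforce simp: ops)
    also have "Fract 1 a * Fract (a * f) 1 = Fract f 1"
      using a(2) by (simp add: eq_fract)
    finally show "Fract f 1 \<in> J" .
  qed
  then show ?thesis
    using f unfolding symbolic_power_def Let_def RA_def A_def by simp
qed

text \<open>g^t has degree t D, so it is outside I^r once t D < r \<alpha>. For the largest such t
  the quotient t e / r tends to e \<alpha> / D as r grows.\<close>

lemma resurgence_lower_bound:
  fixes F :: "nat \<Rightarrow> (nat, 'k::field) mpoly"
  assumes I: "I \<subseteq> low_order N \<alpha>" and D: "0 < D" and al: "0 < \<alpha>" and e: "0 < e"
    and g: "g \<in> forms N D" "g \<noteq> 0"
    and sym: "\<And>t. 0 < t \<Longrightarrow> g ^ t \<in> symbolic_power (poly_ring N) I (t * e)"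
  shows "ereal (real e * real \<alpha> / real D) \<le> resurgence (poly_ring N) I"
proof (rule ccontr)
  let ?S = "{ereal (real m / real r) | m r. 1 \<le> m \<and> 1 \<le> r \<and>
    \<not> symbolic_power (poly_ring N) I m \<subseteq> ideal_power N I r}"
  assume "\<not> ereal (real e * real \<alpha> / real D) \<le> resurgence (poly_ring N) I"
  then have "Sup ?S < ereal (real e * real \<alpha> / real D)"
    unfolding resurgence_def by (simp add: not_le)
  then obtain y where y: "Sup ?S < ereal y" "ereal y < ereal (real e * real \<alpha> / real D)"
    using ereal_dense2 by blast
  define x where "x = real e * real \<alpha> / real D"
  have xy: "y < x" using y(2) by (simp add: x_def)
  \<comment> \<open>Rounding t costs at most e / r in the quotient; r0 brings this below x - y. The
    summand D + 1 in r makes r \<alpha> exceed D, so that t is positive.\<close>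
  obtain r0 where r0: "real e / (x - y) < real r0" using reals_Archimedean2 by blast
  define r where "r = r0 + D + 1"
  define t where "t = (r * \<alpha> - 1) div D"
  have "D \<le> r * \<alpha> - 1"
  proof -
    have "r \<le> r * \<alpha>" using al by simp
    then show ?thesis by (simp add: r_def)
  qed
  then have t: "0 < t" using D by (simp add: t_def div_greater_zero_iff)
  have "t * D \<le> r * \<alpha> - 1" by (simp add: t_def)
  moreover have "0 < r * \<alpha>" using al by (simp add: r_def)
  ultimately have tD: "t * D < r * \<alpha>" by linarith
  have "r * \<alpha> - 1 < (t + 1) * D"
    unfolding t_def using D by (metis add.commute dividend_less_div_times mult.commute mult_Suc_right plus_1_eq_Suc)
  then have "r * \<alpha> \<le> (t + 1) * D" by linarith
  then have ra: "real r * real \<alpha> \<le> (real t + 1) * real D"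
    by (metis of_nat_1 of_nat_add of_nat_le_iff of_nat_mult)
  have "real r * x = real e * (real r * real \<alpha>) / real D" by (simp add: x_def)
  also have "\<dots> \<le> real e * ((real t + 1) * real D) / real D"
    by (intro divide_right_mono mult_left_mono ra) auto
  finally have "real r * x \<le> real e * (real t + 1)" using D by simp
  moreover have "real e < (x - y) * real r"
  proof -
    have "real e < (x - y) * real r0" using r0 xy by (simp add: field_simps)
    also have "\<dots> \<le> (x - y) * real r" using xy by (intro mult_left_mono) (auto simp: r_def)
    finally show ?thesis .
  qed
  ultimately have "y * real r < real e * real t" by (simp add: algebra_simps)
  moreover have r: "0 < r" by (simp add: r_def)
  ultimately have yt: "y < real (t * e) / real r" by (simp add: field_simps)
  have "g ^ t \<notin> ideal_power N I r"
  proof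
    assume "g ^ t \<in> ideal_power N I r"
    then have low: "g ^ t \<in> low_order N (r * \<alpha>)" using ideal_power_low_order[OF I] by blast
    have "g ^ t \<noteq> 0" using g(2) by simp
    then obtain \<mu> where mu: "\<mu> \<in> keys (g ^ t)" by (metis keys_eq_empty ex_in_conv)
    have "tdeg \<mu> = t * D" using forms_power[OF g(1), of t] mu by (simp add: forms_iff)
    then show False using low mu tD by (auto simp: low_order_def)
  qed
  then have "\<not> symbolic_power (poly_ring N) I (t * e) \<subseteq> ideal_power N I r" using sym[OF t] by blast
  moreover have "1 \<le> t * e" "1 \<le> r" using t e r by auto
  ultimately have "ereal (real (t * e) / real r) \<in> ?S" by blast
  then have "ereal (real (t * e) / real r) \<le> Sup ?S" by (rule Sup_upper)
  then have "ereal (real (t * e) / real r) < ereal y" using y(1) by (rule le_less_trans)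
  then show False using yt by simp
qed

text \<open>The product of all \<open>F\<^sub>j\<close> vanishes to order \<open>e\<close> along the star configuration; the element
  \<open>a\<close> below is a nonzerodivisor modulo its ideal, as only one summand survives on each component.\<close>

theorem star_resurgence_lower_bound:
  fixes F :: "nat \<Rightarrow> (nat, 'k::field) mpoly"
  assumes inf: "infinite (UNIV :: 'k set)" and e: "0 < e" "e \<le> s"
    and d: "mono_on {1..s} d" "\<And>i. i \<in> {1..s} \<Longrightarrow> 0 < d i"
    and F: "\<And>i. i \<in> {1..s} \<Longrightarrow> F i \<in> forms N (d i)" "\<And>i. i \<in> {1..s} \<Longrightarrow> F i \<noteq> 0"
    and det: "\<And>T. T \<subseteq> {1..s} \<Longrightarrow> card T \<le> e \<Longrightarrow> detects_ideal N s F T"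
  shows "ereal (real e * real (\<Sum>i = 1..s - e + 1. d i) / real (\<Sum>i = 1..s. d i))
    \<le> proj_resurgence N (star_config N e s F)"
proof -
  define I where "I = vanishing_ideal N (star_config N e s F)"
  define \<alpha> where "\<alpha> = (\<Sum>i = 1..s - e + 1. d i)"
  have Ieq: "I = {f \<in> polys N. \<forall>x\<in>star_config N e s F. mpoly_eval x f = 0}"
    and I: "ideal I (poly_ring N)"
    unfolding I_def by (rule vanishing_ideal_iff[OF inf e(1) F(1)], assumption)+
  have FT: "F i \<in> polys N" if "i \<in> {1..s}" for i using F(1)[OF that] by (rule forms_polys)
  have I_form: "f \<in> form_ideal N F T" if f: "f \<in> I" and T: "T \<subseteq> {1..s}" "card T = e" for f T
    using f T by (intro star_ideal_in_form_ideal[OF inf e(1) T det F(1)]) (auto simp: Ieq)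
  have in_I: "f \<in> I" if "f \<in> polys N"
    "\<And>x T. T \<subseteq> {1..s} \<Longrightarrow> card T = e \<Longrightarrow> (\<forall>i\<in>T. mpoly_eval x (F i) = 0) \<Longrightarrow> mpoly_eval x f = 0" for f
  proof -
    have "mpoly_eval x f = 0" if "x \<in> star_config N e s F" for x
    proof -
      obtain T where "T \<subseteq> {1..s}" "card T = e" "\<forall>i\<in>T. mpoly_eval x (F i) = 0"
        using \<open>x \<in> star_config N e s F\<close> unfolding star_config_iff[OF e(1)] by blast
      then show ?thesis by (rule \<open>\<And>x T. T \<subseteq> {1..s} \<Longrightarrow> card T = e \<Longrightarrow> \<forall>i\<in>T. mpoly_eval x (F i) = 0 \<Longrightarrow> mpoly_eval x f = 0\<close>)
    qed
    then show ?thesis using that(1) unfolding Ieq by simp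
  qed
  have I_low: "I \<subseteq> low_order N \<alpha>"
  proof
    fix f assume f: "f \<in> I"
    then have fp: "f \<in> polys N" by (simp add: Ieq)
    have "hcomp n f = 0" if n: "n < \<alpha>" for n
    proof (rule low_degree_star_form_zero[OF F(1) d(1) e(2) det hcomp_forms[OF fp]])
      show "hcomp n f \<in> form_ideal N F T" if T: "T \<subseteq> {1..s}" "card T = e" for T
        by (rule form_ideal_hcomp[where d = d, OF _ I_form[OF f T]]) (use F(1) T(1) in auto)
    qed (use n in \<open>auto simp: \<alpha>_def\<close>)
    then have "\<alpha> \<le> tdeg \<mu>" if "\<mu> \<in> keys f" for \<mu>
      using that lookup_hcomp[of "tdeg \<mu>" f \<mu>] by (metis in_keys_iff lookup_zero not_le)
    then show "f \<in> low_order N \<alpha>" using fp by (simp add: low_order_def)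
  qed
  define g where "g = (\<Prod>i\<in>{1..s}. F i)"
  define S where "S = {T. T \<subseteq> {1..s} \<and> card T = e}"
  have finS: "finite S" unfolding S_def by (rule finite_subset[of _ "Pow {1..s}"]) auto
  \<comment> \<open>\<open>c T\<close> vanishes on every component other than that of T, since no
    other set of e indices is contained in T.\<close>
  define c where "c T = (\<Prod>j\<in>{1..s} - T. F j)" for T
  have c_polys: "c T \<in> polys N" for T unfolding c_def by (intro polys_prod FT) auto
  have c_zero: "mpoly_eval x (c T') = 0"
    if "T \<in> S" "T' \<in> S" "T' \<noteq> T" "\<forall>i\<in>T. mpoly_eval x (F i) = 0" for x T T'
  proof -
    have "\<not> T \<subseteq> T'"
    proof
      assume "T \<subseteq> T'"
      moreover have "finite T'" using that(2) finite_subset by (auto simp: S_def)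
      ultimately have "T = T'" using that(1,2) by (intro card_subset_eq) (auto simp: S_def)
      then show False using that(3) by simp
    qed
    moreover have "T \<subseteq> {1..s}" using that(1) by (simp add: S_def)
    ultimately obtain j where "j \<in> T" "j \<in> {1..s} - T'" by blast
    then show ?thesis using that(4) by (auto simp: c_def intro!: prod_zero)
  qed
  have "g ^ t \<in> symbolic_power (poly_ring N) I (t * e)" if t: "0 < t" for t
  proof -
    \<comment> \<open>The exponent t e supplies, for each of the t factors g, one factor
      \<open>c T\<close> for every F_i with i in T.\<close>
    define a where "a = (\<Sum>T\<in>S. c T ^ (t * e))"
    have M: "0 < t * e" using t e by simp
    have a_polys: "a \<in> polys N" unfolding a_def by (intro polys_sum polys_power c_polys)
    have a_eval: "mpoly_eval x a = mpoly_eval x (c T) ^ (t * e)"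
      if T: "T \<in> S" "\<forall>i\<in>T. mpoly_eval x (F i) = 0" for x T
    proof -
      have "mpoly_eval x a = (\<Sum>T'\<in>S. if T' = T then mpoly_eval x (c T) ^ (t * e) else 0)"
        unfolding a_def eval_sum eval_power
        by (intro sum.cong refl) (use c_zero[OF T(1) _ _ T(2)] M in auto)
      then show ?thesis using T finS by (simp add: sum.delta)
    qed
    have nzd: "h \<in> I" if h: "h \<in> polys N" "a * h \<in> I" for h
    proof -
      have "h \<in> form_ideal N F T" if T: "T \<in> S" for T
      proof -
        have "mpoly_eval x h = 0"
          if x: "\<forall>i\<in>T. mpoly_eval x (F i) = 0" "\<forall>j\<in>{1..s} - T. mpoly_eval x (F j) \<noteq> 0" for x
        proof -
          have "a * h \<in> form_ideal N F T" using I_form[OF h(2)] T by (simp add: S_def)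
          then have "mpoly_eval x (a * h) = 0" using form_ideal_eval x(1) by blast
          moreover have "mpoly_eval x (c T) \<noteq> 0" using x(2) by (simp add: c_def prod_zero_iff)
          ultimately show ?thesis using a_eval[OF T x(1)] by simp
        qed
        moreover have "detects_ideal N s F T" using T by (intro det) (auto simp: S_def)
        ultimately show ?thesis using h(1) unfolding detects_ideal_def by blast
      qed
      then have hT: "h \<in> form_ideal N F T" if "T \<subseteq> {1..s}" "card T = e" for T
        using that by (simp add: S_def)
      show ?thesis
      proof (rule in_I[OF h(1)])
        fix x T assume T: "T \<subseteq> {1..s}" "card T = e" "\<forall>i\<in>T. mpoly_eval x (F i) = 0"
        show "mpoly_eval x h = 0" by (rule form_ideal_eval[OF hT[OF T(1,2)]]) (use T(3) in blast)
      qed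
    qed
    have "1 \<notin> I"
    proof
      assume "1 \<in> I"
      then have "(1 :: (nat, 'k) mpoly) \<in> low_order N \<alpha>" using I_low by blast
      moreover have "0 < \<alpha>" using d(2) e by (auto simp: \<alpha>_def intro!: sum_pos)
      ultimately show False by (auto simp: low_order_def)
    qed
    then have a0: "a \<noteq> 0" using nzd[of 1] ideal_closed(2)[OF I] by auto
    have "a * g ^ t = (\<Sum>T\<in>S. c T ^ t * (\<Prod>i\<in>T. F i * c T) ^ t)"
      unfolding a_def sum_distrib_right
    proof (intro sum.cong refl)
      fix T assume "T \<in> S"
      then have T: "T \<subseteq> {1..s}" "card T = e" by (auto simp: S_def)
      have "g = (\<Prod>i\<in>T. F i) * c T"
        unfolding g_def c_def using T(1) by (subst prod.subset_diff[of T]) (auto simp: mult.commute)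
      moreover have "(\<Prod>i\<in>T. F i * c T) = (\<Prod>i\<in>T. F i) * c T ^ e"
        using T(2) by (simp add: prod.distrib)
      ultimately show "c T ^ (t * e) * g ^ t = c T ^ t * (\<Prod>i\<in>T. F i * c T) ^ t"
        by (simp add: power_mult_distrib power_mult[symmetric] mult.commute mult.left_commute)
    qed
    also have "\<dots> \<in> ideal_power N I (t * e)"
    proof (intro ideal_sum_closed[OF ideal_power_ideal[OF I]] ideal_closed(4)[OF ideal_power_ideal[OF I]])
      fix T assume TS: "T \<in> S"
      then have T: "T \<subseteq> {1..s}" "card T = e" by (auto simp: S_def)
      \<comment> \<open>F_i vanishes on the component of T, and \<open>c T\<close> on all the
        others.\<close>
      have "F i * c T \<in> I" if i: "i \<in> T" for i
      proof (rule in_I)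
        show "F i * c T \<in> polys N" using i T by (intro polys_mult FT c_polys) auto
        fix x T' assume T': "T' \<subseteq> {1..s}" "card T' = e" "\<forall>i\<in>T'. mpoly_eval x (F i) = 0"
        show "mpoly_eval x (F i * c T) = 0"
          using c_zero[of T' T x] T' TS i by (cases "T' = T") (auto simp: S_def)
      qed
      moreover have "finite T" using T finite_subset by blast
      ultimately have "(\<Prod>i\<in>T. F i * c T) \<in> ideal_power N I (card T)"
        by (intro ideal_power_prod[OF I]) auto
      then have "(\<Prod>i\<in>T. F i * c T) \<in> ideal_power N I e" using T(2) by simp
      then show "(\<Prod>i\<in>T. F i * c T) ^ t \<in> ideal_power N I (t * e)" by (rule ideal_power_power[OF I])
    qed (intro polys_power c_polys)
    finally have "a * g ^ t \<in> ideal_power N I (t * e)" .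
    moreover have "g ^ t \<in> polys N" unfolding g_def by (intro polys_power polys_prod FT)
    ultimately show ?thesis using nzd by (intro symbolic_powerI[OF I _ a_polys a0]) auto
  qed
  moreover have "g \<in> forms N (\<Sum>i = 1..s. d i)" unfolding g_def by (intro forms_prod F(1))
  moreover have "g \<noteq> 0" using F(2) by (simp add: g_def prod_zero_iff)
  moreover have "0 < (\<Sum>i = 1..s. d i)" using d(2) e by (intro sum_pos) auto
  moreover have "0 < \<alpha>" using d(2) e by (auto simp: \<alpha>_def intro!: sum_pos)
  ultimately show ?thesis
    unfolding proj_resurgence_def I_def[symmetric] \<alpha>_def[symmetric]
    by (intro resurgence_lower_bound[OF I_low _ _ e(1), of _ g]) auto
qed

theorem general_star_resurgence_lower_bound:
  fixes d :: "nat \<Rightarrow> nat"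
  assumes e: "1 \<le> e" "e \<le> N" "e \<le> s" and d: "\<And>i. i \<in> {1..s} \<Longrightarrow> 0 < d i" "mono_on {1..s} d"
  shows "for_general N s d (\<lambda>F :: nat \<Rightarrow> (nat, 'k::alg_closed_field) mpoly.
    ereal (real e * real (\<Sum>i = 1..s - e + 1. d i) / real (\<Sum>i = 1..s. d i))
      \<le> proj_resurgence N (star_config N e s F))"
proof -
  define A where "A = {T. T \<subseteq> {1..s} \<and> card T \<le> e}"
  have "finite A" unfolding A_def by (rule finite_subset[of _ "Pow {1..s}"]) auto
  moreover have "A \<noteq> {}" unfolding A_def by (auto intro: exI[of _ "{}"])
  ultimately have "for_general N s d (\<lambda>F :: nat \<Rightarrow> (nat, 'k) mpoly. \<forall>T\<in>A. detects_ideal N s F T)"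
    using e d(1) by (intro for_general_ball infinite_UNIV_alg_closed general_detects_ideal) (auto simp: A_def)
  then show ?thesis
  proof (rule for_general_mono)
    fix F :: "nat \<Rightarrow> (nat, 'k) mpoly"
    assume F: "F \<in> hypersurface_tuples N s d" "\<forall>T\<in>A. detects_ideal N s F T"
    show "ereal (real e * real (\<Sum>i = 1..s - e + 1. d i) / real (\<Sum>i = 1..s. d i))
        \<le> proj_resurgence N (star_config N e s F)"
      by (rule star_resurgence_lower_bound[OF infinite_UNIV_alg_closed _ e(3) d(2,1)])
        (use e F hypersurface_tuples_form[OF F(1)] in \<open>auto simp: A_def\<close>)
  qed
qed


section \<open>Orders of vanishing at the points cut out by hyperplanes in general position\<close>

section \<open>Orders of vanishing along lines\<close>

text \<open>Such a polynomial exists by \<open>eval_line\<close>. Over an infinite field it is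
  unique, so all computations go through values and \<open>poly_ext\<close>.\<close>

definition line_poly :: "(nat, 'k::field) mpoly \<Rightarrow> (nat \<Rightarrow> 'k) \<Rightarrow> (nat \<Rightarrow> 'k) \<Rightarrow> 'k poly" where
  "line_poly f p v = (SOME P. \<forall>t. mpoly_eval (\<lambda>i. p i + t * v i) f = poly P t)"

lemma poly_line_poly [simp]: "poly (line_poly f p v) t = mpoly_eval (\<lambda>i. p i + t * v i) f"
  unfolding line_poly_def by (rule sym, rule spec[OF someI_ex[OF eval_line]])

lemma poly_ext:
  fixes P Q :: "'k::idom poly"
  assumes "infinite (UNIV :: 'k set)" "\<And>t. poly P t = poly Q t"
  shows "P = Q"
  using poly_eq_0_if_zeros[of "P - Q"] assms by simp

text \<open>Closure under x + t v covers sums and, with x = 0, multiples; so these are the linear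
  subspaces.\<close>

definition vspace :: "(nat \<Rightarrow> 'k::field) set \<Rightarrow> bool" where
  "vspace V \<longleftrightarrow> (\<lambda>_. 0) \<in> V \<and> (\<forall>x\<in>V. \<forall>v\<in>V. \<forall>t. (\<lambda>i. x i + t * v i) \<in> V)"

lemma vspaceD: "vspace V \<Longrightarrow> x \<in> V \<Longrightarrow> v \<in> V \<Longrightarrow> (\<lambda>i. x i + t * v i) \<in> V"
  unfolding vspace_def by blast

lemma eval_linear:
  assumes "f \<in> forms N 1"
  shows "mpoly_eval (\<lambda>i. x i + t * y i) f = mpoly_eval x f + t * mpoly_eval y f"
proof -
  \<comment> \<open>Degree 0 is included because the induction for linear forms passes through
    constants.\<close>
  have "n \<le> 1 \<longrightarrow> mpoly_eval (\<lambda>i. x i + t * y i) f = mpoly_eval x f + (if n = 1 then t * mpoly_eval y f else 0)"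
    if "f \<in> forms N n" for f n
    using that
  proof (induction rule: forms_induct)
    case (var n i p)
    show ?case
    proof
      assume "Suc n \<le> 1"
      then have n: "n = 0" by simp
      have "mpoly_eval (\<lambda>i. x i + t * y i) p = mpoly_eval x p" using var.IH n by simp
      moreover have "mpoly_eval x p = mpoly_eval y p"
        using eval_forms_scale[OF var(2), of 0 x] eval_forms_scale[OF var(2), of 0 y] n by simp
      ultimately show "mpoly_eval (\<lambda>i. x i + t * y i) (var i * p)
          = mpoly_eval x (var i * p) + (if Suc n = 1 then t * mpoly_eval y (var i * p) else 0)"
        using n by (simp add: algebra_simps)
    qed
  qed (auto simp: algebra_simps)
  from this[OF assms] show ?thesis by simp
qed

text \<open>The order at p is measured on the lines through p with directions in V. Unlike partial
  derivatives, this works in every characteristic, and it restricts to subspaces.\<close>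

definition ord_at :: "(nat \<Rightarrow> 'k::field) set \<Rightarrow> nat \<Rightarrow> (nat, 'k) mpoly \<Rightarrow> (nat \<Rightarrow> 'k) \<Rightarrow> bool" where
  "ord_at V m f p \<longleftrightarrow> (\<forall>v\<in>V. monom 1 m dvd line_poly f p v)"

lemma monom_dvd_mult:
  fixes f g :: "'k::field poly"
  assumes "monom 1 m dvd f" "monom 1 n dvd g"
  shows "monom 1 (m + n) dvd f * g"
  using mult_dvd_mono[OF assms] by (simp add: mult_monom)

lemma monom_dvd_cancel:
  fixes f g :: "'k::field poly"
  assumes "monom 1 m dvd f * g" "poly f 0 \<noteq> 0"
  shows "monom 1 m dvd g"
proof (cases "g = 0")
  case False
  have "f \<noteq> 0" using assms(2) by auto
  then have "m \<le> order 0 (f * g)" using assms(1) False by (simp add: monom_1_dvd_iff)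
  also have "\<dots> = order 0 g" using \<open>f \<noteq> 0\<close> False assms(2) by (simp add: order_mult order_0I)
  finally show ?thesis using False by (simp add: monom_1_dvd_iff)
qed simp

locale infinite_field =
  fixes K :: "'k::field itself"
  assumes inf: "infinite (UNIV :: 'k set)"
begin

lemma line_poly_mult: "line_poly (f * g) p v = line_poly f p v * line_poly g p (v :: nat \<Rightarrow> 'k)"
  by (rule poly_ext[OF inf]) simp

lemma line_poly_add: "line_poly (f + g) p v = line_poly f p v + line_poly g p (v :: nat \<Rightarrow> 'k)"
  by (rule poly_ext[OF inf]) simp

lemma line_poly_linear: "f \<in> forms N 1 \<Longrightarrow> line_poly f p v = [:mpoly_eval p f, mpoly_eval v f :: 'k:]"
  by (rule poly_ext[OF inf]) (simp add: eval_linear)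

lemma line_poly_cong:
  assumes "vspace V" "p \<in> V" "v \<in> V" "\<And>x. x \<in> V \<Longrightarrow> mpoly_eval x f = mpoly_eval x (g :: (nat, 'k) mpoly)"
  shows "line_poly f p v = line_poly g p v"
  by (rule poly_ext[OF inf]) (simp add: assms(4)[OF vspaceD[OF assms(1-3)]])

lemma ord_at_cong:
  assumes "vspace V" "p \<in> V" "\<And>x. x \<in> V \<Longrightarrow> mpoly_eval x f = mpoly_eval x (g :: (nat, 'k) mpoly)"
  shows "ord_at V m f p \<longleftrightarrow> ord_at V m g p"
  unfolding ord_at_def using line_poly_cong[OF assms(1,2) _ assms(3)] by simp

lemma ord_at_mult: "ord_at V m f p \<Longrightarrow> ord_at V n g p \<Longrightarrow> ord_at V (m + n) (f * g) (p :: nat \<Rightarrow> 'k)"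
  unfolding ord_at_def by (simp add: line_poly_mult monom_dvd_mult)

lemma ord_at_add: "ord_at V m f p \<Longrightarrow> ord_at V m g p \<Longrightarrow> ord_at V m (f + g) (p :: nat \<Rightarrow> 'k)"
  unfolding ord_at_def by (simp add: line_poly_add)

lemma ord_at_0: "ord_at V 0 f (p :: nat \<Rightarrow> 'k)"
  unfolding ord_at_def monom_1_dvd_iff' by simp

lemma ord_at_zero: "ord_at V m 0 (p :: nat \<Rightarrow> 'k)"
proof -
  have "line_poly 0 p v = 0" for v :: "nat \<Rightarrow> 'k" by (rule poly_ext[OF inf]) simp
  then show ?thesis unfolding ord_at_def by simp
qed

lemma ord_at_mono: "ord_at V m f p \<Longrightarrow> n \<le> m \<Longrightarrow> ord_at V n f (p :: nat \<Rightarrow> 'k)"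
  unfolding ord_at_def monom_1_dvd_iff' by simp

lemma ord_at_1:
  assumes "mpoly_eval p f = 0"
  shows "ord_at V 1 f (p :: nat \<Rightarrow> 'k)"
proof -
  have "coeff (line_poly f p v) 0 = 0" for v
    using poly_line_poly[of f p v 0] assms by (simp add: poly_0_coeff_0)
  then show ?thesis unfolding ord_at_def monom_1_dvd_iff' by simp
qed

lemma ord_at_mono_space: "ord_at V m f p \<Longrightarrow> W \<subseteq> V \<Longrightarrow> ord_at W m f (p :: nat \<Rightarrow> 'k)"
  unfolding ord_at_def by blast

lemma ord_at_cancel_unit:
  assumes "ord_at V m (f * g) p" "mpoly_eval p f \<noteq> 0"
  shows "ord_at V m g (p :: nat \<Rightarrow> 'k)"
  unfolding ord_at_def
proof
  fix v assume "v \<in> V"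
  then have "monom 1 m dvd line_poly f p v * line_poly g p v"
    using assms(1) unfolding ord_at_def by (simp add: line_poly_mult)
  then show "monom 1 m dvd line_poly g p v"
    by (rule monom_dvd_cancel) (use assms(2) in simp)
qed

text \<open>The coefficients of a restriction to a line depend polynomially on the direction. P is a
  polynomial in c over k[t], evaluated at constants.\<close>

lemma line_poly_pencil:
  "\<exists>P. \<forall>c. line_poly f p (\<lambda>i. v i + c * v' i) = poly P [:c :: 'k:]"
proof (induction f rule: mpoly_induct)
  case zero
  have "line_poly 0 p u = 0" for u :: "nat \<Rightarrow> 'k" by (rule poly_ext[OF inf]) simp
  then show ?case by (intro exI[of _ 0]) simp
next
  case (single \<mu> a)
  let ?q = "\<lambda>i. [:[:p i, v i:], [:0, v' i:]:]"
  have "line_poly (Poly_Mapping.single \<mu> a) p (\<lambda>i. v i + c * v' i)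
      = poly ([:[:a:]:] * (\<Prod>i\<in>keys \<mu>. ?q i ^ lookup \<mu> i)) [:c:]" for c
    by (rule poly_ext[OF inf])
      (simp add: eval_single mono_eval_def poly_prod algebra_simps)
  then show ?case by (intro exI[of _ "[:[:a:]:] * (\<Prod>i\<in>keys \<mu>. ?q i ^ lookup \<mu> i)"] allI)
next
  case (add f g)
  then obtain P Q where "\<forall>c. line_poly f p (\<lambda>i. v i + c * v' i) = poly P [:c:]"
    "\<forall>c. line_poly g p (\<lambda>i. v i + c * v' i) = poly Q [:c:]" by blast
  then show ?case by (intro exI[of _ "P + Q"]) (simp add: line_poly_add)
qed

lemma coeff_poly_const:
  "coeff (poly P [:c:]) j = poly (map_poly (\<lambda>r. coeff r j) P) (c :: 'k)"
proof (induction P)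
  case (pCons a P)
  have "map_poly (\<lambda>r. coeff r j) (pCons a P) = pCons (coeff a j) (map_poly (\<lambda>r. coeff r j) P)"
    by (rule map_poly_pCons) simp
  then show ?case using pCons by simp
qed simp

text \<open>Directions along which \<open>l\<close> vanishes are limits of directions along which it does not.\<close>

lemma ord_at_cancel_linear:
  assumes V: "vspace V" and l: "l \<in> forms N 1" "mpoly_eval p l = 0" and v1: "v1 \<in> V" "mpoly_eval v1 l \<noteq> 0"
    and ord: "ord_at V m (l * f) p"
  shows "ord_at V (m - 1) f (p :: nat \<Rightarrow> 'k)"
  unfolding ord_at_def
proof
  fix v assume v: "v \<in> V"
  have main: "monom 1 (m - 1) dvd line_poly f p u" if u: "u \<in> V" "mpoly_eval u l \<noteq> 0" for u
  proof (cases m)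
    case 0
    then show ?thesis unfolding monom_1_dvd_iff' by simp
  next
    case (Suc n)
    have lp: "line_poly l p u = monom 1 1 * [:mpoly_eval u l:]"
      using l by (simp add: line_poly_linear monom_altdef)
    have eq: "monom 1 1 * monom 1 n = (monom 1 m :: 'k poly)" by (simp add: mult_monom Suc)
    have "monom 1 m dvd line_poly l p u * line_poly f p u"
      using ord u(1) unfolding ord_at_def line_poly_mult by blast
    then have "monom 1 1 * monom 1 n dvd monom 1 1 * ([:mpoly_eval u l:] * line_poly f p u)"
      unfolding lp eq[symmetric] mult.assoc .
    then have "monom 1 n dvd [:mpoly_eval u l:] * line_poly f p u"
      unfolding dvd_mult_cancel_left by (simp add: monom_eq_0_iff)
    then have "monom 1 n dvd line_poly f p u" by (rule monom_dvd_cancel) (use u(2) in simp)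
    then show ?thesis by (simp add: Suc)
  qed
  obtain P where P: "\<And>c. line_poly f p (\<lambda>i. v i + c * v1 i) = poly P [:c:]"
    using line_poly_pencil[of f p v v1] by blast
  show "monom 1 (m - 1) dvd line_poly f p v"
  proof (subst monom_1_dvd_iff', intro allI impI)
    fix j assume j: "j < m - 1"
    \<comment> \<open>The j-th coefficient as a polynomial in the direction parameter c. It vanishes
      unless l(v) + c l(v1) = 0, that is for all but one c, so it is 0.\<close>
    define Q where "Q = map_poly (\<lambda>r. coeff r j) P"
    have Q: "poly Q c = coeff (line_poly f p (\<lambda>i. v i + c * v1 i)) j" for c
      by (simp add: Q_def P coeff_poly_const)
    have "poly Q c = 0" if "mpoly_eval v l + c * mpoly_eval v1 l \<noteq> 0" for c
    proof -
      have "mpoly_eval (\<lambda>i. v i + c * v1 i) l \<noteq> 0" using that by (simp add: eval_linear[OF l(1)])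
      then have "monom 1 (m - 1) dvd line_poly f p (\<lambda>i. v i + c * v1 i)"
        by (rule main[OF vspaceD[OF V v v1(1)]])
      then show ?thesis using j unfolding Q monom_1_dvd_iff' by simp
    qed
    then have z: "poly Q c * (mpoly_eval v l + c * mpoly_eval v1 l) = 0" for c by (metis mult_eq_0_iff)
    have "poly (Q * [:mpoly_eval v l, mpoly_eval v1 l:]) c = poly Q c * (mpoly_eval v l + c * mpoly_eval v1 l)" for c
      by (simp add: algebra_simps)
    then have "poly (Q * [:mpoly_eval v l, mpoly_eval v1 l:]) c = 0" for c unfolding z .
    then have "Q * [:mpoly_eval v l, mpoly_eval v1 l:] = 0" using inf by (intro poly_eq_0_if_zeros) simp
    moreover have "[:mpoly_eval v l, mpoly_eval v1 l:] \<noteq> 0" using v1(2) by simp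
    ultimately have "Q = 0" by (metis mult_eq_0_iff)
    then show "coeff (line_poly f p v) j = 0" using Q[of 0] by simp
  qed
qed

text \<open>Polynomial functions on a vector space over an infinite field have no zero divisors:
  restrict them to the line joining the two points.\<close>

lemma nonzero_mult_on_vspace:
  assumes V: "vspace V" and x: "x \<in> V" "mpoly_eval x f \<noteq> 0" and y: "y \<in> V" "mpoly_eval y g \<noteq> (0 :: 'k)"
  shows "\<exists>z\<in>V. mpoly_eval z f \<noteq> 0 \<and> mpoly_eval z g \<noteq> 0"
proof -
  define u where "u = (\<lambda>i. y i + (-1) * x i)"
  have u: "u \<in> V" unfolding u_def by (rule vspaceD[OF V y(1) x(1)])
  have "poly (line_poly f x u) 0 \<noteq> 0" "poly (line_poly g x u) 1 \<noteq> 0" using x(2) y(2) by (simp_all add: u_def)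
  then have "line_poly f x u \<noteq> 0" "line_poly g x u \<noteq> 0" by (metis poly_0)+
  then have "line_poly f x u * line_poly g x u \<noteq> 0" by simp
  then have "{t. poly (line_poly f x u * line_poly g x u) t = 0} \<noteq> UNIV"
    using inf poly_eq_0_if_zeros by metis
  then obtain t where "poly (line_poly f x u * line_poly g x u) t \<noteq> 0" by blast
  then show ?thesis using vspaceD[OF V x(1) u, of t] by (intro bexI[of _ "\<lambda>i. x i + t * u i"]) auto
qed

end

text \<open>The map x - l(x) v projects along v onto l = 0, and f differs from its pullback by a
  multiple of l. The clause for \<open>n = 0\<close> compensates for the truncated
  \<open>n - 1\<close>.\<close>

lemma linear_division:
  fixes l :: "(nat, 'k::field) mpoly"
  assumes l: "l \<in> forms N 1" and f: "f \<in> forms N n" and v: "mpoly_eval v l = 1"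
  shows "\<exists>g\<in>forms N (n - 1). (n = 0 \<longrightarrow> g = 0) \<and>
    (\<forall>x. mpoly_eval x f = mpoly_eval (\<lambda>i. x i + (- mpoly_eval x l) * v i) f + mpoly_eval x l * mpoly_eval x g)"
  using f
proof (induction rule: forms_induct)
  case (zero n)
  show ?case by (intro bexI[of _ 0]) auto
next
  case (const c)
  show ?case by (intro bexI[of _ 0]) auto
next
  case (add n p q)
  from add.IH(1) obtain g where g: "g \<in> forms N (n - 1)" "n = 0 \<longrightarrow> g = 0"
    "\<forall>x. mpoly_eval x p = mpoly_eval (\<lambda>i. x i + (- mpoly_eval x l) * v i) p + mpoly_eval x l * mpoly_eval x g"
    by (elim bexE conjE) (rule that)
  from add.IH(2) obtain h where h: "h \<in> forms N (n - 1)" "n = 0 \<longrightarrow> h = 0"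
    "\<forall>x. mpoly_eval x q = mpoly_eval (\<lambda>i. x i + (- mpoly_eval x l) * v i) q + mpoly_eval x l * mpoly_eval x h"
    by (elim bexE conjE) (rule that)
  show ?case
  proof (intro bexI[of _ "g + h"] conjI allI)
    fix x
    show "mpoly_eval x (p + q) = mpoly_eval (\<lambda>i. x i + (- mpoly_eval x l) * v i) (p + q) + mpoly_eval x l * mpoly_eval x (g + h)"
      using spec[OF g(3), of x] spec[OF h(3), of x] unfolding eval_add by (simp only: distrib_left add_ac)
  qed (use g h in auto)
next
  case (var n i p)
  from var.IH obtain g where g: "g \<in> forms N (n - 1)" "n = 0 \<longrightarrow> g = 0"
    "\<forall>x. mpoly_eval x p = mpoly_eval (\<lambda>i. x i + (- mpoly_eval x l) * v i) p + mpoly_eval x l * mpoly_eval x g"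
    by (elim bexE conjE) (rule that)
  define y where "y x = (\<lambda>i. x i + (- mpoly_eval x l) * v i)" for x
  \<comment> \<open>With P = P' + L Q, the difference x_i P - (x_i - L v_i) P' is L (v_i P' + x_i
    Q), and P' is P - L Q.\<close>
  define h where "h = const (v i) * (p - l * g) + var i * g"
  have lg: "l * g \<in> forms N n" "var i * g \<in> forms N n"
    using forms_mult[OF l g(1)] forms_mult[OF forms_var[OF var(1)] g(1)] g(2) by (cases n; simp)+
  have "h \<in> forms N n" unfolding h_def by (intro forms_add forms_const_mult forms_diff lg var)
  moreover have "mpoly_eval x (var i * p) = mpoly_eval (y x) (var i * p) + mpoly_eval x l * mpoly_eval x h" for x
  proof -
    have p: "mpoly_eval x p = mpoly_eval (y x) p + mpoly_eval x l * mpoly_eval x g" unfolding y_def by (rule spec[OF g(3)])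
    have yi: "y x i = x i - mpoly_eval x l * v i" by (simp add: y_def)
    have "x i * P = (x i - L * v i) * P' + L * (v i * (P - L * Q) + x i * Q)" if "P = P' + L * Q" for P P' L Q :: 'k
      using that by (simp add: algebra_simps)
    from this[OF p] show ?thesis unfolding h_def eval_mult eval_add eval_diff eval_const eval_var yi .
  qed
  ultimately show ?case unfolding y_def by (intro bexI[of _ h] conjI allI) simp_all
qed

text \<open>A form that is nonzero at the zero vector has degree 0, so any nonzero vector will do.
  Order conditions are imposed only at points with a nonzero coordinate.\<close>

lemma form_nonzero_vector:
  assumes f: "f \<in> forms N k" and x: "x \<in> V" "mpoly_eval x f \<noteq> 0" and p: "p \<in> V" "\<exists>i\<le>N. p i \<noteq> 0"
  shows "\<exists>y\<in>V. (\<exists>i\<le>N. y i \<noteq> 0) \<and> mpoly_eval y f \<noteq> (0 :: 'k::field)"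
proof (cases "\<exists>i\<le>N. x i \<noteq> 0")
  case False
  have "mpoly_eval x f = mpoly_eval (\<lambda>i. 0 * x i) f"
    using False by (intro eval_cong[OF forms_polys[OF f]]) auto
  also have "\<dots> = 0 ^ k * mpoly_eval x f" by (rule eval_forms_scale[OF f])
  finally have "k = 0" using x(2) by (cases k) auto
  then have "mpoly_eval x f = mpoly_eval p f"
    using eval_forms_scale[OF f, of 0 p] eval_forms_scale[OF f, of 0 x] by simp
  then show ?thesis using p x(2) by auto
qed (use x in blast)

lemma line_poly_degree:
  assumes inf: "infinite (UNIV :: 'k::field set)" and f: "f \<in> forms N k"
  shows "degree (line_poly f p v :: 'k poly) \<le> k"
proof -
  have "\<exists>P. degree P \<le> k \<and> (\<forall>t. mpoly_eval (\<lambda>i. p i + t * v i) f = poly P t)"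
    using f
  proof (induction rule: forms_induct)
    case (zero n)
    show ?case by (intro exI[of _ 0]) simp
  next
    case (const c)
    show ?case by (intro exI[of _ "[:c:]"]) simp
  next
    case (add n f g)
    then obtain P Q where "degree P \<le> n" "\<forall>t. mpoly_eval (\<lambda>i. p i + t * v i) f = poly P t"
      "degree Q \<le> n" "\<forall>t. mpoly_eval (\<lambda>i. p i + t * v i) g = poly Q t" by blast
    then show ?case by (intro exI[of _ "P + Q"]) (simp add: degree_add_le)
  next
    case (var n i f)
    then obtain P where P: "degree P \<le> n" "\<forall>t. mpoly_eval (\<lambda>i. p i + t * v i) f = poly P t" by blast
    have "degree ([:p i, v i:] * P) \<le> degree [:p i, v i:] + degree P" by (rule degree_mult_le)
    also have "\<dots> \<le> Suc n" using P(1) by simp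
    finally show ?case using P(2) by (intro exI[of _ "[:p i, v i:] * P"]) (simp add: algebra_simps)
  qed
  then obtain P where P: "degree P \<le> k" "\<forall>t. mpoly_eval (\<lambda>i. p i + t * v i) f = poly P t" by blast
  have "line_poly f p v = P" by (rule poly_ext[OF inf]) (use P(2) in simp)
  then show ?thesis using P(1) by simp
qed


section \<open>Hyperplanes in general position\<close>

text \<open>n stands for the projective dimension of V. Any n + 1 of the L_j give coordinates on V,
  any n have a common nonzero zero and admit dual vectors. In this form, with linear forms still in
  N + 1 variables, passing to a hyperplane requires no change of coordinates.\<close>

definition gen_pos :: "nat \<Rightarrow> nat \<Rightarrow> (nat \<Rightarrow> 'k::field) set \<Rightarrow> nat set \<Rightarrow> (nat \<Rightarrow> (nat, 'k) mpoly) \<Rightarrow> bool" where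
  "gen_pos N n V S L \<longleftrightarrow> vspace V \<and> finite S \<and> (\<forall>i\<in>S. L i \<in> forms N 1) \<and>
     (\<forall>T\<subseteq>S. card T = Suc n \<longrightarrow> (\<forall>i\<le>N. \<exists>c. \<forall>x\<in>V. x i = (\<Sum>j\<in>T. c j * mpoly_eval x (L j)))) \<and>
     (\<forall>T\<subseteq>S. card T = n \<longrightarrow> (\<exists>p\<in>V. (\<exists>i\<le>N. p i \<noteq> 0) \<and> (\<forall>j\<in>T. mpoly_eval p (L j) = 0))) \<and>
     (\<forall>T\<subseteq>S. card T = n \<longrightarrow> (\<forall>i\<in>T. \<exists>v\<in>V. mpoly_eval v (L i) = 1 \<and> (\<forall>j\<in>T - {i}. mpoly_eval v (L j) = 0)))"

definition points_ord :: "nat \<Rightarrow> nat \<Rightarrow> (nat \<Rightarrow> 'k::field) set \<Rightarrow> nat set \<Rightarrow> (nat \<Rightarrow> (nat, 'k) mpoly) \<Rightarrow> nat \<Rightarrow> (nat, 'k) mpoly \<Rightarrow> bool" where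
  "points_ord N n V S L m f \<longleftrightarrow> (\<forall>T\<subseteq>S. card T = n \<longrightarrow>
     (\<forall>p\<in>V. (\<exists>i\<le>N. p i \<noteq> 0) \<longrightarrow> (\<forall>j\<in>T. mpoly_eval p (L j) = 0) \<longrightarrow> ord_at V m f p))"

definition hyperplane :: "(nat \<Rightarrow> 'k::field) set \<Rightarrow> (nat, 'k) mpoly \<Rightarrow> (nat \<Rightarrow> 'k) set" where
  "hyperplane V l = {x \<in> V. mpoly_eval x l = 0}"

lemma vspace_hyperplane:
  assumes "vspace V" "l \<in> forms N 1"
  shows "vspace (hyperplane V l)"
proof -
  have "mpoly_eval (\<lambda>_. 0) l = 0" using eval_forms_scale[OF assms(2), of 0] by simp
  then show ?thesis
    using assms(1) unfolding vspace_def hyperplane_def by (simp add: eval_linear[OF assms(2)])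
qed

lemma gen_posD:
  assumes "gen_pos N n V S L"
  shows "vspace V" "finite S" "i \<in> S \<Longrightarrow> L i \<in> forms N 1"
    "T \<subseteq> S \<Longrightarrow> card T = Suc n \<Longrightarrow> k \<le> N \<Longrightarrow> \<exists>c. \<forall>x\<in>V. x k = (\<Sum>j\<in>T. c j * mpoly_eval x (L j))"
    "T \<subseteq> S \<Longrightarrow> card T = n \<Longrightarrow> \<exists>p\<in>V. (\<exists>i\<le>N. p i \<noteq> 0) \<and> (\<forall>j\<in>T. mpoly_eval p (L j) = 0)"
    "T \<subseteq> S \<Longrightarrow> card T = n \<Longrightarrow> i \<in> T \<Longrightarrow> \<exists>v\<in>V. mpoly_eval v (L i) = 1 \<and> (\<forall>j\<in>T - {i}. mpoly_eval v (L j) = 0)"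
proof -
  note d = assms[unfolded gen_pos_def]
  note d3 = d[THEN conjunct2, THEN conjunct2]
  show "vspace V" by (rule d[THEN conjunct1])
  show "finite S" by (rule d[THEN conjunct2, THEN conjunct1])
  show "i \<in> S \<Longrightarrow> L i \<in> forms N 1" by (rule d3[THEN conjunct1, rule_format])
  show "T \<subseteq> S \<Longrightarrow> card T = Suc n \<Longrightarrow> k \<le> N \<Longrightarrow> \<exists>c. \<forall>x\<in>V. x k = (\<Sum>j\<in>T. c j * mpoly_eval x (L j))"
    by (rule d3[THEN conjunct2, THEN conjunct1, rule_format])
  show "T \<subseteq> S \<Longrightarrow> card T = n \<Longrightarrow> \<exists>p\<in>V. (\<exists>i\<le>N. p i \<noteq> 0) \<and> (\<forall>j\<in>T. mpoly_eval p (L j) = 0)"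
    by (rule d3[THEN conjunct2, THEN conjunct2, THEN conjunct1, rule_format])
  show "T \<subseteq> S \<Longrightarrow> card T = n \<Longrightarrow> i \<in> T \<Longrightarrow> \<exists>v\<in>V. mpoly_eval v (L i) = 1 \<and> (\<forall>j\<in>T - {i}. mpoly_eval v (L j) = 0)"
    by (rule d3[THEN conjunct2, THEN conjunct2, THEN conjunct2, rule_format])
qed

lemma gen_pos_subset:
  assumes gp: "gen_pos N n V S L" and sub: "S' \<subseteq> S"
  shows "gen_pos N n V S' L"
  unfolding gen_pos_def
proof (intro conjI allI impI ballI)
  show "vspace V" by (rule gen_posD(1)[OF gp])
  show "finite S'" using gen_posD(2)[OF gp] sub by (rule finite_subset[rotated])
  show "L i \<in> forms N 1" if "i \<in> S'" for i using gen_posD(3)[OF gp] sub that by blast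
next
  fix T k assume "T \<subseteq> S'" "card T = Suc n" "k \<le> N"
  then show "\<exists>c. \<forall>x\<in>V. x k = (\<Sum>j\<in>T. c j * mpoly_eval x (L j))"
    using sub by (intro gen_posD(4)[OF gp]) auto
next
  fix T assume "T \<subseteq> S'" "card T = n"
  then show "\<exists>p\<in>V. (\<exists>i\<le>N. p i \<noteq> 0) \<and> (\<forall>j\<in>T. mpoly_eval p (L j) = 0)"
    using sub by (intro gen_posD(5)[OF gp]) auto
next
  fix T i assume "T \<subseteq> S'" "card T = n" "i \<in> T"
  then show "\<exists>v\<in>V. mpoly_eval v (L i) = 1 \<and> (\<forall>j\<in>T - {i}. mpoly_eval v (L j) = 0)"
    using sub by (intro gen_posD(6)[OF gp]) auto
qed

text \<open>On the hyperplane L_s = 0 each condition for T is the condition on V for T with s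
  added.\<close>

lemma gen_pos_restrict:
  assumes gp: "gen_pos N (Suc n) V S L" and s: "s \<in> S"
  shows "gen_pos N n (hyperplane V (L s)) (S - {s}) L"
proof -
  note gpD = gen_posD[OF gp]
  have ins: "insert s T \<subseteq> S" "card (insert s T) = Suc (card T)" "finite T" "s \<notin> T" if "T \<subseteq> S - {s}" for T
  proof -
    show fT: "finite T" using that gpD(2) finite_subset by blast
    show sT: "s \<notin> T" using that by blast
    show "insert s T \<subseteq> S" using that s by blast
    show "card (insert s T) = Suc (card T)" by (rule card_insert_disjoint[OF fT sT])
  qed
  show ?thesis
    unfolding gen_pos_def
  proof (intro conjI allI impI ballI)
    show "vspace (hyperplane V (L s))" by (rule vspace_hyperplane[OF gpD(1) gpD(3)[OF s]])
    show "finite (S - {s})" using gpD(2) by simp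
    show "L i \<in> forms N 1" if "i \<in> S - {s}" for i using gpD(3) that by simp
  next
    fix T k assume T: "T \<subseteq> S - {s}" "card T = Suc n" and k: "k \<le> N"
    obtain c where c: "\<forall>x\<in>V. x k = (\<Sum>j\<in>insert s T. c j * mpoly_eval x (L j))"
      using gpD(4)[OF ins(1)[OF T(1)] _ k] ins(2)[OF T(1)] T(2) by auto
    have "x k = (\<Sum>j\<in>T. c j * mpoly_eval x (L j))" if "x \<in> hyperplane V (L s)" for x
    proof -
      have x: "x \<in> V" "mpoly_eval x (L s) = 0" using that by (simp_all add: hyperplane_def)
      have "x k = (\<Sum>j\<in>insert s T. c j * mpoly_eval x (L j))" using c x(1) by blast
      then show ?thesis using ins(3,4)[OF T(1)] x(2) by simp
    qed
    then show "\<exists>c. \<forall>x\<in>hyperplane V (L s). x k = (\<Sum>j\<in>T. c j * mpoly_eval x (L j))" by blast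
  next
    fix T assume T: "T \<subseteq> S - {s}" "card T = n"
    obtain p where "p \<in> V" "\<exists>i\<le>N. p i \<noteq> 0" "\<forall>j\<in>insert s T. mpoly_eval p (L j) = 0"
      using gpD(5)[OF ins(1)[OF T(1)]] ins(2)[OF T(1)] T(2) by auto
    then show "\<exists>p\<in>hyperplane V (L s). (\<exists>i\<le>N. p i \<noteq> 0) \<and> (\<forall>j\<in>T. mpoly_eval p (L j) = 0)"
      unfolding hyperplane_def by (intro bexI[of _ p]) auto
  next
    fix T i assume T: "T \<subseteq> S - {s}" "card T = n" and i: "i \<in> T"
    obtain v where v: "v \<in> V" "mpoly_eval v (L i) = 1" "\<forall>j\<in>insert s T - {i}. mpoly_eval v (L j) = 0"
      using gpD(6)[OF ins(1)[OF T(1)], of i] ins(2)[OF T(1)] T(2) i by auto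
    moreover have "s \<noteq> i" using T i by auto
    ultimately show "\<exists>v\<in>hyperplane V (L s). mpoly_eval v (L i) = 1 \<and> (\<forall>j\<in>T - {i}. mpoly_eval v (L j) = 0)"
      unfolding hyperplane_def by (intro bexI[of _ v]) auto
  qed
qed

lemma points_ord_restrict:
  assumes "points_ord N (Suc n) V S L m f" and s: "s \<in> S" and fin: "finite S"
  shows "points_ord N n (hyperplane V (L s)) (S - {s}) L m f"
  unfolding points_ord_def
proof (intro allI impI ballI)
  fix T p
  assume T: "T \<subseteq> S - {s}" "card T = n" and p: "p \<in> hyperplane V (L s)" "\<exists>i\<le>N. p i \<noteq> 0" "\<forall>j\<in>T. mpoly_eval p (L j) = 0"
  have "finite T" using T(1) fin finite_subset by blast
  moreover have "s \<notin> T" using T(1) by blast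
  ultimately have "insert s T \<subseteq> S" "card (insert s T) = Suc n" using T s by auto
  moreover have "p \<in> V" "\<forall>j\<in>insert s T. mpoly_eval p (L j) = 0" using p by (auto simp: hyperplane_def)
  ultimately have "ord_at V m f p" using assms(1) p(2) unfolding points_ord_def by blast
  then show "ord_at (hyperplane V (L s)) m f p"
    unfolding ord_at_def hyperplane_def by blast
qed

lemma gen_pos_no_common_zero:
  assumes gp: "gen_pos N n V S L" and T: "T \<subseteq> S" "card T = Suc n"
    and x: "x \<in> V" "\<And>j. j \<in> T \<Longrightarrow> mpoly_eval x (L j) = 0" and k: "k \<le> N"
  shows "x k = 0"
proof -
  obtain c where "\<forall>x\<in>V. x k = (\<Sum>j\<in>T. c j * mpoly_eval x (L j))"
    using gen_posD(4)[OF gp T k] by blast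
  then have "x k = (\<Sum>j\<in>T. c j * mpoly_eval x (L j))" using x(1) by blast
  also have "\<dots> = 0" by (intro sum.neutral) (simp add: x(2))
  finally show ?thesis .
qed

lemma gen_pos_unit_vector:
  assumes gp: "gen_pos N n V S L" and s: "s \<in> S" and n: "0 < n" "n \<le> card S"
  shows "\<exists>v\<in>V. mpoly_eval v (L s) = 1"
proof -
  have fin: "finite S" by (rule gen_posD(2)[OF gp])
  have "n - 1 \<le> card (S - {s})" using n s fin by simp
  then obtain T where T: "T \<subseteq> S - {s}" "card T = n - 1" "finite T"
    using obtain_subset_with_card_n by blast
  moreover from T(1) have "s \<notin> T" by blast
  ultimately have "insert s T \<subseteq> S" "card (insert s T) = n" using s n by auto
  then show ?thesis using gen_posD(6)[OF gp, of "insert s T" s] by blast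
qed

context infinite_field
begin

text \<open>Projection along v sends V into the hyperplane, where f vanishes, so only the multiple
  of l survives. The result is an equality of functions on V, not of polynomials.\<close>

lemma divide_on_vspace:
  assumes V: "vspace V" and l: "l \<in> forms N 1" "v \<in> V" "mpoly_eval v l = 1" and f: "f \<in> forms N n"
    and zero: "\<And>x. x \<in> hyperplane V l \<Longrightarrow> mpoly_eval x f = (0 :: 'k)"
  shows "\<exists>g\<in>forms N (n - 1). (n = 0 \<longrightarrow> g = 0) \<and> (\<forall>x\<in>V. mpoly_eval x f = mpoly_eval x (l * g))"
proof -
  obtain g where g: "g \<in> forms N (n - 1)" "n = 0 \<longrightarrow> g = 0"
    "\<And>x. mpoly_eval x f = mpoly_eval (\<lambda>i. x i + (- mpoly_eval x l) * v i) f + mpoly_eval x l * mpoly_eval x g"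
    using linear_division[OF l(1) f l(3)] by blast
  have "mpoly_eval x f = mpoly_eval x (l * g)" if x: "x \<in> V" for x
  proof -
    have "mpoly_eval (\<lambda>i. x i + (- mpoly_eval x l) * v i) l = 0"
      unfolding eval_linear[OF l(1)] l(3) by simp
    then have h: "(\<lambda>i. x i + (- mpoly_eval x l) * v i) \<in> hyperplane V l"
      unfolding hyperplane_def using vspaceD[OF V x l(2)] by blast
    show ?thesis using g(3)[of x] unfolding zero[OF h] by simp
  qed
  then show ?thesis using g by blast
qed

text \<open>The L_a are divided out one by one. The quotient vanishes on the next hyperplane because
  the product so far is not identically zero there and functions on it have no zero
  divisors.\<close>

lemma divide_all_on_vspace:
  assumes gp: "gen_pos N (Suc n) V S L" and card: "Suc (Suc n) \<le> card S" and f: "f \<in> forms N k"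
    and nz: "x0 \<in> V" "mpoly_eval x0 f \<noteq> 0"
    and zero: "\<And>s x. s \<in> S \<Longrightarrow> x \<in> hyperplane V (L s) \<Longrightarrow> mpoly_eval x f = (0 :: 'k)"
    and A: "finite A" "A \<subseteq> S"
  shows "card A \<le> k \<and> (\<exists>g\<in>forms N (k - card A). \<forall>x\<in>V. mpoly_eval x f = mpoly_eval x ((\<Prod>a\<in>A. L a) * g))"
  using A
proof (induction A rule: finite_induct)
  case empty
  then show ?case using f by auto
next
  case (insert s A)
  then obtain g where g: "card A \<le> k" "g \<in> forms N (k - card A)"
    "\<And>x. x \<in> V \<Longrightarrow> mpoly_eval x f = mpoly_eval x ((\<Prod>a\<in>A. L a) * g)" by auto
  have s: "s \<in> S" "s \<notin> A" "A \<subseteq> S" using insert by auto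
  have V: "vspace V" and fin: "finite S" by (rule gen_posD[OF gp])+
  have Vs: "vspace (hyperplane V (L s))" by (rule vspace_hyperplane[OF V gen_posD(3)[OF gp s(1)]])
  have unit: "\<exists>v\<in>hyperplane V (L s). mpoly_eval v (\<Prod>a\<in>B. L a) \<noteq> 0" if "finite B" "B \<subseteq> A" for B
    using that
  proof (induction B rule: finite_induct)
    case empty
    show ?case using Vs unfolding vspace_def by (intro bexI[of _ "\<lambda>_. 0"]) auto
  next
    case (insert a B)
    then obtain v where v: "v \<in> hyperplane V (L s)" "mpoly_eval v (\<Prod>a\<in>B. L a) \<noteq> 0" by auto
    have "a \<in> S" "a \<noteq> s" using insert s by auto
    have "\<exists>v\<in>hyperplane V (L s). mpoly_eval v (L a) \<noteq> 0"
    proof -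
      \<comment> \<open>A common zero of L_s and n further forms is no zero of L_a, as n + 2 of the
        forms have no common zero other than 0. This takes n indices besides s and a.\<close>
      have "n \<le> card (S - {s, a})" using card fin s(1) \<open>a \<in> S\<close> \<open>a \<noteq> s\<close> by simp
      then obtain T where T: "T \<subseteq> S - {s, a}" "card T = n" "finite T"
        using obtain_subset_with_card_n by blast
      have sT: "s \<notin> T" and aT: "a \<notin> T" using T(1) by blast+
      have sub: "insert s T \<subseteq> S" "card (insert s T) = Suc n" using T s(1) sT by auto
      obtain p where p: "p \<in> V" "\<exists>i\<le>N. p i \<noteq> 0" "\<forall>j\<in>insert s T. mpoly_eval p (L j) = 0"
        using gen_posD(5)[OF gp sub] by blast
      have "mpoly_eval p (L a) \<noteq> 0"
      proof
        assume pa: "mpoly_eval p (L a) = 0"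
        have "p k = 0" if "k \<le> N" for k
        proof (rule gen_pos_no_common_zero[OF gp, of "insert a (insert s T)"])
          show "insert a (insert s T) \<subseteq> S" using T s \<open>a \<in> S\<close> by auto
          show "card (insert a (insert s T)) = Suc (Suc n)" using T(2,3) sT aT \<open>a \<noteq> s\<close> by simp
          show "mpoly_eval p (L j) = 0" if "j \<in> insert a (insert s T)" for j using that p(3) pa by auto
        qed (use p that in auto)
        then show False using p(2) by blast
      qed
      then show ?thesis using p by (intro bexI[of _ p]) (auto simp: hyperplane_def)
    qed
    then obtain y where "y \<in> hyperplane V (L s)" "mpoly_eval y (L a) \<noteq> 0" by blast
    from nonzero_mult_on_vspace[OF Vs v this] show ?case using insert by auto
  qed
  have gzero: "mpoly_eval x g = 0" if x: "x \<in> hyperplane V (L s)" for x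
  proof (rule ccontr)
    assume nzg: "mpoly_eval x g \<noteq> 0"
    obtain v where "v \<in> hyperplane V (L s)" "mpoly_eval v (\<Prod>a\<in>A. L a) \<noteq> 0"
      using unit[OF insert.hyps(1)] by blast
    from nonzero_mult_on_vspace[OF Vs this x nzg] obtain z
      where z: "z \<in> hyperplane V (L s)" "mpoly_eval z (\<Prod>a\<in>A. L a) \<noteq> 0" "mpoly_eval z g \<noteq> 0" by blast
    have "mpoly_eval z f \<noteq> 0" using g(3)[of z] z by (simp add: hyperplane_def prod_zero_iff)
    then show False using zero[OF s(1) z(1)] by simp
  qed
  obtain v where v: "v \<in> V" "mpoly_eval v (L s) = 1"
    using gen_pos_unit_vector[OF gp s(1)] card by auto
  have "\<exists>h\<in>forms N (k - card A - 1). (k - card A = 0 \<longrightarrow> h = 0) \<and> (\<forall>x\<in>V. mpoly_eval x g = mpoly_eval x (L s * h))"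
    by (rule divide_on_vspace[OF V gen_posD(3)[OF gp s(1)] v g(2)]) (rule gzero)
  then obtain h where h: "h \<in> forms N (k - card A - 1)" "k - card A = 0 \<longrightarrow> h = 0"
    "\<forall>x\<in>V. mpoly_eval x g = mpoly_eval x (L s * h)"
    by (elim bexE conjE) (rule that)
  have eq: "mpoly_eval x f = mpoly_eval x ((\<Prod>a\<in>insert s A. L a) * h)" if "x \<in> V" for x
    using g(3)[OF that] bspec[OF h(3) that] insert.hyps by (simp add: mult.commute mult.left_commute)
  have "k - card A \<noteq> 0"
  proof
    assume "k - card A = 0"
    then have "h = 0" using h(2) by simp
    then show False using eq[OF nz(1)] nz(2) by simp
  qed
  then show ?case using g(1) insert.hyps h(1) eq by (auto simp: diff_diff_eq)
qed

text \<open>A factor that vanishes at p costs one order, any other factor none.\<close>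

lemma ord_at_cancel_product:
  assumes V: "vspace V" and p: "p \<in> V" and fin: "finite A"
    and L: "\<And>a. a \<in> A \<Longrightarrow> L a \<in> forms N 1" "\<And>a. a \<in> A \<Longrightarrow> \<exists>v\<in>V. mpoly_eval v (L a) \<noteq> 0"
    and ord: "ord_at V m ((\<Prod>a\<in>A. L a) * f) p"
  shows "ord_at V (m - card {a\<in>A. mpoly_eval p (L a) = 0}) f (p :: nat \<Rightarrow> 'k)"
  using fin L ord
proof (induction A arbitrary: m rule: finite_induct)
  case (insert a A)
  have ord: "ord_at V m (L a * ((\<Prod>a\<in>A. L a) * f)) p" using insert by (simp add: mult.assoc)
  show ?case
  proof (cases "mpoly_eval p (L a) = 0")
    case True
    obtain v where v: "v \<in> V" "mpoly_eval v (L a) \<noteq> 0" using insert.prems(2) by blast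
    have "ord_at V (m - 1) ((\<Prod>a\<in>A. L a) * f) p"
      by (rule ord_at_cancel_linear[OF V _ True v ord]) (use insert in auto)
    then have "ord_at V (m - 1 - card {a\<in>A. mpoly_eval p (L a) = 0}) f p"
      by (intro insert.IH) (use insert in auto)
    moreover have "{x \<in> insert a A. mpoly_eval p (L x) = 0} = insert a {a\<in>A. mpoly_eval p (L a) = 0}"
      using True by auto
    ultimately show ?thesis using insert.hyps by simp
  next
    case False
    have "ord_at V m ((\<Prod>a\<in>A. L a) * f) p" by (rule ord_at_cancel_unit[OF ord False])
    then have "ord_at V (m - card {a\<in>A. mpoly_eval p (L a) = 0}) f p"
      by (intro insert.IH) (use insert in auto)
    moreover have "{x \<in> insert a A. mpoly_eval p (L x) = 0} = {a\<in>A. mpoly_eval p (L a) = 0}"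
      using False by auto
    ultimately show ?thesis by simp
  qed
qed simp

text \<open>Either some hyperplane does not contain the hypersurface \<open>f = 0\<close>, and \<open>f\<close> is restricted to
  it, or \<open>f\<close> is divisible by all the \<open>L s\<close>; dividing by them lowers the orders by \<open>n\<close>.\<close>

theorem points_ord_degree_bound:
  assumes "gen_pos N n V S L" "n \<le> card S" "f \<in> forms N k" "x \<in> V" "mpoly_eval x f \<noteq> (0 :: 'k)"
    and "points_ord N n V S L m f"
  shows "m * card S \<le> n * k"
  using assms
proof (induction n arbitrary: V S f k m x)
  case 0
  note gp = "0.prems"(1)
  obtain p where p: "p \<in> V" "\<exists>i\<le>N. p i \<noteq> 0" using gen_posD(5)[OF gp, of "{}"] by auto
  obtain y where y: "y \<in> V" "\<exists>i\<le>N. y i \<noteq> 0" "mpoly_eval y f \<noteq> 0"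
    using form_nonzero_vector[OF "0.prems"(3,4,5) p] by blast
  \<comment> \<open>At a point where f is nonzero the order is 0, which forces m = 0.\<close>
  have "ord_at V m f y"
    by (rule "0.prems"(6)[unfolded points_ord_def, rule_format, of "{}"]) (use y in simp_all)
  then have "monom 1 m dvd line_poly f y y" using y(1) unfolding ord_at_def by blast
  then obtain q where "line_poly f y y = monom 1 m * q" by (rule dvdE)
  then have "mpoly_eval y f = 0 ^ m * poly q 0"
    using poly_line_poly[of f y y 0] by (simp add: poly_monom)
  then show ?case using y(3) by (cases m) auto
next
  case (Suc n V S f k m x)
  note gp = Suc.prems(1)
  have V: "vspace V" and fin: "finite S" by (rule gen_posD[OF gp])+
  from Suc.prems(3-6) show ?case
  proof (induction k arbitrary: f m x rule: less_induct)
    case (less k)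
    show ?case
    proof (cases "card S = Suc n")
      case True
      \<comment> \<open>Only T = S has to be considered. On the line from p to x the restriction of
        f is nonzero of degree at most k, so m \<le> k.\<close>
      obtain p where p: "p \<in> V" "\<exists>i\<le>N. p i \<noteq> 0" "\<forall>j\<in>S. mpoly_eval p (L j) = 0"
        using gen_posD(5)[OF gp, of S] True by auto
      have "ord_at V m f p"
        by (rule less.prems(4)[unfolded points_ord_def, rule_format, of S]) (use p True in simp_all)
      define v where "v = (\<lambda>i. x i + (-1) * p i)"
      have "v \<in> V" unfolding v_def by (rule vspaceD[OF V less.prems(2) p(1)])
      then have dvd: "monom 1 m dvd line_poly f p v" using \<open>ord_at V m f p\<close> unfolding ord_at_def by blast
      have "poly (line_poly f p v) 1 \<noteq> 0" using less.prems(3) by (simp add: v_def)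
      then have "line_poly f p v \<noteq> 0" by (metis poly_0)
      then have "degree (monom (1::'k) m) \<le> degree (line_poly f p v)" using dvd by (rule dvd_imp_degree_le[rotated])
      then have "m \<le> k" using line_poly_degree[OF inf less.prems(1), of p v] by (simp add: degree_monom_eq)
      then have "Suc n * m \<le> Suc n * k" by (rule mult_le_mono2)
      then show ?thesis unfolding True by (simp only: mult.commute)
    next
      case False
      then have cS: "Suc (Suc n) \<le> card S" using Suc.prems(2) by simp
      show ?thesis
      proof (cases "\<exists>s\<in>S. \<exists>y\<in>hyperplane V (L s). mpoly_eval y f \<noteq> 0")
        case True
        then obtain s y where s: "s \<in> S" "y \<in> hyperplane V (L s)" "mpoly_eval y f \<noteq> 0" by blast
        have "m * card (S - {s}) \<le> n * k"
          by (rule Suc.IH[OF gen_pos_restrict[OF gp s(1)] _ less.prems(1) s(2,3)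
                points_ord_restrict[OF less.prems(4) s(1) fin]])
            (use cS fin s(1) in simp)
        then have le: "m * (card S - 1) \<le> n * k" using fin s(1) by simp
        \<comment> \<open>On the hyperplane m (card S - 1) \<le> n k, and n \<le> card S - 1. Adding
          m \<le> k to this bound gives the claim.\<close>
        have "m \<le> k"
        proof (rule ccontr)
          assume "\<not> m \<le> k"
          then have "k < m" by simp
          have "n * k \<le> (card S - 1) * k" using cS by (intro mult_right_mono) auto
          also have "\<dots> < (card S - 1) * m" using \<open>k < m\<close> cS by simp
          finally show False using le by (simp add: mult.commute)
        qed
        have "m * card S = m * (card S - 1) + m" using cS by (cases "card S") auto
        also have "\<dots> \<le> n * k + k" using le \<open>m \<le> k\<close> by simp
        finally show ?thesis by simp
      next
        case zero: False
        obtain g where g: "card S \<le> k" "g \<in> forms N (k - card S)"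
          "\<And>x. x \<in> V \<Longrightarrow> mpoly_eval x f = mpoly_eval x ((\<Prod>a\<in>S. L a) * g)"
          using divide_all_on_vspace[OF gp cS less.prems(1-3) _ fin] zero by blast
        show ?thesis
        proof (cases "m \<le> Suc n")
          case True
          then show ?thesis using g(1) by (intro mult_le_mono) auto
        next
          case False
          \<comment> \<open>Exactly the n + 1 hyperplanes of T pass through p. Dividing by all L_a
            thus lowers the order by n + 1 and the degree by card S, and both sides of the
            inequality fall by (n + 1) card S.\<close>
          have ordg: "points_ord N (Suc n) V S L (m - Suc n) g"
            unfolding points_ord_def
          proof (intro allI impI ballI)
            fix T p assume T: "T \<subseteq> S" "card T = Suc n" and p: "p \<in> V" "\<exists>i\<le>N. p i \<noteq> 0" "\<forall>j\<in>T. mpoly_eval p (L j) = 0"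
            have "ord_at V m f p" using less.prems(4) T p unfolding points_ord_def by blast
            then have "ord_at V m ((\<Prod>a\<in>S. L a) * g) p"
              using ord_at_cong[OF V p(1) g(3)] by blast
            then have "ord_at V (m - card {a\<in>S. mpoly_eval p (L a) = 0}) g p"
            proof (rule ord_at_cancel_product[OF V p(1) fin, rotated 2])
              show "\<exists>v\<in>V. mpoly_eval v (L a) \<noteq> 0" if a: "a \<in> S" for a
              proof -
                obtain v where "v \<in> V" "mpoly_eval v (L a) = 1"
                  using gen_pos_unit_vector[OF gp a] cS by auto
                then show ?thesis by (intro bexI[of _ v]) auto
              qed
            qed (rule gen_posD(3)[OF gp])
            moreover have "{a\<in>S. mpoly_eval p (L a) = 0} = T"
            proof
              show "T \<subseteq> {a\<in>S. mpoly_eval p (L a) = 0}" using T p by auto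
              show "{a\<in>S. mpoly_eval p (L a) = 0} \<subseteq> T"
              proof (rule subsetI, rule ccontr)
                fix a assume a: "a \<in> {a\<in>S. mpoly_eval p (L a) = 0}" "a \<notin> T"
                have "finite T" using T(1) fin finite_subset by blast
                then have sub: "insert a T \<subseteq> S" "card (insert a T) = Suc (Suc n)" using a T by auto
                have van: "mpoly_eval p (L j) = 0" if "j \<in> insert a T" for j using a p(3) that by auto
                have "p i = 0" if "i \<le> N" for i
                  by (rule gen_pos_no_common_zero[OF gp sub p(1) van that])
                then show False using p(2) by blast
              qed
            qed
            ultimately show "ord_at V (m - Suc n) g p" using T(2) by simp
          qed
          have "mpoly_eval x g \<noteq> 0" using g(3)[OF less.prems(2)] less.prems(3) by auto
          moreover have "k - card S < k" using g(1) cS by simp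
          ultimately have "(m - Suc n) * card S \<le> Suc n * (k - card S)"
            using less.IH[OF _ g(2) less.prems(2) _ ordg] by blast
          then have "m * card S - Suc n * card S \<le> Suc n * k - Suc n * card S"
            by (simp add: diff_mult_distrib diff_mult_distrib2)
          moreover have "Suc n * card S \<le> Suc n * k" using g(1) by (rule mult_le_mono2)
          moreover have "Suc n * card S \<le> m * card S" using False by (intro mult_le_mono1) simp
          ultimately show ?thesis by linarith
        qed
      qed
    qed
  qed
qed

end


section \<open>Forms vanishing to high order at the points\<close>

text \<open>\<open>power_span N L a S r k\<close> consists of the forms of degree \<open>k\<close> in the \<open>r\<close>-th power of the ideal
  generated by the products of \<open>a\<close> distinct forms among the \<open>L i\<close>, \<open>i \<in> S\<close>.\<close>

inductive power_span :: "nat \<Rightarrow> (nat \<Rightarrow> (nat, 'k::field) mpoly) \<Rightarrow> nat \<Rightarrow> nat set \<Rightarrow> nat \<Rightarrow> nat \<Rightarrow> (nat, 'k) mpoly \<Rightarrow> bool"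
  for N L a S where
  base: "h \<in> forms N k \<Longrightarrow> power_span N L a S 0 k h"
| mult: "power_span N L a S r k f \<Longrightarrow> B \<subseteq> S \<Longrightarrow> card B = a \<Longrightarrow> power_span N L a S (Suc r) (a + k) ((\<Prod>i\<in>B. L i) * f)"
| zero: "power_span N L a S r k 0"
| add: "power_span N L a S r k f \<Longrightarrow> power_span N L a S r k g \<Longrightarrow> power_span N L a S r k (f + g)"

lemma power_span_sum: "(\<And>i. i \<in> A \<Longrightarrow> power_span N L a S r k (f i)) \<Longrightarrow> power_span N L a S r k (\<Sum>i\<in>A. f i)"
  by (induction A rule: infinite_finite_induct) (auto intro: power_span.intros)

lemma prod_linear_form:
  assumes "\<And>i. i \<in> B \<Longrightarrow> L i \<in> forms N 1"
  shows "(\<Prod>i\<in>B. L i) \<in> forms N (card B)"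
  using forms_prod[of B L N "\<lambda>_. 1"] assms by simp

lemma power_span_form:
  assumes "\<And>i. i \<in> S \<Longrightarrow> L i \<in> forms N 1"
  shows "power_span N L a S r k f \<Longrightarrow> f \<in> forms N k"
proof (induction rule: power_span.induct)
  case (mult r k f B)
  have "(\<Prod>i\<in>B. L i) \<in> forms N (card B)" by (rule prod_linear_form) (use assms mult(2) in blast)
  then show ?case using mult by (auto intro: forms_mult)
qed auto

lemma power_span_zero_exponent:
  assumes "\<And>i. i \<in> S \<Longrightarrow> L i \<in> forms N 1" "h \<in> forms N k"
  shows "power_span N L 0 S r k h"
proof (induction r)
  case 0
  show ?case by (rule power_span.base[OF assms(2)])
next
  case (Suc r)
  from power_span.mult[OF Suc, of "{}"] show ?case by simp
qed

lemma form_as_variables: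
  assumes "f \<in> forms N k" "k = Suc n"
  shows "\<exists>h. (\<forall>i\<le>N. h i \<in> forms N n) \<and> f = (\<Sum>i\<le>N. var i * h i :: (nat, 'k::field) mpoly)"
  using assms
proof (induction arbitrary: n rule: forms_induct)
  case (zero m)
  show ?case by (intro exI[of _ "\<lambda>_. 0"]) simp
next
  case (add m p q)
  then obtain h g where "\<forall>i\<le>N. h i \<in> forms N n" "p = (\<Sum>i\<le>N. var i * h i)"
    "\<forall>i\<le>N. g i \<in> forms N n" "q = (\<Sum>i\<le>N. var i * g i)" by blast
  then show ?case by (intro exI[of _ "\<lambda>i. h i + g i"]) (simp add: distrib_left sum.distrib)
next
  case (var m i p)
  have "(\<Sum>j\<le>N. var j * (if j = i then p else 0)) = (\<Sum>j\<le>N. if j = i then var i * p else 0)"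
    by (intro sum.cong) auto
  also have "\<dots> = var i * p" using var(1) by (simp add: sum.delta)
  finally show ?case using var by (intro exI[of _ "\<lambda>j. if j = i then p else 0"]) auto
qed auto

text \<open>The products of \<open>card S - n\<close> of the \<open>L i\<close> span all forms of that degree, because any
  \<open>n + 1\<close> of them are a basis of the linear forms.\<close>

lemma forms_in_product_span:
  fixes L :: "nat \<Rightarrow> (nat, 'k::field) mpoly"
  assumes gp: "gen_pos N n V S L" and a: "a + n \<le> card S" and f: "f \<in> forms N k" "a \<le> k"
  shows "\<exists>g. power_span N L a S 1 k g \<and> (\<forall>x\<in>V. mpoly_eval x f = mpoly_eval x g)"
  using a f(2)
proof (induction a)
  case 0
  have "power_span N L 0 S 1 k f" by (rule power_span_zero_exponent[OF gen_posD(3)[OF gp] f(1)])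
  then show ?case by blast
next
  case (Suc a)
  have fin: "finite S" by (rule gen_posD(2)[OF gp])
  obtain g where g: "power_span N L a S 1 k g" "\<forall>x\<in>V. mpoly_eval x f = mpoly_eval x g"
    using Suc by auto
  \<comment> \<open>r is a variable for the sake of the rule induction; only r = 1 matters.\<close>
  have "power_span N L a S r k g \<Longrightarrow> r = 1 \<longrightarrow> Suc a \<le> k \<longrightarrow>
      (\<exists>h. power_span N L (Suc a) S 1 k h \<and> (\<forall>x\<in>V. mpoly_eval x g = mpoly_eval x h))" for r k g
  proof (induction rule: power_span.induct)
    case (mult r k f B)
    show ?case
    proof (intro impI)
      assume r: "Suc r = 1" and k: "Suc a \<le> a + k"
      then have "power_span N L a S 0 k f" using mult(1) by simp
      then have ff: "f \<in> forms N k" by (rule power_span_form[rotated]) (rule gen_posD(3)[OF gp])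
      obtain k' where k': "k = Suc k'" using k by (cases k) auto
      obtain h where h: "\<forall>i\<le>N. h i \<in> forms N k'" "f = (\<Sum>i\<le>N. var i * h i)"
        using form_as_variables[OF ff k'] by blast
      have finB: "finite B" using mult(2) fin finite_subset by blast
      \<comment> \<open>Outside B there remain n + 1 of the forms, so every variable is a
        combination of them on V and one more factor can be moved into the product.\<close>
      have "Suc n \<le> card (S - B)" using Suc.prems(1) mult(2,3) fin finB by (simp add: card_Diff_subset)
      then obtain T where T: "T \<subseteq> S - B" "card T = Suc n" "finite T"
        using obtain_subset_with_card_n by blast
      have TS: "T \<subseteq> S" using T(1) by blast
      have "\<forall>i\<in>{..N}. \<exists>c. \<forall>x\<in>V. x i = (\<Sum>j\<in>T. c j * mpoly_eval x (L j))"
        using gen_posD(4)[OF gp TS T(2)] by simp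
      from bchoice[OF this] obtain c where
        c: "\<forall>i\<in>{..N}. \<forall>x\<in>V. x i = (\<Sum>j\<in>T. c i j * mpoly_eval x (L j))" ..
      define g' where "g' = (\<Sum>i\<le>N. \<Sum>j\<in>T. (\<Prod>b\<in>insert j B. L b) * (const (c i j) * h i))"
      have "power_span N L (Suc a) S 1 (Suc a + k') g'"
        unfolding g'_def
      proof (intro power_span_sum)
        fix i j assume i: "i \<in> {..N}" and j: "j \<in> T"
        have "power_span N L (Suc a) S 0 k' (const (c i j) * h i)"
          using h(1) i by (intro power_span.base forms_const_mult) auto
        moreover have "insert j B \<subseteq> S" using j T(1) mult(2) by blast
        moreover have "card (insert j B) = Suc a" using j T(1) mult(3) finB by (subst card_insert_disjoint) auto
        ultimately show "power_span N L (Suc a) S 1 (Suc a + k') ((\<Prod>b\<in>insert j B. L b) * (const (c i j) * h i))"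
          unfolding One_nat_def by (rule power_span.mult)
      qed
      moreover have "mpoly_eval x ((\<Prod>b\<in>B. L b) * f) = mpoly_eval x g'" if x: "x \<in> V" for x
      proof -
        let ?P = "\<Prod>b\<in>B. mpoly_eval x (L b)"
        have ins: "(\<Prod>b\<in>insert j B. mpoly_eval x (L b)) = mpoly_eval x (L j) * ?P" if "j \<in> T" for j
          using that T(1) finB by (subst prod.insert) auto
        have "mpoly_eval x ((\<Prod>b\<in>B. L b) * f) = (\<Sum>i\<le>N. ?P * (x i * mpoly_eval x (h i)))"
          unfolding h(2) by (simp add: sum_distrib_left)
        also have "\<dots> = (\<Sum>i\<le>N. \<Sum>j\<in>T. (\<Prod>b\<in>insert j B. mpoly_eval x (L b)) * (c i j * mpoly_eval x (h i)))"
        proof (intro sum.cong refl)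
          fix i assume "i \<in> {..N}"
          then have xi: "x i = (\<Sum>j\<in>T. c i j * mpoly_eval x (L j))" using c x by blast
          have "?P * (x i * mpoly_eval x (h i)) = (\<Sum>j\<in>T. (mpoly_eval x (L j) * ?P) * (c i j * mpoly_eval x (h i)))"
            unfolding xi sum_distrib_left sum_distrib_right by (intro sum.cong refl) (simp add: mult_ac)
          also have "\<dots> = (\<Sum>j\<in>T. (\<Prod>b\<in>insert j B. mpoly_eval x (L b)) * (c i j * mpoly_eval x (h i)))"
            by (intro sum.cong refl) (simp only: ins)
          finally show "?P * (x i * mpoly_eval x (h i)) = (\<Sum>j\<in>T. (\<Prod>b\<in>insert j B. mpoly_eval x (L b)) * (c i j * mpoly_eval x (h i)))" .
        qed
        also have "\<dots> = mpoly_eval x g'" unfolding g'_def by simp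
        finally show ?thesis .
      qed
      moreover have "Suc a + k' = a + k" using k' by simp
      ultimately show "\<exists>h. power_span N L (Suc a) S 1 (a + k) h \<and> (\<forall>x\<in>V. mpoly_eval x ((\<Prod>b\<in>B. L b) * f) = mpoly_eval x h)"
        by (intro exI[of _ g'] conjI ballI) (simp_all only:)
    qed
  next
    case (zero r k)
    show ?case by (intro impI exI[of _ 0]) (auto intro: power_span.zero)
  next
    case (add r k f g)
    show ?case
    proof (intro impI)
      assume rk: "r = 1" "Suc a \<le> k"
      obtain h h' where "power_span N L (Suc a) S 1 k h" "\<forall>x\<in>V. mpoly_eval x f = mpoly_eval x h"
        "power_span N L (Suc a) S 1 k h'" "\<forall>x\<in>V. mpoly_eval x g = mpoly_eval x h'"
        using add.IH rk by blast
      then show "\<exists>h. power_span N L (Suc a) S 1 k h \<and> (\<forall>x\<in>V. mpoly_eval x (f + g) = mpoly_eval x h)"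
        by (intro exI[of _ "h + h'"]) (auto intro: power_span.add)
    qed
  qed auto
  from this[OF g(1)] obtain h where "power_span N L (Suc a) S 1 k h" "\<forall>x\<in>V. mpoly_eval x g = mpoly_eval x h"
    using Suc.prems by blast
  then show ?case using g(2) by (intro exI[of _ h]) auto
qed

text \<open>Restricting to the hyperplane \<open>L s = 0\<close> turns products of \<open>a\<close> of the \<open>L i\<close>, \<open>i \<noteq> s\<close>, times
  \<open>L s\<close> into all forms of degree \<open>a\<close>; this lifts elements of powers from the hyperplane.\<close>

lemma lift_form:
  fixes L :: "nat \<Rightarrow> (nat, 'k::field) mpoly"
  assumes gp: "gen_pos N n W (S - {s}) L" and s: "s \<in> S" "finite S" "L s \<in> forms N 1"
    and a: "a + n \<le> card (S - {s})"
  shows "f \<in> forms N k \<Longrightarrow> j * a \<le> k \<Longrightarrow>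
    \<exists>g\<in>forms N k. power_span N L (Suc a) S j (k + j) (L s ^ j * g) \<and> (\<forall>x\<in>W. mpoly_eval x f = mpoly_eval x g)"
proof (induction j arbitrary: f k)
  case 0
  then show ?case by (intro bexI[of _ f]) (auto intro: power_span.base)
next
  case (Suc j)
  have Lf: "L i \<in> forms N 1" if "i \<in> S - {s}" for i using gen_posD(3)[OF gp that] .
  obtain g where g: "power_span N L a (S - {s}) 1 k g" "\<forall>x\<in>W. mpoly_eval x f = mpoly_eval x g"
    using forms_in_product_span[OF gp a Suc.prems(1)] Suc.prems(2) by auto
  have "power_span N L a (S - {s}) r k g \<Longrightarrow> r = 1 \<longrightarrow> Suc j * a \<le> k \<longrightarrow>
    (\<exists>h\<in>forms N k. power_span N L (Suc a) S (Suc j) (k + Suc j) (L s ^ Suc j * h) \<and> (\<forall>x\<in>W. mpoly_eval x g = mpoly_eval x h))" for r k g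
  proof (induction rule: power_span.induct)
    case (mult r k f B)
    show ?case
    proof (intro impI)
      assume r: "Suc r = 1" and k: "Suc j * a \<le> a + k"
      then have "power_span N L a (S - {s}) 0 k f" using mult(1) by simp
      then have ff: "f \<in> forms N k" by (rule power_span_form[rotated]) (rule Lf)
      obtain g where g: "g \<in> forms N k" "power_span N L (Suc a) S j (k + j) (L s ^ j * g)"
        "\<forall>x\<in>W. mpoly_eval x f = mpoly_eval x g"
        using Suc.IH[OF ff] k by auto
      have finB: "finite B" using mult(2) s(2) finite_subset by blast
      have sB: "s \<notin> B" using mult(2) by blast
      have "insert s B \<subseteq> S" using mult(2) s(1) by blast
      moreover have "card (insert s B) = Suc a" using sB finB mult(3) by simp
      ultimately have "power_span N L (Suc a) S (Suc j) (Suc a + (k + j)) ((\<Prod>i\<in>insert s B. L i) * (L s ^ j * g))"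
        by (rule power_span.mult[OF g(2)])
      also have "(\<Prod>i\<in>insert s B. L i) * (L s ^ j * g) = L s ^ Suc j * ((\<Prod>i\<in>B. L i) * g)"
        using sB finB by (simp add: mult_ac)
      also have "Suc a + (k + j) = a + k + Suc j" by simp
      finally have ps: "power_span N L (Suc a) S (Suc j) (a + k + Suc j) (L s ^ Suc j * ((\<Prod>i\<in>B. L i) * g))" .
      have "(\<Prod>i\<in>B. L i) \<in> forms N (card B)" by (rule prod_linear_form) (use Lf mult(2) in blast)
      then have "(\<Prod>i\<in>B. L i) * g \<in> forms N (a + k)" using g(1) mult(3) by (auto intro: forms_mult)
      then show "\<exists>h\<in>forms N (a + k). power_span N L (Suc a) S (Suc j) (a + k + Suc j) (L s ^ Suc j * h) \<and>
          (\<forall>x\<in>W. mpoly_eval x ((\<Prod>i\<in>B. L i) * f) = mpoly_eval x h)"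
        using ps g(3) by (intro bexI[of _ "(\<Prod>i\<in>B. L i) * g"]) auto
    qed
  next
    case (zero r k)
    have "power_span N L (Suc a) S (Suc j) (k + Suc j) (L s ^ Suc j * 0)"
      unfolding mult_zero_right by (rule power_span.zero)
    then show ?case by (intro impI bexI[of _ 0]) auto
  next
    case (add r k f g)
    show ?case
    proof (intro impI)
      assume rk: "r = 1" "Suc j * a \<le> k"
      obtain h where h: "h \<in> forms N k" "power_span N L (Suc a) S (Suc j) (k + Suc j) (L s ^ Suc j * h)" "\<forall>x\<in>W. mpoly_eval x f = mpoly_eval x h"
        using add.IH(1) rk by blast
      obtain h' where h': "h' \<in> forms N k" "power_span N L (Suc a) S (Suc j) (k + Suc j) (L s ^ Suc j * h')" "\<forall>x\<in>W. mpoly_eval x g = mpoly_eval x h'"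
        using add.IH(2) rk by blast
      have "power_span N L (Suc a) S (Suc j) (k + Suc j) (L s ^ Suc j * (h + h'))"
        unfolding distrib_left by (rule power_span.add[OF h(2) h'(2)])
      then show "\<exists>h\<in>forms N k. power_span N L (Suc a) S (Suc j) (k + Suc j) (L s ^ Suc j * h) \<and> (\<forall>x\<in>W. mpoly_eval x (f + g) = mpoly_eval x h)"
        using h(1,3) h'(1,3) by (intro bexI[of _ "h + h'"]) auto
    qed
  qed auto
  from this[OF g(1)] obtain h where "h \<in> forms N k"
    "power_span N L (Suc a) S (Suc j) (k + Suc j) (L s ^ Suc j * h)" "\<forall>x\<in>W. mpoly_eval x g = mpoly_eval x h"
    using Suc.prems(2) by blast
  then show ?case using g(2) by (intro bexI[of _ h]) auto
qed

text \<open>The q products already present avoid s and are kept. The j factors L_s are spent by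
  \<open>lift_form\<close> on the remaining factor, whose degree is still at least j a.\<close>

lemma lift_power_span:
  fixes L :: "nat \<Rightarrow> (nat, 'k::field) mpoly"
  assumes gp: "gen_pos N n W (S - {s}) L" and s: "s \<in> S" "finite S" "L s \<in> forms N 1"
    and a: "a + n \<le> card (S - {s})"
  shows "power_span N L (Suc a) (S - {s}) q k f \<Longrightarrow> q * Suc a + j * a \<le> k \<longrightarrow>
    (\<exists>g\<in>forms N k. power_span N L (Suc a) S (q + j) (k + j) (L s ^ j * g) \<and> (\<forall>x\<in>W. mpoly_eval x f = mpoly_eval x g))"
proof (induction rule: power_span.induct)
  case (base h k)
  then show ?case using lift_form[OF gp s a, of h k j] by simp
next
  case (mult r k f B)
  show ?case
  proof
    assume k: "Suc r * Suc a + j * a \<le> Suc a + k"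
    then obtain g where g: "g \<in> forms N k" "power_span N L (Suc a) S (r + j) (k + j) (L s ^ j * g)"
      "\<forall>x\<in>W. mpoly_eval x f = mpoly_eval x g" using mult.IH by auto
    have "B \<subseteq> S" using mult(2) by blast
    then have "power_span N L (Suc a) S (Suc (r + j)) (Suc a + (k + j)) ((\<Prod>i\<in>B. L i) * (L s ^ j * g))"
      using mult(3) by (rule power_span.mult[OF g(2)])
    also have "(\<Prod>i\<in>B. L i) * (L s ^ j * g) = L s ^ j * ((\<Prod>i\<in>B. L i) * g)" by (simp add: mult_ac)
    finally have ps: "power_span N L (Suc a) S (Suc r + j) (Suc a + k + j) (L s ^ j * ((\<Prod>i\<in>B. L i) * g))"
      by (simp add: add_ac)
    have "(\<Prod>i\<in>B. L i) \<in> forms N (card B)" by (rule prod_linear_form) (use gen_posD(3)[OF gp] mult(2) in blast)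
    from forms_mult[OF this g(1)] have "(\<Prod>i\<in>B. L i) * g \<in> forms N (Suc a + k)" unfolding mult(3) .
    then show "\<exists>g\<in>forms N (Suc a + k). power_span N L (Suc a) S (Suc r + j) (Suc a + k + j) (L s ^ j * g) \<and>
        (\<forall>x\<in>W. mpoly_eval x ((\<Prod>i\<in>B. L i) * f) = mpoly_eval x g)"
      using ps g(3) by (intro bexI[of _ "(\<Prod>i\<in>B. L i) * g"]) auto
  qed
next
  case (zero r k)
  have "power_span N L (Suc a) S (r + j) (k + j) (L s ^ j * 0)"
    unfolding mult_zero_right by (rule power_span.zero)
  then show ?case by (intro impI bexI[of _ 0]) auto
next
  case (add r k f g)
  show ?case
  proof
    assume rk: "r * Suc a + j * a \<le> k"
    obtain h where h: "h \<in> forms N k" "power_span N L (Suc a) S (r + j) (k + j) (L s ^ j * h)" "\<forall>x\<in>W. mpoly_eval x f = mpoly_eval x h"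
      using add.IH(1) rk by blast
    obtain h' where h': "h' \<in> forms N k" "power_span N L (Suc a) S (r + j) (k + j) (L s ^ j * h')" "\<forall>x\<in>W. mpoly_eval x g = mpoly_eval x h'"
      using add.IH(2) rk by blast
    have "power_span N L (Suc a) S (r + j) (k + j) (L s ^ j * (h + h'))"
      unfolding distrib_left by (rule power_span.add[OF h(2) h'(2)])
    then show "\<exists>h\<in>forms N k. power_span N L (Suc a) S (r + j) (k + j) (L s ^ j * h) \<and> (\<forall>x\<in>W. mpoly_eval x (f + g) = mpoly_eval x h)"
      using h(1,3) h'(1,3) by (intro bexI[of _ "h + h'"]) auto
  qed
qed

text \<open>Each of the r products takes one of the r factors L_s.\<close>

lemma power_span_insert:
  assumes "s \<in> S" "finite S"
  shows "power_span N L a (S - {s}) r k f \<Longrightarrow> power_span N L (Suc a) S r (k + r) (L s ^ r * f)"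
proof (induction rule: power_span.induct)
  case (base h k)
  then show ?case by (auto intro: power_span.base)
next
  case (mult r k f B)
  have "finite B" "s \<notin> B" using mult(2) assms(2) finite_subset by blast+
  moreover have "insert s B \<subseteq> S" using mult(2) assms(1) by blast
  ultimately have "power_span N L (Suc a) S (Suc r) (Suc a + (k + r)) ((\<Prod>i\<in>insert s B. L i) * (L s ^ r * f))"
    using mult by (intro power_span.mult) auto
  also have "(\<Prod>i\<in>insert s B. L i) * (L s ^ r * f) = L s ^ Suc r * ((\<Prod>i\<in>B. L i) * f)"
    using \<open>finite B\<close> \<open>s \<notin> B\<close> by (simp add: mult_ac)
  also have "Suc a + (k + r) = a + k + Suc r" by simp
  finally show ?case .
next
  case (zero r k)
  show ?case unfolding mult_zero_right by (rule power_span.zero)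
next
  case (add r k f g)
  from power_span.add[OF add.IH] show ?case unfolding distrib_left .
qed

context infinite_field
begin

text \<open>More than card S - a of the forms vanish at p, so every product of a of them contains
  one of these.\<close>

lemma power_span_ord:
  fixes L :: "nat \<Rightarrow> (nat, 'k) mpoly"
  assumes "power_span N L a S r k f" and fin: "finite S"
    and T: "T \<subseteq> S" "card S < a + card T" and p: "\<And>j. j \<in> T \<Longrightarrow> mpoly_eval p (L j) = 0"
  shows "ord_at V r f p"
  using assms(1)
proof (induction rule: power_span.induct)
  case (mult r k f B)
  have "B \<inter> T \<noteq> {}"
  proof
    assume "B \<inter> T = {}"
    moreover have "finite B" "finite T" using mult(2) T(1) fin finite_subset by blast+
    ultimately have "card (B \<union> T) = a + card T" using mult(3) by (simp add: card_Un_disjoint)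
    moreover have "card (B \<union> T) \<le> card S" using mult(2) T(1) fin by (intro card_mono) auto
    ultimately show False using T(2) by simp
  qed
  then obtain j where j: "j \<in> B" "j \<in> T" by blast
  have "finite B" using mult(2) fin finite_subset by blast
  then have "mpoly_eval p (\<Prod>i\<in>B. L i) = 0" using j p by (auto intro!: prod_zero)
  then have "ord_at V 1 (\<Prod>i\<in>B. L i) p" by (rule ord_at_1)
  from ord_at_mult[OF this mult.IH] show ?case by simp
qed (auto intro: ord_at_0 ord_at_zero ord_at_add)

lemma ord_at_cancel_power:
  assumes V: "vspace V" and l: "l \<in> forms N 1" "mpoly_eval p l = 0" and v: "v \<in> V" "mpoly_eval v l \<noteq> 0"
  shows "ord_at V m (l ^ j * f) p \<Longrightarrow> ord_at V (m - j) f (p :: nat \<Rightarrow> 'k)"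
proof (induction j arbitrary: m)
  case (Suc j)
  have "ord_at V (m - 1) (l ^ j * f) p"
    by (rule ord_at_cancel_linear[OF V l v]) (use Suc.prems in \<open>simp add: mult.assoc\<close>)
  from Suc.IH[OF this] show ?case by simp
qed simp

lemma ord_at_diff: "ord_at V m f p \<Longrightarrow> ord_at V m g p \<Longrightarrow> ord_at V m (f - g) (p :: nat \<Rightarrow> 'k)"
proof -
  assume f: "ord_at V m f p" and g: "ord_at V m g p"
  have "ord_at V (0 + m) (const (-1) * g) p" by (rule ord_at_mult[OF ord_at_0 g])
  from ord_at_add[OF f this[simplified]] show ?thesis by (simp add: const_uminus)
qed

text \<open>Successive division by \<open>L s\<close>: after \<open>j\<close> steps the quotient still has order \<open>r - j\<close> at the
  points on \<open>L s = 0\<close>, so its restriction is in the \<open>(r - j)\<close>-th power by induction; after \<open>r\<close>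
  steps only the points off that hyperplane matter.\<close>

theorem high_order_form_in_power:
  fixes L :: "nat \<Rightarrow> (nat, 'k) mpoly"
  assumes "gen_pos N n V S L" "n \<le> Suc (card S)" "r * (Suc (card S) - n) \<le> k" "f \<in> forms N k"
    and "points_ord N n V S L r f"
  shows "\<exists>g. power_span N L (Suc (card S) - n) S r k g \<and> (\<forall>x\<in>V. mpoly_eval x f = mpoly_eval x g)"
  using assms
proof (induction n arbitrary: V S r k f)
  case 0
  note gp = "0.prems"(1)
  show ?case
  proof (cases "r = 0")
    case True
    then show ?thesis using "0.prems"(4) by (auto intro: power_span.base)
  next
    case False
    have "mpoly_eval x f = 0" if x: "x \<in> V" for x
    proof (rule ccontr)
      assume nz: "mpoly_eval x f \<noteq> 0"
      obtain p where p: "p \<in> V" "\<exists>i\<le>N. p i \<noteq> 0" using gen_posD(5)[OF gp, of "{}"] by auto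
      have "r * card S \<le> 0 * k"
        by (rule points_ord_degree_bound[OF gp _ "0.prems"(4) x nz "0.prems"(5)]) simp
      obtain y where y: "y \<in> V" "\<exists>i\<le>N. y i \<noteq> 0" "mpoly_eval y f \<noteq> 0"
        using form_nonzero_vector[OF "0.prems"(4) x nz p] by blast
      have "ord_at V r f y"
        by (rule "0.prems"(5)[unfolded points_ord_def, rule_format, of "{}"]) (use y in simp_all)
      then have "monom 1 r dvd line_poly f y y" using y(1) unfolding ord_at_def by blast
      then obtain q where "line_poly f y y = monom 1 r * q" by (rule dvdE)
      then have "mpoly_eval y f = 0 ^ r * poly q 0"
        using poly_line_poly[of f y y 0] by (simp add: poly_monom)
      then show False using y(3) False by (simp add: zero_power)
    qed
    then show ?thesis by (intro exI[of _ 0]) (auto intro: power_span.zero)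
  qed
next
  case (Suc n V S r k f)
  from Suc.prems show ?case
  proof (induction "card S" arbitrary: S k f)
    case 0
    note gp = "0.prems"(1)
    have "Suc (card S) - Suc n = 0" using "0.hyps" by simp
    then show ?case
      using power_span_zero_exponent[of S L N f k r] gen_posD(3)[OF gp] "0.prems"(4) by auto
  next
    case (Suc m S k f)
    note gp = Suc.prems(1)
    show ?case
    proof (cases "card S = n")
      \<comment> \<open>The products have no factors here, so the r-th power is everything.\<close>
      case True
      then show ?thesis
        using power_span_zero_exponent[of S L N f k r] gen_posD(3)[OF gp] Suc.prems(4) by auto
    next
      case False
      then have n: "Suc n \<le> card S" using Suc.prems(2) by simp
      have V: "vspace V" and fin: "finite S" by (rule gen_posD[OF gp])+
      obtain s where s: "s \<in> S" using n by fastforce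
      have cS': "card (S - {s}) = m" "card S = Suc m" using s fin Suc.hyps(2) by simp_all
      define b where "b = m - n"
      have mb: "m = n + b" using n cS' by (simp add: b_def)
      have ab: "Suc (card S) - Suc n = Suc b" using cS' mb by simp
      have Ls: "L s \<in> forms N 1" by (rule gen_posD(3)[OF gp s])
      obtain v where v: "v \<in> V" "mpoly_eval v (L s) = 1"
        using gen_pos_unit_vector[OF gp s] n by auto
      define W where "W = hyperplane V (L s)"
      have gpW: "gen_pos N n W (S - {s}) L" unfolding W_def by (rule gen_pos_restrict[OF gp s])
      have rk: "r * Suc b \<le> k" using Suc.prems(3) unfolding ab .
      have step: "j \<le> r \<Longrightarrow> \<exists>H G. power_span N L (Suc b) S r k H \<and> G \<in> forms N (k - j) \<and>
          (\<forall>x\<in>V. mpoly_eval x f = mpoly_eval x (H + L s ^ j * G))" for j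
      proof (induction j)
        case 0
        show ?case using Suc.prems(4) by (intro exI[of _ 0] exI[of _ f]) (auto intro: power_span.zero)
      next
        case (Suc j)
        then obtain H G where H: "power_span N L (Suc b) S r k H" and G: "G \<in> forms N (k - j)"
          and fHG: "\<forall>x\<in>V. mpoly_eval x f = mpoly_eval x (H + L s ^ j * G)" by auto
        have jr: "j < r" using Suc.prems by simp
        \<comment> \<open>The degree k - j of G has to pay for r - j products of b + 1 factors on
          the hyperplane and for lifting with j factors L_s, at b each.\<close>
        have split: "r * Suc b = (r - j) * Suc b + j * b + j"
        proof -
          have "r = (r - j) + j" using jr by simp
          then have "r * Suc b = (r - j) * Suc b + j * Suc b" by (metis add_mult_distrib)
          then show ?thesis by simp
        qed
        have kj: "(r - j) * Suc b + j * b \<le> k - j" "j < k"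
        proof -
          show "(r - j) * Suc b + j * b \<le> k - j" using rk split by linarith
          have "0 < (r - j) * Suc b" using jr by simp
          then show "j < k" using rk split by linarith
        qed
        have ordG: "points_ord N n W (S - {s}) L (r - j) G"
          unfolding points_ord_def
        proof (intro allI impI ballI)
          fix T p assume T: "T \<subseteq> S - {s}" "card T = n" and p: "p \<in> W" "\<exists>i\<le>N. p i \<noteq> 0" "\<forall>j\<in>T. mpoly_eval p (L j) = 0"
          have pV: "p \<in> V" "mpoly_eval p (L s) = 0" using p(1) by (auto simp: W_def hyperplane_def)
          have "finite T" "s \<notin> T" using T(1) fin finite_subset by blast+
          then have T': "insert s T \<subseteq> S" "card (insert s T) = Suc n" using T s by auto
          have p': "\<forall>j\<in>insert s T. mpoly_eval p (L j) = 0" using p(3) pV(2) by auto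
          have "ord_at V r f p"
            by (rule \<open>points_ord N (Suc n) V S L r f\<close>[unfolded points_ord_def, rule_format, OF T' pV(1) p(2)]) (use p' in blast)
          moreover have "ord_at V r H p"
            by (rule power_span_ord[OF H fin T'(1)]) (use T'(2) p' cS' mb in auto)
          ultimately have "ord_at V r (f - H) p" by (rule ord_at_diff)
          then have "ord_at V r (L s ^ j * G) p"
            by (subst (asm) ord_at_cong[OF V pV(1), of _ "L s ^ j * G"]) (use fHG in auto)
          then have "ord_at V (r - j) G p"
            by (rule ord_at_cancel_power[OF V Ls pV(2) v(1), rotated]) (use v(2) in simp)
          then show "ord_at W (r - j) G p"
            by (rule ord_at_mono_space) (auto simp: W_def hyperplane_def)
        qed
        have "Suc (card (S - {s})) - n = Suc b" using cS' mb by simp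
        moreover have "\<exists>g. power_span N L (Suc (card (S - {s})) - n) (S - {s}) (r - j) (k - j) g \<and> (\<forall>x\<in>W. mpoly_eval x G = mpoly_eval x g)"
          by (rule \<open>\<And>V S r k f. gen_pos N n V S L \<Longrightarrow> n \<le> Suc (card S) \<Longrightarrow> r * (Suc (card S) - n) \<le> k \<Longrightarrow> f \<in> forms N k \<Longrightarrow>
              points_ord N n V S L r f \<Longrightarrow> \<exists>g. power_span N L (Suc (card S) - n) S r k g \<and> (\<forall>x\<in>V. mpoly_eval x f = mpoly_eval x g)\<close>[OF gpW _ _ G ordG])
            (use cS' mb kj in simp_all)
        ultimately obtain h where h: "power_span N L (Suc b) (S - {s}) (r - j) (k - j) h" "\<forall>x\<in>W. mpoly_eval x G = mpoly_eval x h"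
          by auto
        have ba: "b + n \<le> card (S - {s})" using cS' mb by simp
        obtain g where g: "g \<in> forms N (k - j)" "power_span N L (Suc b) S (r - j + j) (k - j + j) (L s ^ j * g)"
          "\<forall>x\<in>W. mpoly_eval x h = mpoly_eval x g"
          using lift_power_span[OF gpW s fin Ls ba h(1), of j] kj(1) by blast
        have ps: "power_span N L (Suc b) S r k (L s ^ j * g)" using g(2) jr kj(2) by simp
        have "\<exists>G'\<in>forms N (k - j - 1). (k - j = 0 \<longrightarrow> G' = 0) \<and> (\<forall>x\<in>V. mpoly_eval x (G - g) = mpoly_eval x (L s * G'))"
          by (rule divide_on_vspace[OF V Ls v forms_diff[OF G g(1)]]) (use h(2) g(3) in \<open>simp add: W_def\<close>)
        then obtain G' where G': "G' \<in> forms N (k - j - 1)" "\<forall>x\<in>V. mpoly_eval x (G - g) = mpoly_eval x (L s * G')"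
          by (elim bexE conjE) (rule that)
        have "mpoly_eval x f = mpoly_eval x ((H + L s ^ j * g) + L s ^ Suc j * G')" if x: "x \<in> V" for x
        proof -
          have "mpoly_eval x G = mpoly_eval x g + mpoly_eval x (L s) * mpoly_eval x G'"
            using bspec[OF G'(2) x] by (simp add: algebra_simps)
          then show ?thesis using bspec[OF fHG x] by (simp add: algebra_simps)
        qed
        then show ?case
          using power_span.add[OF H ps] G'(1) by (intro exI[of _ "H + L s ^ j * g"] exI[of _ G']) auto
      qed
      obtain H G where H: "power_span N L (Suc b) S r k H" and G: "G \<in> forms N (k - r)"
        and fHG: "\<forall>x\<in>V. mpoly_eval x f = mpoly_eval x (H + L s ^ r * G)" using step[of r] by auto
      \<comment> \<open>The points on L_s = 0 are settled. Without s the products have b factors,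
        and r b \<le> k - r, so the induction on card S applies to G; the factor L_s^r then restores
        the size b + 1.\<close>
      have rk': "r * b + r \<le> k" using rk by simp
      have ordG: "points_ord N (Suc n) V (S - {s}) L r G"
        unfolding points_ord_def
      proof (intro allI impI ballI)
        fix T p assume T: "T \<subseteq> S - {s}" "card T = Suc n" and p: "p \<in> V" "\<exists>i\<le>N. p i \<noteq> 0" "\<forall>j\<in>T. mpoly_eval p (L j) = 0"
        have TS: "T \<subseteq> S" using T(1) by blast
        have finT: "finite T" "s \<notin> T" using T(1) fin finite_subset by blast+
        have "ord_at V r f p"
          by (rule Suc.prems(5)[unfolded points_ord_def, rule_format, OF TS T(2) p(1,2)]) (use p(3) in blast)
        moreover have "ord_at V r H p"
          by (rule power_span_ord[OF H fin TS]) (use T(2) p(3) cS' mb in auto)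
        ultimately have "ord_at V r (f - H) p" by (rule ord_at_diff)
        then have ordL: "ord_at V r (L s ^ r * G) p"
          by (subst (asm) ord_at_cong[OF V p(1), of _ "L s ^ r * G"]) (use fHG in auto)
        have "mpoly_eval p (L s) \<noteq> 0"
        proof
          assume z: "mpoly_eval p (L s) = 0"
          have sub: "insert s T \<subseteq> S" "card (insert s T) = Suc (Suc n)" using TS s finT T(2) by auto
          have van: "mpoly_eval p (L j) = 0" if "j \<in> insert s T" for j using z p(3) that by auto
          have "p i = 0" if "i \<le> N" for i by (rule gen_pos_no_common_zero[OF gp sub p(1) van that])
          then show False using p(2) by blast
        qed
        then show "ord_at V r G p" by (intro ord_at_cancel_unit[OF ordL]) simp
      qed
      have "\<exists>g. power_span N L (Suc (card (S - {s})) - Suc n) (S - {s}) r (k - r) g \<and> (\<forall>x\<in>V. mpoly_eval x G = mpoly_eval x g)"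
        by (rule Suc.hyps(1)[OF _ gen_pos_subset[OF gp] _ _ G ordG]) (use cS' mb rk' in auto)
      moreover have "Suc (card (S - {s})) - Suc n = b" using cS' mb by simp
      ultimately obtain g where g: "power_span N L b (S - {s}) r (k - r) g" "\<forall>x\<in>V. mpoly_eval x G = mpoly_eval x g" by auto
      have "power_span N L (Suc b) S r (k - r + r) (L s ^ r * g)" by (rule power_span_insert[OF s fin g(1)])
      then have "power_span N L (Suc b) S r k (L s ^ r * g)" using rk' by simp
      from power_span.add[OF H this] show ?thesis
        unfolding ab using fHG g(2) by (intro exI[of _ "H + L s ^ r * g"]) auto
    qed
  qed
qed

end


section \<open>General hyperplanes and the resurgence of star configurations of points\<close>

section \<open>General hyperplanes\<close>

lemma single_one_inj: "single i (Suc 0) = single j (Suc 0) \<Longrightarrow> i = j"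
  by (metis lookup_single_eq lookup_single_not_eq nat.distinct(1))

lemma linear_form_eval:
  assumes "f \<in> forms N 1"
  shows "mpoly_eval x f = (\<Sum>j\<le>N. lookup f (single j 1) * x j)"
proof -
  have "\<mu> \<in> (\<lambda>j. single j 1) ` {..N}" if "\<mu> \<in> keys f" for \<mu>
  proof -
    have mu: "keys \<mu> \<subseteq> {0..N}" "tdeg \<mu> = 1"
      using that assms by (auto simp: forms_iff carrier_poly_ring)
    have "tdeg \<mu> = 1 \<longrightarrow> (\<exists>j. \<mu> = single j 1)"
    proof (induction \<mu> rule: mono_induct)
      case (add \<mu> v)
      show ?case
      proof
        assume "tdeg (single v 1 + \<mu>) = 1"
        then have "\<mu> = 0" by (simp add: tdeg_add)
        then show "\<exists>j. single v 1 + \<mu> = single j 1" by auto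
      qed
    qed simp
    then obtain j where "\<mu> = single j 1" using mu(2) by blast
    then show ?thesis using mu(1) by auto
  qed
  then have "mpoly_eval x f = (\<Sum>\<mu>\<in>(\<lambda>j. single j 1) ` {..N}. lookup f \<mu> * mono_eval x \<mu>)"
    by (intro mpoly_eval_superset) auto
  also have "\<dots> = (\<Sum>j\<le>N. lookup f (single j 1) * x j)"
    by (subst sum.reindex) (auto simp: inj_on_def dest: single_one_inj)
  finally show ?thesis .
qed

text \<open>Completing the hyperplanes indexed by \<open>T\<close> by coordinate hyperplanes gives a linear system that
  is invertible for general \<open>F\<close>, since it is so when the \<open>F i\<close> are the remaining coordinates.\<close>

lemma general_linear_coordinates:
  assumes T: "T \<subseteq> {1..s}" "card T \<le> Suc N" and \<tau>: "bij_betw \<tau> {Suc N - card T..N} T"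
    and G: "\<And>F i. G F i = (if i \<in> {Suc N - card T..N} then F (\<tau> i) else var i)"
  shows "for_general N s (\<lambda>_. 1) (\<lambda>F :: nat \<Rightarrow> (nat, 'k::field) mpoly. \<exists>C.
    (\<forall>i\<le>N. \<forall>x. x i = (\<Sum>j\<le>N. C i j * mpoly_eval x (G F j))) \<and>
    (\<forall>j\<le>N. \<forall>l\<le>N. mpoly_eval (\<lambda>i. C i j) (G F l) = (if l = j then 1 else 0)))"
proof -
  let ?I = "{Suc N - card T..N}"
  define PF :: "((nat \<Rightarrow> (nat, 'k) mpoly) \<Rightarrow> 'k) set" where "PF = range (\<lambda>q F. mpoly_eval (coords F) q)"
  define D :: "(nat \<Rightarrow> (nat, 'k) mpoly) set" where "D = hypersurface_tuples N s (\<lambda>_. 1)"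
  \<comment> \<open>With this choice the completed system at w consists of the coordinates in order,
    so its matrix is the identity. Off T any nonzero linear form will do.\<close>
  define w :: "nat \<Rightarrow> (nat, 'k) mpoly" where
    "w = (\<lambda>i\<in>{1..s}. if i \<in> T then var (inv_into ?I \<tau> i) else var 0)"
  have inv: "inv_into ?I \<tau> i \<in> ?I" if "i \<in> T" for i
    using \<tau> that inv_into_into[of i \<tau> ?I] by (simp add: bij_betw_def)
  have tauT: "\<tau> i \<in> T" "inv_into ?I \<tau> (\<tau> i) = i" if "i \<in> ?I" for i
    using \<tau> that inv_into_f_f[of \<tau> ?I i] by (auto simp: bij_betw_def)
  have var0: "(var i :: (nat, 'k) mpoly) \<noteq> 0" for i
    by (metis eval_0 eval_var[of "\<lambda>_. 1 :: 'k" i] zero_neq_one)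
  have "w \<in> D"
    unfolding D_def hypersurface_tuples_def
  proof (rule PiE_I)
    fix i assume "i \<in> {1..s}"
    then show "w i \<in> forms N 1 - {0}"
      using inv[of i] var0 forms_var[of "inv_into ?I \<tau> i" N] forms_var[of 0 N] by (auto simp: w_def)
  qed (auto simp: w_def)
  have Gw: "G w i = var i" for i
    using tauT[of i] T(1) by (auto simp: G w_def)
  have PF: "(\<lambda>F. mpoly_eval (coords F) q) \<in> PF" for q unfolding PF_def by (rule rangeI)
  interpret function_ring PF D w
  proof
    show "w \<in> D" by fact
    show "(\<lambda>_. c) \<in> PF" for c using PF[of "const c"] by simp
    fix f g assume "f \<in> PF" "g \<in> PF"
    then obtain p q where "f = (\<lambda>F. mpoly_eval (coords F) p)" "g = (\<lambda>F. mpoly_eval (coords F) q)"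
      unfolding PF_def by blast
    then show "(\<lambda>F. f F + g F) \<in> PF" "(\<lambda>F. f F * g F) \<in> PF" using PF[of "p + q"] PF[of "p * q"] by simp_all
  qed
  define A where "A i j F = lookup (G F i) (single j 1)" for i j F
  have Areg: "A i j \<in> regular" for i j
  proof (rule PF_regular)
    show "A i j \<in> PF"
    proof (cases "i \<in> ?I")
      case True
      then show ?thesis using PF[of "var (\<tau> i, single j 1)"] by (simp add: A_def[abs_def] G)
    next
      case False
      then show ?thesis
        using PF[of "const (lookup (var i) (single j 1))"] unfolding A_def[abs_def] G if_not_P[OF False] by simp
    qed
  qed
  have Aw: "A i j w = (if i = j then 1 else 0)" for i j
    by (auto simp: A_def Gw var_def lookup_single when_def dest: single_one_inj)
  obtain C where C: "near (\<lambda>p. \<forall>i\<in>{..N}. \<forall>l\<in>{..N}. (\<Sum>j\<in>{..N}. C i j p * A j l p) = (if i = l then 1 else 0))"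
    "near (\<lambda>p. \<forall>i\<in>{..N}. \<forall>l\<in>{..N}. (\<Sum>j\<in>{..N}. A i j p * C j l p) = (if i = l then 1 else 0))"
  proof (rule regular_inverse_matrix[of "{..N}" A])
    fix c :: "nat \<Rightarrow> 'k" assume "\<And>j. j \<in> {..N} \<Longrightarrow> (\<Sum>i\<in>{..N}. c i * A i j w) = 0"
    moreover have "(\<Sum>i\<in>{..N}. c i * A i j w) = c j" if "j \<in> {..N}" for j
    proof -
      have "(\<Sum>i\<in>{..N}. c i * A i j w) = (\<Sum>i\<in>{..N}. if i = j then c i else 0)"
        by (intro sum.cong) (auto simp: Aw)
      then show ?thesis using that by (simp add: sum.delta)
    qed
    ultimately show "\<forall>i\<in>{..N}. c i = 0" by simp
  qed (use Areg in auto)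
  obtain q where q: "q \<in> PF" "q w \<noteq> 0"
    "\<And>F. F \<in> D \<Longrightarrow> q F \<noteq> 0 \<Longrightarrow> (\<forall>i\<in>{..N}. \<forall>l\<in>{..N}. (\<Sum>j\<in>{..N}. C i j F * A j l F) = (if i = l then 1 else 0)) \<and>
      (\<forall>i\<in>{..N}. \<forall>l\<in>{..N}. (\<Sum>j\<in>{..N}. A i j F * C j l F) = (if i = l then 1 else 0))"
    using near_conj[OF C] unfolding near_def by blast
  obtain r where r: "q = (\<lambda>F. mpoly_eval (coords F) r)" using q(1) unfolding PF_def by blast
  show ?thesis
  proof (rule for_generalI[where w = w and q = r])
    show "w \<in> hypersurface_tuples N s (\<lambda>_. 1)" using \<open>w \<in> D\<close> by (simp add: D_def)
    show "mpoly_eval (coords w) r \<noteq> 0" using q(2) by (simp add: r)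
    fix F assume F: "F \<in> hypersurface_tuples N s (\<lambda>_. 1)" "mpoly_eval (coords F) r \<noteq> 0"
    have CA: "(\<Sum>j\<le>N. C i j F * A j l F) = (if i = l then 1 else 0)"
      and AC: "(\<Sum>j\<le>N. A i j F * C j l F) = (if i = l then 1 else 0)" if "i \<le> N" "l \<le> N" for i l
      using q(3)[of F] F that by (auto simp: D_def r)
    have GF: "mpoly_eval x (G F j) = (\<Sum>l\<le>N. A j l F * x l)" if "j \<le> N" for j x
      unfolding A_def
    proof (rule linear_form_eval)
      show "G F j \<in> forms N 1"
        using tauT(1)[of j] T(1) hypersurface_tuples_form(1)[OF F(1)] forms_var[OF that] by (auto simp: G)
    qed
    show "\<exists>C. (\<forall>i\<le>N. \<forall>x. x i = (\<Sum>j\<le>N. C i j * mpoly_eval x (G F j))) \<and>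
        (\<forall>j\<le>N. \<forall>l\<le>N. mpoly_eval (\<lambda>i. C i j) (G F l) = (if l = j then 1 else 0))"
    proof (intro exI[of _ "\<lambda>i j. C i j F"] conjI allI impI)
      fix i and x :: "nat \<Rightarrow> 'k" assume i: "i \<le> N"
      have "(\<Sum>j\<le>N. C i j F * mpoly_eval x (G F j)) = (\<Sum>j\<le>N. \<Sum>l\<le>N. C i j F * A j l F * x l)"
        by (intro sum.cong refl) (simp add: GF sum_distrib_left mult.assoc)
      also have "\<dots> = (\<Sum>l\<le>N. (\<Sum>j\<le>N. C i j F * A j l F) * x l)"
        by (subst sum.swap) (simp add: sum_distrib_right)
      also have "\<dots> = (\<Sum>l\<le>N. if i = l then x l else 0)" by (intro sum.cong refl) (use CA i in auto)
      also have "\<dots> = x i" using i by (simp add: sum.delta')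
      finally show "x i = (\<Sum>j\<le>N. C i j F * mpoly_eval x (G F j))" by simp
    next
      fix j l assume "j \<le> N" "l \<le> N"
      then show "mpoly_eval (\<lambda>i. C i j F) (G F l) = (if l = j then 1 else 0)" using AC[of l j] by (simp add: GF)
    qed
  qed
qed

lemma general_hyperplanes_independent:
  assumes T: "T \<subseteq> {1..s}" "card T = Suc N"
  shows "for_general N s (\<lambda>_. 1) (\<lambda>F :: nat \<Rightarrow> (nat, 'k::field) mpoly.
    \<forall>i\<le>N. \<exists>c. \<forall>x. x i = (\<Sum>j\<in>T. c j * mpoly_eval x (F j)))"
proof -
  have finT: "finite T" using T(1) finite_subset by blast
  obtain \<tau> where tau: "bij_betw \<tau> {Suc N - card T..N} T"
    using finite_same_card_bij[of "{Suc N - card T..N}" T] finT T(2) by auto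
  define G where "G F i = (if i \<in> {Suc N - card T..N} then F (\<tau> i) else var i)" for F :: "nat \<Rightarrow> (nat, 'k) mpoly" and i
  show ?thesis
  proof (rule for_general_mono[OF general_linear_coordinates[where G = G, OF T(1) _ tau G_def]], goal_cases)
    case 1
    then show ?case using T(2) by simp
  next
    case (2 F)
    then obtain C where C: "\<forall>i\<le>N. \<forall>x. x i = (\<Sum>j\<le>N. C i j * mpoly_eval x (F (\<tau> j)))"
      using T(2) by (auto simp: G_def)
    show ?case
    proof (intro allI impI)
      fix i assume i: "i \<le> N"
      have tau': "bij_betw \<tau> {..N} T" using tau T(2) by (simp add: atMost_atLeast0)
      let ?c = "\<lambda>j. C i (inv_into {..N} \<tau> j)"
      have "x i = (\<Sum>j\<in>T. ?c j * mpoly_eval x (F j))" for x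
      proof -
        have "(\<Sum>j\<in>T. ?c j * mpoly_eval x (F j)) = (\<Sum>j\<le>N. ?c (\<tau> j) * mpoly_eval x (F (\<tau> j)))"
          by (rule sum.reindex_bij_betw[OF tau', symmetric])
        also have "\<dots> = (\<Sum>j\<le>N. C i j * mpoly_eval x (F (\<tau> j)))"
          by (intro sum.cong refl) (use tau' in \<open>auto simp: bij_betw_def inv_into_f_f\<close>)
        finally show ?thesis using C i by simp
      qed
      then show "\<exists>c. \<forall>x. x i = (\<Sum>j\<in>T. c j * mpoly_eval x (F j))" by (intro exI[of _ ?c]) blast
    qed
  qed
qed

text \<open>The system is completed by x_0. Column 0 of the inverse matrix is the common point,
  scaled to x_0 = 1, and the other columns are the dual vectors.\<close>

lemma general_hyperplanes_point:
  assumes T: "T \<subseteq> {1..s}" "card T = N"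
  shows "for_general N s (\<lambda>_. 1) (\<lambda>F :: nat \<Rightarrow> (nat, 'k::field) mpoly.
    (\<exists>p. (\<exists>i\<le>N. p i \<noteq> 0) \<and> (\<forall>j\<in>T. mpoly_eval p (F j) = 0) \<and>
      (\<forall>x. (\<forall>j\<in>T. mpoly_eval x (F j) = 0) \<longrightarrow> (\<exists>t. \<forall>i\<le>N. x i = t * p i))) \<and>
    (\<forall>i\<in>T. \<exists>v. mpoly_eval v (F i) = 1 \<and> (\<forall>j\<in>T - {i}. mpoly_eval v (F j) = 0)))"
proof -
  have finT: "finite T" using T(1) finite_subset by blast
  obtain \<tau> where tau: "bij_betw \<tau> {Suc N - card T..N} T"
    using finite_same_card_bij[of "{Suc N - card T..N}" T] finT T(2) by auto
  have tau': "bij_betw \<tau> {1..N} T" using tau T(2) by simp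
  define G where "G F i = (if i \<in> {Suc N - card T..N} then F (\<tau> i) else var i)" for F :: "nat \<Rightarrow> (nat, 'k) mpoly" and i
  have G: "G F 0 = var 0" "i \<in> {1..N} \<Longrightarrow> G F i = F (\<tau> i)" for F i
    using T(2) by (auto simp: G_def)
  have tauT: "\<exists>i\<in>{1..N}. j = \<tau> i" if "j \<in> T" for j using tau' that by (auto simp: bij_betw_def)
  show ?thesis
  proof (rule for_general_mono[OF general_linear_coordinates[where G = G, OF T(1) _ tau G_def]], goal_cases)
    case 1
    then show ?case using T(2) by simp
  next
    case (2 F)
    then obtain C where C: "\<And>i x. i \<le> N \<Longrightarrow> x i = (\<Sum>j\<le>N. C i j * mpoly_eval x (G F j))"
      "\<And>j l. j \<le> N \<Longrightarrow> l \<le> N \<Longrightarrow> mpoly_eval (\<lambda>i. C i j) (G F l) = (if l = j then 1 else 0)"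
      by blast
    have zeroT: "mpoly_eval (\<lambda>i. C i l) (F j) = 0" if "j \<in> T" "l \<le> N" "\<And>i. i \<in> {1..N} \<Longrightarrow> j = \<tau> i \<Longrightarrow> i \<noteq> l" for j l
    proof -
      obtain i where i: "i \<in> {1..N}" "j = \<tau> i" using tauT \<open>j \<in> T\<close> by blast
      then have "i \<noteq> l" using that(3) by blast
      then show ?thesis using C(2)[of l i] i that(2) G(2)[OF i(1)] by simp
    qed
    show ?case
    proof (rule conjI, rule exI[of _ "\<lambda>i. C i 0"], intro conjI allI impI ballI)
      have "C 0 0 = 1" using C(2)[of 0 0] G(1) by simp
      then show "\<exists>i\<le>N. C i 0 \<noteq> 0" by (intro exI[of _ 0]) simp
      show "mpoly_eval (\<lambda>i. C i 0) (F j) = 0" if "j \<in> T" for j using zeroT[OF that, of 0] by auto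
      fix x assume x: "\<forall>j\<in>T. mpoly_eval x (F j) = 0"
      show "\<exists>t. \<forall>i\<le>N. x i = t * C i 0"
      proof (intro exI[of _ "x 0"] allI impI)
        fix i assume "i \<le> N"
        then have "x i = (\<Sum>j\<le>N. C i j * mpoly_eval x (G F j))" by (rule C(1))
        also have "\<dots> = (\<Sum>j\<le>N. if j = 0 then C i 0 * x 0 else 0)"
        proof (intro sum.cong refl)
          fix j assume "j \<in> {..N}"
          moreover have "\<tau> j \<in> T" if "j \<in> {1..N}" using tau' that by (auto simp: bij_betw_def)
          ultimately show "C i j * mpoly_eval x (G F j) = (if j = 0 then C i 0 * x 0 else 0)"
            using x G(1)[of F] G(2)[of j F] by (cases "j = 0") auto
        qed
        also have "\<dots> = x 0 * C i 0" by (simp add: sum.delta)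
        finally show "x i = x 0 * C i 0" .
      qed
    next
      show "\<forall>i\<in>T. \<exists>v. mpoly_eval v (F i) = 1 \<and> (\<forall>j\<in>T - {i}. mpoly_eval v (F j) = 0)"
      proof
        fix i assume "i \<in> T"
        then obtain l where l: "l \<in> {1..N}" "i = \<tau> l" using tauT by blast
        have "mpoly_eval (\<lambda>k. C k l) (F i) = 1" using C(2)[of l l] l G(2)[OF l(1), of F] by simp
        moreover have "mpoly_eval (\<lambda>k. C k l) (F j) = 0" if "j \<in> T - {i}" for j
          by (rule zeroT) (use that l in auto)
        ultimately show "\<exists>v. mpoly_eval v (F i) = 1 \<and> (\<forall>j\<in>T - {i}. mpoly_eval v (F j) = 0)" by blast
      qed
    qed
  qed
qed

theorem general_hyperplanes_gen_pos:
  assumes inf: "infinite (UNIV :: 'k::field set)" and "N \<le> s"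
  shows "for_general N s (\<lambda>_. 1) (\<lambda>F :: nat \<Rightarrow> (nat, 'k) mpoly. gen_pos N N UNIV {1..s} F \<and>
    (\<forall>T\<subseteq>{1..s}. card T = N \<longrightarrow> (\<forall>x p. (\<exists>i\<le>N. p i \<noteq> 0) \<longrightarrow> (\<forall>j\<in>T. mpoly_eval p (F j) = 0) \<longrightarrow>
      (\<forall>j\<in>T. mpoly_eval x (F j) = 0) \<longrightarrow> (\<exists>t. \<forall>i\<le>N. x i = t * p i))))"
proof -
  let ?Q1 = "\<lambda>T (F :: nat \<Rightarrow> (nat, 'k) mpoly). \<forall>i\<le>N. \<exists>c. \<forall>x. x i = (\<Sum>j\<in>T. c j * mpoly_eval x (F j))"
  let ?Q2 = "\<lambda>T (F :: nat \<Rightarrow> (nat, 'k) mpoly).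
    (\<exists>p. (\<exists>i\<le>N. p i \<noteq> 0) \<and> (\<forall>j\<in>T. mpoly_eval p (F j) = 0) \<and>
      (\<forall>x. (\<forall>j\<in>T. mpoly_eval x (F j) = 0) \<longrightarrow> (\<exists>t. \<forall>i\<le>N. x i = t * p i))) \<and>
    (\<forall>i\<in>T. \<exists>v. mpoly_eval v (F i) = 1 \<and> (\<forall>j\<in>T - {i}. mpoly_eval v (F j) = 0))"
  define Q where "Q T F = (if card T = N then ?Q2 T F else ?Q1 T F)" for T F
  define A where "A = {T. T \<subseteq> {1..s} \<and> (card T = N \<or> card T = Suc N)}"
  have "finite A" unfolding A_def by (rule finite_subset[of _ "Pow {1..s}"]) auto
  moreover have "{1..N} \<in> A" using assms(2) by (auto simp: A_def)
  moreover have "for_general N s (\<lambda>_. 1) (Q T)" if "T \<in> A" for T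
  proof (cases "card T = N")
    case True
    then have "Q T = ?Q2 T" by (intro ext) (simp add: Q_def)
    then show ?thesis using general_hyperplanes_point[of T s N] that True by (simp add: A_def)
  next
    case False
    then have "Q T = ?Q1 T" by (intro ext) (simp add: Q_def)
    then show ?thesis using general_hyperplanes_independent[of T s N] that False by (simp add: A_def)
  qed
  ultimately have "for_general N s (\<lambda>_. 1) (\<lambda>F. \<forall>T\<in>A. Q T F)" by (intro for_general_ball[OF inf]) auto
  then show ?thesis
  proof (rule for_general_mono)
    fix F :: "nat \<Rightarrow> (nat, 'k) mpoly"
    assume F: "F \<in> hypersurface_tuples N s (\<lambda>_. 1)" and Q: "\<forall>T\<in>A. Q T F"
    have Q1: "?Q1 T F" if "T \<subseteq> {1..s}" "card T = Suc N" for T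
    proof -
      have "Q T F" using Q that by (simp add: A_def)
      then show ?thesis using that(2) by (simp add: Q_def)
    qed
    have Q2: "?Q2 T F" if "T \<subseteq> {1..s}" "card T = N" for T
    proof -
      have "Q T F" using Q that by (simp add: A_def)
      then show ?thesis unfolding Q_def if_P[OF that(2)] .
    qed
    show "gen_pos N N UNIV {1..s} F \<and>
      (\<forall>T\<subseteq>{1..s}. card T = N \<longrightarrow> (\<forall>x p. (\<exists>i\<le>N. p i \<noteq> 0) \<longrightarrow> (\<forall>j\<in>T. mpoly_eval p (F j) = 0) \<longrightarrow>
        (\<forall>j\<in>T. mpoly_eval x (F j) = 0) \<longrightarrow> (\<exists>t. \<forall>i\<le>N. x i = t * p i)))"
    proof (intro conjI allI impI)
      show "gen_pos N N UNIV {1..s} F"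
        unfolding gen_pos_def
      proof (intro conjI allI impI ballI)
        show "vspace UNIV" by (simp add: vspace_def)
        show "F i \<in> forms N 1" if "i \<in> {1..s}" for i using hypersurface_tuples_form(1)[OF F that] .
      next
        fix T i assume "T \<subseteq> {1..s}" "card T = Suc N" "i \<le> N"
        then show "\<exists>c. \<forall>x\<in>UNIV. x i = (\<Sum>j\<in>T. c j * mpoly_eval x (F j))" using Q1[of T] by simp
      next
        fix T assume "T \<subseteq> {1..s}" "card T = N"
        from Q2[OF this] show "\<exists>p\<in>UNIV. (\<exists>i\<le>N. p i \<noteq> 0) \<and> (\<forall>j\<in>T. mpoly_eval p (F j) = 0)" by blast
      next
        fix T i assume "T \<subseteq> {1..s}" "card T = N" "i \<in> T"
        then show "\<exists>v\<in>UNIV. mpoly_eval v (F i) = 1 \<and> (\<forall>j\<in>T - {i}. mpoly_eval v (F j) = 0)"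
          using Q2[of T] by blast
      qed simp
    next
      fix T x p
      assume T: "T \<subseteq> {1..s}" "card T = N" and p: "\<exists>i\<le>N. p i \<noteq> 0" "\<forall>j\<in>T. mpoly_eval p (F j) = 0"
        and x: "\<forall>j\<in>T. mpoly_eval x (F j) = 0"
      obtain p0 where p0: "\<And>x. \<forall>j\<in>T. mpoly_eval x (F j) = 0 \<Longrightarrow> \<exists>t. \<forall>i\<le>N. x i = t * p0 i"
        using Q2[OF T] by blast
      obtain a where a: "\<forall>i\<le>N. p i = a * p0 i" using p0[OF p(2)] by blast
      obtain b where b: "\<forall>i\<le>N. x i = b * p0 i" using p0[OF x] by blast
      have "a \<noteq> 0" using p(1) a by auto
      then show "\<exists>t. \<forall>i\<le>N. x i = t * p i" using a b by (intro exI[of _ "b / a"]) simp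
    qed
  qed
qed


section \<open>Symbolic powers and orders of vanishing\<close>

lemma ring_localization:
  assumes A: "1 \<in> A" "0 \<notin> A" "\<And>a b. a \<in> A \<Longrightarrow> b \<in> A \<Longrightarrow> a * b \<in> A" "A \<subseteq> polys N"
  shows "ring (localization (poly_ring N :: (nat, 'k::field) mpoly ring) A)"
proof -
  define RA where "RA = localization (poly_ring N :: (nat, 'k) mpoly ring) A"
  have ops: "x \<otimes>\<^bsub>RA\<^esub> y = x * y" "x \<oplus>\<^bsub>RA\<^esub> y = x + y" "\<one>\<^bsub>RA\<^esub> = 1" "\<zero>\<^bsub>RA\<^esub> = 0" for x y
    by (simp_all add: RA_def localization_def ring_of_type_algebra_def)
  have carrier: "carrier RA = {Fract f a | f a. f \<in> polys N \<and> a \<in> A}"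
    by (simp add: RA_def localization_def)
  have FractI: "Fract f a \<in> carrier RA" if "f \<in> polys N" "a \<in> A" for f a using that unfolding carrier by blast
  have nz: "a \<noteq> 0" if "a \<in> A" for a using A(2) that by blast
  have AN: "a \<in> polys N" if "a \<in> A" for a using A(4) that by blast
  have one: "1 \<in> carrier RA" and zero: "0 \<in> carrier RA"
    using FractI[of 1 1] FractI[of 0 1] A(1) by (simp_all add: One_fract_def Zero_fract_def)
  have add: "x + y \<in> carrier RA" and mult: "x * y \<in> carrier RA" if xy: "x \<in> carrier RA" "y \<in> carrier RA" for x y
  proof -
    obtain f a g b where x: "x = Fract f a" "f \<in> polys N" "a \<in> A" and y: "y = Fract g b" "g \<in> polys N" "b \<in> A"
      using xy unfolding carrier by blast
    have "x + y = Fract (f * b + g * a) (a * b)" "x * y = Fract (f * g) (a * b)"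
      using nz[OF x(3)] nz[OF y(3)] by (simp_all add: x(1) y(1))
    then show "x + y \<in> carrier RA" "x * y \<in> carrier RA"
      using FractI[of "f * b + g * a" "a * b"] FractI[of "f * g" "a * b"] A(3)[OF x(3) y(3)] x y AN by simp_all
  qed
  have "ring RA"
  proof (rule ringI)
    show "abelian_group RA"
    proof (rule abelian_groupI)
      fix x assume "x \<in> carrier RA"
      then obtain f a where x: "x = Fract f a" "f \<in> polys N" "a \<in> A" unfolding carrier by blast
      then have "- x \<in> carrier RA" using FractI[of "- f" a] by simp
      then show "\<exists>y\<in>carrier RA. y \<oplus>\<^bsub>RA\<^esub> x = \<zero>\<^bsub>RA\<^esub>" by (intro bexI[of _ "- x"]) (simp add: ops)
    qed (auto simp: ops add zero algebra_simps)
    show "Group.monoid RA" by (rule monoidI) (auto simp: ops mult one algebra_simps)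
  qed (auto simp: ops algebra_simps)
  then show ?thesis by (simp add: RA_def)
qed

text \<open>Fractions with numerator in I^m and denominator in A form an ideal, so an element of the
  extended ideal needs only one denominator.\<close>

lemma symbolic_powerE:
  assumes I: "ideal I (poly_ring N)" and f: "f \<in> symbolic_power (poly_ring N) I m"
  obtains a where "a \<in> polys N" "\<And>P. P \<in> associated_primes (poly_ring N) I \<Longrightarrow> a \<notin> P"
    and "a * f \<in> ideal_power N I m"
proof -
  define A where "A = carrier (poly_ring N) - \<Union> (associated_primes (poly_ring N) I)"
  define RA where "RA = localization (poly_ring N) A"
  note Im = ideal_closed[OF ideal_power_ideal[OF I, of m]]
  have f': "f \<in> polys N" "Fract f 1 \<in> genideal RA ((\<lambda>g. Fract g 1) ` ideal_power N I m)"
    using f by (auto simp: symbolic_power_def Let_def RA_def A_def)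
  have prime: "primeideal P (poly_ring N)" if "P \<in> associated_primes (poly_ring N) I" for P
    using that by (simp add: associated_primes_def)
  have AN: "a \<in> polys N" if "a \<in> A" for a using that by (simp add: A_def)
  have oneA: "1 \<in> A"
  proof -
    have "1 \<notin> P" if P: "P \<in> associated_primes (poly_ring N) I" for P
    proof
      assume "1 \<in> P"
      then have "P = polys N"
        using ideal.one_imp_carrier[OF primeideal.axioms(1)[OF prime[OF P]]] by simp
      then show False using primeideal.I_notcarr[OF prime[OF P]] by simp
    qed
    then show ?thesis by (auto simp: A_def)
  qed
  have multA: "a * b \<in> A" if "a \<in> A" "b \<in> A" for a b
  proof -
    have "a * b \<notin> P" if P: "P \<in> associated_primes (poly_ring N) I" for P
    proof
      assume "a * b \<in> P"
      then have "a \<in> P \<or> b \<in> P"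
        using primeideal.I_prime[OF prime[OF P], of a b] \<open>a \<in> A\<close> \<open>b \<in> A\<close> by (simp add: A_def)
      then show False using P \<open>a \<in> A\<close> \<open>b \<in> A\<close> by (auto simp: A_def)
    qed
    then show ?thesis using \<open>a \<in> A\<close> \<open>b \<in> A\<close> by (auto simp: A_def)
  qed
  have "\<exists>a\<in>A. a * f \<in> ideal_power N I m"
  proof (cases "0 \<in> A")
    \<comment> \<open>0 lies in every prime, so this happens only without associated primes; then a
      = 0 satisfies all claims.\<close>
    case True
    then show ?thesis using Im(2) by (intro bexI[of _ 0]) simp_all
  next
    case False
    have ops: "x \<otimes>\<^bsub>RA\<^esub> y = x * y" "x \<oplus>\<^bsub>RA\<^esub> y = x + y" "\<one>\<^bsub>RA\<^esub> = 1" "\<zero>\<^bsub>RA\<^esub> = 0" for x y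
      by (simp_all add: RA_def localization_def ring_of_type_algebra_def)
    have carrier: "carrier RA = {Fract f a | f a. f \<in> polys N \<and> a \<in> A}"
      by (simp add: RA_def localization_def)
    have nz: "a \<noteq> 0" if "a \<in> A" for a using False that by blast
    have RA: "ring RA"
      unfolding RA_def by (rule ring_localization[OF oneA False multA]) (auto simp: A_def)
    define J where "J = {Fract g a | g a. g \<in> ideal_power N I m \<and> a \<in> A}"
    have JI: "Fract g a \<in> J" if "g \<in> ideal_power N I m" "a \<in> A" for g a using that unfolding J_def by blast
    have Jmult: "x * y \<in> J" if xJ: "x \<in> J" and yR: "y \<in> carrier RA" for x y
    proof -
      obtain f a g b where x: "x = Fract f a" "f \<in> ideal_power N I m" "a \<in> A"
        and y: "y = Fract g b" "g \<in> polys N" "b \<in> A"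
        using xJ yR unfolding carrier J_def by blast
      have "x * y = Fract (f * g) (a * b)" by (simp add: x(1) y(1))
      then show ?thesis using JI[OF Im(5)[OF x(2) y(2)] multA[OF x(3) y(3)]] by simp
    qed
    have "ideal J RA"
    proof (rule idealI[OF RA])
      have Jcar: "J \<subseteq> carrier RA" using Im(1) unfolding J_def carrier by blast
      have J0: "0 \<in> J" using JI[OF Im(2) oneA] by (simp add: Zero_fract_def)
      have Jadd: "x + y \<in> J" if xJ: "x \<in> J" and yJ: "y \<in> J" for x y
      proof -
        obtain f a g b where x: "x = Fract f a" "f \<in> ideal_power N I m" "a \<in> A"
          and y: "y = Fract g b" "g \<in> ideal_power N I m" "b \<in> A"
          using xJ yJ unfolding J_def by blast
        have "x + y = Fract (f * b + g * a) (a * b)" using nz[OF x(3)] nz[OF y(3)] by (simp add: x(1) y(1))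
        then show ?thesis
          using JI[OF Im(3)[OF Im(5)[OF x(2) AN[OF y(3)]] Im(5)[OF y(2) AN[OF x(3)]]] multA[OF x(3) y(3)]] by simp
      qed
      show "subgroup J (add_monoid RA)"
      proof (unfold_locales, goal_cases)
        case (4 x)
        have "\<ominus>\<^bsub>RA\<^esub> x = - x"
        proof (rule abelian_group.minus_equality[OF ring.is_abelian_group[OF RA]])
          have "-1 \<in> carrier RA"
            unfolding carrier using oneA by (intro CollectI exI[of _ "-1"] exI[of _ 1]) (simp add: One_fract_def)
          then have "x * -1 \<in> J" by (rule Jmult[OF 4])
          then show "- x \<in> carrier RA" using Jcar by auto
        qed (use 4 Jcar in \<open>auto simp: ops\<close>)
        moreover have "-1 \<in> carrier RA"
          unfolding carrier using oneA by (intro CollectI exI[of _ "-1"] exI[of _ 1]) (simp add: One_fract_def)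
        then have "x * -1 \<in> J" by (rule Jmult[OF 4])
        ultimately show ?case by (simp add: a_inv_def)
      qed (use Jcar J0 Jadd in \<open>auto simp: ops\<close>)
      fix a x assume "a \<in> J" "x \<in> carrier RA"
      then show "x \<otimes>\<^bsub>RA\<^esub> a \<in> J" "a \<otimes>\<^bsub>RA\<^esub> x \<in> J" using Jmult[of a x] by (simp_all add: ops mult.commute)
    qed
    moreover have "(\<lambda>g. Fract g 1) ` ideal_power N I m \<subseteq> J" using JI oneA by auto
    ultimately have "Fract f 1 \<in> J" using f'(2) unfolding genideal_def by blast
    then obtain g a where g: "Fract f 1 = Fract g a" "g \<in> ideal_power N I m" "a \<in> A" unfolding J_def by blast
    then have "a * f = g" using nz[OF g(3)] by (simp add: eq_fract mult.commute)
    then show ?thesis using g by blast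
  qed
  then obtain a where a: "a \<in> A" "a * f \<in> ideal_power N I m" by blast
  show thesis by (rule that[of a]) (use a in \<open>auto simp: A_def\<close>)
qed

context infinite_field
begin

lemma ideal_power_ord:
  assumes "\<And>g. g \<in> I \<Longrightarrow> mpoly_eval q g = (0 :: 'k)"
  shows "f \<in> ideal_power N I m \<Longrightarrow> ord_at UNIV m f q"
proof (induction m arbitrary: f)
  case 0
  show ?case by (rule ord_at_0)
next
  case (Suc m)
  from Suc.prems show ?case
    unfolding ideal_power_Suc
  proof (induction f rule: ideal_prod.induct)
    case (prod i j)
    then have "ord_at UNIV (m + 1) (i * j) q" by (intro ord_at_mult ord_at_1 Suc.IH assms)
    then show ?case by simp
  next
    case (sum s1 s2)
    then show ?case by (simp add: ord_at_add)
  qed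
qed

text \<open>The j-th coefficient of f at t p in direction t v is a polynomial in t, with the
  coefficients of the components of f at p as its own coefficients. It vanishes where h does not,
  hence identically. The polynomial h allows finitely many exceptional t.\<close>

lemma hcomp_ord:
  assumes f: "f \<in> polys N" and h: "h \<noteq> 0"
    and ord: "\<And>t. poly h t \<noteq> 0 \<Longrightarrow> ord_at UNIV m f (\<lambda>i. t * p i)"
  shows "ord_at UNIV m (hcomp n f) (p :: nat \<Rightarrow> 'k)"
  unfolding ord_at_def monom_1_dvd_iff'
proof (intro ballI allI impI)
  fix v :: "nat \<Rightarrow> 'k" and j assume j: "j < m"
  define c where "c n = coeff (line_poly (hcomp n f) p v) j" for n
  have scale: "line_poly (hcomp n f) (\<lambda>i. t * p i) (\<lambda>i. t * v i) = smult (t ^ n) (line_poly (hcomp n f) p v)" for t n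
  proof (rule poly_ext[OF inf])
    fix u
    have "mpoly_eval (\<lambda>i. t * (p i + u * v i)) (hcomp n f) = t ^ n * mpoly_eval (\<lambda>i. p i + u * v i) (hcomp n f)"
      by (rule eval_forms_scale[OF hcomp_forms[OF f]])
    then show "poly (line_poly (hcomp n f) (\<lambda>i. t * p i) (\<lambda>i. t * v i)) u
        = poly (smult (t ^ n) (line_poly (hcomp n f) p v)) u" by (simp add: algebra_simps)
  qed
  have line: "line_poly f p' v' = (\<Sum>n\<le>maxdeg f. line_poly (hcomp n f) p' v')" for p' v' :: "nat \<Rightarrow> 'k"
  proof (rule poly_ext[OF inf])
    fix u
    have "mpoly_eval (\<lambda>i. p' i + u * v' i) f = (\<Sum>n\<le>maxdeg f. mpoly_eval (\<lambda>i. p' i + u * v' i) (hcomp n f))"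
      by (subst sum_hcomp[of f]) simp
    then show "poly (line_poly f p' v') u = poly (\<Sum>n\<le>maxdeg f. line_poly (hcomp n f) p' v') u"
      by (simp add: poly_sum)
  qed
  define Q where "Q = (\<Sum>n\<le>maxdeg f. monom (c n) n)"
  have "poly (Q * h) t = 0" for t
  proof (cases "poly h t = 0")
    case False
    then have "coeff (line_poly f (\<lambda>i. t * p i) (\<lambda>i. t * v i)) j = 0"
      using ord[OF False] j unfolding ord_at_def monom_1_dvd_iff' by blast
    moreover have "coeff (line_poly f (\<lambda>i. t * p i) (\<lambda>i. t * v i)) j = poly Q t"
      by (simp add: line scale coeff_sum Q_def poly_sum poly_monom c_def mult.commute)
    ultimately show ?thesis by simp
  qed simp
  then have "Q * h = 0" using inf by (intro poly_eq_0_if_zeros) auto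
  then have Q: "Q = 0" using h by simp
  show "coeff (line_poly (hcomp n f) p v) j = 0"
  proof (cases "n \<le> maxdeg f")
    case True
    then have "coeff Q n = c n" by (simp add: Q_def coeff_sum sum.delta)
    then show ?thesis using Q by (simp add: c_def)
  next
    case False
    then have "hcomp n f = 0"
      using tdeg_le_maxdeg[of _ f] by (intro poly_mapping_eqI) (fastforce simp: lookup_hcomp in_keys_iff)
    then have "line_poly (hcomp n f) p v = 0" by (intro poly_ext[OF inf]) simp
    then show ?thesis by simp
  qed
qed

text \<open>The ideal of the point \<open>p\<close> is the annihilator of the product of the hyperplanes not containing
  \<open>p\<close> modulo the ideal of the star configuration, so it is an associated prime.\<close>

lemma point_ideal_associated:
  fixes F :: "nat \<Rightarrow> (nat, 'k) mpoly"
  assumes gp: "gen_pos N N UNIV {1..s} F" and N: "0 < N" and T: "T \<subseteq> {1..s}" "card T = N"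
    and p: "\<exists>i\<le>N. p i \<noteq> 0" "\<forall>j\<in>T. mpoly_eval p (F j) = 0"
    and line: "\<And>x. \<forall>j\<in>T. mpoly_eval x (F j) = 0 \<Longrightarrow> \<exists>t. \<forall>i\<le>N. x i = t * p i"
  shows "{g \<in> polys N. \<forall>t. mpoly_eval (\<lambda>i. t * p i) g = 0}
      \<in> associated_primes (poly_ring N) (vanishing_ideal N (star_config N N s F))" (is "?P \<in> _")
    and "vanishing_ideal N (star_config N N s F) \<subseteq> {g \<in> polys N. \<forall>t. mpoly_eval (\<lambda>i. t * p i) g = 0}"
proof -
  let ?I = "vanishing_ideal N (star_config N N s F)"
  have F: "F i \<in> forms N 1" if "i \<in> {1..s}" for i by (rule gen_posD(3)[OF gp that])
  have I: "vanishing_ideal N (star_config N N s F) = {f \<in> polys N. \<forall>x\<in>star_config N N s F. mpoly_eval x f = 0}"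
    "ideal (vanishing_ideal N (star_config N N s F)) (poly_ring N)"
    by (rule vanishing_ideal_iff[where d = "\<lambda>_. 1", OF inf N], rule F, assumption)+
  have finT: "finite T" using T(1) finite_subset by blast
  define c where "c = (\<Prod>j\<in>{1..s} - T. F j)"
  have c: "c \<in> polys N" unfolding c_def by (intro polys_prod) (use F forms_polys in blast)
  have zeros: "mpoly_eval (\<lambda>i. t * p i) (F j) = 0" if "j \<in> T" for j t
    using eval_forms_scale[OF F, of j t p] that T(1) p(2) by auto
  have cp: "mpoly_eval (\<lambda>i. t * p i) c \<noteq> 0" if t: "t \<noteq> 0" for t
  proof -
    have "mpoly_eval (\<lambda>i. t * p i) (F j) \<noteq> 0" if j: "j \<in> {1..s} - T" for j
    proof
      assume 0: "mpoly_eval (\<lambda>i. t * p i) (F j) = 0"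
      obtain i where i: "i \<le> N" "p i \<noteq> 0" using p(1) by blast
      have "t * p i = 0"
        by (rule gen_pos_no_common_zero[OF gp, of "insert j T" "\<lambda>i. t * p i"]) (use j T finT zeros 0 i(1) in auto)
      then show False using t i(2) by simp
    qed
    then show ?thesis by (simp add: c_def prod_zero_iff)
  qed
  \<comment> \<open>Membership in the ideal of p is the vanishing of a univariate restriction, and
    the ideal is prime because k[t] is a domain.\<close>
  have lp: "line_poly g (\<lambda>_. 0) p = 0 \<longleftrightarrow> (\<forall>t. mpoly_eval (\<lambda>i. t * p i) g = 0)" for g
  proof
    assume "line_poly g (\<lambda>_. 0) p = 0"
    then show "\<forall>t. mpoly_eval (\<lambda>i. t * p i) g = 0" using poly_line_poly[of g "\<lambda>_. 0" p] by simp
  next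
    assume "\<forall>t. mpoly_eval (\<lambda>i. t * p i) g = 0"
    then show "line_poly g (\<lambda>_. 0) p = 0" by (intro poly_ext[OF inf]) simp
  qed
  have P: "?P = {g \<in> polys N. g * c \<in> ?I}"
  proof (intro equalityI subsetI)
    fix g assume g: "g \<in> ?P"
    have "mpoly_eval x (g * c) = 0" if "x \<in> star_config N N s F" for x
    proof (cases "\<exists>j\<in>{1..s} - T. mpoly_eval x (F j) = 0")
      case True
      then have "mpoly_eval x c = 0" by (auto simp: c_def intro: prod_zero)
      then show ?thesis by simp
    next
      case False
      obtain T' where T': "T' \<subseteq> {1..s}" "card T' = N" "\<forall>j\<in>T'. mpoly_eval x (F j) = 0"
        using \<open>x \<in> star_config N N s F\<close> unfolding star_config_iff[OF N] by blast
      then have "T' \<subseteq> T" using False by blast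
      then have "T' = T" using T'(2) T(2) finT by (intro card_subset_eq) auto
      then obtain t where "\<forall>i\<le>N. x i = t * p i" using line[of x] T'(3) by blast
      then have "mpoly_eval x g = mpoly_eval (\<lambda>i. t * p i) g" using g by (intro eval_cong[of g N]) auto
      then show ?thesis using g by simp
    qed
    then show "g \<in> {g \<in> polys N. g * c \<in> ?I}" using g c unfolding I(1) by simp
  next
    fix g assume g: "g \<in> {g \<in> polys N. g * c \<in> ?I}"
    have "mpoly_eval (\<lambda>i. t * p i) g = 0" if t: "t \<noteq> 0" for t
    proof -
      define x where "x i = (if i \<le> N then t * p i else 0)" for i
      have ev: "mpoly_eval x h = mpoly_eval (\<lambda>i. t * p i) h" if "h \<in> polys N" for h
        using that by (rule eval_cong) (simp add: x_def)
      have "x \<in> proj_space N" using p(1) t by (auto simp: proj_space_def x_def)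
      moreover have "mpoly_eval x (F j) = 0" if "j \<in> T" for j
        using ev[OF forms_polys[OF F]] zeros[OF that] T(1) that by auto
      ultimately have "x \<in> star_config N N s F" using T unfolding star_config_iff[OF N] by blast
      then have "mpoly_eval x (g * c) = 0" using g unfolding I(1) by blast
      then show ?thesis using ev[of g] ev[OF c] cp[OF t] g by simp
    qed
    \<comment> \<open>The factor T takes care of t = 0, for which t p is not a point of projective
      space.\<close>
    then have "poly (line_poly g (\<lambda>_. 0) p * [:0, 1:]) t = 0" for t by (cases "t = 0") simp_all
    then have "line_poly g (\<lambda>_. 0) p * [:0, 1:] = 0" using inf by (intro poly_eq_0_if_zeros) auto
    then have "line_poly g (\<lambda>_. 0) p = 0" by simp
    then show "g \<in> ?P" using g lp by blast
  qed
  show "?I \<subseteq> ?P"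
    unfolding P using ideal_closed(1,5)[OF I(2)] c by blast
  have "primeideal ?P (poly_ring N)"
  proof (rule primeidealI)
    show "ideal ?P (poly_ring N)" by (rule ideal_poly_ringI) auto
    show "cring (poly_ring N)" by (rule cring_poly_ring)
    have "1 \<notin> ?P" by simp
    then show "carrier (poly_ring N) \<noteq> ?P" using polys_1[of N] by blast
    fix a b assume ab: "a \<in> polys N" "b \<in> polys N" "a \<otimes>\<^bsub>poly_ring N\<^esub> b \<in> ?P"
    then have "line_poly (a * b) (\<lambda>_. 0) p = 0" unfolding lp by simp
    then have "line_poly a (\<lambda>_. 0) p = 0 \<or> line_poly b (\<lambda>_. 0) p = 0" by (simp add: line_poly_mult)
    then show "a \<in> ?P \<or> b \<in> ?P" using ab unfolding lp by blast
  qed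
  then show "?P \<in> associated_primes (poly_ring N) ?I"
    unfolding associated_primes_def using c P by (auto intro!: bexI[of _ c])
qed

text \<open>The multiplier a from \<open>symbolic_powerE\<close> is outside the prime of p, so it is
  nonzero at t p for all but finitely many t. There it can be cancelled from a f, which has order at
  least m.\<close>

lemma symbolic_power_points_ord:
  fixes F :: "nat \<Rightarrow> (nat, 'k) mpoly"
  assumes gp: "gen_pos N N UNIV {1..s} F" and N: "0 < N"
    and line: "\<And>T x p. T \<subseteq> {1..s} \<Longrightarrow> card T = N \<Longrightarrow> \<exists>i\<le>N. p i \<noteq> 0 \<Longrightarrow> \<forall>j\<in>T. mpoly_eval p (F j) = 0 \<Longrightarrow>
      \<forall>j\<in>T. mpoly_eval x (F j) = 0 \<Longrightarrow> \<exists>t. \<forall>i\<le>N. x i = t * p i"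
    and f: "f \<in> symbolic_power (poly_ring N) (vanishing_ideal N (star_config N N s F)) m"
  shows "points_ord N N UNIV {1..s} F m (hcomp n f)"
  unfolding points_ord_def
proof (intro allI impI ballI)
  fix T p assume T: "T \<subseteq> {1..s}" "card T = N" and p: "\<exists>i\<le>N. p i \<noteq> 0" "\<forall>j\<in>T. mpoly_eval p (F j) = 0"
  have F: "F i \<in> forms N 1" if "i \<in> {1..s}" for i by (rule gen_posD(3)[OF gp that])
  have I: "vanishing_ideal N (star_config N N s F) = {f \<in> polys N. \<forall>x\<in>star_config N N s F. mpoly_eval x f = 0}"
    "ideal (vanishing_ideal N (star_config N N s F)) (poly_ring N)"
    by (rule vanishing_ideal_iff[where d = "\<lambda>_. 1", OF inf N], rule F, assumption)+
  note assoc = point_ideal_associated[OF gp N T p line[OF T p]]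
  obtain a where a: "a \<in> polys N" "\<And>P. P \<in> associated_primes (poly_ring N) (vanishing_ideal N (star_config N N s F)) \<Longrightarrow> a \<notin> P"
    "a * f \<in> ideal_power N (vanishing_ideal N (star_config N N s F)) m"
    using symbolic_powerE[OF I(2) f] by blast
  have fp: "f \<in> polys N" using f by (simp add: symbolic_power_def Let_def)
  obtain t0 where "mpoly_eval (\<lambda>i. t0 * p i) a \<noteq> 0" using a(2)[OF assoc(1)] a(1) by blast
  then have "poly (line_poly a (\<lambda>_. 0) p) t0 \<noteq> 0" by simp
  then have "line_poly a (\<lambda>_. 0) p \<noteq> 0" by (metis poly_0)
  with fp show "ord_at UNIV m (hcomp n f) p"
  proof (rule hcomp_ord)
    fix t assume "poly (line_poly a (\<lambda>_. 0) p) t \<noteq> 0"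
    then have "mpoly_eval (\<lambda>i. t * p i) a \<noteq> 0" by simp
    moreover have "ord_at UNIV m (a * f) (\<lambda>i. t * p i)"
      by (rule ideal_power_ord[OF _ a(3)]) (use assoc(2) in blast)
    ultimately show "ord_at UNIV m f (\<lambda>i. t * p i)" by (rule ord_at_cancel_unit[rotated])
  qed
qed


section \<open>The resurgence of a star configuration of points\<close>

text \<open>A product of s - N + 1 of the s hyperplanes involves one of any N of them, so it
  vanishes on the configuration.\<close>

lemma power_span_ideal_power:
  fixes F :: "nat \<Rightarrow> (nat, 'k) mpoly"
  assumes N: "0 < N" "N \<le> s" and F: "\<And>i. i \<in> {1..s} \<Longrightarrow> F i \<in> forms N 1"
  shows "power_span N F (Suc s - N) {1..s} r k g \<Longrightarrow>
    g \<in> ideal_power N (vanishing_ideal N (star_config N N s F)) r"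
proof (induction rule: power_span.induct)
  have I: "vanishing_ideal N (star_config N N s F) = {f \<in> polys N. \<forall>x\<in>star_config N N s F. mpoly_eval x f = 0}"
    "ideal (vanishing_ideal N (star_config N N s F)) (poly_ring N)"
    by (rule vanishing_ideal_iff[where d = "\<lambda>_. 1", OF inf N(1)], rule F, assumption)+
  note Ir = ideal_closed[OF ideal_power_ideal[OF I(2)]]
  {
    case (base h k)
    then show ?case by (simp add: ideal_power_0 forms_polys)
  next
    case (mult r k f B)
    have "(\<Prod>i\<in>B. F i) \<in> vanishing_ideal N (star_config N N s F)"
      unfolding I(1)
    proof (intro CollectI conjI ballI)
      show "(\<Prod>i\<in>B. F i) \<in> polys N" using mult(2) F forms_polys by (intro polys_prod) blast
      fix x assume "x \<in> star_config N N s F"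
      then obtain T where T: "T \<subseteq> {1..s}" "card T = N" "\<forall>i\<in>T. mpoly_eval x (F i) = 0"
        unfolding star_config_iff[OF N(1)] by blast
      have "B \<inter> T \<noteq> {}"
      proof
        assume "B \<inter> T = {}"
        then have "card (B \<union> T) = card B + card T"
          using mult(2) T(1) by (intro card_Un_disjoint) (blast intro: finite_subset[OF _ finite_atLeastAtMost])+
        moreover have "card (B \<union> T) \<le> card {1..s}" using mult(2) T(1) by (intro card_mono) auto
        ultimately show False using mult(3) T(2) N by simp
      qed
      then obtain j where "j \<in> B" "j \<in> T" by blast
      moreover have "finite B" using mult(2) finite_subset by blast
      ultimately show "mpoly_eval x (\<Prod>i\<in>B. F i) = 0" using T(3) by (auto intro: prod_zero)
    qed
    then show ?case by (subst mult.commute) (rule ideal_power_mult1[OF mult.IH])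
  next
    case (zero r k)
    show ?case by (rule Ir(2))
  next
    case (add r k f g)
    then show ?case by (intro Ir(3))
  }
qed

theorem star_resurgence_upper_bound:
  fixes F :: "nat \<Rightarrow> (nat, 'k) mpoly"
  assumes gp: "gen_pos N N UNIV {1..s} F" and N: "0 < N" "N \<le> s"
    and line: "\<And>T x p. T \<subseteq> {1..s} \<Longrightarrow> card T = N \<Longrightarrow> \<exists>i\<le>N. p i \<noteq> 0 \<Longrightarrow> \<forall>j\<in>T. mpoly_eval p (F j) = 0 \<Longrightarrow>
      \<forall>j\<in>T. mpoly_eval x (F j) = 0 \<Longrightarrow> \<exists>t. \<forall>i\<le>N. x i = t * p i"
  shows "proj_resurgence N (star_config N N s F) \<le> ereal (real N * (real s - real N + 1) / real s)"
  unfolding proj_resurgence_def resurgence_def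
proof (rule Sup_least)
  let ?I = "vanishing_ideal N (star_config N N s F)"
  fix q assume "q \<in> {ereal (real m / real r) | m r.
    1 \<le> m \<and> 1 \<le> r \<and> \<not> symbolic_power (poly_ring N) ?I m \<subseteq> ideal_power N ?I r}"
  then obtain m r where q: "q = ereal (real m / real r)" and r: "1 \<le> r"
    and "\<not> symbolic_power (poly_ring N) ?I m \<subseteq> ideal_power N ?I r" by blast
  then obtain f where f: "f \<in> symbolic_power (poly_ring N) ?I m" "f \<notin> ideal_power N ?I r" by blast
  have F: "F i \<in> forms N 1" if "i \<in> {1..s}" for i by (rule gen_posD(3)[OF gp that])
  have I: "vanishing_ideal N (star_config N N s F) = {f \<in> polys N. \<forall>x\<in>star_config N N s F. mpoly_eval x f = 0}"
    "ideal (vanishing_ideal N (star_config N N s F)) (poly_ring N)"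
    by (rule vanishing_ideal_iff[where d = "\<lambda>_. 1", OF inf N(1)], rule F, assumption)+
  have fp: "f \<in> polys N" using f(1) by (simp add: symbolic_power_def Let_def)
  obtain n where n: "hcomp n f \<notin> ideal_power N ?I r"
    using f(2) sum_hcomp[of f] ideal_sum_closed[OF ideal_power_ideal[OF I(2)], of "{..maxdeg f}" "\<lambda>n. hcomp n f" r] by metis
  have form: "hcomp n f \<in> forms N n" using fp by simp
  have ord: "points_ord N N UNIV {1..s} F m (hcomp n f)"
    by (rule symbolic_power_points_ord[OF gp N(1) line f(1)])
  have "m * s \<le> N * (r * (Suc s - N))"
  proof (cases "m < r")
    \<comment> \<open>Here m / r < 1, and with s = N + a the bound to be shown at 1 reads N + a
      \<le> N (a + 1).\<close>
    case True
    obtain a where a: "s = N + a" using N(2) le_Suc_ex by blast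
    have "s \<le> N * (Suc s - N)" using N(1) by (cases N) (simp_all add: a algebra_simps)
    then have "m * s \<le> r * (N * (Suc s - N))" using True by (intro mult_le_mono) simp
    then show ?thesis by (simp add: mult.left_commute)
  next
    case False
    \<comment> \<open>Otherwise \<open>high_order_form_in_power\<close> would put the component into
      I^r, functions on the whole space being polynomials.\<close>
    have "n < r * (Suc s - N)"
    proof (rule ccontr)
      assume "\<not> n < r * (Suc s - N)"
      moreover have "points_ord N N UNIV {1..s} F r (hcomp n f)"
        using ord ord_at_mono[of UNIV m "hcomp n f" _ r] False unfolding points_ord_def not_less by blast
      ultimately have "\<exists>g. power_span N F (Suc (card {1..s}) - N) {1..s} r n g \<and> (\<forall>x\<in>UNIV. mpoly_eval x (hcomp n f) = mpoly_eval x g)"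
        using N(2) by (intro high_order_form_in_power[OF gp _ _ form]) simp_all
      then obtain g where g: "power_span N F (Suc s - N) {1..s} r n g" "\<forall>x. mpoly_eval x (hcomp n f) = mpoly_eval x g"
        by auto
      have "g \<in> forms N n" by (rule power_span_form[OF _ g(1)]) (rule F)
      then have "hcomp n f = g" using g(2) fp by (intro eval_eqI[OF inf hcomp_polys[OF fp]] forms_polys) auto
      then show False using n power_span_ideal_power[OF N F g(1)] by simp
    qed
    moreover have "hcomp n f \<noteq> 0" using n ideal_closed(2)[OF ideal_power_ideal[OF I(2)], of r] by auto
    then obtain x where "mpoly_eval x (hcomp n f) \<noteq> 0" using eval_eqI[OF inf hcomp_polys[OF fp] polys_0, of n] by auto
    then have "m * s \<le> N * n" using points_ord_degree_bound[OF gp _ form UNIV_I _ ord] N(2) by simp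
    ultimately show ?thesis by (meson le_trans less_imp_le mult_le_mono2)
  qed
  then have "real (m * s) \<le> real (N * (r * (Suc s - N)))" by (rule of_nat_mono)
  moreover have "real (Suc s - N) = real s - real N + 1" using N(2) by (simp add: of_nat_diff)
  ultimately have "real m * real s \<le> real N * (real s - real N + 1) * real r"
    by (simp only: of_nat_mult mult_ac)
  moreover have "a / x \<le> c / y" if "a * y \<le> c * x" "0 < x" "0 < y" for a c x y :: real
    using that by (simp add: field_simps)
  ultimately have "real m / real r \<le> real N * (real s - real N + 1) / real s" using r N by simp
  then show "q \<le> ereal (real N * (real s - real N + 1) / real s)" by (simp add: q)
qed

end

theorem theorem2p4p3:
  fixes N e s :: nat
  assumes "1 \<le> e" and "e \<le> N" and "e \<le> s"
  shows
    "(N \<le> s \<longrightarrow>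
       for_general N s (\<lambda>_. 1) (\<lambda>F :: nat \<Rightarrow> (nat, 'k::alg_closed_field) mpoly.
         proj_resurgence N (star_config N N s F) =
           ereal (real N * (real s - real N + 1) / real s))) \<and>
     for_general N s (\<lambda>_. 1) (\<lambda>F :: nat \<Rightarrow> (nat, 'k) mpoly.
       ereal (real e * (real s - real e + 1) / real s) \<le>
         proj_resurgence N (star_config N e s F)) \<and>
     (\<forall>d :: nat \<Rightarrow> nat. (\<forall>i\<in>{1..s}. 0 < d i) \<and> mono_on {1..s} d \<longrightarrow>
       for_general N s d (\<lambda>F :: nat \<Rightarrow> (nat, 'k) mpoly.
         ereal (real e * real (\<Sum>i = 1..s - e + 1. d i) / real (\<Sum>i = 1..s. d i)) \<le>
           proj_resurgence N (star_config N e s F)))"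
proof (intro conjI impI allI)
  have inf: "infinite (UNIV :: 'k set)" by (rule infinite_UNIV_alg_closed)
  interpret infinite_field "TYPE('k)" by unfold_locales (rule inf)
  \<comment> \<open>Stated for every e because the equality for points uses it with N in place of
    e.\<close>
  have lower: "for_general N s (\<lambda>_. 1) (\<lambda>F :: nat \<Rightarrow> (nat, 'k) mpoly.
      ereal (real e * (real s - real e + 1) / real s) \<le> proj_resurgence N (star_config N e s F))"
    if "1 \<le> e" "e \<le> N" "e \<le> s" for e
    using general_star_resurgence_lower_bound[of e N s "\<lambda>_. 1"] that
    by (simp add: mono_on_def of_nat_diff algebra_simps)
  show "for_general N s (\<lambda>_. 1) (\<lambda>F :: nat \<Rightarrow> (nat, 'k) mpoly.
       ereal (real e * (real s - real e + 1) / real s) \<le> proj_resurgence N (star_config N e s F))"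
    by (rule lower) fact+
  show "for_general N s d (\<lambda>F :: nat \<Rightarrow> (nat, 'k) mpoly.
      ereal (real e * real (\<Sum>i = 1..s - e + 1. d i) / real (\<Sum>i = 1..s. d i)) \<le>
        proj_resurgence N (star_config N e s F))"
    if "(\<forall>i\<in>{1..s}. 0 < d i) \<and> mono_on {1..s} d" for d
    by (rule general_star_resurgence_lower_bound) (use assms that in auto)
  assume Ns: "N \<le> s"
  have N: "0 < N" "1 \<le> N" using assms by auto
  show "for_general N s (\<lambda>_. 1) (\<lambda>F :: nat \<Rightarrow> (nat, 'k) mpoly.
      proj_resurgence N (star_config N N s F) = ereal (real N * (real s - real N + 1) / real s))"
    using for_general_conj[OF inf lower[OF N(2) order_refl Ns] general_hyperplanes_gen_pos[OF inf Ns]]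
  proof (rule for_general_mono)
    fix F :: "nat \<Rightarrow> (nat, 'k) mpoly"
    assume F: "ereal (real N * (real s - real N + 1) / real s) \<le> proj_resurgence N (star_config N N s F) \<and>
      gen_pos N N UNIV {1..s} F \<and>
      (\<forall>T\<subseteq>{1..s}. card T = N \<longrightarrow> (\<forall>x p. (\<exists>i\<le>N. p i \<noteq> 0) \<longrightarrow> (\<forall>j\<in>T. mpoly_eval p (F j) = 0) \<longrightarrow>
        (\<forall>j\<in>T. mpoly_eval x (F j) = 0) \<longrightarrow> (\<exists>t. \<forall>i\<le>N. x i = t * p i)))"
    then have "proj_resurgence N (star_config N N s F) \<le> ereal (real N * (real s - real N + 1) / real s)"
      by (intro star_resurgence_upper_bound[OF _ N(1) Ns]) blast+
    then show "proj_resurgence N (star_config N N s F) = ereal (real N * (real s - real N + 1) / real s)"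
      using F by (intro antisym) blast+
  qed
qed

end
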